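(* For $\tau\in\mathbb H$, $z\in\mathbb C$ (with functions on the right evaluated at $(\tau,z)$ or $\tau$ unless indicated), $$\vartheta^{24}(\tau,z)=E_4^2E_{4,3}(\tau,2z)-E_{4,4}^3-24\Delta\phi_{0,1}^2\phi_{0,2}\phi_{0,4}^2+36\Delta\phi_{0,2}^6$$ $$+\Delta\phi_{0,3}\bigl(-38\phi_{0,1}\phi_{0,2}^4-477\phi_{0,1}\phi_{0,2}\phi_{0,3}^2+486\phi_{0,2}^3\phi_{0,3}+702\phi_{0,3}^3+55\phi_{0,1}^2\phi_{0,3}\phi_{0,4}+160\phi_{0,1}\phi_{0,2}^2\phi_{0,4}\bigr).$$
   Context: Here $\mathbb H$ is the upper half-plane, $q=e^{2\pi i\tau}$, $\zeta=e^{2\pi i z}$; $\Delta(\tau)=q\prod_{n\ge1}(1-q^n)^{24}$; $E_4=1+240\sum_{n\ge1}\sigma_3(n)q^n$. $\vartheta(\tau,z)=\sum_{n\in\mathbb Z}\bigl(\tfrac{-4}{n}\bigr)q^{n^2/8}\zeta^{n/2}$. Jacobi–Eisenstein series (even $k\ge4$, $m\ge1$): $E_{k,m}(\tau,z)=\frac12\sum_{c,d\in\mathbb Z,\,(c,d)=1}\sum_{\lambda\in\mathbb Z}(c\tau+d)^{-k}e^{2\pi i m\left(\lambda^2\frac{a\tau+b}{c\tau+d}+2\lambda\frac{z}{c\tau+d}-\frac{cz^2}{c\tau+d}\right)}$, where $a,b\in\mathbb Z$ are chosen with $ad-bc=1$. Weak Jacobi forms of weight $0$: with $\vartheta_{00}=\sum_{n\in\mathbb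 Z} q^{n^2/2}\zeta^n$, $\vartheta_{01}=\sum_{n\in\mathbb Z}(-1)^nq^{n^2/2}\zeta^n$, $\vartheta_{10}=q^{1/8}\zeta^{1/2}\sum_{n\in\mathbb Z} q^{n(n+1)/2}\zeta^n$ and $\xi_{ab}(\tau,z)=\vartheta_{ab}(\tau,z)/\vartheta_{ab}(\tau,0)$, $\phi_{0,1}=4(\xi_{00}^2+\xi_{01}^2+\xi_{10}^2)$, $\phi_{0,2}=2(\xi_{00}^2\xi_{01}^2+\xi_{00}^2\xi_{10}^2+\xi_{10}^2\xi_{01}^2)$, $\phi_{0,3}=\bigl(\vartheta(\tau,2z)/\vartheta(\tau,z)\bigr)^2$, $\phi_{0,4}=\vartheta(\tau,3z)/\vartheta(\tau,z)$. *)

theory Defs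
  imports "HOL-Complex_Analysis.Complex_Analysis"
begin

text \<open>
  Fractional powers of \<open>q\<close> and \<open>\<zeta>\<close> are fixed by \<open>q^r = e(r \<tau>)\<close> and \<open>\<zeta>^r = e(r z)\<close>.
\<close>

definition e :: "complex \<Rightarrow> complex" where
  "e x = exp (2 * of_real pi * \<i> * x)"

text \<open>The Kronecker symbol \<open>(-4 / n)\<close>.\<close>

definition chi4 :: "int \<Rightarrow> complex" where
  "chi4 n = (if n mod 4 = 1 then 1 else if n mod 4 = 3 then - 1 else 0)"

definition theta :: "complex \<Rightarrow> complex \<Rightarrow> complex" where
  "theta \<tau> z = (\<Sum>\<^sub>\<infinity>n\<in>(UNIV :: int set).
     chi4 n * e ((of_int n)\<^sup>2 / 8 * \<tau>) * e (of_int n / 2 * z))"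

definition Delta :: "complex \<Rightarrow> complex" where
  "Delta \<tau> = e \<tau> * (\<Prod>n. (1 - e \<tau> ^ Suc n) ^ 24)"

definition sigma3 :: "nat \<Rightarrow> nat" where
  "sigma3 n = (\<Sum>d | d dvd n. d ^ 3)"

definition E4 :: "complex \<Rightarrow> complex" where
  "E4 \<tau> = 1 + 240 * (\<Sum>n. of_nat (sigma3 (Suc n)) * e \<tau> ^ Suc n)"

text \<open>
  The summand of the Jacobi--Eisenstein series does not depend on the choice of \<open>(a, b)\<close>: passing
  to \<open>(a + t c, b + t d)\<close> adds the integer \<open>m \<lambda>\<^sup>2 t\<close> to the argument of \<open>e\<close>.
\<close>

definition cofactors :: "int \<Rightarrow> int \<Rightarrow> int \<times> int" where
  "cofactors c d = (SOME (a, b). a * d - b * c = 1)"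

definition Jacobi_Eisenstein :: "nat \<Rightarrow> nat \<Rightarrow> complex \<Rightarrow> complex \<Rightarrow> complex" where
  "Jacobi_Eisenstein k m \<tau> z =
     1 / 2 * (\<Sum>\<^sub>\<infinity>(c, d)\<in>{(c, d). coprime c d}. \<Sum>\<^sub>\<infinity>l\<in>(UNIV :: int set).
       (let (a, b) = cofactors c d; j = of_int c * \<tau> + of_int d in
          j powi (- int k) *
          e (of_nat m * ((of_int l)\<^sup>2 * ((of_int a * \<tau> + of_int b) / j)
                         + 2 * of_int l * (z / j) - of_int c * z\<^sup>2 / j))))"

definition theta00 :: "complex \<Rightarrow> complex \<Rightarrow> complex" where
  "theta00 \<tau> z = (\<Sum>\<^sub>\<infinity>n\<in>(UNIV :: int set). e ((of_int n)\<^sup>2 / 2 * \<tau>) * e (of_int n * z))"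

definition theta01 :: "complex \<Rightarrow> complex \<Rightarrow> complex" where
  "theta01 \<tau> z = (\<Sum>\<^sub>\<infinity>n\<in>(UNIV :: int set).
     (- 1) powi n * e ((of_int n)\<^sup>2 / 2 * \<tau>) * e (of_int n * z))"

definition theta10 :: "complex \<Rightarrow> complex \<Rightarrow> complex" where
  "theta10 \<tau> z = e (\<tau> / 8) * e (z / 2) * (\<Sum>\<^sub>\<infinity>n\<in>(UNIV :: int set).
     e (of_int n * (of_int n + 1) / 2 * \<tau>) * e (of_int n * z))"

definition xi00 :: "complex \<Rightarrow> complex \<Rightarrow> complex" where
  "xi00 \<tau> z = theta00 \<tau> z / theta00 \<tau> 0"

definition xi01 :: "complex \<Rightarrow> complex \<Rightarrow> complex" where
  "xi01 \<tau> z = theta01 \<tau> z / theta01 \<tau> 0"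

definition xi10 :: "complex \<Rightarrow> complex \<Rightarrow> complex" where
  "xi10 \<tau> z = theta10 \<tau> z / theta10 \<tau> 0"

definition phi01 :: "complex \<Rightarrow> complex \<Rightarrow> complex" where
  "phi01 \<tau> z = 4 * ((xi00 \<tau> z)\<^sup>2 + (xi01 \<tau> z)\<^sup>2 + (xi10 \<tau> z)\<^sup>2)"

definition phi02 :: "complex \<Rightarrow> complex \<Rightarrow> complex" where
  "phi02 \<tau> z = 2 * ((xi00 \<tau> z)\<^sup>2 * (xi01 \<tau> z)\<^sup>2 + (xi00 \<tau> z)\<^sup>2 * (xi10 \<tau> z)\<^sup>2
                     + (xi10 \<tau> z)\<^sup>2 * (xi01 \<tau> z)\<^sup>2)"

text \<open>
  \<open>\<phi>\<^bsub>0,3\<^esub>\<close> and \<open>\<phi>\<^bsub>0,4\<^esub>\<close> are holomorphic on all of \<open>\<complex>\<close> in \<open>z\<close>, but \<open>\<vartheta>(\<tau>,z)\<close> vanishes at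
  \<open>z \<in> \<int>\<tau> + \<int>\<close>, where the literal quotient would be \<open>0 / 0 = 0\<close> in HOL. The quotients are
  therefore read as meromorphic functions of \<open>z\<close>, with removable singularities filled in.
\<close>

definition phi03 :: "complex \<Rightarrow> complex \<Rightarrow> complex" where
  "phi03 \<tau> = remove_sings (\<lambda>z. (theta \<tau> (2 * z) / theta \<tau> z)\<^sup>2)"

definition phi04 :: "complex \<Rightarrow> complex \<Rightarrow> complex" where
  "phi04 \<tau> = remove_sings (\<lambda>z. theta \<tau> (3 * z) / theta \<tau> z)"

end

theory Submission
  imports Defs
begin

text \<open>
  The identity is one between weak Jacobi forms of weight 12 and index 12. It holds because every form in it is a
  polynomial in four functions, after which it becomes an identity in four independent variables
  (\<open>theta_24_polynomial\<close>).

  Let \<open>k = \<vartheta> / \<eta>\<^sup>3\<close> (\<open>klein\<close>), \<open>Q = k\<^sup>2\<close> (weight -2, index 1) and let \<open>Y = \<phi>\<^bsub>0,1\<^esub> / 12\<close> be the mean of the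
  three squares \<open>\<xi>\<^sub>i\<^sup>2\<close> (weight 0, index 1). For fixed \<open>\<tau>\<close> the even theta functions of index 1 form a plane, so
  \<open>\<xi>\<^sub>i\<^sup>2 = Y - \<epsilon>\<^sub>i Q\<close> with \<open>\<epsilon>\<^sub>i\<close> depending on \<open>\<tau>\<close> only and \<open>\<epsilon>\<^sub>1 + \<epsilon>\<^sub>2 + \<epsilon>\<^sub>3 = 0\<close>; up to scaling, \<open>Y / Q\<close> is the Weierstrass
  function and the \<open>\<epsilon>\<^sub>i\<close> are its values at the half-periods. The symmetric functions
  \<open>a = \<epsilon>\<^sub>1 \<epsilon>\<^sub>2 + \<epsilon>\<^sub>1 \<epsilon>\<^sub>3 + \<epsilon>\<^sub>2 \<epsilon>\<^sub>3\<close> and \<open>b = - \<epsilon>\<^sub>1 \<epsilon>\<^sub>2 \<epsilon>\<^sub>3\<close> are modular forms of weight 4 and 6. In these terms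
  \<open>\<Delta> = 16 (- 4 a\<^sup>3 - 27 b\<^sup>2)\<close>, \<open>E\<^sub>4 = - 48 a\<close>, and \<open>\<vartheta>\<^sup>2\<^sup>4 = \<Delta>\<^sup>3 Q\<^sup>1\<^sup>2\<close> because \<open>\<vartheta> = \<eta>\<^sup>3 k\<close>, which is the triple product.

  What turns a form into such a polynomial is \<open>jform_weight_12\<close> with its corollary \<open>jform_unique\<close>: a weak Jacobi
  form of weight \<open>k\<close> and index \<open>m\<close> with \<open>k + 2 m < 12\<close> is determined by its limit at the cusp. Indeed, if that limit is
  zero, the Taylor coefficients at \<open>z = 0\<close> below degree \<open>2 m\<close> vanish one after the other, since each is a
  cusp form of level one and weight below 12. So the form is divisible by \<open>Q\<^sup>m\<close>, and the quotient is an entire elliptic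
  function, hence a cusp form in \<open>\<tau>\<close> alone, of weight \<open>k + 2 m < 12\<close>. If \<open>k + 2 m = 12\<close>, a multiple of \<open>\<Delta> Q\<^sup>m\<close> may
  remain.

  This gives the formulas for \<open>Y(2 z)\<close>, \<open>Q(2 z)\<close> and \<open>\<vartheta>(3 z) / \<vartheta>(z)\<close>, and \<open>E\<^bsub>4,3\<^esub>\<close> (where \<open>k + 2 m = 10\<close>), by
  comparing limits at the cusp. For \<open>E\<^bsub>4,4\<^esub>\<close> (where \<open>k + 2 m = 12\<close>) it leaves one constant, which is found at
  \<open>z = \<tau> / 2\<close>: there \<open>Y = \<epsilon> Q\<close> for one of the three \<open>\<epsilon>\<^sub>i\<close>, while \<open>q E\<^bsub>4,4\<^esub>(\<tau>, \<tau> / 2)\<close> tends to zero at the cusp.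

  The analytic input is the inversion formula for \<open>k\<close>, proved by comparing quasi-periods (\<open>klein_S\<close>); the
  modularity of \<open>E\<^sub>4\<close>, read off from the fourth Taylor coefficient of \<open>log k\<close> at \<open>z = 0\<close> (\<open>E4sum_S\<close>); and
  the locally uniform convergence of the Jacobi--Eisenstein series (\<open>jac_term_norm_weight\<close>), where the Gaussian
  sum over \<open>\<lambda>\<close> costs \<open>\<bar>c \<tau> + d\<bar>\<close> to the power \<open>3/2\<close>, leaving the summable \<open>\<bar>c \<tau> + d\<bar>\<close> to the power \<open>- 5/2\<close>.
\<close>

section \<open>The upper half-plane and the exponential\<close>

definition uhp :: "complex set" where "uhp = {\<tau>. 0 < Im \<tau>}"

lemma open_uhp [simp]: "open uhp"
  unfolding uhp_def by (rule open_halfspace_Im_gt)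

lemma connected_uhp: "connected uhp"
  unfolding uhp_def by (intro convex_connected convex_halfspace_Im_gt)

lemma uhp_nz: "\<tau> \<in> uhp \<Longrightarrow> \<tau> \<noteq> 0"
  by (auto simp: uhp_def)

lemma uhp_add_1: "\<tau> \<in> uhp \<Longrightarrow> \<tau> + 1 \<in> uhp"
  by (auto simp: uhp_def)

lemma Im_neg_inverse: "Im (- 1 / \<tau>) = Im \<tau> / (norm \<tau>)\<^sup>2"
  by (simp add: Im_divide cmod_power2)

lemma uhp_neg_inverse: "\<tau> \<in> uhp \<Longrightarrow> - 1 / \<tau> \<in> uhp"
  using uhp_nz[of \<tau>] unfolding uhp_def mem_Collect_eq Im_neg_inverse by simp

lemma e_add: "e (x + y) = e x * e y"
  by (simp add: e_def ring_distribs exp_add)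

lemma e_0 [simp]: "e 0 = 1"
  by (simp add: e_def)

lemma e_nz [simp]: "e x \<noteq> 0"
  by (simp add: e_def)

lemma e_minus: "e (- x) = inverse (e x)"
  by (simp add: e_def exp_minus)

lemma e_diff: "e (x - y) = e x / e y"
  by (simp add: e_def ring_distribs exp_diff)

lemma e_of_nat_mult: "e (of_nat n * x) = e x ^ n"
  by (simp add: e_def exp_of_nat_mult[symmetric] mult_ac)

lemma e_int [simp]: "e (of_int n) = 1"
  unfolding e_def by (subst exp_eq_1) auto

lemma e_1 [simp]: "e 1 = 1"
  using e_int[of 1] by simp

lemma e_half: "e (1 / 2) = - 1"
  by (simp add: e_def)

lemma e_quarter: "e (1 / 4) = \<i>"
proof -
  have "e (1 / 4) = cis (pi / 2)"
    by (simp add: e_def cis_conv_exp field_simps)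
  then show ?thesis by simp
qed

lemma e_add_int: "e (x + of_int n) = e x"
  by (simp add: e_add)

lemma e_eq_1_iff: "e x = 1 \<longleftrightarrow> x \<in> \<int>"
proof
  assume "e x = 1"
  then obtain n :: int where n: "Re (2 * of_real pi * \<i> * x) = 0" "Im (2 * of_real pi * \<i> * x) = of_int (2 * n) * pi"
    unfolding e_def exp_eq_1 by blast
  then have "x = of_int n" by (auto simp: complex_eq_iff)
  then show "x \<in> \<int>" by simp
qed (auto elim: Ints_cases)

lemma norm_e: "norm (e x) = exp (- 2 * pi * Im x)"
  by (simp add: e_def)

lemma holomorphic_e [holomorphic_intros]: "f holomorphic_on A \<Longrightarrow> (\<lambda>x. e (f x)) holomorphic_on A"
  unfolding e_def by (intro holomorphic_intros)

lemma continuous_on_e [continuous_intros]: "continuous_on A f \<Longrightarrow> continuous_on A (\<lambda>x. e (f x))"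
  unfolding e_def by (intro continuous_intros)

section \<open>Quasi-periodic entire functions\<close>

lemma lattice_reduce:
  assumes "Im \<tau> > 0"
  obtains s t :: real and m n :: int
  where "z = of_real s + of_real t * \<tau> + of_int m + of_int n * \<tau>" "0 \<le> s" "s \<le> 1" "0 \<le> t" "t \<le> 1"
proof -
  define T where "T = Im z / Im \<tau>"
  define S where "S = Re z - T * Re \<tau>"
  have "z = of_real S + of_real T * \<tau>"
    using assms by (simp add: complex_eq_iff S_def T_def)
  also have "\<dots> = of_real (frac S) + of_real (frac T) * \<tau> + of_int \<lfloor>S\<rfloor> + of_int \<lfloor>T\<rfloor> * \<tau>"
    by (simp add: frac_def algebra_simps)
  finally show ?thesis
    using that[of "frac S" "frac T"] frac_lt_1[of S] frac_lt_1[of T] by (simp add: less_imp_le)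
qed

lemma periodic_int:
  fixes h :: "complex \<Rightarrow> 'a"
  assumes "\<And>z. h (z + w) = h z"
  shows "h (z + of_int n * w) = h z"
proof -
  have nat: "h (z + of_nat k * w) = h z" for k z
  proof (induction k arbitrary: z)
    case (Suc k)
    have "h (z + of_nat (Suc k) * w) = h ((z + of_nat k * w) + w)" by (simp add: algebra_simps)
    then show ?case using assms Suc by simp
  qed simp
  show ?thesis
  proof (cases "n \<ge> 0")
    case True then show ?thesis using nat[of z "nat n"] by simp
  next
    case False
    then show ?thesis using nat[of "z + of_int n * w" "nat (- n)"] by simp
  qed
qed

lemma entire_isCont: "f holomorphic_on UNIV \<Longrightarrow> isCont f z"
  using holomorphic_on_imp_continuous_on[of f UNIV] by (simp add: continuous_on_eq_continuous_at)

text \<open>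
  The quotient \<open>f / g\<close> is elliptic, and its singularities are removable: they lie at lattice points, all of
  which look like the origin. So Liouville's theorem applies.
\<close>

lemma quasi_periodic_unique:
  fixes f g :: "complex \<Rightarrow> complex"
  assumes \<tau>: "Im \<tau> > 0"
    and f: "f holomorphic_on UNIV" and g: "g holomorphic_on UNIV"
    and f1: "\<And>z. f (z + 1) = \<alpha> * f z" and g1: "\<And>z. g (z + 1) = \<alpha> * g z"
    and f2: "\<And>z. f (z + \<tau>) = \<beta> z * f z" and g2: "\<And>z. g (z + \<tau>) = \<beta> z * g z"
    and nz: "\<alpha> \<noteq> 0" "\<And>z. \<beta> z \<noteq> 0"
    and zeros: "\<And>z. g z = 0 \<Longrightarrow> \<exists>m n :: int. z = of_int m + of_int n * \<tau>"
    and lim: "((\<lambda>z. f z / g z) \<longlongrightarrow> L) (at 0)"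
  shows "f z = L * g z"
proof -
  define h where "h z = f z / g z" for z
  have h1: "h (z + 1) = h z" and h2: "h (z + \<tau>) = h z" for z
    using nz by (auto simp: h_def f1 g1 f2 g2)
  have hp: "h (z + of_int m + of_int n * \<tau>) = h z" for z m n
    using periodic_int[of h 1 z m] periodic_int[of h \<tau> "z + of_int m" n] h1 h2 by simp
  have "g (1 / 2) \<noteq> 0"
  proof
    assume "g (1 / 2) = 0"
    then obtain m n :: int where mn: "1 / 2 = of_int m + of_int n * \<tau>"
      using zeros by blast
    from arg_cong[OF mn, of Im] \<tau> have "n = 0" by simp
    with arg_cong[OF mn, of Re] have "(1 / 2 :: real) = of_int m" by simp
    then have "of_int (2 * m) = (of_int 1 :: real)" by simp
    then have "2 * m = 1" by (simp only: of_int_eq_iff)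
    then show False by presburger
  qed
  then have iso: "\<exists>r>0. \<forall>z\<in>ball \<omega> r - {\<omega>}. g z \<noteq> 0" for \<omega>
  proof (cases "g \<omega> = 0")
    case True
    with isolated_zeros[OF g open_UNIV connected_UNIV, of \<omega> "1 / 2"] \<open>g (1 / 2) \<noteq> 0\<close>
    show ?thesis by (metis DiffD1 DiffD2 UNIV_I singletonI)
  next
    case False
    have "isCont g \<omega>" using g by (rule entire_isCont)
    from continuous_at_avoid[OF this False] show ?thesis by (auto simp: dist_commute)
  qed
  have lim\<omega>: "(h \<longlongrightarrow> L) (at \<omega>)" if "g \<omega> = 0" for \<omega>
  proof -
    from zeros[OF that] obtain m n :: int where mn: "\<omega> = of_int m + of_int n * \<tau>" by blast
    have "((\<lambda>z. h (\<omega> + z)) \<longlongrightarrow> L) (at 0)"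
      using lim hp[of _ m n] by (simp add: mn h_def[symmetric] add_ac)
    then show ?thesis using LIM_offset_zero_cancel by blast
  qed
  define k where "k z = (if g z = 0 then L else h z)" for z
  have k\<omega>: "\<forall>\<^sub>F z in at \<omega>. k z = h z" for \<omega>
  proof -
    obtain r where "r > 0" "\<forall>z\<in>ball \<omega> r - {\<omega>}. g z \<noteq> 0" using iso by blast
    then show ?thesis unfolding eventually_at
      by (intro exI[of _ r]) (auto simp: k_def dist_commute)
  qed
  have klim: "(k \<longlongrightarrow> k \<omega>) (at \<omega>)" for \<omega>
  proof (cases "g \<omega> = 0")
    case True
    then show ?thesis using lim\<omega>[OF True] tendsto_cong[OF k\<omega>[of \<omega>], of L] by (simp add: k_def[of \<omega>])
  next
    case False
    have "isCont f \<omega>" "isCont g \<omega>"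
      using f g by (auto intro: entire_isCont)
    then have "(h \<longlongrightarrow> h \<omega>) (at \<omega>)"
      unfolding h_def isCont_def using False by (intro tendsto_divide) auto
    then show ?thesis using False tendsto_cong[OF k\<omega>[of \<omega>], of "h \<omega>"] by (simp add: k_def[of \<omega>])
  qed
  then have kcont: "continuous_on UNIV k"
    by (simp add: continuous_on_eq_continuous_at isCont_def)
  have "k field_differentiable at \<omega>" for \<omega>
  proof -
    obtain r where r: "r > 0" "\<forall>z\<in>ball \<omega> r - {\<omega>}. g z \<noteq> 0" using iso by blast
    have "h holomorphic_on ball \<omega> r - {\<omega>}"
      unfolding h_def using r f g by (intro holomorphic_intros) (auto intro: holomorphic_on_subset)
    then have "k holomorphic_on ball \<omega> r - {\<omega>}"
      by (rule holomorphic_transform) (use r in \<open>auto simp: k_def\<close>)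
    then have "k holomorphic_on ball \<omega> r"
      by (rule no_isolated_singularity[rotated]) (auto intro: continuous_on_subset[OF kcont])
    then show ?thesis using r(1) holomorphic_on_imp_differentiable_at by auto
  qed
  then have khol: "k holomorphic_on UNIV"
    by (simp add: holomorphic_on_def field_differentiable_at_within)
  have kper: "k (z + of_int m + of_int n * \<tau>) = k z" for z m n
  proof -
    have "k (z + 1) = k z" "k (z + \<tau>) = k z" for z
      using h1 h2 nz by (auto simp: k_def g1 g2)
    then show ?thesis
      using periodic_int[of k 1 z m] periodic_int[of k \<tau> "z + of_int m" n] by simp
  qed
  define D where "D = (\<lambda>(s, t). of_real s + of_real t * \<tau>) ` ({0..1 :: real} \<times> {0..1 :: real})"
  have "compact D" unfolding D_def
    by (intro compact_continuous_image compact_Times)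
       (auto simp: split_def intro!: continuous_intros)
  then have "bounded (k ` D)"
    by (intro compact_imp_bounded compact_continuous_image continuous_on_subset[OF kcont]) auto
  moreover have "range k \<subseteq> k ` D"
  proof
    fix w assume "w \<in> range k"
    then obtain z where "w = k z" by auto
    obtain s t m n where z: "z = of_real s + of_real t * \<tau> + of_int m + of_int n * \<tau>"
      "0 \<le> s" "s \<le> 1" "0 \<le> t" "t \<le> 1" using lattice_reduce[OF \<tau>] by metis
    then have "k z = k (of_real s + of_real t * \<tau>)" using kper by simp
    then show "w \<in> k ` D" using z \<open>w = k z\<close> unfolding D_def by force
  qed
  ultimately have "bounded (range k)" by (rule bounded_subset)
  then obtain c where c: "\<And>z. k z = c"
    using Liouville_theorem[OF khol] by (auto simp: constant_on_def)
  have "(k \<longlongrightarrow> L) (at 0)" using lim tendsto_cong[OF k\<omega>, of L 0] by (simp add: h_def[abs_def])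
  moreover have "k = (\<lambda>_. c)" using c by auto
  ultimately have cL: "c = L" by (simp add: tendsto_const_iff)
  have *: "f z = L * g z" if "g z \<noteq> 0" for z
    using c[of z] cL that by (simp add: k_def h_def field_simps)
  show ?thesis
  proof (cases "g z = 0")
    case True
    obtain r where r: "r > 0" "\<forall>w\<in>ball z r - {z}. g w \<noteq> 0" using iso by blast
    have "isCont f z" "isCont g z"
      using f g by (auto intro: entire_isCont)
    then have 1: "((\<lambda>w. f w - L * g w) \<longlongrightarrow> f z - L * g z) (at z)"
      unfolding isCont_def by (intro tendsto_intros)
    have "\<forall>\<^sub>F w in at z. f w - L * g w = 0"
      unfolding eventually_at using r * by (intro exI[of _ r]) (auto simp: dist_commute)
    from tendsto_cong[OF this] 1 have "((\<lambda>w. 0) \<longlongrightarrow> f z - L * g z) (at z)" by simp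
    then show ?thesis by (simp add: tendsto_const_iff)
  qed (use * in auto)
qed

section \<open>Level one modular functions\<close>

text \<open>
  The strip makes uniform bounds on \<open>\<bar>c \<tau> + d\<bar>\<close> possible; functions of period 1 do not see the difference.
\<close>

definition cusp :: "complex filter" where
  "cusp = inf (filtercomap Im at_top) (principal {\<tau>. \<bar>Re \<tau>\<bar> \<le> 1 / 2})"

lemma eventually_cusp:
  "eventually P cusp \<longleftrightarrow> (\<exists>B. \<forall>\<tau>. \<bar>Re \<tau>\<bar> \<le> 1 / 2 \<longrightarrow> Im \<tau> \<ge> B \<longrightarrow> P \<tau>)"
  unfolding cusp_def eventually_inf_principal eventually_filtercomap_at_top_linorder by auto

lemma cusp_nonbot [simp]: "cusp \<noteq> bot"
proof
  assume "cusp = bot"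
  then have "eventually (\<lambda>_. False) cusp" by simp
  then obtain B where "\<And>\<tau>. \<bar>Re \<tau>\<bar> \<le> 1 / 2 \<Longrightarrow> Im \<tau> \<ge> B \<Longrightarrow> False"
    unfolding eventually_cusp by blast
  from this[of "Complex 0 B"] show False by simp
qed

lemma filterlim_Im_cusp: "filterlim Im at_top cusp"
  unfolding filterlim_at_top eventually_cusp by auto

lemma eventually_cusp_uhp: "eventually (\<lambda>\<tau>. \<tau> \<in> uhp) cusp"
  unfolding eventually_cusp uhp_def by (intro exI[of _ 1]) auto

lemma translate_to_strip:
  assumes "\<And>\<tau>. \<tau> \<in> uhp \<Longrightarrow> g (\<tau> + 1) = g \<tau>" "\<tau> \<in> uhp"
  obtains \<tau>' where "\<bar>Re \<tau>'\<bar> \<le> 1 / 2" "Im \<tau>' = Im \<tau>" "g \<tau>' = g \<tau>"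
proof -
  define G where "G w = g (if w \<in> uhp then w else \<i>)" for w
  have "G (w + 1) = G w" for w using assms by (auto simp: G_def uhp_def)
  from periodic_int[of G 1, OF this]
  have "G (\<tau> + of_int (- round (Re \<tau>))) = G \<tau>" by (metis mult.right_neutral)
  then show ?thesis
    using that[of "\<tau> + of_int (- round (Re \<tau>))"] assms(2) of_int_round_abs_le[of "Re \<tau>"]
    by (simp add: G_def uhp_def abs_minus_commute)
qed

text \<open>
  Once \<open>\<bar>Re \<tau>\<bar> \<le> 1/2\<close> and \<open>Im \<tau> < 1/2\<close>, the inversion at least doubles the imaginary part. The region obtained is
  larger than the usual fundamental domain, which is enough for compactness arguments.
\<close>

lemma modular_reduce:
  assumes T: "\<And>\<tau>. \<tau> \<in> uhp \<Longrightarrow> g (\<tau> + 1) = g \<tau>"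
    and S: "\<And>\<tau>. \<tau> \<in> uhp \<Longrightarrow> g (- 1 / \<tau>) = g \<tau>"
    and \<tau>: "\<tau> \<in> uhp"
  obtains \<tau>' where "\<bar>Re \<tau>'\<bar> \<le> 1 / 2" "Im \<tau>' \<ge> 1 / 2" "g \<tau>' = g \<tau>"
proof -
  have "\<exists>\<tau>'. \<bar>Re \<tau>'\<bar> \<le> 1 / 2 \<and> Im \<tau>' \<ge> 1 / 2 \<and> g \<tau>' = g \<tau>"
    if "Im \<tau> * 2 ^ n \<ge> 1 / 2" "\<tau> \<in> uhp" for n \<tau>
    using that
  proof (induction n arbitrary: \<tau>)
    case 0
    then show ?case using translate_to_strip[of g \<tau>] T by (metis power_0 mult.right_neutral)
  next
    case (Suc n)
    obtain \<tau>1 where \<tau>1: "\<bar>Re \<tau>1\<bar> \<le> 1 / 2" "Im \<tau>1 = Im \<tau>" "g \<tau>1 = g \<tau>"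
      using translate_to_strip[of g \<tau>] T Suc by metis
    show ?case
    proof (cases "Im \<tau> \<ge> 1 / 2")
      case True then show ?thesis using \<tau>1 by auto
    next
      case False
      have uh: "\<tau>1 \<in> uhp" using \<tau>1 Suc.prems by (auto simp: uhp_def)
      have "(Re \<tau>1)\<^sup>2 \<le> (1 / 2)\<^sup>2" using \<tau>1(1) by (metis abs_ge_zero power2_abs power_mono)
      moreover have "(Im \<tau>1)\<^sup>2 \<le> (1 / 2)\<^sup>2"
        using False \<tau>1(2) uh unfolding uhp_def by (intro power_mono) auto
      ultimately have n2: "(norm \<tau>1)\<^sup>2 \<le> 1 / 2" unfolding cmod_power2 by (simp add: power2_eq_square)
      have npos: "(norm \<tau>1)\<^sup>2 > 0" using uhp_nz[OF uh] by simp
      have "Im (- 1 / \<tau>1) \<ge> Im \<tau>1 / (1 / 2)" unfolding Im_neg_inverse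
        using n2 npos uh by (intro divide_left_mono) (auto simp: uhp_def)
      then have "Im (- 1 / \<tau>1) * 2 ^ n \<ge> 2 * Im \<tau> * 2 ^ n" 
        using \<tau>1(2) by (intro mult_right_mono) auto
      then have "Im (- 1 / \<tau>1) * 2 ^ n \<ge> 1 / 2" using Suc.prems by (simp add: mult_ac)
      from Suc.IH[OF this uhp_neg_inverse[OF uh]] show ?thesis using S[OF uh] \<tau>1(3) by metis
    qed
  qed
  moreover obtain n where "1 / 2 / Im \<tau> < 2 ^ n"
    using real_arch_pow[of 2 "1 / 2 / Im \<tau>"] by auto
  ultimately show ?thesis using that \<tau> by (metis uhp_def mem_Collect_eq pos_divide_less_eq less_imp_le mult.commute)
qed

text \<open>
  If \<open>g\<close> were not zero, \<open>\<bar>g\<bar>\<close> would attain its maximum over the upper half-plane in a compact set, so that \<open>g\<close> would be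
  constant.
\<close>

lemma modular_function_eq_0:
  assumes hol: "g holomorphic_on uhp"
    and T: "\<And>\<tau>. \<tau> \<in> uhp \<Longrightarrow> g (\<tau> + 1) = g \<tau>"
    and S: "\<And>\<tau>. \<tau> \<in> uhp \<Longrightarrow> g (- 1 / \<tau>) = g \<tau>"
    and lim: "(g \<longlongrightarrow> 0) cusp"
    and \<tau>: "\<tau> \<in> uhp"
  shows "g \<tau> = 0"
proof (rule ccontr)
  assume nz: "g \<tau> \<noteq> 0"
  from tendstoD[OF lim, of "norm (g \<tau>)"] nz obtain B where
    B: "\<And>\<tau>'. \<bar>Re \<tau>'\<bar> \<le> 1 / 2 \<Longrightarrow> Im \<tau>' \<ge> B \<Longrightarrow> norm (g \<tau>') < norm (g \<tau>)"
    unfolding eventually_cusp by auto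
  define K where "K = cbox (Complex (- 1 / 2) (1 / 2)) (Complex (1 / 2) (max B 1))"
  have Kuhp: "K \<subseteq> uhp" by (auto simp: K_def uhp_def in_cbox_complex_iff)
  obtain \<tau>0 where \<tau>0: "\<bar>Re \<tau>0\<bar> \<le> 1 / 2" "Im \<tau>0 \<ge> 1 / 2" "g \<tau>0 = g \<tau>"
    using modular_reduce[of g \<tau>] T S \<tau> by metis
  have inK: "\<tau>' \<in> K" if "\<bar>Re \<tau>'\<bar> \<le> 1 / 2" "Im \<tau>' \<ge> 1 / 2" "norm (g \<tau>') \<ge> norm (g \<tau>)" for \<tau>'
  proof -
    have "Im \<tau>' \<le> B" using that B[of \<tau>'] by linarith
    then show ?thesis using that by (auto simp: K_def in_cbox_complex_iff)
  qed
  have "compact K" unfolding K_def by (rule compact_cbox)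
  moreover have "K \<noteq> {}" using inK[of \<tau>0] \<tau>0 by auto
  moreover have "continuous_on K (\<lambda>x. norm (g x))"
    by (intro continuous_intros continuous_on_subset[OF holomorphic_on_imp_continuous_on[OF hol] Kuhp])
  ultimately obtain \<xi> where \<xi>: "\<xi> \<in> K" "\<And>x. x \<in> K \<Longrightarrow> norm (g x) \<le> norm (g \<xi>)"
    using continuous_attains_sup[of K "\<lambda>x. norm (g x)"] by auto
  have max: "norm (g x) \<le> norm (g \<xi>)" if "x \<in> uhp" for x
  proof (cases "norm (g x) \<ge> norm (g \<tau>)")
    case True
    obtain x' where "\<bar>Re x'\<bar> \<le> 1 / 2" "Im x' \<ge> 1 / 2" "g x' = g x"
      using modular_reduce[of g x, OF T S \<open>x \<in> uhp\<close>] by blast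
    then show ?thesis using inK[of x'] \<xi> True by metis
  next
    case False
    then show ?thesis using \<xi>(2)[OF inK[of \<tau>0]] \<tau>0 by auto
  qed
  have "g constant_on uhp"
    by (rule maximum_modulus_principle[OF hol open_uhp connected_uhp open_uhp order_refl _ max])
       (use \<xi> Kuhp in auto)
  then obtain c where c: "\<And>x. x \<in> uhp \<Longrightarrow> g x = c" by (auto simp: constant_on_def)
  have "\<forall>\<^sub>F x in cusp. g x = c"
    using eventually_cusp_uhp by eventually_elim (rule c)
  from tendsto_cong[OF this] lim have "((\<lambda>_. c) \<longlongrightarrow> 0) cusp" by simp
  then have "c = 0" by (simp add: tendsto_const_iff)
  with c \<tau> nz show False by auto
qed

section \<open>Holomorphic functions on the product of the upper half-plane and the plane\<close>

text \<open>
  Holomorphy along every holomorphic curve is closed under composition by definition and passes to locally uniform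
  limits, where each curve is treated separately.
\<close>

definition hol2 :: "(complex \<Rightarrow> complex \<Rightarrow> complex) \<Rightarrow> bool" where
  "hol2 f \<longleftrightarrow> continuous_on (uhp \<times> UNIV) (\<lambda>(\<tau>, z). f \<tau> z) \<and>
     (\<forall>U g h. open U \<longrightarrow> g holomorphic_on U \<longrightarrow> h holomorphic_on U \<longrightarrow> g ` U \<subseteq> uhp \<longrightarrow>
        (\<lambda>t. f (g t) (h t)) holomorphic_on U)"

lemma hol2D:
  assumes "hol2 f" "open U" "g holomorphic_on U" "h holomorphic_on U" "g ` U \<subseteq> uhp"
  shows "(\<lambda>t. f (g t) (h t)) holomorphic_on U"
  using assms unfolding hol2_def by blast

lemma hol2_entire: "hol2 f \<Longrightarrow> \<tau> \<in> uhp \<Longrightarrow> f \<tau> holomorphic_on UNIV"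
  using hol2D[of f UNIV "\<lambda>_. \<tau>" "\<lambda>z. z"] by (auto simp: holomorphic_on_const holomorphic_on_ident)

lemma hol2_uhp: "hol2 f \<Longrightarrow> (\<lambda>\<tau>. f \<tau> z) holomorphic_on uhp"
  using hol2D[of f uhp "\<lambda>\<tau>. \<tau>" "\<lambda>_. z"] by (auto simp: holomorphic_on_const holomorphic_on_ident)

lemma hol2_continuous: "hol2 f \<Longrightarrow> continuous_on (uhp \<times> UNIV) (\<lambda>(\<tau>, z). f \<tau> z)"
  unfolding hol2_def by blast

named_theorems hol2_intros

lemma hol2_const [hol2_intros]: "hol2 (\<lambda>\<tau> z. c)"
  unfolding hol2_def by (auto intro!: continuous_intros holomorphic_intros simp: split_def)

lemma hol2_fst [hol2_intros]: "hol2 (\<lambda>\<tau> z. \<tau>)"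
  unfolding hol2_def by (auto intro!: continuous_intros holomorphic_intros simp: split_def)

lemma hol2_snd [hol2_intros]: "hol2 (\<lambda>\<tau> z. z)"
  unfolding hol2_def by (auto intro!: continuous_intros holomorphic_intros simp: split_def)

lemma hol2_add [hol2_intros]: "hol2 f \<Longrightarrow> hol2 g \<Longrightarrow> hol2 (\<lambda>\<tau> z. f \<tau> z + g \<tau> z)"
  unfolding hol2_def by (auto intro!: continuous_intros holomorphic_intros simp: split_def)

lemma hol2_diff [hol2_intros]: "hol2 f \<Longrightarrow> hol2 g \<Longrightarrow> hol2 (\<lambda>\<tau> z. f \<tau> z - g \<tau> z)"
  unfolding hol2_def by (auto intro!: continuous_intros holomorphic_intros simp: split_def)

lemma hol2_mult [hol2_intros]: "hol2 f \<Longrightarrow> hol2 g \<Longrightarrow> hol2 (\<lambda>\<tau> z. f \<tau> z * g \<tau> z)"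
  unfolding hol2_def by (auto intro!: continuous_intros holomorphic_intros simp: split_def)

lemma hol2_uminus [hol2_intros]: "hol2 f \<Longrightarrow> hol2 (\<lambda>\<tau> z. - f \<tau> z)"
  unfolding hol2_def by (auto intro!: continuous_intros holomorphic_intros simp: split_def)

lemma hol2_power [hol2_intros]: "hol2 f \<Longrightarrow> hol2 (\<lambda>\<tau> z. f \<tau> z ^ n)"
  unfolding hol2_def by (auto intro!: continuous_intros holomorphic_intros simp: split_def)

lemma hol2_e [hol2_intros]: "hol2 f \<Longrightarrow> hol2 (\<lambda>\<tau> z. e (f \<tau> z))"
  unfolding hol2_def by (auto intro!: continuous_intros holomorphic_intros simp: split_def)

lemma hol2_sum [hol2_intros]: "(\<And>i. i \<in> A \<Longrightarrow> hol2 (f i)) \<Longrightarrow> hol2 (\<lambda>\<tau> z. \<Sum>i\<in>A. f i \<tau> z)"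
  unfolding hol2_def by (auto intro!: continuous_intros holomorphic_intros simp: split_def)

lemma hol2_prod [hol2_intros]: "(\<And>i. i \<in> A \<Longrightarrow> hol2 (f i)) \<Longrightarrow> hol2 (\<lambda>\<tau> z. \<Prod>i\<in>A. f i \<tau> z)"
  unfolding hol2_def by (auto intro!: continuous_intros holomorphic_intros simp: split_def)

lemma hol2_divide [hol2_intros]:
  assumes "hol2 f" "hol2 g" "\<And>\<tau> z. \<tau> \<in> uhp \<Longrightarrow> g \<tau> z \<noteq> 0"
  shows "hol2 (\<lambda>\<tau> z. f \<tau> z / g \<tau> z)"
  using assms unfolding hol2_def
  by (auto intro!: continuous_intros holomorphic_intros simp: split_def image_subset_iff)

lemma hol2_compose:
  assumes f: "hol2 f" and g: "hol2 g" and h: "hol2 h" and gu: "\<And>\<tau> z. \<tau> \<in> uhp \<Longrightarrow> g \<tau> z \<in> uhp"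
  shows "hol2 (\<lambda>\<tau> z. f (g \<tau> z) (h \<tau> z))"
  unfolding hol2_def
proof (intro conjI allI impI)
  have "continuous_on (uhp \<times> UNIV) (\<lambda>x. (g (fst x) (snd x), h (fst x) (snd x)))"
    using hol2_continuous[OF g] hol2_continuous[OF h] by (intro continuous_intros) (simp_all add: split_def)
  then have "continuous_on (uhp \<times> UNIV) (\<lambda>x. (\<lambda>(\<tau>, z). f \<tau> z) (g (fst x) (snd x), h (fst x) (snd x)))"
    by (rule continuous_on_compose2[OF hol2_continuous[OF f]]) (use gu in auto)
  then show "continuous_on (uhp \<times> UNIV) (\<lambda>(\<tau>, z). f (g \<tau> z) (h \<tau> z))" by (simp add: split_def)
next
  fix U a b assume U: "open U" "a holomorphic_on U" "b holomorphic_on U" "a ` U \<subseteq> uhp"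
  show "(\<lambda>t. f (g (a t) (b t)) (h (a t) (b t))) holomorphic_on U"
    by (rule hol2D[OF f U(1) hol2D[OF g U] hol2D[OF h U]]) (use U gu in auto)
qed

text \<open>
  Compact sets exhausting the domain, on which series are bounded termwise.
\<close>

definition hbox :: "real \<Rightarrow> real \<Rightarrow> (complex \<times> complex) set" where
  "hbox \<delta> R = {(\<tau>, z). \<delta> \<le> Im \<tau> \<and> norm \<tau> \<le> R \<and> norm z \<le> R}"

lemma hbox_uhp: "\<delta> > 0 \<Longrightarrow> (\<tau>, z) \<in> hbox \<delta> R \<Longrightarrow> \<tau> \<in> uhp"
  by (auto simp: hbox_def uhp_def)

lemma compact_hbox: "compact (hbox \<delta> R)"
proof -
  have "hbox \<delta> R = (cball 0 R \<inter> {\<tau>. Im \<tau> \<ge> \<delta>}) \<times> cball 0 R" by (auto simp: hbox_def)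
  then show ?thesis
    by (simp only:) (intro compact_Times closed_Int_compact compact_Int_closed compact_cball closed_halfspace_Im_ge)
qed

lemma hol2_bounded:
  assumes "hol2 f" "\<delta> > 0"
  obtains M where "M > 0" "\<And>\<tau> z. (\<tau>, z) \<in> hbox \<delta> R \<Longrightarrow> norm (f \<tau> z) \<le> M"
proof -
  have "continuous_on (hbox \<delta> R) (\<lambda>(\<tau>, z). f \<tau> z)"
    by (rule continuous_on_subset[OF hol2_continuous[OF assms(1)]]) (use hbox_uhp[OF assms(2)] in auto)
  then have "bounded ((\<lambda>(\<tau>, z). f \<tau> z) ` hbox \<delta> R)"
    by (intro compact_imp_bounded compact_continuous_image compact_hbox)
  then show ?thesis using that unfolding bounded_pos by force
qed

lemma hol2_uniform_limit:
  assumes F: "\<And>i. hol2 (F i)" and nt: "Fil \<noteq> bot"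
    and lim: "\<And>\<delta> R. \<delta> > 0 \<Longrightarrow> uniform_limit (hbox \<delta> R) (\<lambda>i (\<tau>, z). F i \<tau> z) (\<lambda>(\<tau>, z). f \<tau> z) Fil"
  shows "hol2 f"
  unfolding hol2_def
proof (intro conjI allI impI)
  have cont: "continuous_on (hbox \<delta> R) (\<lambda>(\<tau>, z). f \<tau> z)" if "\<delta> > 0" for \<delta> R
  proof (rule uniform_limit_theorem[OF _ lim[OF that] nt], intro always_eventually allI)
    show "continuous_on (hbox \<delta> R) (\<lambda>(\<tau>, z). F i \<tau> z)" for i
      by (rule continuous_on_subset[OF hol2_continuous[OF F]]) (use hbox_uhp[OF that] in auto)
  qed
  have "isCont (\<lambda>(\<tau>, z). f \<tau> z) x" if xU: "x \<in> uhp \<times> UNIV" for x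
  proof -
    obtain \<tau> z where x: "x = (\<tau>, z)" "0 < Im \<tau>" using xU by (auto simp: uhp_def)
    define R where "R = norm \<tau> + norm z + 1"
    define S where "S = ({w. Im w > Im \<tau> / 2} \<inter> ball 0 R) \<times> ball (0 :: complex) R"
    have oS: "open S" unfolding S_def by (intro open_Times open_Int open_halfspace_Im_gt open_ball)
    have "norm \<tau> < R" "norm z < R"
      unfolding R_def using norm_ge_zero[of \<tau>] norm_ge_zero[of z] by linarith+
    then have xS: "x \<in> S" using x by (simp add: S_def)
    have "S \<subseteq> hbox (Im \<tau> / 2) R" by (auto simp: S_def hbox_def)
    from continuous_on_subset[OF cont this] x have "continuous_on S (\<lambda>(\<tau>, z). f \<tau> z)" by simp
    then show ?thesis using xS unfolding continuous_on_eq_continuous_at[OF oS] by (rule bspec)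
  qed
  then show "continuous_on (uhp \<times> UNIV) (\<lambda>(\<tau>, z). f \<tau> z)"
    by (rule continuous_at_imp_continuous_on[OF ballI])
next
  fix U g h assume U: "open U" "g holomorphic_on U" "h holomorphic_on U" "g ` U \<subseteq> uhp"
  have "(\<lambda>t. f (g t) (h t)) field_differentiable at x" if x: "x \<in> U" for x
  proof -
    obtain r where r: "r > 0" "cball x r \<subseteq> U" using U(1) x open_contains_cball by blast
    have cg: "continuous_on (cball x r) g" and ch: "continuous_on (cball x r) h"
      by (rule continuous_on_subset[OF holomorphic_on_imp_continuous_on[OF U(2)] r(2)],
          rule continuous_on_subset[OF holomorphic_on_imp_continuous_on[OF U(3)] r(2)])
    have "cball x r \<noteq> {}" using r by auto
    then obtain x0 where x0: "x0 \<in> cball x r" "\<And>y. y \<in> cball x r \<Longrightarrow> Im (g x0) \<le> Im (g y)"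
      using continuous_attains_inf[OF compact_cball, of x r "\<lambda>y. Im (g y)", OF _ continuous_on_Im[OF cg]] by blast
    define \<delta> where "\<delta> = Im (g x0)"
    have "g x0 \<in> uhp" using U(4) r(2) x0(1) by (auto simp only: image_subset_iff subset_iff)
    then have \<delta>: "\<delta> > 0" by (simp add: \<delta>_def uhp_def)
    have "bounded (g ` cball x r)" "bounded (h ` cball x r)"
      by (rule compact_imp_bounded, rule compact_continuous_image, rule cg ch, rule compact_cball)+
    then obtain A B where AB: "\<And>y. y \<in> cball x r \<Longrightarrow> norm (g y) \<le> A" "\<And>y. y \<in> cball x r \<Longrightarrow> norm (h y) \<le> B"
      unfolding bounded_iff ball_simps(9) by metis
    have "uniform_limit (cball x r) (\<lambda>i y. (\<lambda>(\<tau>, z). F i \<tau> z) (g y, h y)) (\<lambda>y. (\<lambda>(\<tau>, z). f \<tau> z) (g y, h y)) Fil"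
    proof (rule uniform_limit_compose'[OF lim[OF \<delta>, of "max A B"]])
      show "(\<lambda>y. (g y, h y)) \<in> cball x r \<rightarrow> hbox \<delta> (max A B)"
        unfolding hbox_def \<delta>_def using x0(2) AB by (simp add: Pi_iff le_max_iff_disj del: mem_cball)
    qed
    then have ul: "uniform_limit (cball x r) (\<lambda>i y. F i (g y) (h y)) (\<lambda>y. f (g y) (h y)) Fil" by simp
    have hi: "(\<lambda>y. F i (g y) (h y)) holomorphic_on U" for i by (rule hol2D[OF F U])
    have "\<forall>\<^sub>F i in Fil. continuous_on (cball x r) (\<lambda>y. F i (g y) (h y)) \<and> (\<lambda>y. F i (g y) (h y)) holomorphic_on ball x r"
    proof (intro always_eventually allI conjI)
      fix i
      show "continuous_on (cball x r) (\<lambda>y. F i (g y) (h y))"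
        by (rule holomorphic_on_imp_continuous_on, rule holomorphic_on_subset[OF hi r(2)])
      show "(\<lambda>y. F i (g y) (h y)) holomorphic_on ball x r"
        by (rule holomorphic_on_subset[OF hi]) (use r(2) in force)
    qed
    from holomorphic_uniform_limit[OF this ul nt]
    have "(\<lambda>y. f (g y) (h y)) holomorphic_on ball x r" by blast
    then show ?thesis using r(1) holomorphic_on_imp_differentiable_at by auto
  qed
  then show "(\<lambda>t. f (g t) (h t)) holomorphic_on U"
    by (simp add: holomorphic_on_def field_differentiable_at_within)
qed

lemma hol2_infsum:
  assumes "\<And>i. i \<in> I \<Longrightarrow> hol2 (f i)"
    and "\<And>\<delta> R. \<delta> > 0 \<Longrightarrow> \<exists>M. M summable_on I \<and> (\<forall>i\<in>I. \<forall>(\<tau>, z)\<in>hbox \<delta> R. norm (f i \<tau> z) \<le> M i)"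
  shows "hol2 (\<lambda>\<tau> z. \<Sum>\<^sub>\<infinity>i\<in>I. f i \<tau> z)"
proof (rule hol2_uniform_limit)
  show "hol2 (\<lambda>\<tau> z. \<Sum>i\<in>X \<inter> I. f i \<tau> z)" for X using assms(1) by (intro hol2_sum) auto
  show "finite_subsets_at_top I \<noteq> bot" by simp
  fix \<delta> R :: real assume "\<delta> > 0"
  then obtain M where M: "M summable_on I" "\<And>i \<tau> z. i \<in> I \<Longrightarrow> (\<tau>, z) \<in> hbox \<delta> R \<Longrightarrow> norm (f i \<tau> z) \<le> M i"
    using assms(2)[of \<delta> R] by blast
  have "uniform_limit (hbox \<delta> R) (\<lambda>X y. \<Sum>i\<in>X. f i (fst y) (snd y)) (\<lambda>y. \<Sum>\<^sub>\<infinity>i\<in>I. f i (fst y) (snd y))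
          (finite_subsets_at_top I)"
    by (rule Weierstrass_m_test_general[OF _ M(1)]) (use M(2) in auto)
  moreover have "\<forall>\<^sub>F X in finite_subsets_at_top I. \<forall>y\<in>hbox \<delta> R.
      (\<Sum>i\<in>X. f i (fst y) (snd y)) = (\<Sum>i\<in>X \<inter> I. f i (fst y) (snd y))"
    by (rule eventually_finite_subsets_at_top_weakI) (simp add: Int_absorb2)
  ultimately show "uniform_limit (hbox \<delta> R) (\<lambda>X (\<tau>, z). \<Sum>i\<in>X \<inter> I. f i \<tau> z)
     (\<lambda>(\<tau>, z). \<Sum>\<^sub>\<infinity>i\<in>I. f i \<tau> z) (finite_subsets_at_top I)"
    unfolding split_def by (subst (asm) uniform_limit_cong) auto
qed

section \<open>The infinite product\<close>

text \<open>
  The \<open>q\<close>-Pochhammer symbol \<open>(x; q)\<^sub>\<infinity>\<close> at \<open>x = e u\<close>, \<open>q = e \<tau>\<close>.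
\<close>

definition qpoch :: "complex \<Rightarrow> complex \<Rightarrow> complex" where
  "qpoch \<tau> u = (\<Prod>n. 1 - e (u + of_nat n * \<tau>))"

lemma e_add_nat_mult: "e (u + of_nat n * \<tau>) = e u * e \<tau> ^ n"
  by (simp add: e_add e_of_nat_mult)

lemma norm_e_less_1: "\<tau> \<in> uhp \<Longrightarrow> norm (e \<tau>) < 1"
  by (simp add: norm_e uhp_def)

lemma qpoch_convergent:
  assumes "\<tau> \<in> uhp"
  shows "convergent_prod (\<lambda>n. 1 - e (u + of_nat n * \<tau>))"
proof -
  have "summable (\<lambda>n. norm (e u) * norm (e \<tau>) ^ n)"
    using norm_e_less_1[OF assms] by (intro summable_mult summable_geometric) simp
  then have "summable (\<lambda>n. norm ((1 - e (u + of_nat n * \<tau>)) - 1))"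
    by (simp add: e_add_nat_mult norm_mult norm_power)
  then show ?thesis
    by (intro abs_convergent_prod_imp_convergent_prod summable_imp_abs_convergent_prod)
qed

lemma qpoch_LIMSEQ: "\<tau> \<in> uhp \<Longrightarrow> (\<lambda>N. \<Prod>n<N. 1 - e (u + of_nat n * \<tau>)) \<longlonglongrightarrow> qpoch \<tau> u"
  unfolding qpoch_def using convergent_prod_LIMSEQ[OF qpoch_convergent] LIMSEQ_lessThan_iff_atMost by blast

lemma qpoch_eqI: "\<tau> \<in> uhp \<Longrightarrow> (\<lambda>N. \<Prod>n<N. 1 - e (u + of_nat n * \<tau>)) \<longlonglongrightarrow> L \<Longrightarrow> qpoch \<tau> u = L"
  using qpoch_LIMSEQ LIMSEQ_unique by blast

lemma qpoch_eq_0_iff: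
  assumes "\<tau> \<in> uhp"
  shows "qpoch \<tau> u = 0 \<longleftrightarrow> (\<exists>n. u + of_nat n * \<tau> \<in> \<int>)"
  using has_prod_eq_0_iff[OF convergent_prod_has_prod[OF qpoch_convergent[OF assms, of u]]]
  by (auto simp: qpoch_def e_eq_1_iff[symmetric] image_iff)

lemma qpoch_step:
  assumes "\<tau> \<in> uhp"
  shows "qpoch \<tau> u = (1 - e u) * qpoch \<tau> (u + \<tau>)"
proof (rule qpoch_eqI[OF assms])
  have "(\<lambda>N. (1 - e u) * (\<Prod>n<N. 1 - e (u + \<tau> + of_nat n * \<tau>))) \<longlonglongrightarrow> (1 - e u) * qpoch \<tau> (u + \<tau>)"
    by (intro tendsto_mult tendsto_const qpoch_LIMSEQ assms)
  also have "(\<lambda>N. (1 - e u) * (\<Prod>n<N. 1 - e (u + \<tau> + of_nat n * \<tau>))) =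
             (\<lambda>N. \<Prod>n<Suc N. 1 - e (u + of_nat n * \<tau>))"
    by (subst prod.lessThan_Suc_shift) (simp add: algebra_simps)
  finally show "(\<lambda>N. \<Prod>n<N. 1 - e (u + of_nat n * \<tau>)) \<longlonglongrightarrow> (1 - e u) * qpoch \<tau> (u + \<tau>)"
    by (subst (asm) filterlim_sequentially_Suc)
qed

lemma qpoch_int: "qpoch \<tau> (u + of_int k) = qpoch \<tau> u"
proof -
  have "e (u + of_int k + of_nat n * \<tau>) = e (u + of_nat n * \<tau>)" for n
    using e_add_int[of "u + of_nat n * \<tau>" k] by (simp add: add_ac)
  then show ?thesis by (simp add: qpoch_def)
qed

lemma qpoch_1 [simp]: "qpoch \<tau> (u + 1) = qpoch \<tau> u"
  using qpoch_int[of \<tau> u 1] by simp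

lemma qpoch_\<tau>_plus_1: "qpoch (\<tau> + 1) u = qpoch \<tau> u"
proof -
  have "e (u + of_nat n * (\<tau> + 1)) = e (u + of_nat n * \<tau>)" for n
    using e_add_int[of "u + of_nat n * \<tau>" "int n"] by (simp add: algebra_simps)
  then show ?thesis by (simp add: qpoch_def)
qed

lemma qpoch_mult_half:
  assumes "\<tau> \<in> uhp"
  shows "qpoch \<tau> u * qpoch \<tau> (u + 1 / 2) = qpoch (2 * \<tau>) (2 * u)"
proof (rule sym, rule qpoch_eqI)
  have *: "(1 - e (u + of_nat n * \<tau>)) * (1 - e (u + 1 / 2 + of_nat n * \<tau>)) = 1 - e (2 * u + of_nat n * (2 * \<tau>))" for n
  proof -
    have "e (u + 1 / 2 + of_nat n * \<tau>) = - e (u + of_nat n * \<tau>)"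
      using e_add[of "u + of_nat n * \<tau>" "1 / 2"] by (simp add: add_ac e_half)
    moreover have "e (2 * u + of_nat n * (2 * \<tau>)) = e (u + of_nat n * \<tau>) ^ 2"
      using e_of_nat_mult[of 2 "u + of_nat n * \<tau>"] by (simp add: algebra_simps)
    ultimately show ?thesis by (simp add: algebra_simps power2_eq_square)
  qed
  have "(\<lambda>N. (\<Prod>n<N. 1 - e (u + of_nat n * \<tau>)) * (\<Prod>n<N. 1 - e (u + 1 / 2 + of_nat n * \<tau>)))
          \<longlonglongrightarrow> qpoch \<tau> u * qpoch \<tau> (u + 1 / 2)"
    by (intro tendsto_mult qpoch_LIMSEQ assms)
  then show "(\<lambda>N. \<Prod>n<N. 1 - e (2 * u + of_nat n * (2 * \<tau>))) \<longlonglongrightarrow> qpoch \<tau> u * qpoch \<tau> (u + 1 / 2)"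
    by (simp add: prod.distrib[symmetric] *)
qed (use assms in \<open>simp add: uhp_def\<close>)

lemma qpoch_even_odd:
  assumes "\<tau> \<in> uhp"
  shows "qpoch \<tau> u = qpoch (2 * \<tau>) u * qpoch (2 * \<tau>) (u + \<tau>)"
proof -
  have 2: "2 * \<tau> \<in> uhp" using assms by (simp add: uhp_def)
  have "(\<Prod>n<2 * N. 1 - e (u + of_nat n * \<tau>)) =
      (\<Prod>n<N. 1 - e (u + of_nat n * (2 * \<tau>))) * (\<Prod>n<N. 1 - e (u + \<tau> + of_nat n * (2 * \<tau>)))" for N
    by (induction N) (simp_all add: algebra_simps)
  moreover have "(\<lambda>N. (\<Prod>n<N. 1 - e (u + of_nat n * (2 * \<tau>))) * (\<Prod>n<N. 1 - e (u + \<tau> + of_nat n * (2 * \<tau>))))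
      \<longlonglongrightarrow> qpoch (2 * \<tau>) u * qpoch (2 * \<tau>) (u + \<tau>)"
    by (intro tendsto_mult qpoch_LIMSEQ 2)
  moreover have "(\<lambda>N. \<Prod>n<2 * N. 1 - e (u + of_nat n * \<tau>)) \<longlonglongrightarrow> qpoch \<tau> u"
    using LIMSEQ_subseq_LIMSEQ[OF qpoch_LIMSEQ[OF assms, of u], of "\<lambda>N. 2 * N"]
    by (simp add: strict_mono_def o_def)
  ultimately show ?thesis using LIMSEQ_unique by auto
qed

lemma norm_qpoch_minus_1_le:
  assumes "\<tau> \<in> uhp"
  shows "norm (qpoch \<tau> u - 1) \<le> exp (norm (e u) / (1 - norm (e \<tau>))) - 1"
proof (rule LIMSEQ_le_const2)
  show "(\<lambda>N. norm ((\<Prod>n<N. 1 - e (u + of_nat n * \<tau>)) - 1)) \<longlonglongrightarrow> norm (qpoch \<tau> u - 1)"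
    by (intro tendsto_intros qpoch_LIMSEQ assms)
  show "\<exists>N0. \<forall>N\<ge>N0. norm ((\<Prod>n<N. 1 - e (u + of_nat n * \<tau>)) - 1) \<le> exp (norm (e u) / (1 - norm (e \<tau>))) - 1"
  proof (intro exI allI impI)
    fix N :: nat
    have "norm ((\<Prod>n<N. 1 + - e (u + of_nat n * \<tau>)) - 1) \<le> (\<Prod>n<N. 1 + norm (- e (u + of_nat n * \<tau>))) - 1"
      by (rule norm_prod_minus1_le_prod_minus1)
    also have "(\<Prod>n<N. 1 + norm (- e (u + of_nat n * \<tau>))) \<le> exp (\<Sum>n<N. norm (- e (u + of_nat n * \<tau>)))"
      by (rule prod_le_exp_sum) auto
    also have "(\<Sum>n<N. norm (- e (u + of_nat n * \<tau>))) = norm (e u) * (\<Sum>n<N. norm (e \<tau>) ^ n)"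
      by (simp add: e_add_nat_mult norm_mult norm_power sum_distrib_left)
    also have "\<dots> \<le> norm (e u) * (1 / (1 - norm (e \<tau>)))"
    proof (intro mult_left_mono)
      have "(\<Sum>n<N. norm (e \<tau>) ^ n) \<le> (\<Sum>n. norm (e \<tau>) ^ n)"
        using norm_e_less_1[OF assms] by (intro sum_le_suminf summable_geometric) auto
      also have "\<dots> = 1 / (1 - norm (e \<tau>))" using norm_e_less_1[OF assms] by (intro suminf_geometric) auto
      finally show "(\<Sum>n<N. norm (e \<tau>) ^ n) \<le> 1 / (1 - norm (e \<tau>))" .
    qed auto
    finally show "norm ((\<Prod>n<N. 1 - e (u + of_nat n * \<tau>)) - 1) \<le> exp (norm (e u) / (1 - norm (e \<tau>))) - 1"
      by simp
  qed
qed

lemma hol2_qpoch: "hol2 qpoch"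
proof (rule hol2_uniform_limit)
  show "hol2 (\<lambda>\<tau> u. \<Prod>n<N. 1 - e (u + of_nat n * \<tau>))" for N :: nat
    by (intro hol2_intros)
  show "sequentially \<noteq> bot" by simp
  fix \<delta> R :: real assume \<delta>: "\<delta> > 0"
  have "uniformly_convergent_on (hbox \<delta> R) (\<lambda>N x. \<Prod>n<N. (1 - e (snd x + of_nat n * fst x)))"
  proof (rule uniformly_convergent_on_prod'[OF _ compact_hbox])
    show "continuous_on (hbox \<delta> R) (\<lambda>x. 1 - e (snd x + of_nat n * fst x))" for n
      by (intro continuous_intros)
    show "uniformly_convergent_on (hbox \<delta> R) (\<lambda>N x. \<Sum>n<N. norm (1 - e (snd x + of_nat n * fst x) - 1))"
    proof (rule Weierstrass_m_test')
      show "summable (\<lambda>n. exp (2 * pi * R) * exp (- 2 * pi * \<delta>) ^ n)"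
        using \<delta> by (intro summable_mult summable_geometric) auto
      fix n :: nat and x assume x: "x \<in> hbox \<delta> R"
      have "norm (e (snd x)) \<le> exp (2 * pi * R)"
      proof -
        have "- Im (snd x) \<le> R" using x abs_Im_le_cmod[of "snd x"] by (auto simp: hbox_def)
        then have "2 * pi * (- Im (snd x)) \<le> 2 * pi * R" by (intro mult_left_mono) auto
        then show ?thesis by (simp add: norm_e)
      qed
      moreover have "norm (e (fst x)) \<le> exp (- 2 * pi * \<delta>)"
        using x by (auto simp: norm_e hbox_def)
      ultimately show "norm (norm (1 - e (snd x + of_nat n * fst x) - 1)) \<le> exp (2 * pi * R) * exp (- 2 * pi * \<delta>) ^ n"
        by (simp add: e_add_nat_mult norm_mult norm_power mult_mono power_mono)
    qed
  qed
  then obtain l where l: "uniform_limit (hbox \<delta> R) (\<lambda>N x. \<Prod>n<N. (1 - e (snd x + of_nat n * fst x))) l sequentially"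
    unfolding uniformly_convergent_on_def by blast
  have "l x = qpoch (fst x) (snd x)" if x: "x \<in> hbox \<delta> R" for x
  proof -
    have "fst x \<in> uhp" using hbox_uhp[OF \<delta>, of "fst x" "snd x" R] x by simp
    from qpoch_eqI[OF this tendsto_uniform_limitI[OF l x]] show ?thesis by simp
  qed
  then have "uniform_limit (hbox \<delta> R) (\<lambda>N x. \<Prod>n<N. (1 - e (snd x + of_nat n * fst x)))
               (\<lambda>x. qpoch (fst x) (snd x)) sequentially"
    by (intro uniform_limit_cong'[THEN iffD1, OF _ _ l]) auto
  then show "uniform_limit (hbox \<delta> R) (\<lambda>N (\<tau>, u). \<Prod>n<N. 1 - e (u + of_nat n * \<tau>)) (\<lambda>(\<tau>, u). qpoch \<tau> u) sequentially"
    by (simp add: split_def)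
qed

section \<open>The theta quotient of weight -1 and index 1/2\<close>

text \<open>
  The quotient \<open>\<vartheta>(\<tau>, z) / \<eta>(\<tau>)\<^sup>3\<close> in product form, a Klein form up to normalization. Starting from the product, its
  zeros and quasi-periods are evident, and the quotient of weight -1 has an inversion formula free of roots of \<open>\<tau>\<close>.
\<close>

definition klein :: "complex \<Rightarrow> complex \<Rightarrow> complex" where
  "klein \<tau> z = (e (z / 2) - e (- z / 2)) * qpoch \<tau> (\<tau> + z) * qpoch \<tau> (\<tau> - z) / (qpoch \<tau> \<tau>)\<^sup>2"

lemma qpoch_self_nz: "\<tau> \<in> uhp \<Longrightarrow> qpoch \<tau> \<tau> \<noteq> 0"
proof
  assume \<tau>: "\<tau> \<in> uhp" and "qpoch \<tau> \<tau> = 0"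
  then obtain n where "\<tau> + of_nat n * \<tau> \<in> \<int>" using qpoch_eq_0_iff by blast
  then obtain k where k: "\<tau> + of_nat n * \<tau> = of_int k" by (auto elim: Ints_cases)
  from arg_cong[OF k, of Im] have "(1 + real n) * Im \<tau> = 0" by (simp add: algebra_simps)
  then show False using \<tau> by (auto simp: uhp_def)
qed

lemma qpoch_minus_1: "qpoch \<tau> (u - 1) = qpoch \<tau> u"
  using qpoch_int[of \<tau> u "-1"] by simp

lemma e_plus_1: "e (z + 1) = e z"
  by (simp add: e_add)

lemma e_1_plus: "e (1 + z) = e z"
  by (simp add: e_add)

lemma e_half_mult: "e (z / 2) * e (z / 2) = e z"
  using e_add[of "z / 2" "z / 2"] by simp

lemma klein_theta:
  assumes "\<tau> \<in> uhp"
  shows "klein \<tau> z = - e (- z / 2) * qpoch \<tau> z * qpoch \<tau> (\<tau> - z) / (qpoch \<tau> \<tau>)\<^sup>2"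
proof -
  have "e (- z / 2) * e z = e (z / 2)" using e_add[of "- z / 2" z] by (simp add: field_simps)
  then have 1: "e (z / 2) - e (- z / 2) = - e (- z / 2) * (1 - e z)" by (simp add: algebra_simps)
  have 2: "qpoch \<tau> z = (1 - e z) * qpoch \<tau> (\<tau> + z)" using qpoch_step[OF assms, of z] by (simp add: add.commute)
  show ?thesis unfolding klein_def 1 2 by (simp only: mult_ac)
qed

lemma klein_0 [simp]: "klein \<tau> 0 = 0"
  by (simp add: klein_def)

lemma klein_minus: "klein \<tau> (- z) = - klein \<tau> z"
proof -
  have "e (- z / 2) - e (- (- z) / 2) = - (e (z / 2) - e (- z / 2))" by simp
  moreover have "\<tau> + - z = \<tau> - z" "\<tau> - - z = \<tau> + z" by simp_all
  ultimately show ?thesis unfolding klein_def by (simp only: mult_minus_left mult_minus_right minus_divide_left mult_ac)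
qed

lemma klein_plus_1: "klein \<tau> (z + 1) = - klein \<tau> z"
proof -
  have "e ((z + 1) / 2) = - e (z / 2)" "e (- (z + 1) / 2) = - e (- z / 2)"
    using e_add[of "z / 2" "1 / 2"] e_add[of "- z / 2" "- 1 / 2"] e_minus[of "1/2"]
    by (simp_all add: e_half add_divide_distrib diff_divide_distrib)
  moreover have "qpoch \<tau> (\<tau> + (z + 1)) = qpoch \<tau> (\<tau> + z)" "qpoch \<tau> (\<tau> - (z + 1)) = qpoch \<tau> (\<tau> - z)"
    using qpoch_1[of \<tau> "\<tau> + z"] qpoch_minus_1[of \<tau> "\<tau> - z"] by (simp_all add: algebra_simps)
  ultimately show ?thesis by (simp add: klein_def algebra_simps diff_divide_distrib)
qed

lemma klein_minus_1: "klein \<tau> (z - 1) = - klein \<tau> z"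
  using klein_plus_1[of \<tau> "z - 1"] by simp

lemma klein_plus_\<tau>:
  assumes "\<tau> \<in> uhp"
  shows "klein \<tau> (z + \<tau>) = - e (- \<tau> / 2 - z) * klein \<tau> z"
proof -
  have 1: "(e z - 1) * qpoch \<tau> (z + \<tau>) = - qpoch \<tau> z" using qpoch_step[OF assms, of z] by (simp add: algebra_simps)
  have 2: "qpoch \<tau> (- z) = (1 - e (- z)) * qpoch \<tau> (\<tau> - z)" using qpoch_step[OF assms, of "- z"] by simp
  have 3: "qpoch \<tau> (z + \<tau>) * qpoch \<tau> (- z) = - e (- z) * (qpoch \<tau> z * qpoch \<tau> (\<tau> - z))"
  proof -
    have "1 - e (- z) = e (- z) * (e z - 1)" by (simp add: algebra_simps e_minus)
    then show ?thesis unfolding 2 using 1 by (metis (no_types, opaque_lifting) mult.assoc mult.left_commute mult_minus_left mult_minus_right)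
  qed
  have 4: "e (- (z + \<tau>) / 2) * e (- z) = e (- \<tau> / 2 - z) * e (- z / 2)"
    unfolding e_add[symmetric] by (rule arg_cong[where f = e]) (simp add: field_simps)
  have "klein \<tau> (z + \<tau>) = - e (- (z + \<tau>) / 2) * (qpoch \<tau> (z + \<tau>) * qpoch \<tau> (- z)) / (qpoch \<tau> \<tau>)\<^sup>2"
    by (simp add: klein_theta[OF assms] mult.assoc)
  also have "\<dots> = (e (- (z + \<tau>) / 2) * e (- z)) * qpoch \<tau> z * qpoch \<tau> (\<tau> - z) / (qpoch \<tau> \<tau>)\<^sup>2"
    unfolding 3 by simp
  finally show ?thesis unfolding 4 by (simp add: klein_theta[OF assms] mult_ac)
qed

lemma klein_eq_0D:
  assumes "\<tau> \<in> uhp" "klein \<tau> z = 0"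
  shows "\<exists>m n :: int. z = of_int m + of_int n * \<tau>"
proof -
  have "qpoch \<tau> z = 0 \<or> qpoch \<tau> (\<tau> - z) = 0"
    using assms qpoch_self_nz[OF assms(1)] by (simp add: klein_theta)
  then obtain n where "z + of_nat n * \<tau> \<in> \<int> \<or> \<tau> - z + of_nat n * \<tau> \<in> \<int>"
    using qpoch_eq_0_iff[OF assms(1)] by blast
  then consider k where "z + of_nat n * \<tau> = of_int k" | k where "\<tau> - z + of_nat n * \<tau> = of_int k"
    by (auto elim: Ints_cases)
  then show ?thesis
  proof cases
    case 1
    then show ?thesis by (intro exI[of _ k] exI[of _ "- int n"]) (simp add: algebra_simps)
  next
    case 2
    then show ?thesis by (intro exI[of _ "- k"] exI[of _ "int n + 1"]) (simp add: algebra_simps)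
  qed
qed

lemma half_period_not_lattice:
  assumes \<tau>: "\<tau> \<in> uhp" and eq: "(of_int a + of_int b * \<tau>) / 2 = of_int m + of_int n * \<tau>"
  shows "even a \<and> even b"
proof -
  have *: "of_int a + of_int b * \<tau> = of_int (2 * m) + of_int (2 * n) * \<tau>"
    using eq by (simp add: field_simps)
  have "of_int b * Im \<tau> = of_int (2 * n) * Im \<tau>" using arg_cong[OF *, of Im] by simp
  then have "(of_int b :: real) = of_int (2 * n)" using \<tau> by (simp add: uhp_def)
  then have b: "b = 2 * n" by (simp only: of_int_eq_iff)
  then have "(of_int a :: real) = of_int (2 * m)" using arg_cong[OF *, of Re] by simp
  then have "a = 2 * m" by (simp only: of_int_eq_iff)
  with b show ?thesis by simp
qed

lemma klein_half_nz:
  assumes "\<tau> \<in> uhp"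
  shows "klein \<tau> (1 / 2) \<noteq> 0" "klein \<tau> (\<tau> / 2) \<noteq> 0" "klein \<tau> ((\<tau> + 1) / 2) \<noteq> 0"
proof -
  have *: "klein \<tau> ((of_int a + of_int b * \<tau>) / 2) \<noteq> 0" if "odd a \<or> odd b" for a b
    using klein_eq_0D[OF assms, of "(of_int a + of_int b * \<tau>) / 2"] half_period_not_lattice[OF assms, of a b] that by blast
  show "klein \<tau> (1 / 2) \<noteq> 0" "klein \<tau> (\<tau> / 2) \<noteq> 0" "klein \<tau> ((\<tau> + 1) / 2) \<noteq> 0"
    using *[of 1 0] *[of 0 1] *[of 1 1] by (simp_all add: add.commute)
qed

lemma hol2_qpoch' [hol2_intros]: "hol2 f \<Longrightarrow> hol2 (\<lambda>\<tau> z. qpoch \<tau> (f \<tau> z))"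
  by (intro hol2_compose[OF hol2_qpoch hol2_fst])

lemma hol2_klein: "hol2 klein"
  unfolding klein_def divide_inverse[of _ 2]
  by (intro hol2_intros) (auto simp: qpoch_self_nz)

lemma hol2_klein' [hol2_intros]: "hol2 f \<Longrightarrow> hol2 (\<lambda>\<tau> z. klein \<tau> (f \<tau> z))"
  by (intro hol2_compose[OF hol2_klein hol2_fst])

lemma klein_over_z:
  assumes "\<tau> \<in> uhp"
  shows "((\<lambda>z. klein \<tau> z / z) \<longlongrightarrow> 2 * of_real pi * \<i>) (at 0)"
proof -
  have "((\<lambda>z. e (z / 2) - e (- z / 2)) has_field_derivative 2 * of_real pi * \<i>) (at 0)"
    unfolding e_def by (auto intro!: derivative_eq_intros)
  then have 1: "((\<lambda>z. (e (z / 2) - e (- z / 2)) / z) \<longlongrightarrow> 2 * of_real pi * \<i>) (at 0)"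
    by (simp add: has_field_derivative_iff)
  have "(\<lambda>z. qpoch \<tau> (\<tau> + z) * qpoch \<tau> (\<tau> - z) / (qpoch \<tau> \<tau>)\<^sup>2) holomorphic_on UNIV"
    by (rule hol2_entire[OF _ assms, of "\<lambda>\<tau> z. qpoch \<tau> (\<tau> + z) * qpoch \<tau> (\<tau> - z) / (qpoch \<tau> \<tau>)\<^sup>2"])
       (intro hol2_intros, simp add: qpoch_self_nz)
  from entire_isCont[OF this, of 0]
  have "((\<lambda>z. qpoch \<tau> (\<tau> + z) * qpoch \<tau> (\<tau> - z) / (qpoch \<tau> \<tau>)\<^sup>2) \<longlongrightarrow> 1) (at 0)"
    using qpoch_self_nz[OF assms] by (simp add: isCont_def power2_eq_square)
  from tendsto_mult[OF 1 this] show ?thesis by (simp add: klein_def mult_ac)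
qed

lemma klein_T: "klein (\<tau> + 1) z = klein \<tau> z"
proof -
  have "qpoch (\<tau> + 1) (\<tau> + 1 + u) = qpoch \<tau> (\<tau> + u)" for u
  proof -
    have "qpoch (\<tau> + 1) (\<tau> + 1 + u) = qpoch \<tau> (\<tau> + u + 1)" by (subst qpoch_\<tau>_plus_1) (simp add: add_ac)
    then show ?thesis by simp
  qed
  from this[of z] this[of "- z"] this[of 0] show ?thesis by (simp add: klein_def)
qed

text \<open>
  Both sides have the same quasi-periods in \<open>z\<close>, so their quotient is an entire elliptic function; its constant
  value is read off at \<open>z = 0\<close>.
\<close>

lemma klein_S:
  assumes \<tau>: "\<tau> \<in> uhp"
  shows "klein (- 1 / \<tau>) (z / \<tau>) = e (z\<^sup>2 / (2 * \<tau>)) * klein \<tau> z / \<tau>"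
proof -
  have nz: "\<tau> \<noteq> 0" by (rule uhp_nz[OF \<tau>])
  have \<tau>': "- 1 / \<tau> \<in> uhp" by (rule uhp_neg_inverse[OF \<tau>])
  define f where "f z = klein (- 1 / \<tau>) (z / \<tau>) * e (- z\<^sup>2 / (2 * \<tau>))" for z
  have "f z = (1 / \<tau>) * klein \<tau> z"
  proof (rule quasi_periodic_unique[where \<alpha> = "-1" and \<beta> = "\<lambda>z. - e (- \<tau> / 2 - z)" and \<tau> = \<tau>
      and f = f and g = "klein \<tau>" and L = "1 / \<tau>"])
    show "Im \<tau> > 0" using \<tau> by (simp add: uhp_def)
    have "(\<lambda>z. klein (- 1 / \<tau>) (z / \<tau>)) holomorphic_on UNIV"
      by (rule holomorphic_on_compose_gen[OF _ hol2_entire[OF hol2_klein \<tau>'], of "\<lambda>z. z / \<tau>", unfolded o_def])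
         (auto intro!: holomorphic_intros simp: nz)
    then show "f holomorphic_on UNIV"
      unfolding f_def by (intro holomorphic_intros) (simp_all add: nz)
    show "klein \<tau> holomorphic_on UNIV" by (rule hol2_entire[OF hol2_klein \<tau>])
    show "f (z + 1) = - 1 * f z" for z
    proof -
      define u where "u = (z + 1) / \<tau>"
      have "- (- 1 / \<tau>) / 2 = 1 / (2 * \<tau>)" by simp
      then have "klein (- 1 / \<tau>) (u + - 1 / \<tau>) = - e (1 / (2 * \<tau>) - u) * klein (- 1 / \<tau>) u"
        using klein_plus_\<tau>[OF \<tau>', of u] by (simp only:)
      moreover have "u + - 1 / \<tau> = z / \<tau>" by (simp add: u_def add_divide_distrib)
      ultimately have 1: "klein (- 1 / \<tau>) (z / \<tau>) = - e (1 / (2 * \<tau>) - u) * klein (- 1 / \<tau>) u" by simp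
      have 2: "e (1 / (2 * \<tau>) - u) * e (- z\<^sup>2 / (2 * \<tau>)) = e (- (z + 1)\<^sup>2 / (2 * \<tau>))"
        unfolding e_add[symmetric] u_def using nz by (intro arg_cong[where f = e]) (simp add: field_simps power2_eq_square)
      show ?thesis unfolding f_def 1 using 2 by (simp add: u_def mult_ac)
    qed
    show "f (z + \<tau>) = - e (- \<tau> / 2 - z) * f z" for z
    proof -
      have 1: "(z + \<tau>) / \<tau> = z / \<tau> + 1" using nz by (simp add: field_simps)
      have 2: "e (- (z + \<tau>)\<^sup>2 / (2 * \<tau>)) = e (- \<tau> / 2 - z) * e (- z\<^sup>2 / (2 * \<tau>))"
        unfolding e_add[symmetric] using nz by (intro arg_cong[where f = e]) (simp add: field_simps power2_eq_square)
      show ?thesis unfolding f_def 1 2 by (simp add: klein_plus_1)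
    qed
    show "klein \<tau> (z + 1) = - 1 * klein \<tau> z" for z by (simp add: klein_plus_1)
    show "klein \<tau> (z + \<tau>) = - e (- \<tau> / 2 - z) * klein \<tau> z" for z by (rule klein_plus_\<tau>[OF \<tau>])
    show "klein \<tau> z = 0 \<Longrightarrow> \<exists>m n :: int. z = of_int m + of_int n * \<tau>" for z by (rule klein_eq_0D[OF \<tau>])
    show "((\<lambda>z. f z / klein \<tau> z) \<longlongrightarrow> 1 / \<tau>) (at 0)"
    proof -
      have "filterlim (\<lambda>z. z / \<tau>) (at 0) (at 0)"
        using nz by (intro filterlim_atI tendsto_eq_intros) (auto simp: eventually_at_filter)
      from filterlim_compose[OF klein_over_z[OF \<tau>'] this]
      have "((\<lambda>z. klein (- 1 / \<tau>) (z / \<tau>) / (z / \<tau>)) \<longlongrightarrow> 2 * of_real pi * \<i>) (at 0)" .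
      moreover have "((\<lambda>z. e (- z\<^sup>2 / (2 * \<tau>))) \<longlongrightarrow> e (- 0\<^sup>2 / (2 * \<tau>))) (at 0)"
        unfolding e_def by (intro tendsto_intros) (simp add: nz)
      ultimately have "((\<lambda>z. klein (- 1 / \<tau>) (z / \<tau>) / (z / \<tau>) * e (- z\<^sup>2 / (2 * \<tau>)) * (1 / \<tau>) / (klein \<tau> z / z)) \<longlongrightarrow>
           2 * of_real pi * \<i> * e (- 0\<^sup>2 / (2 * \<tau>)) * (1 / \<tau>) / (2 * of_real pi * \<i>)) (at 0)"
        by (intro tendsto_mult tendsto_divide klein_over_z[OF \<tau>] tendsto_const) auto
      then have "((\<lambda>z. klein (- 1 / \<tau>) (z / \<tau>) / (z / \<tau>) * e (- z\<^sup>2 / (2 * \<tau>)) * (1 / \<tau>) / (klein \<tau> z / z)) \<longlongrightarrow> 1 / \<tau>) (at 0)"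
        by simp
      then show ?thesis
        by (rule Lim_transform_eventually) (auto simp: eventually_at_filter f_def nz)
    qed
  qed auto
  then have "(klein (- 1 / \<tau>) (z / \<tau>) * e (- z\<^sup>2 / (2 * \<tau>))) * e (z\<^sup>2 / (2 * \<tau>)) = (1 / \<tau> * klein \<tau> z) * e (z\<^sup>2 / (2 * \<tau>))"
    by (simp only: f_def)
  then show ?thesis unfolding mult.assoc e_add[symmetric] by (simp add: mult_ac)
qed

section \<open>Squares of theta quotients at the half-periods\<close>

text \<open>
  The form \<open>\<phi>\<^bsub>-2,1\<^esub>\<close>. The functions \<open>X10\<close>, \<open>X01\<close>, \<open>X00\<close> are the squares of the \<open>\<xi>\<^bsub>ab\<^esub>\<close>, see \<open>xi_sq\<close> below.
\<close>

definition Qf :: "complex \<Rightarrow> complex \<Rightarrow> complex" where "Qf \<tau> z = (klein \<tau> z)\<^sup>2"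

definition X10 :: "complex \<Rightarrow> complex \<Rightarrow> complex" where
  "X10 \<tau> z = (klein \<tau> (z + 1 / 2) / klein \<tau> (1 / 2))\<^sup>2"

definition X01 :: "complex \<Rightarrow> complex \<Rightarrow> complex" where
  "X01 \<tau> z = (klein \<tau> (z + \<tau> / 2) / klein \<tau> (\<tau> / 2))\<^sup>2 * e z"

definition X00 :: "complex \<Rightarrow> complex \<Rightarrow> complex" where
  "X00 \<tau> z = (klein \<tau> (z + (\<tau> + 1) / 2) / klein \<tau> ((\<tau> + 1) / 2))\<^sup>2 * e z"

definition Yf :: "complex \<Rightarrow> complex \<Rightarrow> complex" where
  "Yf \<tau> z = (X10 \<tau> z + X01 \<tau> z + X00 \<tau> z) / 3"

lemma hol2_Qf: "hol2 Qf" and hol2_X10: "hol2 X10" and hol2_X01: "hol2 X01" and hol2_X00: "hol2 X00"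
proof -
  note * = hol2_intros klein_half_nz
  show "hol2 Qf" unfolding Qf_def by (intro *)
  show "hol2 X10" unfolding X10_def by (intro *)
  show "hol2 X01" unfolding X01_def by (intro * | simp)+
  show "hol2 X00" unfolding X00_def by (intro * | simp)+
qed

lemma hol2_Yf: "hol2 Yf"
  unfolding Yf_def by (intro hol2_intros hol2_X10 hol2_X01 hol2_X00) simp

lemma X_0: "\<tau> \<in> uhp \<Longrightarrow> X10 \<tau> 0 = 1" "\<tau> \<in> uhp \<Longrightarrow> X01 \<tau> 0 = 1" "\<tau> \<in> uhp \<Longrightarrow> X00 \<tau> 0 = 1"
  by (simp_all add: X10_def X01_def X00_def klein_half_nz)

lemma Qf_plus_1: "Qf \<tau> (z + 1) = Qf \<tau> z"
  by (simp add: Qf_def klein_plus_1)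

lemma X_plus_1:
  "X10 \<tau> (z + 1) = X10 \<tau> z" "X01 \<tau> (z + 1) = X01 \<tau> z" "X00 \<tau> (z + 1) = X00 \<tau> z"
  using klein_plus_1[of \<tau> "z + 1 / 2"] klein_plus_1[of \<tau> "z + \<tau> / 2"] klein_plus_1[of \<tau> "z + (\<tau> + 1) / 2"]
  by (simp_all add: X10_def X01_def X00_def e_1_plus add_ac power2_eq_square)

lemma klein_sq_plus_\<tau>:
  assumes "\<tau> \<in> uhp"
  shows "(klein \<tau> (z + \<tau>))\<^sup>2 = e (- \<tau> - 2 * z) * (klein \<tau> z)\<^sup>2"
proof -
  have "e (- \<tau> - 2 * z) = (e (- \<tau> / 2 - z))\<^sup>2"
    using e_of_nat_mult[of 2 "- \<tau> / 2 - z"] by (simp add: algebra_simps)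
  then show ?thesis by (simp add: klein_plus_\<tau>[OF assms] power_mult_distrib)
qed

lemma Qf_plus_\<tau>: "\<tau> \<in> uhp \<Longrightarrow> Qf \<tau> (z + \<tau>) = e (- \<tau> - 2 * z) * Qf \<tau> z"
  by (simp add: Qf_def klein_sq_plus_\<tau>)

lemma X_plus_\<tau>:
  assumes "\<tau> \<in> uhp"
  shows "X10 \<tau> (z + \<tau>) = e (- \<tau> - 2 * z) * X10 \<tau> z" (is ?A)
    "X01 \<tau> (z + \<tau>) = e (- \<tau> - 2 * z) * X01 \<tau> z" (is ?B)
    "X00 \<tau> (z + \<tau>) = e (- \<tau> - 2 * z) * X00 \<tau> z" (is ?C)
proof -
  have 1: "e (- \<tau> - 2 * (z + 1 / 2)) = e (- \<tau> - 2 * z)"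
  proof -
    have "- \<tau> - 2 * (z + 1 / 2) = (- \<tau> - 2 * z) + of_int (- 1)" by simp
    then show ?thesis by (simp only: e_add_int)
  qed
  have 2: "e (- \<tau> - 2 * (z + \<tau> / 2)) * e (z + \<tau>) = e (- \<tau> - 2 * z) * e z"
    unfolding e_add[symmetric] by (simp add: algebra_simps)
  have 3: "e (- \<tau> - 2 * (z + (\<tau> + 1) / 2)) * e (z + \<tau>) = e (- \<tau> - 2 * z) * e z"
  proof -
    have "- \<tau> - 2 * (z + (\<tau> + 1) / 2) + (z + \<tau>) = (- \<tau> - 2 * z + z) + of_int (- 1)" by (simp add: field_simps)
    then show ?thesis by (simp only: e_add[symmetric] e_add_int)
  qed
  have "(klein \<tau> (z + \<tau> + w))\<^sup>2 = e (- \<tau> - 2 * (z + w)) * (klein \<tau> (z + w))\<^sup>2" for w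
    using klein_sq_plus_\<tau>[OF assms, of "z + w"] by (simp add: add_ac)
  note 4 = this[of "1 / 2"] this[of "\<tau> / 2"] this[of "(\<tau> + 1) / 2"]
  show ?A unfolding X10_def power_divide 4 1 by simp
  show ?B unfolding X01_def power_divide 4 using 2 by (simp add: mult_ac)
  show ?C unfolding X00_def power_divide 4 using 3 by (simp add: mult_ac)
qed

lemma X_minus:
  assumes "\<tau> \<in> uhp"
  shows "X10 \<tau> (- z) = X10 \<tau> z" (is ?A) "X01 \<tau> (- z) = X01 \<tau> z" (is ?B) "X00 \<tau> (- z) = X00 \<tau> z" (is ?C)
proof -
  have m: "(klein \<tau> (- z + w))\<^sup>2 = (klein \<tau> (z - w))\<^sup>2" for w
    using klein_minus[of \<tau> "z - w"] by (simp add: power2_eq_square)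
  have 1: "(klein \<tau> (z + 1 / 2))\<^sup>2 = (klein \<tau> (z - 1 / 2))\<^sup>2"
  proof -
    have "z + 1 / 2 = (z - 1 / 2) + 1" by simp
    then show ?thesis by (simp only: klein_plus_1 power2_minus)
  qed
  have 2: "(klein \<tau> (z + \<tau> / 2))\<^sup>2 * e z = (klein \<tau> (z - \<tau> / 2))\<^sup>2 * e (- z)"
  proof -
    have A: "e (- \<tau> - 2 * (z - \<tau> / 2)) * e z = e (- z)" unfolding e_add[symmetric] by (simp add: algebra_simps)
    have "z - \<tau> / 2 + \<tau> = z + \<tau> / 2" by (simp add: field_simps)
    with klein_sq_plus_\<tau>[OF assms, of "z - \<tau> / 2"]
    have B: "(klein \<tau> (z + \<tau> / 2))\<^sup>2 = e (- \<tau> - 2 * (z - \<tau> / 2)) * (klein \<tau> (z - \<tau> / 2))\<^sup>2" by (simp only:)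
    show ?thesis unfolding B A[symmetric] by (simp only: mult_ac)
  qed
  have 3: "(klein \<tau> (z + (\<tau> + 1) / 2))\<^sup>2 * e z = (klein \<tau> (z - (\<tau> + 1) / 2))\<^sup>2 * e (- z)"
  proof -
    have A: "e (- \<tau> - 2 * (z - (\<tau> + 1) / 2)) * e z = e (- z)"
    proof -
      have "- \<tau> - 2 * (z - (\<tau> + 1) / 2) + z = - z + of_int 1" by (simp add: field_simps)
      then show ?thesis by (simp only: e_add[symmetric] e_add_int)
    qed
    have "(klein \<tau> (z - (\<tau> + 1) / 2 + \<tau>))\<^sup>2 = (klein \<tau> (z + (\<tau> + 1) / 2))\<^sup>2"
      using klein_minus_1[of \<tau> "z + (\<tau> + 1) / 2"] by (simp add: algebra_simps add_divide_distrib)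
    then have B: "(klein \<tau> (z + (\<tau> + 1) / 2))\<^sup>2 = e (- \<tau> - 2 * (z - (\<tau> + 1) / 2)) * (klein \<tau> (z - (\<tau> + 1) / 2))\<^sup>2"
      using klein_sq_plus_\<tau>[OF assms, of "z - (\<tau> + 1) / 2"] by (simp only:)
    show ?thesis unfolding B A[symmetric] by (simp only: mult_ac)
  qed
  show ?A unfolding X10_def power_divide m 1 ..
  show ?B unfolding X01_def power_divide m using 2 by (simp add: divide_simps)
  show ?C unfolding X00_def power_divide m using 3 by (simp add: divide_simps)
qed

text \<open>
  Evenness forces the order of vanishing at the origin to be even.
\<close>

lemma even_double_zero:
  assumes f: "f holomorphic_on UNIV" and ev: "\<And>z. f (- z) = f z" and 0: "f 0 = 0"
  shows "\<exists>L :: complex. ((\<lambda>z. f z / z\<^sup>2) \<longlongrightarrow> L) (at 0)"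
proof -
  obtain h where h: "h holomorphic_on ball 0 1" "\<And>z. norm z < 1 \<Longrightarrow> f z = z * h z"
    using Schwarz3[of f 1] f 0 by (metis holomorphic_on_subset subset_UNIV)
  have odd: "h (- z) = - h z" if "norm z < 1" "z \<noteq> 0" for z
  proof -
    have "z * h (- z) = z * (- h z)" using h(2)[of z] h(2)[of "- z"] ev[of z] that(1) by simp
    then show ?thesis using that(2) by (subst (asm) mult_left_cancel)
  qed
  have "h 0 = 0"
  proof -
    have "isCont h 0" using h(1) by (intro continuous_on_interior[of "ball 0 1"]) (auto intro: holomorphic_on_imp_continuous_on)
    then have 1: "(h \<longlongrightarrow> h 0) (at 0)" by (simp add: isCont_def)
    have "filterlim (\<lambda>z :: complex. - z) (at 0) (at 0)"
      by (intro filterlim_atI tendsto_eq_intros) (auto simp: eventually_at_filter)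
    from filterlim_compose[OF 1 this] have "((\<lambda>z. h (- z)) \<longlongrightarrow> h 0) (at 0)" .
    moreover have "((\<lambda>z. - h z) \<longlongrightarrow> - h 0) (at 0)" using 1 by (intro tendsto_minus)
    moreover have "\<forall>\<^sub>F z in at 0. h (- z) = - h z"
      unfolding eventually_at using odd by (intro exI[of _ 1]) auto
    ultimately have "((\<lambda>z. - h z) \<longlongrightarrow> h 0) (at 0)" using tendsto_cong by fast
    from tendsto_unique[OF _ this \<open>((\<lambda>z. - h z) \<longlongrightarrow> - h 0) (at 0)\<close>] show ?thesis by simp
  qed
  then obtain h2 where h2: "h2 holomorphic_on ball 0 1" "\<And>z. norm z < 1 \<Longrightarrow> h z = z * h2 z"
    using Schwarz3[OF h(1)] by metis
  have "isCont h2 0" using h2(1) by (intro continuous_on_interior[of "ball 0 1"]) (auto intro: holomorphic_on_imp_continuous_on)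
  then have "(h2 \<longlongrightarrow> h2 0) (at 0)" by (simp add: isCont_def)
  moreover have "\<forall>\<^sub>F z in at 0. h2 z = f z / z\<^sup>2"
    unfolding eventually_at using h(2) h2(2) by (intro exI[of _ 1]) (auto simp: power2_eq_square)
  ultimately have "((\<lambda>z. f z / z\<^sup>2) \<longlongrightarrow> h2 0) (at 0)" by (rule Lim_transform_eventually)
  then show ?thesis by blast
qed

text \<open>
  The even theta functions of index 1 that vanish at the origin form a line: \<open>f / Q\<close> is elliptic without poles.
\<close>

lemma index_1_eq_Qf:
  assumes \<tau>: "\<tau> \<in> uhp" and f: "f holomorphic_on UNIV" and ev: "\<And>z. f (- z) = f z" and 0: "f 0 = 0"
    and f1: "\<And>z. f (z + 1) = f z" and f2: "\<And>z. f (z + \<tau>) = e (- \<tau> - 2 * z) * f z"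
  shows "\<exists>c. \<forall>z. f z = c * Qf \<tau> z"
proof -
  obtain L where L: "((\<lambda>z. f z / z\<^sup>2) \<longlongrightarrow> L) (at 0)" using even_double_zero[OF f ev 0] by blast
  have "((\<lambda>z. (f z / z\<^sup>2) / (klein \<tau> z / z)\<^sup>2) \<longlongrightarrow> L / (2 * of_real pi * \<i>)\<^sup>2) (at 0)"
    by (intro tendsto_divide L tendsto_power klein_over_z[OF \<tau>]) auto
  then have lim: "((\<lambda>z. f z / Qf \<tau> z) \<longlongrightarrow> L / (2 * of_real pi * \<i>)\<^sup>2) (at 0)"
    by (rule Lim_transform_eventually) (auto simp: eventually_at_filter Qf_def power_divide)
  have zer: "\<exists>m n :: int. z = of_int m + of_int n * \<tau>" if "Qf \<tau> z = 0" for z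
    using klein_eq_0D[OF \<tau>, of z] that by (simp add: Qf_def)
  have "f z = (L / (2 * of_real pi * \<i>)\<^sup>2) * Qf \<tau> z" for z
    by (rule quasi_periodic_unique[OF _ f hol2_entire[OF hol2_Qf \<tau>] _ _ f2 Qf_plus_\<tau>[OF \<tau>] _ _ zer lim, of 1])
       (use \<tau> in \<open>simp_all add: uhp_def f1 Qf_plus_1\<close>)
  then show ?thesis by blast
qed

text \<open>
  The function \<open>Y - X\<^sub>i\<close> vanishes at \<open>z = 0\<close> and is therefore a multiple of \<open>Q\<close>; the factor is its value relative to
  \<open>Q\<close> at \<open>z = 1/2\<close>, where \<open>Q\<close> does not vanish.
\<close>

definition eps10 :: "complex \<Rightarrow> complex" where "eps10 \<tau> = (Yf \<tau> (1 / 2) - X10 \<tau> (1 / 2)) / Qf \<tau> (1 / 2)"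
definition eps01 :: "complex \<Rightarrow> complex" where "eps01 \<tau> = (Yf \<tau> (1 / 2) - X01 \<tau> (1 / 2)) / Qf \<tau> (1 / 2)"
definition eps00 :: "complex \<Rightarrow> complex" where "eps00 \<tau> = (Yf \<tau> (1 / 2) - X00 \<tau> (1 / 2)) / Qf \<tau> (1 / 2)"

lemma X_eq:
  assumes \<tau>: "\<tau> \<in> uhp"
  shows "X10 \<tau> z = Yf \<tau> z - eps10 \<tau> * Qf \<tau> z"
    "X01 \<tau> z = Yf \<tau> z - eps01 \<tau> * Qf \<tau> z"
    "X00 \<tau> z = Yf \<tau> z - eps00 \<tau> * Qf \<tau> z"
proof -
  have Qnz: "Qf \<tau> (1 / 2) \<noteq> 0" by (simp add: Qf_def klein_half_nz[OF \<tau>])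
  have *: "X z = Yf \<tau> z - (Yf \<tau> (1 / 2) - X (1 / 2)) / Qf \<tau> (1 / 2) * Qf \<tau> z"
    if X: "X holomorphic_on UNIV" "\<And>z. X (- z) = X z" "X 0 = 1" "\<And>z. X (z + 1) = X z"
      "\<And>z. X (z + \<tau>) = e (- \<tau> - 2 * z) * X z" for X
  proof -
    have "\<exists>c. \<forall>z. Yf \<tau> z - X z = c * Qf \<tau> z"
    proof (rule index_1_eq_Qf[OF \<tau>])
      show "(\<lambda>z. Yf \<tau> z - X z) holomorphic_on UNIV"
        by (intro holomorphic_intros hol2_entire[OF hol2_Yf \<tau>] X(1))
    qed (simp_all add: X Yf_def X_minus[OF \<tau>] X_plus_1 X_plus_\<tau>[OF \<tau>] X_0[OF \<tau>] algebra_simps add_divide_distrib)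
    then obtain c where c: "\<And>z. Yf \<tau> z - X z = c * Qf \<tau> z" by blast
    have "c = (Yf \<tau> (1 / 2) - X (1 / 2)) / Qf \<tau> (1 / 2)" unfolding c using Qnz by simp
    then show ?thesis using c[of z] by (simp add: algebra_simps)
  qed
  note ** = hol2_entire[OF _ \<tau>] X_minus[OF \<tau>] X_0[OF \<tau>] X_plus_1 X_plus_\<tau>[OF \<tau>]
  show "X10 \<tau> z = Yf \<tau> z - eps10 \<tau> * Qf \<tau> z" unfolding eps10_def
    by (rule *) (intro hol2_X10 **)+
  show "X01 \<tau> z = Yf \<tau> z - eps01 \<tau> * Qf \<tau> z" unfolding eps01_def
    by (rule *) (intro hol2_X01 **)+
  show "X00 \<tau> z = Yf \<tau> z - eps00 \<tau> * Qf \<tau> z" unfolding eps00_def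
    by (rule *) (intro hol2_X00 **)+
qed

lemma eps_sum: "eps10 \<tau> + eps01 \<tau> + eps00 \<tau> = 0"
  by (simp add: eps10_def eps01_def eps00_def Yf_def add_divide_distrib[symmetric] field_simps)

text \<open>
  The differences are found by evaluating \<open>X\<^sub>i - X\<^sub>j = (\<epsilon>\<^sub>j - \<epsilon>\<^sub>i) Q\<close> at a half-period where one of the two squares vanishes.
\<close>

lemma eps_diff:
  assumes \<tau>: "\<tau> \<in> uhp"
  defines "k1 \<equiv> klein \<tau> (1 / 2)" and "k2 \<equiv> klein \<tau> (\<tau> / 2)" and "k3 \<equiv> klein \<tau> ((\<tau> + 1) / 2)"
  shows "eps10 \<tau> - eps01 \<tau> = - k3\<^sup>2 / (k1\<^sup>2 * k2\<^sup>2)"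
    and "eps10 \<tau> - eps00 \<tau> = - k2\<^sup>2 / (k1\<^sup>2 * k3\<^sup>2)"
    and "eps01 \<tau> - eps00 \<tau> = e (- \<tau> / 2) * k1\<^sup>2 / (k2\<^sup>2 * k3\<^sup>2)"
proof -
  have nz: "k1 \<noteq> 0" "k2 \<noteq> 0" "k3 \<noteq> 0" using klein_half_nz[OF \<tau>] by (simp_all add: k1_def k2_def k3_def)
  have Q: "Qf \<tau> (1 / 2) = k1\<^sup>2" "Qf \<tau> (\<tau> / 2) = k2\<^sup>2" by (simp_all add: Qf_def k1_def k2_def)
  have a: "X10 \<tau> (1 / 2) = 0" using klein_plus_1[of \<tau> 0] by (simp add: X10_def)
  have b: "X01 \<tau> (1 / 2) = - k3\<^sup>2 / k2\<^sup>2"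
    by (simp add: X01_def e_half k2_def k3_def add_divide_distrib add_ac power_divide)
  have c: "X00 \<tau> (1 / 2) = - k2\<^sup>2 / k3\<^sup>2"
  proof -
    have "1 / 2 + (\<tau> + 1) / 2 = \<tau> / 2 + 1" by (simp add: field_simps)
    then show ?thesis using klein_plus_1[of \<tau> "\<tau> / 2"] by (simp add: X00_def e_half k2_def k3_def power_divide)
  qed
  have d: "X01 \<tau> (\<tau> / 2) = 0"
    using klein_plus_\<tau>[OF \<tau>, of 0] by (simp add: X01_def)
  have f: "X00 \<tau> (\<tau> / 2) = e (- \<tau> / 2) * k1\<^sup>2 / k3\<^sup>2"
  proof -
    have "\<tau> / 2 + (\<tau> + 1) / 2 = 1 / 2 + \<tau>" by (simp add: field_simps)
    moreover have "e (- \<tau> - 2 * (1 / 2)) * e (\<tau> / 2) = e (- \<tau> / 2)"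
    proof -
      have "- \<tau> - 2 * (1 / 2) + \<tau> / 2 = - \<tau> / 2 + of_int (- 1)" by (simp add: field_simps)
      then show ?thesis by (simp only: e_add[symmetric] e_add_int)
    qed
    ultimately show ?thesis using klein_sq_plus_\<tau>[OF \<tau>, of "1 / 2"]
      by (simp add: X00_def k1_def k3_def power_divide mult_ac)
  qed
  note E = X_eq[OF \<tau>]
  have "(eps10 \<tau> - eps01 \<tau>) * k1\<^sup>2 = - k3\<^sup>2 / k2\<^sup>2"
    using E(1)[of "1 / 2"] E(2)[of "1 / 2"] unfolding a b Q by (simp add: algebra_simps)
  then show "eps10 \<tau> - eps01 \<tau> = - k3\<^sup>2 / (k1\<^sup>2 * k2\<^sup>2)" using nz by (simp add: field_simps)
  have "(eps10 \<tau> - eps00 \<tau>) * k1\<^sup>2 = - k2\<^sup>2 / k3\<^sup>2"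
    using E(1)[of "1 / 2"] E(3)[of "1 / 2"] unfolding a c Q by (simp add: algebra_simps)
  then show "eps10 \<tau> - eps00 \<tau> = - k2\<^sup>2 / (k1\<^sup>2 * k3\<^sup>2)" using nz by (simp add: field_simps)
  have "(eps01 \<tau> - eps00 \<tau>) * k2\<^sup>2 = e (- \<tau> / 2) * k1\<^sup>2 / k3\<^sup>2"
    using E(2)[of "\<tau> / 2"] E(3)[of "\<tau> / 2"] unfolding d f Q by (simp add: algebra_simps)
  then show "eps01 \<tau> - eps00 \<tau> = e (- \<tau> / 2) * k1\<^sup>2 / (k2\<^sup>2 * k3\<^sup>2)" using nz by (simp add: field_simps)
qed

lemma Delta_eq_qpoch:
  assumes "\<tau> \<in> uhp"
  shows "Delta \<tau> = e \<tau> * qpoch \<tau> \<tau> ^ 24"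
proof -
  have "e (\<tau> + of_nat n * \<tau>) = e \<tau> ^ Suc n" for n by (simp add: e_add_nat_mult)
  then have "qpoch \<tau> \<tau> ^ 24 = (\<Prod>n. (1 - e \<tau> ^ Suc n) ^ 24)"
    using prodinf_power[OF qpoch_convergent[OF assms, of \<tau>], of 24] by (simp add: qpoch_def)
  then show ?thesis by (simp add: Delta_def)
qed

lemma Delta_nz: "\<tau> \<in> uhp \<Longrightarrow> Delta \<tau> \<noteq> 0"
  by (simp add: Delta_eq_qpoch qpoch_self_nz)

text \<open>
  By \<open>eps_diff\<close> the product of the differences is, up to a power of \<open>e \<tau>\<close>, inverse to the square of the product of
  the three values of \<open>k\<close> at the half-periods; that product telescopes to a power of the product defining \<open>\<Delta>\<close>.
\<close>

lemma Delta_eq_eps: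
  assumes \<tau>: "\<tau> \<in> uhp"
  shows "Delta \<tau> = 16 * ((eps10 \<tau> - eps01 \<tau>) * (eps10 \<tau> - eps00 \<tau>) * (eps01 \<tau> - eps00 \<tau>))\<^sup>2"
proof -
  define k1 k2 k3 where "k1 = klein \<tau> (1 / 2)" "k2 = klein \<tau> (\<tau> / 2)" "k3 = klein \<tau> ((\<tau> + 1) / 2)"
  define P where "P = qpoch \<tau> \<tau>"
  have nz: "k1 \<noteq> 0" "k2 \<noteq> 0" "k3 \<noteq> 0" "P \<noteq> 0"
    using klein_half_nz[OF \<tau>] qpoch_self_nz[OF \<tau>] by (simp_all add: k1_k2_k3_def P_def)
  have "(eps10 \<tau> - eps01 \<tau>) * (eps10 \<tau> - eps00 \<tau>) * (eps01 \<tau> - eps00 \<tau>) = e (- \<tau> / 2) / (k1 * k2 * k3)\<^sup>2"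
    unfolding eps_diff[OF \<tau>] k1_k2_k3_def[symmetric] using nz by (simp add: field_simps power2_eq_square)
  then have 1: "((eps10 \<tau> - eps01 \<tau>) * (eps10 \<tau> - eps00 \<tau>) * (eps01 \<tau> - eps00 \<tau>))\<^sup>2 = e (- \<tau>) / (k1 * k2 * k3) ^ 4"
    using e_of_nat_mult[of 2 "- \<tau> / 2"] by (simp add: power_divide)
  define A1 A2 A3 where "A1 = qpoch \<tau> (\<tau> + 1 / 2)" "A2 = qpoch \<tau> (\<tau> / 2)" "A3 = qpoch \<tau> ((\<tau> + 1) / 2)"
  have "k1 = 2 * \<i> * A1\<^sup>2 / P\<^sup>2"
    using qpoch_minus_1[of \<tau> "\<tau> + 1 / 2"] e_minus[of "1 / 4"]
    by (simp add: k1_k2_k3_def A1_A2_A3_def P_def klein_def e_quarter power2_eq_square)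
  then have k1: "k1 ^ 4 = 16 * A1 ^ 8 / P ^ 8" by (simp add: power_mult_distrib power_divide)
  have "k2 = - e (- \<tau> / 4) * A2\<^sup>2 / P\<^sup>2"
    by (simp add: k1_k2_k3_def A1_A2_A3_def P_def klein_theta[OF \<tau>] power2_eq_square)
  then have k2: "k2 ^ 4 = e (- \<tau>) * A2 ^ 8 / P ^ 8"
    using e_of_nat_mult[of 4 "- \<tau> / 4"] by (simp add: power_mult_distrib power_divide)
  have "\<tau> - (\<tau> + 1) / 2 = (\<tau> + 1) / 2 - 1" by (simp add: field_simps)
  then have "qpoch \<tau> (\<tau> - (\<tau> + 1) / 2) = A3" by (simp only: qpoch_minus_1 A1_A2_A3_def)
  then have "k3 = - e (- ((\<tau> + 1) / 2) / 2) * A3\<^sup>2 / P\<^sup>2"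
    unfolding k1_k2_k3_def klein_theta[OF \<tau>] by (simp add: A1_A2_A3_def P_def power2_eq_square)
  moreover have "- ((\<tau> + 1) / 2) / 2 = - (\<tau> + 1) / 4" by (simp add: field_simps)
  ultimately have "k3 = - e (- (\<tau> + 1) / 4) * A3\<^sup>2 / P\<^sup>2" by (simp only:)
  moreover have "e (- (\<tau> + 1) / 4) ^ 4 = e (- \<tau>)"
  proof -
    have "of_nat 4 * (- (\<tau> + 1) / 4) = - \<tau> + of_int (- 1)" by simp
    then show ?thesis unfolding e_of_nat_mult[symmetric] by (simp only: e_add_int)
  qed
  ultimately have k3: "k3 ^ 4 = e (- \<tau>) * A3 ^ 8 / P ^ 8"
    by (simp add: power_mult_distrib power_divide)
  have "P * (A1 * A2 * A3) = P * 1"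
  proof -
    have "A2 * A3 = qpoch (2 * \<tau>) \<tau>"
      using qpoch_mult_half[OF \<tau>, of "\<tau> / 2"] by (simp add: A1_A2_A3_def add_divide_distrib)
    moreover have "P * A1 = qpoch (2 * \<tau>) (2 * \<tau>)" using qpoch_mult_half[OF \<tau>, of \<tau>] by (simp add: A1_A2_A3_def P_def)
    moreover have "P = qpoch (2 * \<tau>) \<tau> * qpoch (2 * \<tau>) (2 * \<tau>)" using qpoch_even_odd[OF \<tau>, of \<tau>] by (simp add: P_def)
    ultimately show ?thesis by (metis mult.assoc mult.commute mult.right_neutral)
  qed
  then have A: "A1 * A2 * A3 = 1" using nz by simp
  have "(k1 * k2 * k3) ^ 4 = 16 * e (- \<tau>) * e (- \<tau>) * (A1 * A2 * A3) ^ 8 / P ^ 24"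
    unfolding power_mult_distrib k1 k2 k3 by (simp add: power_add[symmetric])
  then have "16 * (e (- \<tau>) / (k1 * k2 * k3) ^ 4) = e \<tau> * P ^ 24"
    unfolding A using nz by (simp add: e_minus field_simps)
  then show ?thesis unfolding 1 Delta_eq_qpoch[OF \<tau>] P_def by simp
qed

section \<open>Limits at the cusp\<close>

text \<open>
  The limit is taken locally uniformly in \<open>z\<close>, so that Taylor coefficients at \<open>z = 0\<close> converge too.
\<close>

definition cusp_lim :: "(complex \<Rightarrow> complex \<Rightarrow> complex) \<Rightarrow> (complex \<Rightarrow> complex) \<Rightarrow> bool" where
  "cusp_lim f f0 \<longleftrightarrow> continuous_on UNIV f0 \<and> (\<forall>r. uniform_limit (cball 0 r) f f0 cusp)"

lemma cusp_lim_pointwise: "cusp_lim f f0 \<Longrightarrow> ((\<lambda>\<tau>. f \<tau> z) \<longlongrightarrow> f0 z) cusp"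
  unfolding cusp_lim_def by (rule tendsto_uniform_limitI[where S = "cball 0 (norm z)"]) auto

lemma cusp_lim_z: "continuous_on UNIV f0 \<Longrightarrow> cusp_lim (\<lambda>\<tau> z. f0 z) f0"
  unfolding cusp_lim_def by (auto intro: uniform_limit_const)

lemma cusp_lim_const: "cusp_lim (\<lambda>\<tau> z. c) (\<lambda>z. c)"
  by (rule cusp_lim_z) simp

lemma cusp_lim_\<tau>: "(g \<longlongrightarrow> L) cusp \<Longrightarrow> cusp_lim (\<lambda>\<tau> z. g \<tau>) (\<lambda>z. L)"
  unfolding cusp_lim_def uniform_limit_iff tendsto_iff by auto

lemma cusp_lim_add: "cusp_lim f f0 \<Longrightarrow> cusp_lim g g0 \<Longrightarrow> cusp_lim (\<lambda>\<tau> z. f \<tau> z + g \<tau> z) (\<lambda>z. f0 z + g0 z)"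
  unfolding cusp_lim_def by (auto intro!: continuous_intros uniform_limit_add)

lemma cusp_lim_diff: "cusp_lim f f0 \<Longrightarrow> cusp_lim g g0 \<Longrightarrow> cusp_lim (\<lambda>\<tau> z. f \<tau> z - g \<tau> z) (\<lambda>z. f0 z - g0 z)"
  unfolding cusp_lim_def by (auto intro!: continuous_intros uniform_limit_minus)

lemma cusp_lim_mult:
  assumes "cusp_lim f f0" "cusp_lim g g0"
  shows "cusp_lim (\<lambda>\<tau> z. f \<tau> z * g \<tau> z) (\<lambda>z. f0 z * g0 z)"
proof -
  have "bounded (h ` cball 0 r)" if "continuous_on UNIV h" for h :: "complex \<Rightarrow> complex" and r
    by (rule compact_imp_bounded, rule compact_continuous_image, rule continuous_on_subset[OF that]) auto
  then show ?thesis using assms unfolding cusp_lim_def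
    by (auto intro!: continuous_intros uniform_lim_mult)
qed

lemma cusp_lim_power: "cusp_lim f f0 \<Longrightarrow> cusp_lim (\<lambda>\<tau> z. f \<tau> z ^ n) (\<lambda>z. f0 z ^ n)"
  by (induction n) (auto intro: cusp_lim_const cusp_lim_mult)

lemma cusp_lim_cong:
  assumes "cusp_lim f f0" "\<And>\<tau> z. \<tau> \<in> uhp \<Longrightarrow> f \<tau> z = g \<tau> z" "\<And>z. f0 z = g0 z"
  shows "cusp_lim g g0"
proof -
  have "f0 = g0" using assms(3) by auto
  moreover have "uniform_limit (cball 0 r) g f0 cusp" if "uniform_limit (cball 0 r) f f0 cusp" for r
  proof (rule uniform_limit_cong[THEN iffD1, OF _ _ that])
    show "\<forall>\<^sub>F \<tau> in cusp. \<forall>z\<in>cball 0 r. f \<tau> z = g \<tau> z"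
      using eventually_cusp_uhp by eventually_elim (simp add: assms(2))
  qed simp
  ultimately show ?thesis using assms(1) unfolding cusp_lim_def by auto
qed

lemma hol2_cong:
  assumes "hol2 f" "\<And>\<tau> z. \<tau> \<in> uhp \<Longrightarrow> f \<tau> z = g \<tau> z"
  shows "hol2 g"
  unfolding hol2_def
proof (intro conjI allI impI)
  show "continuous_on (uhp \<times> UNIV) (\<lambda>(\<tau>, z). g \<tau> z)"
    by (rule continuous_on_cong[THEN iffD1, OF refl _ hol2_continuous[OF assms(1)]]) (auto simp: assms(2))
  fix U a b assume U: "open U" "a holomorphic_on U" "b holomorphic_on U" "a ` U \<subseteq> uhp"
  show "(\<lambda>t. g (a t) (b t)) holomorphic_on U"
    by (rule holomorphic_transform[OF hol2D[OF assms(1) U]]) (use U(4) in \<open>auto simp: assms(2) image_subset_iff\<close>)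
qed

lemma cusp_lim_affine:
  assumes "cusp_lim f f0"
  shows "cusp_lim (\<lambda>\<tau> z. f \<tau> (a * z + b)) (\<lambda>z. f0 (a * z + b))"
  unfolding cusp_lim_def
proof safe
  show "continuous_on UNIV (\<lambda>z. f0 (a * z + b))"
    using assms unfolding cusp_lim_def by (auto intro!: continuous_on_compose2[of UNIV f0] continuous_intros)
  fix r
  show "uniform_limit (cball 0 r) (\<lambda>\<tau> z. f \<tau> (a * z + b)) (\<lambda>z. f0 (a * z + b)) cusp"
  proof (rule uniform_limit_compose'[where f = f and g = f0])
    show "uniform_limit (cball 0 (norm a * r + norm b)) f f0 cusp" using assms unfolding cusp_lim_def by blast
    show "(\<lambda>z. a * z + b) \<in> cball 0 r \<rightarrow> cball 0 (norm a * r + norm b)"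
    proof
      fix z :: complex assume "z \<in> cball 0 r"
      then have "norm a * norm z \<le> norm a * r" by (intro mult_left_mono) auto
      then show "a * z + b \<in> cball 0 (norm a * r + norm b)"
        using norm_triangle_ineq[of "a * z" b] by (simp add: norm_mult)
    qed
  qed
qed

lemma e_cusp: "(e \<longlongrightarrow> 0) cusp"
proof (rule tendsto_norm_zero_cancel)
  have "filterlim (\<lambda>y. exp (- (2 * pi * y))) (nhds 0) at_top"
    by (rule filterlim_compose[OF exp_at_bot])
       (auto intro!: filterlim_uminus_at_bot_at_top[THEN filterlim_compose] filterlim_tendsto_pos_mult_at_top filterlim_ident tendsto_const)
  from filterlim_compose[OF this filterlim_Im_cusp]
  show "((\<lambda>\<tau>. norm (e \<tau>)) \<longlongrightarrow> 0) cusp" by (simp add: norm_e)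
qed

lemma qpoch_cusp:
  assumes "\<And>\<tau> z. \<tau> \<in> uhp \<Longrightarrow> z \<in> A \<Longrightarrow> Im (g \<tau> z) \<ge> Im \<tau> / 2 - r"
  shows "uniform_limit A (\<lambda>\<tau> z. qpoch \<tau> (g \<tau> z)) (\<lambda>_. 1) cusp"
proof -
  define B where "B y = exp (2 * exp (2 * pi * r) * exp (- (pi * y))) - 1" for y
  have "filterlim (\<lambda>y. exp (- (pi * y))) (nhds 0) at_top"
    by (rule filterlim_compose[OF exp_at_bot])
       (auto intro!: filterlim_uminus_at_bot_at_top[THEN filterlim_compose] filterlim_tendsto_pos_mult_at_top filterlim_ident tendsto_const)
  then have "(B \<longlongrightarrow> exp (2 * exp (2 * pi * r) * 0) - 1) at_top"
    unfolding B_def by (intro tendsto_intros)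
  then have "(B \<longlongrightarrow> 0) at_top" by simp
  then have B: "((\<lambda>\<tau>. B (Im \<tau>)) \<longlongrightarrow> 0) cusp" by (rule filterlim_compose[OF _ filterlim_Im_cusp])
  have e1: "\<forall>\<^sub>F \<tau> in cusp. norm (e \<tau>) < 1 / 2"
    using tendstoD[OF e_cusp, of "1 / 2"] by simp
  have "uniform_limit A (\<lambda>\<tau> z. qpoch \<tau> (g \<tau> z) - 1) (\<lambda>_. 0) cusp"
  proof (rule uniform_limit_null_comparison)
    show "uniform_limit A (\<lambda>\<tau> z. B (Im \<tau>)) (\<lambda>_. 0) cusp"
      using B unfolding uniform_limit_iff tendsto_iff by auto
    show "\<forall>\<^sub>F \<tau> in cusp. \<forall>z\<in>A. norm (qpoch \<tau> (g \<tau> z) - 1) \<le> B (Im \<tau>)"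
      using e1 eventually_cusp_uhp
    proof eventually_elim
      case (elim \<tau>)
      show ?case
      proof
        fix z assume "z \<in> A"
        have "2 * pi * (Im \<tau> / 2 - r) \<le> 2 * pi * Im (g \<tau> z)"
          by (intro mult_left_mono assms elim \<open>z \<in> A\<close>) auto
        then have 1: "norm (e (g \<tau> z)) \<le> exp (2 * pi * r) * exp (- (pi * Im \<tau>))"
          by (simp add: norm_e exp_add[symmetric] algebra_simps)
        have "norm (e (g \<tau> z)) / (1 - norm (e \<tau>)) \<le> norm (e (g \<tau> z)) / (1 / 2)"
          using elim by (intro divide_left_mono) auto
        also have "\<dots> \<le> 2 * exp (2 * pi * r) * exp (- (pi * Im \<tau>))" using 1 by simp
        finally show "norm (qpoch \<tau> (g \<tau> z) - 1) \<le> B (Im \<tau>)"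
          by (intro order_trans[OF norm_qpoch_minus_1_le[OF elim(2)]]) (simp add: B_def)
      qed
    qed
  qed
  from uniform_limit_add[OF this uniform_limit_const[where S = A and c = "\<lambda>_. 1"]] show ?thesis by simp
qed

lemma cusp_lim_qpoch:
  fixes g :: "complex \<Rightarrow> complex \<Rightarrow> complex"
  assumes "\<And>\<tau> z. \<tau> \<in> uhp \<Longrightarrow> Im (g \<tau> z) \<ge> Im \<tau> / 2 - norm z"
  shows "cusp_lim (\<lambda>\<tau> z. qpoch \<tau> (g \<tau> z)) (\<lambda>_. 1)"
  unfolding cusp_lim_def
proof safe
  fix r
  show "uniform_limit (cball 0 r) (\<lambda>\<tau> z. qpoch \<tau> (g \<tau> z)) (\<lambda>_. 1) cusp"
  proof (rule qpoch_cusp[where r = r])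
    fix \<tau> z :: complex assume "\<tau> \<in> uhp" "z \<in> cball 0 r"
    then show "Im (g \<tau> z) \<ge> Im \<tau> / 2 - r" using assms[of \<tau> z] by simp
  qed
qed simp

lemma qpoch_cusp_0:
  assumes "\<And>\<tau>. \<tau> \<in> uhp \<Longrightarrow> Im (g \<tau>) \<ge> Im \<tau> / 2"
  shows "((\<lambda>\<tau>. qpoch \<tau> (g \<tau>)) \<longlongrightarrow> 1) cusp"
proof (rule cusp_lim_pointwise[OF cusp_lim_qpoch[of "\<lambda>\<tau> z. g \<tau>"]])
  fix \<tau> z :: complex assume "\<tau> \<in> uhp"
  then show "Im \<tau> / 2 - norm z \<le> Im (g \<tau>)" using assms[of \<tau>] norm_ge_zero[of z] by linarith
qed

lemma Im_bounds: "- norm z \<le> Im z" "Im z \<le> norm z"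
  using abs_Im_le_cmod[of z] by auto

lemma cusp_lim_klein: "cusp_lim klein (\<lambda>z. e (z / 2) - e (- z / 2))"
proof -
  have P: "((\<lambda>\<tau>. qpoch \<tau> \<tau>) \<longlongrightarrow> 1) cusp" by (rule qpoch_cusp_0) (auto simp: uhp_def)
  have "((\<lambda>\<tau>. inverse ((qpoch \<tau> \<tau>)\<^sup>2)) \<longlongrightarrow> inverse (1\<^sup>2)) cusp"
    by (intro tendsto_intros P) auto
  then have 1: "cusp_lim (\<lambda>\<tau> z. inverse ((qpoch \<tau> \<tau>)\<^sup>2)) (\<lambda>_. inverse (1\<^sup>2))" by (rule cusp_lim_\<tau>)
  have "cusp_lim (\<lambda>\<tau> z. (e (z / 2) - e (- z / 2)) * qpoch \<tau> (\<tau> + z) * qpoch \<tau> (\<tau> - z) * inverse ((qpoch \<tau> \<tau>)\<^sup>2))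
         (\<lambda>z. (e (z / 2) - e (- z / 2)) * 1 * 1 * inverse (1\<^sup>2))"
  proof (intro cusp_lim_mult 1)
    show "cusp_lim (\<lambda>\<tau> z. e (z / 2) - e (- z / 2)) (\<lambda>z. e (z / 2) - e (- z / 2))"
      by (rule cusp_lim_z) (intro continuous_intros, auto)
    show "cusp_lim (\<lambda>\<tau> z. qpoch \<tau> (\<tau> + z)) (\<lambda>z. 1)"
    proof (rule cusp_lim_qpoch)
      fix \<tau> z assume "\<tau> \<in> uhp" then show "Im \<tau> / 2 - norm z \<le> Im (\<tau> + z)" using Im_bounds[of z] by (simp add: uhp_def)
    qed
    show "cusp_lim (\<lambda>\<tau> z. qpoch \<tau> (\<tau> - z)) (\<lambda>z. 1)"
    proof (rule cusp_lim_qpoch)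
      fix \<tau> z assume "\<tau> \<in> uhp" then show "Im \<tau> / 2 - norm z \<le> Im (\<tau> - z)" using Im_bounds[of z] by (simp add: uhp_def)
    qed
  qed
  then show ?thesis by (rule cusp_lim_cong) (simp_all add: klein_def divide_inverse[of _ "(qpoch _ _)\<^sup>2"])
qed

text \<open>
  The limits of \<open>Q\<close> and of \<open>X10\<close> at the cusp; \<open>q0 z\<close> is \<open>\<zeta> - 2 + 1/\<zeta>\<close>.
\<close>

definition q0 :: "complex \<Rightarrow> complex" where "q0 z = (e (z / 2) - e (- z / 2))\<^sup>2"
definition x0 :: "complex \<Rightarrow> complex" where "x0 z = 1 + q0 z / 4"

lemma cusp_lim_Qf: "cusp_lim Qf q0"
  unfolding Qf_def[abs_def] q0_def[abs_def] by (rule cusp_lim_power[OF cusp_lim_klein])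

lemma cusp_lim_X10: "cusp_lim X10 x0"
proof -
  have "e (1 / 2 / 2) - e (- (1 / 2) / 2) = 2 * \<i>" using e_minus[of "1 / 4"] by (simp add: e_quarter)
  with cusp_lim_pointwise[OF cusp_lim_klein, of "1 / 2"]
  have "((\<lambda>\<tau>. klein \<tau> (1 / 2)) \<longlongrightarrow> 2 * \<i>) cusp" by simp
  then have "((\<lambda>\<tau>. inverse (klein \<tau> (1 / 2))) \<longlongrightarrow> inverse (2 * \<i>)) cusp" by (intro tendsto_intros) auto
  note cusp_lim_power[OF cusp_lim_mult[OF cusp_lim_affine[OF cusp_lim_klein, of 1 "1 / 2"] cusp_lim_\<tau>[OF this]], of 2]
  then show ?thesis
  proof (rule cusp_lim_cong)
    fix z :: complex
    define u where "u = e (z / 2)"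
    have v: "e (- z / 2) = inverse u" "u \<noteq> 0" using e_minus[of "z / 2"] by (simp_all add: u_def)
    have 4: "e (- (1 / 4)) = - \<i>" using e_minus[of "1 / 4"] by (simp add: e_quarter)
    have "e ((1 * z + 1 / 2) / 2) = e (z / 2 + 1 / 4)" "e (- (1 * z + 1 / 2) / 2) = e (- z / 2 + - (1 / 4))"
      by (rule arg_cong[where f = e], simp add: field_simps)+
    then have AB: "e ((1 * z + 1 / 2) / 2) = u * \<i>" "e (- (1 * z + 1 / 2) / 2) = inverse u * (- \<i>)"
      unfolding e_add e_quarter 4 v(1) by (simp_all only: u_def)
    have "((u * \<i> - inverse u * (- \<i>)) * inverse (2 * \<i>))\<^sup>2 = 1 + (u - inverse u)\<^sup>2 / 4"
      using v(2) by (simp add: field_simps power2_eq_square)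
    then show "((e ((1 * z + 1 / 2) / 2) - e (- (1 * z + 1 / 2) / 2)) * inverse (2 * \<i>))\<^sup>2 = x0 z"
      by (simp only: AB x0_def q0_def v(1) u_def[symmetric])
  qed (simp add: X10_def divide_inverse[of "klein _ _"])
qed

lemma klein_shift_ratio:
  assumes \<tau>: "\<tau> \<in> uhp" and nz: "klein \<tau> w \<noteq> 0"
  shows "klein \<tau> (z + w) / klein \<tau> w = e (- z / 2) * (qpoch \<tau> (w + z) * qpoch \<tau> (\<tau> - w - z)) * inverse (qpoch \<tau> w * qpoch \<tau> (\<tau> - w))"
proof -
  have "qpoch \<tau> w \<noteq> 0" "qpoch \<tau> (\<tau> - w) \<noteq> 0" using nz by (auto simp: klein_theta[OF \<tau>])
  moreover have "- (z + w) / 2 = - z / 2 + - w / 2" by (simp add: field_simps)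
  then have "e (- (z + w) / 2) = e (- z / 2) * e (- w / 2)" by (simp only: e_add)
  moreover have "\<tau> - (z + w) = \<tau> - w - z" "z + w = w + z" by simp_all
  ultimately show ?thesis unfolding klein_theta[OF \<tau>] using qpoch_self_nz[OF \<tau>]
    by (simp only:) (simp add: field_simps)
qed

lemma X01_eq_qpoch:
  assumes \<tau>: "\<tau> \<in> uhp"
  shows "X01 \<tau> z = (qpoch \<tau> (\<tau> / 2 + z) * qpoch \<tau> (\<tau> / 2 - z) * inverse (qpoch \<tau> (\<tau> / 2) * qpoch \<tau> (\<tau> / 2)))\<^sup>2"
proof -
  have "(e (- z / 2))\<^sup>2 = e (- z)" using e_of_nat_mult[of 2 "- z / 2"] by simp
  then have "(e (- z / 2))\<^sup>2 * e z = 1" by (simp only: e_add[symmetric]) simp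
  then show ?thesis unfolding X01_def klein_shift_ratio[OF \<tau> klein_half_nz(2)[OF \<tau>]]
    by (simp add: power_mult_distrib mult_ac)
qed

lemma X00_eq_qpoch:
  assumes \<tau>: "\<tau> \<in> uhp"
  shows "X00 \<tau> z = (qpoch \<tau> ((\<tau> + 1) / 2 + z) * qpoch \<tau> ((\<tau> + 1) / 2 - z) * inverse (qpoch \<tau> ((\<tau> + 1) / 2) * qpoch \<tau> ((\<tau> + 1) / 2)))\<^sup>2"
proof -
  have "\<tau> - (\<tau> + 1) / 2 - z = ((\<tau> + 1) / 2 - z) - 1" "\<tau> - (\<tau> + 1) / 2 = (\<tau> + 1) / 2 - 1"
    by (simp_all add: field_simps)
  then have 1: "qpoch \<tau> (\<tau> - (\<tau> + 1) / 2 - z) = qpoch \<tau> ((\<tau> + 1) / 2 - z)"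
    "qpoch \<tau> (\<tau> - (\<tau> + 1) / 2) = qpoch \<tau> ((\<tau> + 1) / 2)" by (simp_all only: qpoch_minus_1)
  have "(e (- z / 2))\<^sup>2 = e (- z)" using e_of_nat_mult[of 2 "- z / 2"] by simp
  then have "(e (- z / 2))\<^sup>2 * e z = 1" by (simp only: e_add[symmetric]) simp
  then show ?thesis unfolding X00_def klein_shift_ratio[OF \<tau> klein_half_nz(3)[OF \<tau>]] 1
    by (simp add: power_mult_distrib mult_ac)
qed

lemma cusp_lim_theta_ratio:
  assumes "\<And>\<tau>. \<tau> \<in> uhp \<Longrightarrow> Im (w \<tau>) = Im \<tau> / 2"
  shows "cusp_lim (\<lambda>\<tau> z. (qpoch \<tau> (w \<tau> + z) * qpoch \<tau> (w \<tau> - z) * inverse (qpoch \<tau> (w \<tau>) * qpoch \<tau> (w \<tau>)))\<^sup>2) (\<lambda>_. 1)"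
proof -
  have "((\<lambda>\<tau>. qpoch \<tau> (w \<tau>)) \<longlongrightarrow> 1) cusp" by (rule qpoch_cusp_0) (simp add: assms)
  then have "((\<lambda>\<tau>. inverse (qpoch \<tau> (w \<tau>) * qpoch \<tau> (w \<tau>))) \<longlongrightarrow> inverse (1 * 1)) cusp"
    by (intro tendsto_intros) auto
  then have 1: "cusp_lim (\<lambda>\<tau> z. inverse (qpoch \<tau> (w \<tau>) * qpoch \<tau> (w \<tau>))) (\<lambda>_. inverse (1 * 1))" by (rule cusp_lim_\<tau>)
  have 2: "cusp_lim (\<lambda>\<tau> z. qpoch \<tau> (w \<tau> + z)) (\<lambda>z. 1)"
  proof (rule cusp_lim_qpoch)
    fix \<tau> z assume "\<tau> \<in> uhp" then show "Im \<tau> / 2 - norm z \<le> Im (w \<tau> + z)" using Im_bounds[of z] by (simp add: assms)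
  qed
  have 3: "cusp_lim (\<lambda>\<tau> z. qpoch \<tau> (w \<tau> - z)) (\<lambda>z. 1)"
  proof (rule cusp_lim_qpoch)
    fix \<tau> z assume "\<tau> \<in> uhp" then show "Im \<tau> / 2 - norm z \<le> Im (w \<tau> - z)" using Im_bounds[of z] by (simp add: assms)
  qed
  show ?thesis
    by (rule cusp_lim_cong[OF cusp_lim_power[OF cusp_lim_mult[OF cusp_lim_mult[OF 2 3] 1], of 2]]) simp_all
qed

lemma cusp_lim_X01: "cusp_lim X01 (\<lambda>_. 1)"
  by (rule cusp_lim_cong[OF cusp_lim_theta_ratio[of "\<lambda>\<tau>. \<tau> / 2"]]) (simp_all add: X01_eq_qpoch)

lemma cusp_lim_X00: "cusp_lim X00 (\<lambda>_. 1)"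
  by (rule cusp_lim_cong[OF cusp_lim_theta_ratio[of "\<lambda>\<tau>. (\<tau> + 1) / 2"]]) (simp_all add: X00_eq_qpoch)

lemma cusp_lim_Yf: "cusp_lim Yf (\<lambda>z. 1 + q0 z / 12)"
  by (rule cusp_lim_cong[OF cusp_lim_mult[OF cusp_lim_add[OF cusp_lim_add[OF cusp_lim_X10 cusp_lim_X01] cusp_lim_X00] cusp_lim_const[of "1 / 3"]]])
     (simp_all add: Yf_def x0_def field_simps)

lemma eps_cusp: "(eps10 \<longlongrightarrow> - 1 / 6) cusp" "(eps01 \<longlongrightarrow> 1 / 12) cusp" "(eps00 \<longlongrightarrow> 1 / 12) cusp"
proof -
  have q: "q0 (1 / 2) = - 4" using e_minus[of "1 / 4"] by (simp add: q0_def e_quarter power2_eq_square)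
  have *: "((\<lambda>\<tau>. (Yf \<tau> (1 / 2) - X \<tau> (1 / 2)) / Qf \<tau> (1 / 2)) \<longlongrightarrow> (1 + q0 (1/2) / 12 - X0 (1/2)) / q0 (1/2)) cusp"
    if "cusp_lim X X0" for X X0
    by (intro tendsto_intros cusp_lim_pointwise[OF that] cusp_lim_pointwise[OF cusp_lim_Yf] cusp_lim_pointwise[OF cusp_lim_Qf])
       (simp add: q)
  show "(eps10 \<longlongrightarrow> - 1 / 6) cusp" "(eps01 \<longlongrightarrow> 1 / 12) cusp" "(eps00 \<longlongrightarrow> 1 / 12) cusp"
    unfolding eps10_def[abs_def] eps01_def[abs_def] eps00_def[abs_def]
    using *[OF cusp_lim_X10] *[OF cusp_lim_X01] *[OF cusp_lim_X00] by (simp_all add: q x0_def)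
qed

section \<open>Weak Jacobi forms\<close>

text \<open>
  Weak Jacobi forms of weight \<open>k\<close> and index \<open>m\<close>, together with their \<open>q\<^sup>0\<close>-term \<open>f0\<close>, on which the uniqueness
  theorem rests. A form of index 0 that is independent of \<open>z\<close> is a modular form of level one.
\<close>

definition jform :: "int \<Rightarrow> nat \<Rightarrow> (complex \<Rightarrow> complex \<Rightarrow> complex) \<Rightarrow> (complex \<Rightarrow> complex) \<Rightarrow> bool" where
  "jform k m f f0 \<longleftrightarrow> hol2 f \<and> cusp_lim f f0 \<and>
     (\<forall>\<tau>\<in>uhp. \<forall>z. f (\<tau> + 1) z = f \<tau> z
        \<and> f (- 1 / \<tau>) (z / \<tau>) = \<tau> powi k * e (of_nat m * z\<^sup>2 / \<tau>) * f \<tau> z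
        \<and> f \<tau> (z + 1) = f \<tau> z
        \<and> f \<tau> (z + \<tau>) = e (- of_nat m * (\<tau> + 2 * z)) * f \<tau> z)"

lemma jformI:
  assumes "hol2 f" "cusp_lim f f0" "\<And>\<tau> z. \<tau> \<in> uhp \<Longrightarrow> f (\<tau> + 1) z = f \<tau> z"
    "\<And>\<tau> z. \<tau> \<in> uhp \<Longrightarrow> f (- 1 / \<tau>) (z / \<tau>) = \<tau> powi k * e (of_nat m * z\<^sup>2 / \<tau>) * f \<tau> z"
    "\<And>\<tau> z. \<tau> \<in> uhp \<Longrightarrow> f \<tau> (z + 1) = f \<tau> z"
    "\<And>\<tau> z. \<tau> \<in> uhp \<Longrightarrow> f \<tau> (z + \<tau>) = e (- of_nat m * (\<tau> + 2 * z)) * f \<tau> z"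
  shows "jform k m f f0"
  using assms unfolding jform_def by blast

lemma jformD:
  assumes "jform k m f f0"
  shows "hol2 f" "cusp_lim f f0" "\<And>\<tau> z. \<tau> \<in> uhp \<Longrightarrow> f (\<tau> + 1) z = f \<tau> z"
    "\<And>\<tau> z. \<tau> \<in> uhp \<Longrightarrow> f (- 1 / \<tau>) (z / \<tau>) = \<tau> powi k * e (of_nat m * z\<^sup>2 / \<tau>) * f \<tau> z"
    "\<And>\<tau> z. \<tau> \<in> uhp \<Longrightarrow> f \<tau> (z + 1) = f \<tau> z"
    "\<And>\<tau> z. \<tau> \<in> uhp \<Longrightarrow> f \<tau> (z + \<tau>) = e (- of_nat m * (\<tau> + 2 * z)) * f \<tau> z"
  using assms unfolding jform_def by blast+

lemma jform_const: "jform 0 0 (\<lambda>_ _. c) (\<lambda>_. c)"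
  by (rule jformI) (auto intro: hol2_const cusp_lim_const)

lemma jform_add: "jform k m f f0 \<Longrightarrow> jform k m g g0 \<Longrightarrow> jform k m (\<lambda>\<tau> z. f \<tau> z + g \<tau> z) (\<lambda>z. f0 z + g0 z)"
  by (rule jformI) (simp_all only: hol2_add cusp_lim_add jformD ring_distribs)

lemma jform_diff: "jform k m f f0 \<Longrightarrow> jform k m g g0 \<Longrightarrow> jform k m (\<lambda>\<tau> z. f \<tau> z - g \<tau> z) (\<lambda>z. f0 z - g0 z)"
  by (rule jformI) (simp_all only: hol2_diff cusp_lim_diff jformD ring_distribs)

lemma jform_mult:
  assumes f: "jform k m f f0" and g: "jform k' m' g g0"
  shows "jform (k + k') (m + m') (\<lambda>\<tau> z. f \<tau> z * g \<tau> z) (\<lambda>z. f0 z * g0 z)"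
proof (rule jformI)
  fix \<tau> z assume \<tau>: "\<tau> \<in> uhp"
  have "e (of_nat (m + m') * z\<^sup>2 / \<tau>) = e (of_nat m * z\<^sup>2 / \<tau>) * e (of_nat m' * z\<^sup>2 / \<tau>)"
    unfolding e_add[symmetric] by (simp add: ring_distribs add_divide_distrib)
  then show "f (- 1 / \<tau>) (z / \<tau>) * g (- 1 / \<tau>) (z / \<tau>) =
      \<tau> powi (k + k') * e (of_nat (m + m') * z\<^sup>2 / \<tau>) * (f \<tau> z * g \<tau> z)"
    unfolding jformD(4)[OF f \<tau>] jformD(4)[OF g \<tau>] using uhp_nz[OF \<tau>] by (simp add: power_int_add mult_ac)
  have "e (- of_nat (m + m') * (\<tau> + 2 * z)) = e (- of_nat m * (\<tau> + 2 * z)) * e (- of_nat m' * (\<tau> + 2 * z))"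
    unfolding e_add[symmetric] by (simp add: algebra_simps)
  then show "f \<tau> (z + \<tau>) * g \<tau> (z + \<tau>) = e (- of_nat (m + m') * (\<tau> + 2 * z)) * (f \<tau> z * g \<tau> z)"
    unfolding jformD(6)[OF f \<tau>] jformD(6)[OF g \<tau>] by (simp add: mult_ac)
qed (use f g in \<open>auto intro: hol2_mult cusp_lim_mult jformD(1,2) simp: jformD(3,5)\<close>)

lemma jform_power: "jform k m f f0 \<Longrightarrow> jform (int n * k) (n * m) (\<lambda>\<tau> z. f \<tau> z ^ n) (\<lambda>z. f0 z ^ n)"
proof (induction n)
  case (Suc n)
  from jform_mult[OF Suc.prems Suc.IH[OF Suc.prems]] show ?case by (simp add: algebra_simps)
qed (simp add: jform_const)

lemma jform_cong:
  assumes f: "jform k m f f0" and eq: "k = k'" "m = m'" "\<And>\<tau> z. \<tau> \<in> uhp \<Longrightarrow> f \<tau> z = g \<tau> z" "\<And>z. f0 z = g0 z"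
  shows "jform k' m' g g0"
proof (rule jformI)
  show "hol2 g" by (rule hol2_cong[OF jformD(1)[OF f] eq(3)])
  show "cusp_lim g g0" by (rule cusp_lim_cong[OF jformD(2)[OF f] eq(3,4)])
qed (use jformD(3-6)[OF f] in \<open>simp_all only: eq(3)[symmetric] eq(1,2)[symmetric] uhp_add_1 uhp_neg_inverse\<close>)

text \<open>
  Substituting \<open>2 z\<close> multiplies the index by 4.
\<close>

lemma jform_double:
  assumes f: "jform k m f f0"
  shows "jform k (4 * m) (\<lambda>\<tau> z. f \<tau> (2 * z)) (\<lambda>z. f0 (2 * z))"
proof (rule jformI)
  show "hol2 (\<lambda>\<tau> z. f \<tau> (2 * z))" by (intro hol2_compose[OF jformD(1)[OF f] hol2_fst] hol2_intros)
  show "cusp_lim (\<lambda>\<tau> z. f \<tau> (2 * z)) (\<lambda>z. f0 (2 * z))"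
    using cusp_lim_affine[OF jformD(2)[OF f], of 2 0] by simp
  fix \<tau> z assume \<tau>: "\<tau> \<in> uhp"
  show "f (\<tau> + 1) (2 * z) = f \<tau> (2 * z)" by (rule jformD(3)[OF f \<tau>])
  show "f (- 1 / \<tau>) (2 * (z / \<tau>)) = \<tau> powi k * e (of_nat (4 * m) * z\<^sup>2 / \<tau>) * f \<tau> (2 * z)"
    using jformD(4)[OF f \<tau>, of "2 * z"] by (simp add: mult_ac power_mult_distrib)
  show "f \<tau> (2 * (z + 1)) = f \<tau> (2 * z)"
    using jformD(5)[OF f \<tau>, of "2 * z"] jformD(5)[OF f \<tau>, of "2 * z + 1"] by (simp add: algebra_simps)
  have 1: "f \<tau> (2 * (z + \<tau>)) = f \<tau> (2 * z + \<tau> + \<tau>)" by (simp add: algebra_simps)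
  have 2: "e (- of_nat m * (\<tau> + 2 * (2 * z + \<tau>))) * e (- of_nat m * (\<tau> + 2 * (2 * z))) = e (- of_nat (4 * m) * (\<tau> + 2 * z))"
    unfolding e_add[symmetric] by (rule arg_cong[where f = e]) (simp add: algebra_simps)
  show "f \<tau> (2 * (z + \<tau>)) = e (- of_nat (4 * m) * (\<tau> + 2 * z)) * f \<tau> (2 * z)"
    unfolding 1 2[symmetric] jformD(6)[OF f \<tau>] by (simp only: mult_ac)
qed

lemma jform_Qf: "jform (-2) 1 Qf q0"
proof (rule jformI)
  fix \<tau> z assume \<tau>: "\<tau> \<in> uhp"
  have "(e (z\<^sup>2 / (2 * \<tau>)))\<^sup>2 = e (z\<^sup>2 / \<tau>)"
    using e_of_nat_mult[of 2 "z\<^sup>2 / (2 * \<tau>)"] by simp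
  then show "Qf (- 1 / \<tau>) (z / \<tau>) = \<tau> powi (-2) * e (of_nat 1 * z\<^sup>2 / \<tau>) * Qf \<tau> z"
    unfolding Qf_def klein_S[OF \<tau>] using uhp_nz[OF \<tau>]
    by (simp add: power_mult_distrib power_divide power_int_minus field_simps)
  show "Qf \<tau> (z + \<tau>) = e (- of_nat 1 * (\<tau> + 2 * z)) * Qf \<tau> z"
    using Qf_plus_\<tau>[OF \<tau>, of z] by (simp add: algebra_simps)
qed (auto intro: hol2_Qf cusp_lim_Qf simp: Qf_def klein_T klein_plus_1)

lemma X_T:
  "X10 (\<tau> + 1) z = X10 \<tau> z" "X01 (\<tau> + 1) z = X00 \<tau> z" "X00 (\<tau> + 1) z = X01 \<tau> z"
proof -
  have "(\<tau> + 1 + 1) / 2 = \<tau> / 2 + 1" by (simp add: field_simps)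
  moreover from this have "z + (\<tau> + 1 + 1) / 2 = (z + \<tau> / 2) + 1" by simp
  ultimately show "X00 (\<tau> + 1) z = X01 \<tau> z" unfolding X00_def X01_def by (simp only: klein_T klein_plus_1) simp
qed (simp_all add: X10_def X01_def X00_def klein_T)

text \<open>
  The inversion permutes the half-periods, hence exchanges two of the three squares.
\<close>

lemma X_S:
  assumes \<tau>: "\<tau> \<in> uhp"
  shows "X10 (- 1 / \<tau>) (z / \<tau>) = e (z\<^sup>2 / \<tau>) * X01 \<tau> z" (is ?A)
    "X01 (- 1 / \<tau>) (z / \<tau>) = e (z\<^sup>2 / \<tau>) * X10 \<tau> z" (is ?B)
    "X00 (- 1 / \<tau>) (z / \<tau>) = e (z\<^sup>2 / \<tau>) * X00 \<tau> z" (is ?C)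
proof -
  have nz: "\<tau> \<noteq> 0" by (rule uhp_nz[OF \<tau>])
  have *: "(klein (- 1 / \<tau>) ((z + w) / \<tau>) / klein (- 1 / \<tau>) (w / \<tau>))\<^sup>2 * e (u / \<tau>) = e (z\<^sup>2 / \<tau>) * (e ((2 * z * w + u) / \<tau>) * (klein \<tau> (z + w) / klein \<tau> w)\<^sup>2)"
    for w u
  proof -
    have "(z + w)\<^sup>2 / (2 * \<tau>) = w\<^sup>2 / (2 * \<tau>) + (z\<^sup>2 + 2 * z * w) / (2 * \<tau>)"
      by (simp add: power2_eq_square add_divide_distrib algebra_simps)
    then have "e ((z + w)\<^sup>2 / (2 * \<tau>)) = e (w\<^sup>2 / (2 * \<tau>)) * e ((z\<^sup>2 + 2 * z * w) / (2 * \<tau>))"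
      by (simp only: e_add)
    then have 1: "klein (- 1 / \<tau>) ((z + w) / \<tau>) / klein (- 1 / \<tau>) (w / \<tau>) = e ((z\<^sup>2 + 2 * z * w) / (2 * \<tau>)) * (klein \<tau> (z + w) / klein \<tau> w)"
      unfolding klein_S[OF \<tau>] using nz by simp
    have A: "(e ((z\<^sup>2 + 2 * z * w) / (2 * \<tau>)))\<^sup>2 = e ((z\<^sup>2 + 2 * z * w) / \<tau>)"
    proof -
      have "of_nat 2 * (A / (2 * \<tau>)) = A / \<tau>" for A by simp
      then show ?thesis by (simp only: e_of_nat_mult[symmetric])
    qed
    have B: "e ((z\<^sup>2 + 2 * z * w) / \<tau>) * e (u / \<tau>) = e (z\<^sup>2 / \<tau>) * e ((2 * z * w + u) / \<tau>)"
      unfolding e_add[symmetric] by (simp add: add_divide_distrib add.assoc)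
    have C: "F * R * G = (F * G) * R" for F R G :: complex by (simp only: mult_ac)
    show ?thesis unfolding 1 power_mult_distrib A C[of _ _ "e (u / \<tau>)"] B by (simp only: mult.assoc)
  qed
  show ?A
  proof -
    have 1: "z / \<tau> + 1 / 2 = (z + \<tau> / 2) / \<tau>" "\<tau> / 2 / \<tau> = 1 / 2" "(2 * z * (\<tau> / 2) + 0) / \<tau> = z"
      using nz by (simp_all add: field_simps)
    have "X10 (- 1 / \<tau>) (z / \<tau>) = (klein (- 1 / \<tau>) ((z + \<tau> / 2) / \<tau>) / klein (- 1 / \<tau>) (\<tau> / 2 / \<tau>))\<^sup>2 * e (0 / \<tau>)"
      unfolding X10_def 1(1,2) by simp
    also note *[of "\<tau> / 2" 0]
    finally show ?thesis unfolding X01_def 1(3) by (simp only: mult_ac)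
  qed
  show ?B
  proof -
    have 1: "z / \<tau> + - 1 / \<tau> / 2 = (z + (- 1 / 2)) / \<tau>" "- 1 / \<tau> / 2 = (- 1 / 2) / \<tau>" "2 * z * (- 1 / 2) + z = 0"
      using nz by (simp_all add: field_simps)
    have 2: "klein \<tau> (z + (- 1 / 2)) = - klein \<tau> (z + 1 / 2)" "klein \<tau> (- 1 / 2) = - klein \<tau> (1 / 2)"
      using klein_minus_1[of \<tau> "z + 1 / 2"] klein_minus[of \<tau> "1 / 2"] by simp_all
    have "X01 (- 1 / \<tau>) (z / \<tau>) = (klein (- 1 / \<tau>) ((z + (- 1 / 2)) / \<tau>) / klein (- 1 / \<tau>) ((- 1 / 2) / \<tau>))\<^sup>2 * e (z / \<tau>)"
      by (simp only: X01_def 1(2) add_divide_distrib)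
    also note *[of "- 1 / 2" z]
    finally show ?thesis unfolding X10_def 1(3) 2 by simp
  qed
  show ?C
  proof -
    have 1: "z / \<tau> + (- 1 / \<tau> + 1) / 2 = (z + ((\<tau> + 1) / 2 - 1)) / \<tau>" "(- 1 / \<tau> + 1) / 2 = ((\<tau> + 1) / 2 - 1) / \<tau>"
      "(2 * z * ((\<tau> + 1) / 2 - 1) + z) / \<tau> = z"
      using nz by (simp_all add: field_simps)
    have 2: "klein \<tau> (z + ((\<tau> + 1) / 2 - 1)) = - klein \<tau> (z + (\<tau> + 1) / 2)" "klein \<tau> ((\<tau> + 1) / 2 - 1) = - klein \<tau> ((\<tau> + 1) / 2)"
      using klein_minus_1[of \<tau> "z + (\<tau> + 1) / 2"] klein_minus_1[of \<tau> "(\<tau> + 1) / 2"] by (simp_all add: add_diff_eq)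
    have "X00 (- 1 / \<tau>) (z / \<tau>) = (klein (- 1 / \<tau>) ((z + ((\<tau> + 1) / 2 - 1)) / \<tau>) / klein (- 1 / \<tau>) (((\<tau> + 1) / 2 - 1) / \<tau>))\<^sup>2 * e (z / \<tau>)"
      by (simp only: X00_def 1(2) add_divide_distrib[of z])
    also note *[of "(\<tau> + 1) / 2 - 1" z]
    finally show ?thesis unfolding X00_def 1(3) 2 by (simp add: mult_ac)
  qed
qed

lemma Yf_T: "Yf (\<tau> + 1) z = Yf \<tau> z"
  by (simp add: Yf_def X_T)

lemma Yf_S: "\<tau> \<in> uhp \<Longrightarrow> Yf (- 1 / \<tau>) (z / \<tau>) = e (z\<^sup>2 / \<tau>) * Yf \<tau> z"
  by (simp only: Yf_def X_S) (simp add: algebra_simps)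

lemma jform_Yf: "jform 0 1 Yf (\<lambda>z. 1 + q0 z / 12)"
proof (rule jformI)
  fix \<tau> z assume \<tau>: "\<tau> \<in> uhp"
  show "Yf (- 1 / \<tau>) (z / \<tau>) = \<tau> powi 0 * e (of_nat 1 * z\<^sup>2 / \<tau>) * Yf \<tau> z"
    by (simp only: Yf_S[OF \<tau>]) simp
  show "Yf \<tau> (z + \<tau>) = e (- of_nat 1 * (\<tau> + 2 * z)) * Yf \<tau> z"
    unfolding Yf_def X_plus_\<tau>[OF \<tau>] by (simp add: algebra_simps)
qed (auto intro: hol2_Yf cusp_lim_Yf simp: Yf_def X_T X_plus_1)

lemma eps_T:
  assumes \<tau>: "\<tau> \<in> uhp"
  shows "eps10 (\<tau> + 1) = eps10 \<tau>" "eps01 (\<tau> + 1) = eps00 \<tau>" "eps00 (\<tau> + 1) = eps01 \<tau>"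
  by (simp_all add: eps10_def eps01_def eps00_def Yf_T X_T Qf_def klein_T)

lemma eps_S:
  assumes \<tau>: "\<tau> \<in> uhp"
  shows "eps10 (- 1 / \<tau>) = \<tau>\<^sup>2 * eps01 \<tau>" "eps01 (- 1 / \<tau>) = \<tau>\<^sup>2 * eps10 \<tau>" "eps00 (- 1 / \<tau>) = \<tau>\<^sup>2 * eps00 \<tau>"
proof -
  have nz: "\<tau> \<noteq> 0" by (rule uhp_nz[OF \<tau>])
  have Qnz: "Qf \<tau> (1 / 2) \<noteq> 0" by (simp add: Qf_def klein_half_nz[OF \<tau>])
  have *: "c = \<tau>\<^sup>2 * d"
    if a: "e (z\<^sup>2 / \<tau>) * X = Yf (- 1 / \<tau>) (z / \<tau>) - c * Qf (- 1 / \<tau>) (z / \<tau>)" and b: "X = Yf \<tau> z - d * Qf \<tau> z" and z: "z = 1 / 2" for c d X z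
  proof -
    have "e (z\<^sup>2 / \<tau>) * X = e (z\<^sup>2 / \<tau>) * Yf \<tau> z - c * (e (z\<^sup>2 / \<tau>) * Qf \<tau> z / \<tau>\<^sup>2)"
      unfolding a Yf_S[OF \<tau>] using jformD(4)[OF jform_Qf \<tau>, of z] nz by (simp add: power_int_minus field_simps)
    also have "\<dots> = e (z\<^sup>2 / \<tau>) * (Yf \<tau> z - c * Qf \<tau> z / \<tau>\<^sup>2)" by (simp add: algebra_simps)
    finally have "X = Yf \<tau> z - c * Qf \<tau> z / \<tau>\<^sup>2" by simp
    then have "d * Qf \<tau> z = c * Qf \<tau> z / \<tau>\<^sup>2" using b by (simp add: algebra_simps)
    then show ?thesis using Qnz nz unfolding z by (simp add: field_simps)
  qed
  note S = X_S[OF \<tau>, symmetric] and E' = X_eq[OF uhp_neg_inverse[OF \<tau>]] and E = X_eq[OF \<tau>]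
  show "eps10 (- 1 / \<tau>) = \<tau>\<^sup>2 * eps01 \<tau>" by (rule *[OF trans[OF S(1)[of "1 / 2"] E'(1)[of "1 / 2 / \<tau>"]] E(2)[of "1 / 2"] refl])
  show "eps01 (- 1 / \<tau>) = \<tau>\<^sup>2 * eps10 \<tau>" by (rule *[OF trans[OF S(2)[of "1 / 2"] E'(2)[of "1 / 2 / \<tau>"]] E(1)[of "1 / 2"] refl])
  show "eps00 (- 1 / \<tau>) = \<tau>\<^sup>2 * eps00 \<tau>" by (rule *[OF trans[OF S(3)[of "1 / 2"] E'(3)[of "1 / 2 / \<tau>"]] E(3)[of "1 / 2"] refl])
qed

lemma hol2_eps: "hol2 (\<lambda>\<tau> z. eps10 \<tau>)" "hol2 (\<lambda>\<tau> z. eps01 \<tau>)" "hol2 (\<lambda>\<tau> z. eps00 \<tau>)"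
proof -
  have *: "hol2 (\<lambda>\<tau> z. f \<tau> (1 / 2))" if "hol2 f" for f
    by (rule hol2_compose[OF that hol2_fst hol2_const]) 
  have **: "hol2 (\<lambda>\<tau> z. (Yf \<tau> (1 / 2) - X \<tau> (1 / 2)) / Qf \<tau> (1 / 2))" if "hol2 X" for X
    by (rule hol2_divide[OF hol2_diff[OF *[OF hol2_Yf] *[OF that]] *[OF hol2_Qf]]) (simp add: Qf_def klein_half_nz)
  show "hol2 (\<lambda>\<tau> z. eps10 \<tau>)" "hol2 (\<lambda>\<tau> z. eps01 \<tau>)" "hol2 (\<lambda>\<tau> z. eps00 \<tau>)"
    unfolding eps10_def eps01_def eps00_def
    by (rule **[OF hol2_X10], rule **[OF hol2_X01], rule **[OF hol2_X00])
qed

text \<open>The cubic \<open>(Y - \<epsilon>\<^sub>1 Q)(Y - \<epsilon>\<^sub>2 Q)(Y - \<epsilon>\<^sub>3 Q)\<close> is \<open>Y\<^sup>3 + a Y Q\<^sup>2 + b Q\<^sup>3\<close>.\<close>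

definition cub_a :: "complex \<Rightarrow> complex" where
  "cub_a \<tau> = eps10 \<tau> * eps01 \<tau> + eps10 \<tau> * eps00 \<tau> + eps01 \<tau> * eps00 \<tau>"

definition cub_b :: "complex \<Rightarrow> complex" where
  "cub_b \<tau> = - eps10 \<tau> * eps01 \<tau> * eps00 \<tau>"

lemma jform_cub_a: "jform 4 0 (\<lambda>\<tau> _. cub_a \<tau>) (\<lambda>_. - 1 / 48)"
proof (rule jformI)
  show "hol2 (\<lambda>\<tau> _. cub_a \<tau>)" unfolding cub_a_def by (intro hol2_intros hol2_eps)
  have "(cub_a \<longlongrightarrow> (- 1 / 6) * (1 / 12) + (- 1 / 6) * (1 / 12) + (1 / 12) * (1 / 12)) cusp"
    unfolding cub_a_def[abs_def] by (intro tendsto_intros eps_cusp)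
  then show "cusp_lim (\<lambda>\<tau> _. cub_a \<tau>) (\<lambda>_. - 1 / 48)" by (intro cusp_lim_\<tau>) simp
  fix \<tau> z assume \<tau>: "\<tau> \<in> uhp"
  show "cub_a (- 1 / \<tau>) = \<tau> powi 4 * e (of_nat 0 * z\<^sup>2 / \<tau>) * cub_a \<tau>"
    unfolding cub_a_def eps_S[OF \<tau>] by (simp add: algebra_simps power2_eq_square power4_eq_xxxx)
qed (simp_all add: cub_a_def eps_T)

lemma jform_cub_b: "jform 6 0 (\<lambda>\<tau> _. cub_b \<tau>) (\<lambda>_. 1 / 864)"
proof (rule jformI)
  show "hol2 (\<lambda>\<tau> _. cub_b \<tau>)" unfolding cub_b_def by (intro hol2_intros hol2_eps)
  have "(cub_b \<longlongrightarrow> - (- 1 / 6) * (1 / 12) * (1 / 12)) cusp"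
    unfolding cub_b_def[abs_def] by (intro tendsto_intros eps_cusp)
  then show "cusp_lim (\<lambda>\<tau> _. cub_b \<tau>) (\<lambda>_. 1 / 864)" by (intro cusp_lim_\<tau>) simp
  fix \<tau> z assume \<tau>: "\<tau> \<in> uhp"
  have "\<tau> ^ 6 = \<tau>\<^sup>2 * \<tau>\<^sup>2 * \<tau>\<^sup>2" by (simp flip: power_add)
  then show "cub_b (- 1 / \<tau>) = \<tau> powi 6 * e (of_nat 0 * z\<^sup>2 / \<tau>) * cub_b \<tau>"
    unfolding cub_b_def eps_S[OF \<tau>] by simp
qed (simp_all add: cub_b_def eps_T)

lemma Delta_eq_cub_a_cub_b:
  assumes "\<tau> \<in> uhp"
  shows "Delta \<tau> = 16 * (- 4 * cub_a \<tau> ^ 3 - 27 * cub_b \<tau> ^ 2)"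
proof -
  have 0: "eps00 \<tau> = - eps10 \<tau> - eps01 \<tau>" using eps_sum[of \<tau>] by (simp add: algebra_simps eq_neg_iff_add_eq_0)
  show ?thesis unfolding Delta_eq_eps[OF assms] cub_a_def cub_b_def 0 by (simp add: power2_eq_square power3_eq_cube algebra_simps)
qed

section \<open>Modular forms vanishing at the cusp\<close>

lemma uhp_periodic_int:
  assumes "\<And>\<tau>. \<tau> \<in> uhp \<Longrightarrow> g (\<tau> + 1) = g \<tau>" "\<tau> \<in> uhp"
  shows "g (\<tau> + of_int n) = g \<tau>"
proof -
  define G where "G w = g (if w \<in> uhp then w else \<i>)" for w
  have "G (w + 1) = G w" for w using assms by (auto simp: G_def uhp_def)
  from periodic_int[of G 1, OF this] have "G (\<tau> + of_int n * 1) = G \<tau>" .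
  moreover have "\<tau> + of_int n \<in> uhp" using assms(2) by (simp add: uhp_def)
  ultimately show ?thesis using assms(2) by (simp add: G_def)
qed

text \<open>
  A section of \<open>q = e \<tau>\<close> with values in the strip, for passing from \<open>\<tau>\<close> to \<open>q\<close>.
\<close>

definition log_q :: "complex \<Rightarrow> complex" where "log_q q = Ln q / (2 * of_real pi * \<i>)"

lemma e_log_q: "q \<noteq> 0 \<Longrightarrow> e (log_q q) = q"
  by (simp add: e_def log_q_def)

lemma Im_log_q: "q \<noteq> 0 \<Longrightarrow> Im (log_q q) = - ln (norm q) / (2 * pi)"
  by (simp add: log_q_def Im_divide power2_eq_square field_simps)

lemma Re_log_q: "q \<noteq> 0 \<Longrightarrow> \<bar>Re (log_q q)\<bar> \<le> 1 / 2"
proof -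
  assume "q \<noteq> 0"
  have "Re (log_q q) = Im (Ln q) / (2 * pi)"
    by (simp add: log_q_def Re_divide power2_eq_square field_simps)
  moreover have "\<bar>Im (Ln q)\<bar> \<le> pi" using mpi_less_Im_Ln[OF \<open>q \<noteq> 0\<close>] Im_Ln_le_pi[OF \<open>q \<noteq> 0\<close>] by linarith
  then have "\<bar>Im (Ln q)\<bar> / (2 * pi) \<le> pi / (2 * pi)" by (intro divide_right_mono) auto
  ultimately show ?thesis by (simp add: abs_divide)
qed

lemma e_eq_imp: "e x = e y \<Longrightarrow> \<exists>n :: int. x = y + of_int n"
proof -
  assume "e x = e y"
  then have "e (x - y) = 1" by (simp add: e_diff)
  then obtain n where "x - y = of_int n" unfolding e_eq_1_iff by (auto elim: Ints_cases)
  then show ?thesis by (intro exI[of _ n]) (simp add: algebra_simps)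
qed

lemma log_q_cusp: "filterlim log_q cusp (at 0)"
  unfolding filterlim_iff eventually_cusp
proof safe
  fix P B assume B: "\<forall>\<tau>. \<bar>Re \<tau>\<bar> \<le> 1 / 2 \<longrightarrow> B \<le> Im \<tau> \<longrightarrow> P \<tau>"
  show "\<forall>\<^sub>F q in at 0. P (log_q q)"
    unfolding eventually_at
  proof (intro exI conjI ballI impI)
    show "exp (- 2 * pi * B) > 0" by simp
    fix q :: complex assume q: "q \<noteq> 0 \<and> dist q 0 < exp (- 2 * pi * B)"
    then have "ln (norm q) < ln (exp (- 2 * pi * B))" by (intro ln_less_cancel_iff[THEN iffD2]) auto
    then have "ln (norm q) < - 2 * pi * B" by simp
    then have "B \<le> Im (log_q q)" using q by (simp add: Im_log_q field_simps)
    then show "P (log_q q)" using B Re_log_q q by blast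
  qed
qed

text \<open>
  A periodic function is a function of \<open>q\<close> on the punctured disc; if it tends to zero at the cusp, the
  singularity at \<open>q = 0\<close> is removable and a factor \<open>q\<close> splits off.
\<close>

lemma periodic_cusp_factor:
  assumes hol: "g holomorphic_on uhp" and T: "\<And>\<tau>. \<tau> \<in> uhp \<Longrightarrow> g (\<tau> + 1) = g \<tau>"
    and lim: "(g \<longlongrightarrow> 0) cusp"
  obtains D where "D holomorphic_on ball 0 1" "\<And>\<tau>. \<tau> \<in> uhp \<Longrightarrow> g \<tau> = e \<tau> * D (e \<tau>)"
proof -
  define C where "C q = (if q = 0 then 0 else g (log_q q))" for q
  have Ce: "C (e \<tau>) = g \<tau>" if \<tau>: "\<tau> \<in> uhp" for \<tau>
  proof -
    have "e (log_q (e \<tau>)) = e \<tau>" by (simp add: e_log_q)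
    then obtain n where "log_q (e \<tau>) = \<tau> + of_int n" using e_eq_imp by blast
    then show ?thesis using uhp_periodic_int[of g \<tau>, OF T \<tau>] by (simp add: C_def)
  qed
  have d: "C field_differentiable at q0" if q0: "q0 \<noteq> 0" "norm q0 < 1" for q0
  proof -
    define S where "S = {q. Re (q / q0) > 0} \<inter> ball 0 1"
    have "open S" unfolding S_def
      by (intro open_Int open_ball open_Collect_less continuous_intros) (use q0 in auto)
    define w where "w q = log_q q0 + Ln (q / q0) / (2 * of_real pi * \<i>)" for q
    have nz: "q \<noteq> 0" if "q \<in> S" for q using that by (auto simp: S_def)
    have ew: "e (w q) = q" if "q \<in> S" for q
    proof -
      have "e (Ln (q / q0) / (2 * of_real pi * \<i>)) = q / q0" using nz[OF that] q0 by (simp add: e_def)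
      then show ?thesis unfolding w_def e_add using e_log_q[OF q0(1)] q0 by simp
    qed
    have wu: "w q \<in> uhp" if "q \<in> S" for q
    proof -
      have "exp (- 2 * pi * Im (w q)) < exp 0"
        unfolding norm_e[symmetric] ew[OF that] using that by (simp add: S_def)
      then have "- 2 * pi * Im (w q) < 0" by (rule exp_less_cancel)
      then have "2 * (pi * Im (w q)) > 0" by linarith
      then show ?thesis by (simp add: uhp_def zero_less_mult_iff)
    qed
    have "w holomorphic_on S" unfolding w_def
      using q0 by (auto intro!: holomorphic_intros simp: S_def complex_nonpos_Reals_iff)
    then have "(\<lambda>q. g (w q)) holomorphic_on S"
      using holomorphic_on_compose_gen[OF _ hol, of w S] wu by (auto simp: o_def)
    then have "C holomorphic_on S"
    proof (rule holomorphic_transform)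
      fix q assume q: "q \<in> S"
      show "g (w q) = C q" using Ce[OF wu[OF q]] by (simp only: ew[OF q])
    qed
    moreover have "q0 \<in> S" using q0 by (simp add: S_def)
    ultimately show ?thesis using \<open>open S\<close> holomorphic_on_imp_differentiable_at by blast
  qed
  have "((\<lambda>q. g (log_q q)) \<longlongrightarrow> 0) (at 0)" by (rule filterlim_compose[OF lim log_q_cusp])
  then have "(C \<longlongrightarrow> 0) (at 0)"
    by (rule Lim_transform_eventually) (auto simp: eventually_at_filter C_def)
  then have C0: "isCont C 0" by (simp add: isCont_def C_def)
  have "continuous_on (ball 0 1) C"
  proof (intro continuous_at_imp_continuous_on ballI)
    fix q :: complex assume "q \<in> ball 0 1"
    then have "q \<noteq> 0 \<Longrightarrow> norm q < 1" by simp
    then show "isCont C q" using C0 field_differentiable_imp_continuous_at[OF d[of q]] by (cases "q = 0") simp_all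
  qed
  moreover have "C holomorphic_on ball 0 1 - {0}"
    unfolding holomorphic_on_def
  proof
    fix q :: complex assume "q \<in> ball 0 1 - {0}"
    then have "q \<noteq> 0" "norm q < 1" by simp_all
    then show "C field_differentiable at q within ball 0 1 - {0}"
      by (rule field_differentiable_at_within[OF d])
  qed
  ultimately have "C holomorphic_on ball 0 1"
    by (rule no_isolated_singularity) auto
  moreover have "C 0 = 0" by (simp add: C_def)
  ultimately obtain D where D: "D holomorphic_on ball 0 1" "\<And>z. norm z < 1 \<Longrightarrow> C z = z * D z"
    using Schwarz3[of C 1] by blast
  have "g \<tau> = e \<tau> * D (e \<tau>)" if "\<tau> \<in> uhp" for \<tau>
    using D(2)[OF norm_e_less_1[OF that]] Ce[OF that] by simp
  with D(1) that show ?thesis by blast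
qed

lemma tendsto_cusp_cong:
  assumes "(f \<longlongrightarrow> L) cusp" "\<And>\<tau>. \<tau> \<in> uhp \<Longrightarrow> f \<tau> = g \<tau>"
  shows "(g \<longlongrightarrow> L) cusp"
proof (rule Lim_transform_eventually[OF assms(1)])
  show "\<forall>\<^sub>F \<tau> in cusp. f \<tau> = g \<tau>" using eventually_cusp_uhp by eventually_elim (rule assms(2))
qed

lemma qpoch_self_cusp: "((\<lambda>\<tau>. qpoch \<tau> \<tau>) \<longlongrightarrow> 1) cusp"
  by (rule qpoch_cusp_0) (auto simp: uhp_def)

lemma D_e_cusp: "D holomorphic_on ball 0 1 \<Longrightarrow> ((\<lambda>\<tau>. D (e \<tau>)) \<longlongrightarrow> D 0) cusp"
proof -
  assume "D holomorphic_on ball 0 1"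
  then have "isCont D 0" by (intro continuous_on_interior[of "ball 0 1"]) (auto intro: holomorphic_on_imp_continuous_on)
  then show ?thesis by (rule isCont_tendsto_compose[OF _ e_cusp])
qed

lemma jform_cmult: "jform k m f f0 \<Longrightarrow> jform k m (\<lambda>\<tau> z. c * f \<tau> z) (\<lambda>z. c * f0 z)"
  using jform_mult[OF jform_const[of c]] by simp

lemma jform_Delta: "jform 12 0 (\<lambda>\<tau> _. Delta \<tau>) (\<lambda>_. 0)"
proof -
  have "jform 12 0 (\<lambda>\<tau> _. cub_a \<tau> ^ 3) (\<lambda>_. (- 1 / 48) ^ 3)" "jform 12 0 (\<lambda>\<tau> _. cub_b \<tau> ^ 2) (\<lambda>_. (1 / 864) ^ 2)"
    using jform_power[OF jform_cub_a, of 3] jform_power[OF jform_cub_b, of 2] by simp_all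
  then have "jform 12 0 (\<lambda>\<tau> _. 16 * ((- 4) * cub_a \<tau> ^ 3 - 27 * cub_b \<tau> ^ 2)) (\<lambda>_. 16 * ((- 4) * (- 1 / 48) ^ 3 - 27 * (1 / 864) ^ 2))"
    by (intro jform_cmult jform_diff)
  then show ?thesis
    by (rule jform_cong) (simp_all add: Delta_eq_cub_a_cub_b power3_eq_cube power2_eq_square)
qed

lemma modular_form_holomorphic: "jform k 0 (\<lambda>\<tau> _. g \<tau>) l \<Longrightarrow> g holomorphic_on uhp"
  using hol2_uhp[OF jformD(1)] by blast

lemma modular_form_cusp: "jform k 0 (\<lambda>\<tau> _. g \<tau>) (\<lambda>_. L) \<Longrightarrow> (g \<longlongrightarrow> L) cusp"
  using cusp_lim_pointwise[OF jformD(2)] by blast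

lemma modular_form_T: "jform k 0 (\<lambda>\<tau> _. g \<tau>) l \<Longrightarrow> \<tau> \<in> uhp \<Longrightarrow> g (\<tau> + 1) = g \<tau>"
  using jformD(3) by blast

lemma modular_form_S: "jform k 0 (\<lambda>\<tau> _. g \<tau>) l \<Longrightarrow> \<tau> \<in> uhp \<Longrightarrow> g (- 1 / \<tau>) = \<tau> powi k * g \<tau>"
  using jformD(4)[of k 0 "\<lambda>\<tau> _. g \<tau>" l \<tau> 0] by simp

text \<open>
  For weight \<open>k < 12\<close> the quotient \<open>g\<^sup>1\<^sup>2 / \<Delta>\<^sup>k\<close> has weight zero and still tends to zero at the cusp.
\<close>

lemma cusp_form_eq_0:
  assumes g: "jform k 0 (\<lambda>\<tau> _. g \<tau>) (\<lambda>_. 0)" and k: "k < 12" and \<tau>: "\<tau> \<in> uhp"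
  shows "g \<tau> = 0"
proof -
  obtain D where D: "D holomorphic_on ball 0 1" "\<And>\<tau>. \<tau> \<in> uhp \<Longrightarrow> g \<tau> = e \<tau> * D (e \<tau>)"
    using periodic_cusp_factor[OF modular_form_holomorphic[OF g] modular_form_T[OF g] modular_form_cusp[OF g]] by blast
  define h where "h \<tau> = g \<tau> ^ 12 * Delta \<tau> powi (- k)" for \<tau>
  have "h \<tau> = 0"
  proof (rule modular_function_eq_0[OF _ _ _ _ \<tau>])
    show "h holomorphic_on uhp" unfolding h_def
      by (intro holomorphic_intros modular_form_holomorphic[OF g] modular_form_holomorphic[OF jform_Delta] holomorphic_on_power_int)
         (simp add: Delta_nz)
    fix w assume w: "w \<in> uhp"
    show "h (w + 1) = h w" using modular_form_T[OF g w] modular_form_T[OF jform_Delta w] by (simp add: h_def)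
    have "(w powi k) ^ 12 = w powi (k * int 12)" by (simp only: power_int_mult power_int_of_nat)
    moreover have "(w powi 12) powi (- k) = w powi (12 * - k)" by (simp only: power_int_mult)
    ultimately have "(w powi k) ^ 12 * (w powi 12) powi (- k) = w powi (k * int 12 + 12 * - k)"
      by (simp only:) (rule power_int_add[symmetric], simp add: uhp_nz[OF w])
    then have 1: "(w powi k) ^ 12 * (w powi 12) powi (- k) = 1" by simp
    have "h (- 1 / w) = ((w powi k) ^ 12 * (w powi 12) powi (- k)) * h w"
      unfolding h_def modular_form_S[OF g w] modular_form_S[OF jform_Delta w] power_mult_distrib power_int_mult_distrib
      by (simp only: mult_ac)
    then show "h (- 1 / w) = h w" unfolding 1 by simp
  next
    have "((\<lambda>\<tau>. e \<tau> ^ nat (12 - k) * D (e \<tau>) ^ 12 * (qpoch \<tau> \<tau> ^ 24) powi (- k)) \<longlongrightarrow> 0 ^ nat (12 - k) * D 0 ^ 12 * (1 ^ 24) powi (- k)) cusp"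
      by (intro tendsto_intros e_cusp D_e_cusp D(1) qpoch_self_cusp) auto
    then have "((\<lambda>\<tau>. e \<tau> ^ nat (12 - k) * D (e \<tau>) ^ 12 * (qpoch \<tau> \<tau> ^ 24) powi (- k)) \<longlongrightarrow> 0) cusp"
      using k by (simp add: zero_power)
    then show "(h \<longlongrightarrow> 0) cusp"
    proof (rule tendsto_cusp_cong)
      fix w assume w: "w \<in> uhp"
      have "e w ^ nat (12 - k) = e w powi (12 - k)" using k by (simp add: power_int_def)
      also have "\<dots> = e w ^ 12 * e w powi (- k)"
        using power_int_add[of "e w" 12 "- k"] by simp
      finally have "e w ^ nat (12 - k) = e w ^ 12 * e w powi (- k)" .
      then show "e w ^ nat (12 - k) * D (e w) ^ 12 * (qpoch w w ^ 24) powi (- k) = h w"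
        unfolding h_def D(2)[OF w] Delta_eq_qpoch[OF w] power_mult_distrib power_int_mult_distrib by (simp only: mult_ac)
    qed
  qed
  then show ?thesis using Delta_nz[OF \<tau>] by (simp add: h_def power_int_eq_0_iff)
qed

text \<open>
  The quotient by \<open>\<Delta>\<close> has weight zero and a limit at the cusp; subtracting that limit leaves a modular function
  that tends to zero.
\<close>

lemma cusp_form_weight_12:
  assumes g: "jform 12 0 (\<lambda>\<tau> _. g \<tau>) (\<lambda>_. 0)"
  shows "\<exists>c. \<forall>\<tau>\<in>uhp. g \<tau> = c * Delta \<tau>"
proof -
  obtain D where D: "D holomorphic_on ball 0 1" "\<And>\<tau>. \<tau> \<in> uhp \<Longrightarrow> g \<tau> = e \<tau> * D (e \<tau>)"
    using periodic_cusp_factor[OF modular_form_holomorphic[OF g] modular_form_T[OF g] modular_form_cusp[OF g]] by blast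
  have "g \<tau> / Delta \<tau> - D 0 = 0" if \<tau>: "\<tau> \<in> uhp" for \<tau>
  proof (rule modular_function_eq_0[OF _ _ _ _ \<tau>])
    show "(\<lambda>\<tau>. g \<tau> / Delta \<tau> - D 0) holomorphic_on uhp"
      by (intro holomorphic_intros modular_form_holomorphic[OF g] modular_form_holomorphic[OF jform_Delta]) (simp add: Delta_nz)
    fix w assume w: "w \<in> uhp"
    show "g (w + 1) / Delta (w + 1) - D 0 = g w / Delta w - D 0"
      using modular_form_T[OF g w] modular_form_T[OF jform_Delta w] by simp
    show "g (- 1 / w) / Delta (- 1 / w) - D 0 = g w / Delta w - D 0"
      unfolding modular_form_S[OF g w] modular_form_S[OF jform_Delta w] using uhp_nz[OF w] by simp
  next
    have "((\<lambda>\<tau>. D (e \<tau>) / qpoch \<tau> \<tau> ^ 24 - D 0) \<longlongrightarrow> D 0 / 1 ^ 24 - D 0) cusp"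
      by (intro tendsto_intros D_e_cusp D(1) qpoch_self_cusp) auto
    then have "((\<lambda>\<tau>. D (e \<tau>) / qpoch \<tau> \<tau> ^ 24 - D 0) \<longlongrightarrow> 0) cusp" by simp
    then show "((\<lambda>\<tau>. g \<tau> / Delta \<tau> - D 0) \<longlongrightarrow> 0) cusp"
      by (rule tendsto_cusp_cong) (simp add: D(2) Delta_eq_qpoch)
  qed
  then show ?thesis using Delta_nz by (intro exI[of _ "D 0"]) (simp add: field_simps)
qed

section \<open>Uniqueness of weak Jacobi forms of small weight\<close>

lemma quotient_extends:
  assumes F: "F holomorphic_on UNIV" and a: "((\<lambda>z. F z / z ^ n) \<longlongrightarrow> a) (at 0)"
  obtains G where "G holomorphic_on UNIV" "G 0 = a" "\<And>z. z \<noteq> 0 \<Longrightarrow> G z = F z / z ^ n"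
proof -
  define G where "G z = (if z = 0 then a else F z / z ^ n)" for z
  have 1: "G holomorphic_on UNIV - {0}"
  proof (rule holomorphic_transform)
    show "(\<lambda>z. F z / z ^ n) holomorphic_on UNIV - {0}"
      by (intro holomorphic_intros holomorphic_on_subset[OF F]) auto
  qed (auto simp: G_def)
  have "isCont G z" for z
  proof (cases "z = 0")
    case True
    have "(G \<longlongrightarrow> a) (at 0)"
      by (rule Lim_transform_eventually[OF a]) (auto simp: eventually_at_filter G_def)
    then show ?thesis by (simp add: True isCont_def G_def)
  next
    case False
    have "open (UNIV - {0 :: complex})" by auto
    then have "G field_differentiable at z" using 1 False holomorphic_on_imp_differentiable_at by blast
    then show ?thesis by (rule field_differentiable_imp_continuous_at)
  qed
  then have "continuous_on UNIV G" by (simp add: continuous_at_imp_continuous_on)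
  then have "G holomorphic_on UNIV" using 1 by (intro no_isolated_singularity[of UNIV G "{0}"]) auto
  then show ?thesis by (rule that) (auto simp: G_def)
qed

text \<open>
  The maximum principle makes the convergence to a Taylor coefficient uniform in a parameter: the error depends on the
  bound \<open>M\<close> only.
\<close>

lemma quotient_bounds:
  assumes F: "F holomorphic_on UNIV" and a: "((\<lambda>z. F z / z ^ n) \<longlongrightarrow> a) (at 0)"
    and M: "\<And>z. norm z \<le> 1 \<Longrightarrow> norm (F z) \<le> M" "M > 0"
  shows "norm a \<le> M" and "0 < norm z \<Longrightarrow> norm z < 1 \<Longrightarrow> norm (F z / z ^ n - a) \<le> 3 * M * norm z"
proof -
  obtain G where G: "G holomorphic_on UNIV" "G 0 = a" "\<And>z. z \<noteq> 0 \<Longrightarrow> G z = F z / z ^ n"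
    using quotient_extends[OF F a] by blast
  have Gle: "norm (G z) \<le> M" if z: "norm z \<le> 1" for z
  proof (rule maximum_modulus_frontier[of G "cball 0 1"])
    show "G holomorphic_on interior (cball 0 1)" using G(1) by (rule holomorphic_on_subset) simp
    show "continuous_on (closure (cball 0 1)) G"
      by (rule continuous_on_subset[OF holomorphic_on_imp_continuous_on[OF G(1)]]) simp
    show "bounded (cball (0 :: complex) 1)" by simp
    show "z \<in> cball 0 1" using z by simp
    fix w :: complex assume "w \<in> frontier (cball 0 1)"
    then have w: "norm w = 1" by (simp add: sphere_def)
    then have "w \<noteq> 0" by auto
    then show "norm (G w) \<le> M" using M(1)[of w] w by (simp add: G(3) norm_divide norm_power)
  qed
  then show "norm a \<le> M" using G(2) by (metis norm_zero zero_le_one)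
  assume z: "0 < norm z" "norm z < 1"
  define h where "h w = (G w - a) / (3 * M)" for w
  have "norm (h z) \<le> norm z"
  proof (rule Schwarz_Lemma(1)[OF _ _ _ z(2)])
    show "h holomorphic_on ball 0 1" unfolding h_def
      by (intro holomorphic_intros holomorphic_on_subset[OF G(1)]) (use M in auto)
    show "h 0 = 0" by (simp add: h_def G)
    fix w :: complex assume "norm w < 1"
    then have "norm (G w - a) \<le> M + M"
      using Gle[of w] \<open>norm a \<le> M\<close> by (intro norm_triangle_le_diff) auto
    then show "norm (h w) < 1" using M(2) by (simp add: h_def norm_divide)
  qed
  then have "norm (G z - a) \<le> 3 * M * norm z"
    using M(2) by (simp add: h_def norm_divide field_simps)
  moreover have "G z = F z / z ^ n" using z by (intro G(3)) auto
  ultimately show "norm (F z / z ^ n - a) \<le> 3 * M * norm z" by (simp only:)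
qed

text \<open>
  The first nonvanishing Taylor coefficient inherits the transformation law with the weight raised by its degree,
  since the inversion replaces \<open>z\<close> by \<open>z / \<tau>\<close> and the exponential factor is 1 at \<open>z = 0\<close>.
\<close>

lemma taylor_coefficient_modular:
  assumes f: "jform k m f (\<lambda>_. 0)" and a: "\<And>\<tau>. \<tau> \<in> uhp \<Longrightarrow> ((\<lambda>z. f \<tau> z / z ^ n) \<longlongrightarrow> a \<tau>) (at 0)"
  shows "jform (k + int n) 0 (\<lambda>\<tau> _. a \<tau>) (\<lambda>_. 0)"
proof (rule jformI)
  have aeq: "a \<tau> = L" if "\<tau> \<in> uhp" "((\<lambda>z. f \<tau> z / z ^ n) \<longlongrightarrow> L) (at 0)" for \<tau> L
    using tendsto_unique[OF _ a[OF that(1)] that(2)] by simp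
  have hol: "a holomorphic_on uhp"
  proof (rule holomorphic_uniform_sequence[OF open_uhp])
    show "(\<lambda>\<tau>. f \<tau> (1 / of_nat (N + 2)) / (1 / of_nat (N + 2)) ^ n) holomorphic_on uhp" for N
      by (intro holomorphic_intros hol2_uhp[OF jformD(1)[OF f]]) auto
    fix t assume t: "t \<in> uhp"
    define d where "d = Im t / 2"
    have d: "d > 0" using t by (simp add: d_def uhp_def)
    define R where "R = norm t + d + 1"
    obtain M where M: "M > 0" "\<And>\<tau> z. (\<tau>, z) \<in> hbox d R \<Longrightarrow> norm (f \<tau> z) \<le> M"
      using hol2_bounded[OF jformD(1)[OF f] d, of R] by blast
    have box: "(\<tau>, z) \<in> hbox d R" if "\<tau> \<in> cball t d" "norm z \<le> 1" for \<tau> z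
    proof -
      have 1: "norm (t - \<tau>) \<le> d" using that(1) by (simp add: dist_norm)
      have "Im (t - \<tau>) \<le> d" using abs_Im_le_cmod[of "t - \<tau>"] 1 by linarith
      then have "d \<le> Im \<tau>" by (simp add: d_def)
      moreover have "norm \<tau> \<le> norm t + d"
        using norm_triangle_ineq4[of t "t - \<tau>"] 1 by simp
      moreover have "norm z \<le> R" unfolding R_def using that(2) norm_ge_zero[of t] d by linarith
      ultimately show ?thesis using d by (simp add: hbox_def R_def)
    qed
    have sub: "cball t d \<subseteq> uhp" using hbox_uhp[OF d box[of _ 0]] by auto
    have "uniform_limit (cball t d) (\<lambda>N \<tau>. f \<tau> (1 / of_nat (N + 2)) / (1 / of_nat (N + 2)) ^ n - a \<tau>) (\<lambda>_. 0) sequentially"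
    proof (rule uniform_limit_null_comparison)
      have "(\<lambda>N. 3 * M * (1 / real (N + 2))) \<longlonglongrightarrow> 3 * M * 0"
        by (intro tendsto_intros LIMSEQ_ignore_initial_segment lim_1_over_n)
      then show "uniform_limit (cball t d) (\<lambda>N \<tau>. 3 * M * (1 / real (N + 2))) (\<lambda>_. 0) sequentially"
        unfolding uniform_limit_iff tendsto_iff by simp
      show "\<forall>\<^sub>F N in sequentially. \<forall>\<tau>\<in>cball t d. norm (f \<tau> (1 / of_nat (N + 2)) / (1 / of_nat (N + 2)) ^ n - a \<tau>) \<le> 3 * M * (1 / real (N + 2))"
      proof (intro always_eventually allI ballI)
        fix N \<tau> assume \<tau>: "\<tau> \<in> cball t d"
        have nz: "norm (1 / of_nat (N + 2) :: complex) = 1 / real (N + 2)" by (simp add: norm_divide del: of_nat_add of_nat_Suc)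
        show "norm (f \<tau> (1 / of_nat (N + 2)) / (1 / of_nat (N + 2)) ^ n - a \<tau>) \<le> 3 * M * (1 / real (N + 2))"
          unfolding nz[symmetric]
        proof (rule quotient_bounds(2)[OF hol2_entire[OF jformD(1)[OF f]] a])
          show "\<tau> \<in> uhp" "\<tau> \<in> uhp" using \<tau> sub by auto
          show "norm (f \<tau> z) \<le> M" if "norm z \<le> 1" for z by (rule M(2)[OF box[OF \<tau> that]])
          show "M > 0" by (rule M(1))
          show "0 < norm (1 / of_nat (N + 2) :: complex)" "norm (1 / of_nat (N + 2) :: complex) < 1"
            unfolding nz by simp_all
        qed
      qed
    qed
    from uniform_limit_add[OF this uniform_limit_const[where S = "cball t d" and c = a]]
    have "uniform_limit (cball t d) (\<lambda>N \<tau>. f \<tau> (1 / of_nat (N + 2)) / (1 / of_nat (N + 2)) ^ n) a sequentially"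
      by (simp only: diff_add_cancel add_0)
    with d sub show "\<exists>d>0. cball t d \<subseteq> uhp \<and> uniform_limit (cball t d) (\<lambda>N \<tau>. f \<tau> (1 / of_nat (N + 2)) / (1 / of_nat (N + 2)) ^ n) a sequentially"
      by blast
  qed
  show "hol2 (\<lambda>\<tau> _. a \<tau>)"
    unfolding hol2_def
  proof (intro conjI allI impI)
    have "continuous_on (uhp \<times> UNIV) (\<lambda>x. a (fst x))"
      by (rule continuous_on_compose2[OF holomorphic_on_imp_continuous_on[OF hol] continuous_on_fst[OF continuous_on_id]]) auto
    then show "continuous_on (uhp \<times> UNIV) (\<lambda>(\<tau>, z :: complex). a \<tau>)" by (simp add: split_def)
    fix U g assume "open U" "g holomorphic_on U" "g ` U \<subseteq> uhp"
    then show "(\<lambda>t. a (g t)) holomorphic_on U"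
      using holomorphic_on_compose_gen[OF _ hol, of g U] by (simp add: o_def)
  qed
  have "(a \<longlongrightarrow> 0) cusp"
    unfolding tendsto_iff
  proof safe
    fix \<epsilon> :: real assume \<epsilon>: "\<epsilon> > 0"
    have "uniform_limit (cball 0 1) f (\<lambda>_. 0) cusp" using jformD(2)[OF f] by (simp add: cusp_lim_def)
    then have "\<forall>\<^sub>F \<tau> in cusp. \<forall>z\<in>cball 0 1. norm (f \<tau> z) < \<epsilon> / 2"
      using \<epsilon> unfolding uniform_limit_iff by (auto dest!: spec[of _ "\<epsilon> / 2"])
    then show "\<forall>\<^sub>F \<tau> in cusp. dist (a \<tau>) 0 < \<epsilon>" using eventually_cusp_uhp
    proof eventually_elim
      case (elim \<tau>)
      have "norm (a \<tau>) \<le> \<epsilon> / 2"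
        by (rule quotient_bounds(1)[OF hol2_entire[OF jformD(1)[OF f] elim(2)] a[OF elim(2)]]) (use elim(1) \<epsilon> in \<open>auto intro: less_imp_le\<close>)
      then show ?case using \<epsilon> by simp
    qed
  qed
  then show "cusp_lim (\<lambda>\<tau> _. a \<tau>) (\<lambda>_. 0)" by (rule cusp_lim_\<tau>)
  fix \<tau> z assume \<tau>: "\<tau> \<in> uhp"
  show "a (\<tau> + 1) = a \<tau>"
    using aeq[OF uhp_add_1[OF \<tau>], of "a \<tau>"] a[OF \<tau>] by (simp add: jformD(3)[OF f \<tau>])
  have nz: "\<tau> \<noteq> 0" by (rule uhp_nz[OF \<tau>])
  have "a (- 1 / \<tau>) = \<tau> powi (k + int n) * a \<tau>"
  proof (rule tendsto_unique[of "at (0 :: complex)"])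
    have "filterlim (\<lambda>z. z / \<tau>) (at 0) (at 0)"
      using nz by (intro filterlim_atI tendsto_eq_intros) (auto simp: eventually_at_filter)
    from filterlim_compose[OF a[OF uhp_neg_inverse[OF \<tau>]] this]
    show "((\<lambda>z. f (- 1 / \<tau>) (z / \<tau>) / (z / \<tau>) ^ n) \<longlongrightarrow> a (- 1 / \<tau>)) (at 0)" .
    have "((\<lambda>z. e (of_nat m * z\<^sup>2 / \<tau>)) \<longlongrightarrow> e (of_nat m * 0\<^sup>2 / \<tau>)) (at 0)"
      unfolding e_def using nz by (intro tendsto_intros) auto
    then have "((\<lambda>z. \<tau> powi k * e (of_nat m * z\<^sup>2 / \<tau>) * \<tau> ^ n * (f \<tau> z / z ^ n)) \<longlongrightarrow> \<tau> powi k * e (of_nat m * 0\<^sup>2 / \<tau>) * \<tau> ^ n * a \<tau>) (at 0)"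
      by (intro tendsto_mult tendsto_const a[OF \<tau>])
    moreover have eq: "\<tau> powi k * e (of_nat m * 0\<^sup>2 / \<tau>) * \<tau> ^ n * a \<tau> = \<tau> powi (k + int n) * a \<tau>"
      using nz by (simp add: power_int_add)
    ultimately have "((\<lambda>z. \<tau> powi k * e (of_nat m * z\<^sup>2 / \<tau>) * \<tau> ^ n * (f \<tau> z / z ^ n)) \<longlongrightarrow> \<tau> powi (k + int n) * a \<tau>) (at 0)" by (simp only:)
    then show "((\<lambda>z. f (- 1 / \<tau>) (z / \<tau>) / (z / \<tau>) ^ n) \<longlongrightarrow> \<tau> powi (k + int n) * a \<tau>) (at 0)"
      unfolding jformD(4)[OF f \<tau>] by (simp add: power_divide mult_ac)
  qed simp
  then show "a (- 1 / \<tau>) = \<tau> powi (k + int n) * e (of_nat 0 * z\<^sup>2 / \<tau>) * a \<tau>" by simp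
qed simp_all

text \<open>
  As long as its weight stays below 12, each successive Taylor coefficient at \<open>z = 0\<close> is a cusp form of level one
  and hence vanishes.
\<close>

lemma jform_vanishing_order:
  assumes f: "jform k m f (\<lambda>_. 0)"
  shows "k + int n \<le> 12 \<Longrightarrow> \<tau> \<in> uhp \<Longrightarrow> \<exists>L. ((\<lambda>z. f \<tau> z / z ^ n) \<longlongrightarrow> L) (at 0)"
proof (induction n arbitrary: \<tau>)
  case 0
  have "((\<lambda>z. f \<tau> z) \<longlongrightarrow> f \<tau> 0) (at 0)"
    using entire_isCont[OF hol2_entire[OF jformD(1)[OF f] 0(2)], of 0] by (simp only: isCont_def)
  then show ?case by (intro exI[of _ "f \<tau> 0"]) simp
next
  case (Suc n)
  define a where "a w = (SOME L. ((\<lambda>z. f w z / z ^ n) \<longlongrightarrow> L) (at 0))" for w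
  have a: "((\<lambda>z. f w z / z ^ n) \<longlongrightarrow> a w) (at 0)" if "w \<in> uhp" for w
    unfolding a_def by (rule someI_ex, rule Suc.IH[OF _ that]) (use Suc.prems(1) in simp)
  have "a \<tau> = 0"
    by (rule cusp_form_eq_0[OF taylor_coefficient_modular[OF f a]]) (use Suc.prems in auto)
  obtain G where G: "G holomorphic_on UNIV" "G 0 = a \<tau>" "\<And>z. z \<noteq> 0 \<Longrightarrow> G z = f \<tau> z / z ^ n"
    using quotient_extends[OF hol2_entire[OF jformD(1)[OF f] Suc.prems(2)] a[OF Suc.prems(2)]] by blast
  have "(G has_field_derivative deriv G 0) (at 0)"
    using G(1) by (simp add: holomorphic_derivI[of G UNIV])
  then have "((\<lambda>z. G z / z) \<longlongrightarrow> deriv G 0) (at 0)"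
    using G(2) \<open>a \<tau> = 0\<close> by (simp add: has_field_derivative_iff)
  then have "((\<lambda>z. f \<tau> z / z ^ Suc n) \<longlongrightarrow> deriv G 0) (at 0)"
    by (rule Lim_transform_eventually) (auto simp: eventually_at_filter G(3))
  then show ?case by blast
qed

text \<open>
  After \<open>2 m\<close> vanishing coefficients, \<open>f / Q\<^sup>m\<close> is elliptic without poles, so it is a function of \<open>\<tau>\<close> alone, and a cusp form
  of weight \<open>k + 2 m\<close>.
\<close>

theorem jform_weight_12:
  assumes f: "jform k m f (\<lambda>_. 0)" and k: "k + 2 * int m \<le> 12"
  obtains c where "\<And>\<tau> z. \<tau> \<in> uhp \<Longrightarrow> f \<tau> z = c * Delta \<tau> * Qf \<tau> z ^ m" "k + 2 * int m < 12 \<Longrightarrow> c = 0"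
proof -
  define a where "a w = (SOME L. ((\<lambda>z. f w z / z ^ (2 * m)) \<longlongrightarrow> L) (at 0))" for w
  have a: "((\<lambda>z. f w z / z ^ (2 * m)) \<longlongrightarrow> a w) (at 0)" if "w \<in> uhp" for w
    unfolding a_def by (rule someI_ex, rule jform_vanishing_order[OF f _ that]) (use k in simp)
  define C where "C = (2 * of_real pi * \<i>) ^ (2 * m)"
  have Cnz: "C \<noteq> 0" by (simp add: C_def)
  have fQ: "f \<tau> z = a \<tau> / C * Qf \<tau> z ^ m" if \<tau>: "\<tau> \<in> uhp" for \<tau> z
  proof (rule quasi_periodic_unique[where f = "f \<tau>" and g = "\<lambda>z. Qf \<tau> z ^ m" and \<alpha> = 1
         and \<beta> = "\<lambda>z. e (- of_nat m * (\<tau> + 2 * z))" and \<tau> = \<tau>])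
    have Q: "jform (int m * - 2) (m * 1) (\<lambda>\<tau> z. Qf \<tau> z ^ m) (\<lambda>z. q0 z ^ m)" by (rule jform_power[OF jform_Qf])
    show "0 < Im \<tau>" using \<tau> by (simp add: uhp_def)
    show "f \<tau> holomorphic_on UNIV" by (rule hol2_entire[OF jformD(1)[OF f] \<tau>])
    show "(\<lambda>z. Qf \<tau> z ^ m) holomorphic_on UNIV" by (rule hol2_entire[OF jformD(1)[OF Q] \<tau>])
    show "f \<tau> (z + 1) = 1 * f \<tau> z" "Qf \<tau> (z + 1) ^ m = 1 * Qf \<tau> z ^ m" for z
      by (simp_all add: jformD(5)[OF f \<tau>] Qf_plus_1)
    show "f \<tau> (z + \<tau>) = e (- of_nat m * (\<tau> + 2 * z)) * f \<tau> z" for z by (rule jformD(6)[OF f \<tau>])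
    show "Qf \<tau> (z + \<tau>) ^ m = e (- of_nat m * (\<tau> + 2 * z)) * Qf \<tau> z ^ m" for z
      using jformD(6)[OF Q \<tau>] by simp
    show "\<exists>m n :: int. z = of_int m + of_int n * \<tau>" if "Qf \<tau> z ^ m = 0" for z
      using that klein_eq_0D[OF \<tau>, of z] by (cases "m = 0") (auto simp: Qf_def)
    have "((\<lambda>z. f \<tau> z / z ^ (2 * m) / (klein \<tau> z / z) ^ (2 * m)) \<longlongrightarrow> a \<tau> / C) (at 0)"
      unfolding C_def by (intro tendsto_divide a[OF \<tau>] tendsto_power klein_over_z[OF \<tau>]) auto
    then show "((\<lambda>z. f \<tau> z / Qf \<tau> z ^ m) \<longlongrightarrow> a \<tau> / C) (at 0)"
      by (rule Lim_transform_eventually) (auto simp: eventually_at_filter Qf_def power_divide power_mult)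
  qed auto
  have mod: "jform (k + int (2 * m)) 0 (\<lambda>\<tau> _. a \<tau>) (\<lambda>_. 0)" by (rule taylor_coefficient_modular[OF f a])
  show ?thesis
  proof (cases "k + 2 * int m < 12")
    case True
    then have "a \<tau> = 0" if "\<tau> \<in> uhp" for \<tau> using cusp_form_eq_0[OF mod _ that] by simp
    then show ?thesis using fQ by (intro that[of 0]) auto
  next
    case False
    then have "k + int (2 * m) = 12" using k by simp
    then obtain c where "\<And>\<tau>. \<tau> \<in> uhp \<Longrightarrow> a \<tau> = c * Delta \<tau>"
      using cusp_form_weight_12[of a] mod by auto
    then show ?thesis using fQ False by (intro that[of "c / C"]) auto
  qed
qed

corollary jform_unique:
  assumes f: "jform k m f f0" and g: "jform k m g f0" and k: "k + 2 * int m < 12" and \<tau>: "\<tau> \<in> uhp"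
  shows "f \<tau> z = g \<tau> z"
proof -
  have "jform k m (\<lambda>\<tau> z. f \<tau> z - g \<tau> z) (\<lambda>_. 0)"
    by (rule jform_cong[OF jform_diff[OF f g]]) simp_all
  from jform_weight_12[OF this less_imp_le[OF k]] obtain c
    where "\<And>\<tau> z. \<tau> \<in> uhp \<Longrightarrow> f \<tau> z - g \<tau> z = c * Delta \<tau> * Qf \<tau> z ^ m" "k + 2 * int m < 12 \<Longrightarrow> c = 0"
    by blast
  from this(1)[OF \<tau>, of z] this(2)[OF k] show ?thesis by simp
qed

section \<open>Sums over the integers\<close>

lemma int_summable:
  fixes g :: "nat \<Rightarrow> real"
  assumes "summable g" "\<And>n. g n \<ge> 0"
  shows "(\<lambda>k :: int. g (nat \<bar>k\<bar>)) summable_on UNIV"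
proof -
  have g: "g summable_on UNIV" using assms by (intro norm_summable_imp_summable_on) simp
  have "summable (\<lambda>n. g (Suc n))" using assms(1) by (simp only: summable_Suc_iff)
  then have g': "(\<lambda>n. g (Suc n)) summable_on UNIV" using assms(2) by (intro norm_summable_imp_summable_on) simp
  have "(\<lambda>k :: int. g (nat \<bar>k\<bar>)) summable_on range int"
    by (subst summable_on_reindex) (simp_all add: o_def g)
  moreover have "(\<lambda>k :: int. g (nat \<bar>k\<bar>)) summable_on range (\<lambda>n. - int (Suc n))"
    using g' by (subst summable_on_reindex) (auto simp: o_def inj_on_def nat_add_distrib add.commute)
  ultimately have "(\<lambda>k :: int. g (nat \<bar>k\<bar>)) summable_on (range int \<union> range (\<lambda>n. - int (Suc n)))"
    by (rule summable_on_Un_disjoint) auto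
  moreover have "range int \<union> range (\<lambda>n. - int (Suc n)) = UNIV"
  proof -
    have "k \<in> range int \<union> range (\<lambda>n. - int (Suc n))" for k :: int
      by (cases k rule: int_cases) auto
    then show ?thesis by auto
  qed
  ultimately show ?thesis by simp
qed

lemma gauss_summable:
  fixes a b :: real
  assumes a: "a > 0"
  shows "(\<lambda>k :: int. exp (- a * (of_int k)\<^sup>2 + b * \<bar>of_int k\<bar>)) summable_on UNIV"
proof (rule summable_on_comparison_test)
  have "summable (\<lambda>n. exp (- 1 :: real) ^ n)" by (rule summable_geometric) simp
  from int_summable[OF this]
  show "(\<lambda>k :: int. exp ((b + 1)\<^sup>2 / (4 * a)) * exp (- 1) ^ nat \<bar>k\<bar>) summable_on UNIV"
    by (intro summable_on_cmult_right) simp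
  fix k :: int
  define x :: real where "x = \<bar>of_int k\<bar>"
  have "0 \<le> a * (x - (b + 1) / (2 * a))\<^sup>2" using a by simp
  also have "\<dots> = a * x\<^sup>2 - (b + 1) * x + (b + 1)\<^sup>2 / (4 * a)"
    using a by (simp add: field_simps power2_eq_square)
  finally have "- a * (of_int k)\<^sup>2 + b * \<bar>of_int k\<bar> \<le> (b + 1)\<^sup>2 / (4 * a) - x"
    by (simp add: x_def algebra_simps)
  then have "exp (- a * (of_int k)\<^sup>2 + b * \<bar>of_int k\<bar>) \<le> exp ((b + 1)\<^sup>2 / (4 * a) - x)" by (simp only: exp_le_cancel_iff)
  also have "\<dots> = exp ((b + 1)\<^sup>2 / (4 * a)) * exp (- 1) ^ nat \<bar>k\<bar>"
    by (simp add: exp_diff exp_minus x_def exp_of_nat_mult[symmetric] power_inverse field_simps)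
  finally show "exp (- a * (of_int k)\<^sup>2 + b * \<bar>of_int k\<bar>) \<le> exp ((b + 1)\<^sup>2 / (4 * a)) * exp (- 1) ^ nat \<bar>k\<bar>" .
qed simp

text \<open>
  Dominated convergence for infinite sums along an arbitrary filter.
\<close>

lemma infsum_tannery:
  fixes f :: "'i \<Rightarrow> 'a \<Rightarrow> complex"
  assumes M: "M summable_on I" and bound: "\<forall>\<^sub>F x in G. \<forall>i\<in>I. norm (f i x) \<le> M i"
    and lim: "\<And>i. i \<in> I \<Longrightarrow> (f i \<longlongrightarrow> l i) G" and nt: "G \<noteq> bot"
  shows "((\<lambda>x. \<Sum>\<^sub>\<infinity>i\<in>I. f i x) \<longlongrightarrow> (\<Sum>\<^sub>\<infinity>i\<in>I. l i)) G"
proof (rule swap_uniform_limit'[where F = "finite_subsets_at_top I"])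
  show "uniform_limit {x. \<forall>i\<in>I. norm (f i x) \<le> M i} (\<lambda>X x. \<Sum>i\<in>X. f i x) (\<lambda>x. \<Sum>\<^sub>\<infinity>i\<in>I. f i x) (finite_subsets_at_top I)"
    by (rule Weierstrass_m_test_general[OF _ M]) auto
  show "\<forall>\<^sub>F X in finite_subsets_at_top I. ((\<lambda>x. \<Sum>i\<in>X. f i x) \<longlongrightarrow> (\<Sum>i\<in>X. l i)) G"
    by (rule eventually_finite_subsets_at_top_weakI) (auto intro!: tendsto_sum lim)
  have "norm (l i) \<le> M i" if i: "i \<in> I" for i
    by (rule tendsto_upperbound[OF tendsto_norm[OF lim[OF i]] _ nt]) (use bound in eventually_elim, use i in auto)
  then have "l summable_on I"
    by (rule abs_summable_summable[OF Infinite_Sum.abs_summable_on_comparison_test'[OF M]])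
  then show "((\<lambda>X. \<Sum>i\<in>X. l i) \<longlongrightarrow> (\<Sum>\<^sub>\<infinity>i\<in>I. l i)) (finite_subsets_at_top I)"
    using has_sum_infsum[of l I] by (simp only: has_sum_def)
  show "\<forall>\<^sub>F x in G. x \<in> {x. \<forall>i\<in>I. norm (f i x) \<le> M i}" using bound by simp
qed simp

section \<open>The theta series and the triple product\<close>

lemma norm_theta_term:
  assumes "(\<tau>, z) \<in> hbox \<delta> R"
  shows "norm (e ((of_int n)\<^sup>2 / 8 * \<tau>) * e (of_int n / 2 * z)) \<le> exp (- (pi * \<delta> / 4) * (of_int n)\<^sup>2 + pi * R * \<bar>of_int n\<bar>)"
proof -
  have 1: "\<delta> \<le> Im \<tau>" "\<bar>Im z\<bar> \<le> R" using assms abs_Im_le_cmod[of z] by (auto simp: hbox_def)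
  have "- (pi * (of_int n)\<^sup>2 / 4) * Im \<tau> \<le> - (pi * (of_int n)\<^sup>2 / 4) * \<delta>"
    using 1 by (intro mult_left_mono_neg) auto
  moreover have "- (pi * of_int n) * Im z \<le> pi * (R * \<bar>of_int n\<bar>)"
  proof -
    have "- (of_int n * Im z) \<le> \<bar>of_int n\<bar> * \<bar>Im z\<bar>" using abs_ge_minus_self[of "of_int n * Im z"] by (simp add: abs_mult)
    also have "\<dots> \<le> \<bar>of_int n\<bar> * R" using 1 by (intro mult_left_mono) auto
    finally have "pi * - (of_int n * Im z) \<le> pi * (\<bar>of_int n\<bar> * R)" by (intro mult_left_mono) auto
    then show ?thesis by (simp add: mult_ac)
  qed
  ultimately have "- (pi * (of_int n)\<^sup>2 / 4) * Im \<tau> + - (pi * of_int n) * Im z \<le> - (pi * (of_int n)\<^sup>2 / 4) * \<delta> + pi * (R * \<bar>of_int n\<bar>)"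
    by linarith
  moreover have "norm (e ((of_int n)\<^sup>2 / 8 * \<tau>) * e (of_int n / 2 * z)) = exp (- (pi * (of_int n)\<^sup>2 / 4) * Im \<tau> + - (pi * of_int n) * Im z)"
    unfolding norm_mult norm_e exp_add[symmetric]
    by (rule arg_cong[where f = exp]) (simp add: Im_divide power2_eq_square)
  ultimately show ?thesis by (simp add: mult_ac)
qed

lemma norm_chi4: "norm (chi4 n) \<le> 1"
  by (simp add: chi4_def)

lemma hol2_theta: "hol2 theta"
  unfolding theta_def[abs_def]
proof (rule hol2_infsum)
  show "hol2 (\<lambda>\<tau> z. chi4 n * e ((of_int n)\<^sup>2 / 8 * \<tau>) * e (of_int n / 2 * z))" for n :: int
    by (intro hol2_intros)
  fix \<delta> R :: real assume \<delta>: "\<delta> > 0"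
  show "\<exists>M. M summable_on UNIV \<and> (\<forall>n\<in>UNIV. \<forall>(\<tau>, z)\<in>hbox \<delta> R. norm (chi4 n * e ((of_int n)\<^sup>2 / 8 * \<tau>) * e (of_int n / 2 * z)) \<le> M n)"
  proof (intro exI conjI ballI)
    show "(\<lambda>n :: int. exp (- (pi * \<delta> / 4) * (of_int n)\<^sup>2 + pi * R * \<bar>of_int n\<bar>)) summable_on UNIV"
      by (rule gauss_summable) (use \<delta> in simp)
    fix n x assume x: "x \<in> hbox \<delta> R"
    obtain \<tau> z where xx: "x = (\<tau>, z)" by (cases x)
    have "norm (chi4 n * (e ((of_int n)\<^sup>2 / 8 * \<tau>) * e (of_int n / 2 * z))) \<le> 1 * exp (- (pi * \<delta> / 4) * (of_int n)\<^sup>2 + pi * R * \<bar>of_int n\<bar>)"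
      unfolding norm_mult[of "chi4 n"] by (intro mult_mono norm_chi4 norm_theta_term) (use x xx in auto)
    then show "case x of (\<tau>, z) \<Rightarrow> norm (chi4 n * e ((of_int n)\<^sup>2 / 8 * \<tau>) * e (of_int n / 2 * z)) \<le> exp (- (pi * \<delta> / 4) * (of_int n)\<^sup>2 + pi * R * \<bar>of_int n\<bar>)"
      unfolding xx by (simp add: mult.assoc)
  qed
qed

lemma e_int_half: "e (of_int k / 2) = (- 1) powi k"
proof -
  have nat: "e (of_nat n / 2) = (- 1) ^ n" for n
    using e_of_nat_mult[of n "1 / 2"] by (simp add: e_half)
  show ?thesis
  proof (cases "k \<ge> 0")
    case True
    then show ?thesis using nat[of "nat k"] by (simp add: power_int_def)
  next
    case False
    then have "e (of_int k / 2) = e (- (of_nat (nat (- k)) / 2))" by simp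
    then show ?thesis using False nat[of "nat (- k)"] unfolding e_minus by (simp add: power_int_def flip: power_inverse)
  qed
qed

lemma chi4_odd: "chi4 (2 * k + 1) = (- 1) powi k"
proof (cases "even k")
  case True
  then have "(2 * k + 1) mod 4 = 1" by presburger
  then show ?thesis using True by (simp add: chi4_def)
next
  case False
  then have "(2 * k + 1) mod 4 = 3" by presburger
  then show ?thesis using False by (simp add: chi4_def)
qed

lemma chi4_even: "even n \<Longrightarrow> chi4 n = 0"
proof -
  assume "even n"
  then have "n mod 4 \<noteq> 1" "n mod 4 \<noteq> 3" by presburger+
  then show ?thesis by (simp add: chi4_def)
qed

lemma theta_odd:
  "theta \<tau> z = (\<Sum>\<^sub>\<infinity>k\<in>(UNIV :: int set). (- 1) powi k * (e ((of_int (2 * k + 1))\<^sup>2 / 8 * \<tau>) * e (of_int (2 * k + 1) / 2 * z)))"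
proof -
  let ?f = "\<lambda>n. chi4 n * e ((of_int n)\<^sup>2 / 8 * \<tau>) * e (of_int n / 2 * z)"
  have "theta \<tau> z = infsum ?f (range (\<lambda>k. 2 * k + 1))"
    unfolding theta_def
  proof (rule infsum_cong_neutral)
    fix n assume "n \<in> UNIV - range (\<lambda>k :: int. 2 * k + 1)"
    then have "even n" by (metis DiffD2 oddE rangeI)
    then show "?f n = 0" by (simp add: chi4_even)
  qed auto
  also have "\<dots> = (\<Sum>\<^sub>\<infinity>k. ?f (2 * k + 1))"
    by (subst infsum_reindex) (auto simp: inj_on_def o_def)
  finally show ?thesis unfolding chi4_odd mult.assoc .
qed

lemma theta_plus_1: "theta \<tau> (z + 1) = - theta \<tau> z"
proof -
  have "e (of_int (2 * k + 1) / 2 * (z + 1)) = - e (of_int (2 * k + 1) / 2 * z)" for k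
  proof -
    have "of_int (2 * k + 1) / 2 * (z + 1) = (of_int (2 * k + 1) / 2 * z + 1 / 2) + of_int k"
      by (simp add: field_simps)
    then show ?thesis by (simp only: e_add_int e_add[of _ "1 / 2"] e_half) simp
  qed
  then show ?thesis unfolding theta_odd by (simp add: infsum_uminus)
qed

lemma theta_minus: "theta \<tau> (- z) = - theta \<tau> z"
proof -
  have "bij (\<lambda>k :: int. - k)" by (rule bij_uminus)
  then have "theta \<tau> (- z) = (\<Sum>\<^sub>\<infinity>n. chi4 (- n) * e ((of_int (- n))\<^sup>2 / 8 * \<tau>) * e (of_int (- n) / 2 * (- z)))"
    unfolding theta_def by (subst infsum_reindex_bij_betw[of uminus UNIV UNIV]) auto
  also have "\<dots> = (\<Sum>\<^sub>\<infinity>n. - (chi4 n * e ((of_int n)\<^sup>2 / 8 * \<tau>) * e (of_int n / 2 * z)))"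
  proof (rule infsum_cong)
    fix n :: int
    have "chi4 (- n) = - chi4 n"
    proof -
      have "(- n) mod 4 = 1 \<longleftrightarrow> n mod 4 = 3" "(- n) mod 4 = 3 \<longleftrightarrow> n mod 4 = 1" by presburger+
      then show ?thesis by (simp add: chi4_def)
    qed
    then show "chi4 (- n) * e ((of_int (- n))\<^sup>2 / 8 * \<tau>) * e (of_int (- n) / 2 * (- z)) = - (chi4 n * e ((of_int n)\<^sup>2 / 8 * \<tau>) * e (of_int n / 2 * z))"
      by simp
  qed
  finally show ?thesis by (simp add: infsum_uminus theta_def)
qed

lemma bij_plus_1: "bij_betw (\<lambda>k :: int. k + 1) UNIV UNIV"
  by (rule bij_betwI[where g = "\<lambda>k. k - 1"]) auto

lemma theta_plus_\<tau>: "theta \<tau> (z + \<tau>) = - e (- \<tau> / 2 - z) * theta \<tau> z"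
proof -
  let ?f = "\<lambda>k z. (- 1) powi k * (e ((of_int (2 * k + 1))\<^sup>2 / 8 * \<tau>) * e (of_int (2 * k + 1) / 2 * z))"
  have "theta \<tau> (z + \<tau>) = (\<Sum>\<^sub>\<infinity>k. - e (- \<tau> / 2 - z) * ?f (k + 1) z)"
    unfolding theta_odd
  proof (rule infsum_cong)
    fix k :: int
    have "(of_int (2 * k + 1))\<^sup>2 / 8 * \<tau> + of_int (2 * k + 1) / 2 * (z + \<tau>) =
      (- \<tau> / 2 - z) + ((of_int (2 * (k + 1) + 1))\<^sup>2 / 8 * \<tau> + of_int (2 * (k + 1) + 1) / 2 * z)"
      by (simp add: field_simps power2_eq_square)
    then have "e ((of_int (2 * k + 1))\<^sup>2 / 8 * \<tau>) * e (of_int (2 * k + 1) / 2 * (z + \<tau>)) =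
      e (- \<tau> / 2 - z) * (e ((of_int (2 * (k + 1) + 1))\<^sup>2 / 8 * \<tau>) * e (of_int (2 * (k + 1) + 1) / 2 * z))"
      by (simp only: e_add[symmetric])
    moreover have "(- 1 :: complex) powi (k + 1) = - ((- 1) powi k)" by (simp add: power_int_add)
    ultimately show "?f k (z + \<tau>) = - e (- \<tau> / 2 - z) * ?f (k + 1) z"
      by (simp only:) (simp only: mult_minus_left mult_minus_right minus_minus mult_ac)
  qed
  also have "\<dots> = - e (- \<tau> / 2 - z) * (\<Sum>\<^sub>\<infinity>k. ?f (k + 1) z)" by (rule infsum_cmult_right')
  also have "(\<Sum>\<^sub>\<infinity>k. ?f (k + 1) z) = (\<Sum>\<^sub>\<infinity>k. ?f k z)"
    by (rule infsum_reindex_bij_betw[OF bij_plus_1, of "\<lambda>k. ?f k z"])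
  finally show ?thesis unfolding theta_odd .
qed

lemma theta10_eq: "theta \<tau> (z + 1 / 2) = \<i> * theta10 \<tau> z"
proof -
  have "theta \<tau> (z + 1 / 2) = (\<Sum>\<^sub>\<infinity>k. (\<i> * (e (\<tau> / 8) * e (z / 2))) * (e (of_int k * (of_int k + 1) / 2 * \<tau>) * e (of_int k * z)))"
    unfolding theta_odd
  proof (rule infsum_cong)
    fix k :: int
    have "(of_int (2 * k + 1))\<^sup>2 / 8 * \<tau> + of_int (2 * k + 1) / 2 * (z + 1 / 2) =
      of_int k / 2 + (1 / 4 + (\<tau> / 8 + (z / 2 + (of_int k * (of_int k + 1) / 2 * \<tau> + of_int k * z))))"
      by (simp add: field_simps power2_eq_square)
    then have "e ((of_int (2 * k + 1))\<^sup>2 / 8 * \<tau>) * e (of_int (2 * k + 1) / 2 * (z + 1 / 2)) =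
      (- 1) powi k * (\<i> * (e (\<tau> / 8) * (e (z / 2) * (e (of_int k * (of_int k + 1) / 2 * \<tau>) * e (of_int k * z)))))"
      unfolding e_add[symmetric] by (simp only: e_add e_int_half e_quarter)
    moreover have "(- 1 :: complex) powi k * (- 1) powi k = 1"
      by (simp add: power_int_mult_distrib[symmetric])
    ultimately show "(- 1) powi k * (e ((of_int (2 * k + 1))\<^sup>2 / 8 * \<tau>) * e (of_int (2 * k + 1) / 2 * (z + 1 / 2))) =
      (\<i> * (e (\<tau> / 8) * e (z / 2))) * (e (of_int k * (of_int k + 1) / 2 * \<tau>) * e (of_int k * z))"
      by (simp only:) (simp only: mult.assoc[symmetric], simp)
  qed
  also have "\<dots> = (\<i> * (e (\<tau> / 8) * e (z / 2))) * (\<Sum>\<^sub>\<infinity>k\<in>(UNIV :: int set). e (of_int k * (of_int k + 1) / 2 * \<tau>) * e (of_int k * z))"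
    by (rule infsum_cmult_right')
  finally show ?thesis by (simp add: theta10_def mult.assoc)
qed

lemma theta01_eq: "theta \<tau> (z + \<tau> / 2) = - e (- \<tau> / 8 - z / 2) * theta01 \<tau> z"
proof -
  let ?f = "\<lambda>n. (- 1) powi n * e ((of_int n)\<^sup>2 / 2 * \<tau>) * e (of_int n * z)"
  have "theta \<tau> (z + \<tau> / 2) = (\<Sum>\<^sub>\<infinity>k. - e (- \<tau> / 8 - z / 2) * ?f (k + 1))"
    unfolding theta_odd
  proof (rule infsum_cong)
    fix k :: int
    have "(of_int (2 * k + 1))\<^sup>2 / 8 * \<tau> + of_int (2 * k + 1) / 2 * (z + \<tau> / 2) =
      (- \<tau> / 8 - z / 2) + ((of_int (k + 1))\<^sup>2 / 2 * \<tau> + of_int (k + 1) * z)"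
      by (simp add: field_simps power2_eq_square)
    then have "e ((of_int (2 * k + 1))\<^sup>2 / 8 * \<tau>) * e (of_int (2 * k + 1) / 2 * (z + \<tau> / 2)) =
      e (- \<tau> / 8 - z / 2) * (e ((of_int (k + 1))\<^sup>2 / 2 * \<tau>) * e (of_int (k + 1) * z))"
      by (simp only: e_add[symmetric])
    moreover have "(- 1 :: complex) powi (k + 1) = - ((- 1) powi k)" by (simp add: power_int_add)
    ultimately show "(- 1) powi k * (e ((of_int (2 * k + 1))\<^sup>2 / 8 * \<tau>) * e (of_int (2 * k + 1) / 2 * (z + \<tau> / 2))) = - e (- \<tau> / 8 - z / 2) * ?f (k + 1)"
      by (simp only:) (simp only: mult_minus_left mult_minus_right minus_minus mult_ac)
  qed
  also have "\<dots> = - e (- \<tau> / 8 - z / 2) * (\<Sum>\<^sub>\<infinity>k. ?f (k + 1))" by (rule infsum_cmult_right')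
  also have "(\<Sum>\<^sub>\<infinity>k. ?f (k + 1)) = (\<Sum>\<^sub>\<infinity>k. ?f k)"
    by (rule infsum_reindex_bij_betw[OF bij_plus_1])
  finally show ?thesis by (simp add: theta01_def)
qed

lemma theta00_eq: "theta00 \<tau> z = theta01 \<tau> (z + 1 / 2)"
  unfolding theta00_def theta01_def
proof (rule infsum_cong)
  fix n :: int
  have "of_int n * (z + 1 / 2) = of_int n * z + of_int n / 2" by (simp add: field_simps)
  then have "e (of_int n * (z + 1 / 2)) = e (of_int n * z) * (- 1) powi n" by (simp only: e_add e_int_half)
  moreover have "(- 1 :: complex) powi n * (- 1) powi n = 1" by (simp add: power_int_mult_distrib[symmetric])
  ultimately show "e ((of_int n)\<^sup>2 / 2 * \<tau>) * e (of_int n * z) = (- 1) powi n * e ((of_int n)\<^sup>2 / 2 * \<tau>) * e (of_int n * (z + 1 / 2))"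
    by simp
qed

lemma theta_eq_klein_ex:
  assumes \<tau>: "\<tau> \<in> uhp"
  shows "\<exists>K. \<forall>z. theta \<tau> z = K * klein \<tau> z"
proof -
  have hol: "theta \<tau> holomorphic_on UNIV" by (rule hol2_entire[OF hol2_theta \<tau>])
  have 0: "theta \<tau> 0 = 0" using theta_minus[of \<tau> 0] by simp
  have "(theta \<tau> has_field_derivative deriv (theta \<tau>) 0) (at 0)"
    using hol by (simp add: holomorphic_derivI[of _ UNIV])
  then have "((\<lambda>z. theta \<tau> z / z) \<longlongrightarrow> deriv (theta \<tau>) 0) (at 0)"
    using 0 by (simp add: has_field_derivative_iff)
  then have "((\<lambda>z. theta \<tau> z / z / (klein \<tau> z / z)) \<longlongrightarrow> deriv (theta \<tau>) 0 / (2 * of_real pi * \<i>)) (at 0)"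
    by (intro tendsto_divide klein_over_z[OF \<tau>]) auto
  then have lim: "((\<lambda>z. theta \<tau> z / klein \<tau> z) \<longlongrightarrow> deriv (theta \<tau>) 0 / (2 * of_real pi * \<i>)) (at 0)"
    by (rule Lim_transform_eventually) (auto simp: eventually_at_filter)
  have "theta \<tau> z = deriv (theta \<tau>) 0 / (2 * of_real pi * \<i>) * klein \<tau> z" for z
    by (rule quasi_periodic_unique[where \<alpha> = "-1" and \<beta> = "\<lambda>z. - e (- \<tau> / 2 - z)" and \<tau> = \<tau>
        and f = "theta \<tau>" and g = "klein \<tau>", OF _ hol hol2_entire[OF hol2_klein \<tau>] _ _ theta_plus_\<tau> klein_plus_\<tau>[OF \<tau>] _ _ klein_eq_0D[OF \<tau>] lim])
       (use \<tau> in \<open>auto simp: uhp_def theta_plus_1 klein_plus_1\<close>)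
  then show ?thesis by blast
qed

text \<open>
  The triple product for \<open>\<vartheta>\<^bsub>01\<^esub>\<close>. The argument is the classical one: series and product have the same
  quasi-periods, so they differ by a factor (\<open>theta_const\<close>) depending on \<open>\<tau>\<close> only. Comparing the values at
  \<open>(4 \<tau>, 0)\<close> and \<open>(\<tau>, 3/4)\<close> shows that this factor is invariant under \<open>\<tau> \<mapsto> 4 \<tau>\<close>, and it tends to 1 as the imaginary part
  grows.
\<close>

definition tprod :: "complex \<Rightarrow> complex \<Rightarrow> complex" where
  "tprod \<tau> z = qpoch \<tau> \<tau> * (qpoch \<tau> (\<tau> / 2 + z) * qpoch \<tau> (\<tau> / 2 - z))"

definition theta_const :: "complex \<Rightarrow> complex" where
  "theta_const \<tau> = (SOME K. \<forall>z. theta \<tau> z = K * klein \<tau> z) / (e (\<tau> / 8) * qpoch \<tau> \<tau> ^ 3)"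

lemma theta_eq_theta_const:
  assumes \<tau>: "\<tau> \<in> uhp"
  shows "theta \<tau> z = theta_const \<tau> * (e (\<tau> / 8) * qpoch \<tau> \<tau> ^ 3) * klein \<tau> z"
proof -
  let ?K = "SOME K. \<forall>z. theta \<tau> z = K * klein \<tau> z"
  have 1: "theta \<tau> z = ?K * klein \<tau> z" by (rule spec[OF someI_ex[OF theta_eq_klein_ex[OF \<tau>]]])
  have 2: "?K = theta_const \<tau> * (e (\<tau> / 8) * qpoch \<tau> \<tau> ^ 3)"
    using qpoch_self_nz[OF \<tau>] by (simp add: theta_const_def)
  show ?thesis by (rule trans[OF 1]) (simp only: 2)
qed

lemma theta01_eq_tprod:
  assumes \<tau>: "\<tau> \<in> uhp"
  shows "theta01 \<tau> z = theta_const \<tau> * tprod \<tau> z"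
proof -
  have 1: "klein \<tau> (z + \<tau> / 2) = - e (- z / 2 - \<tau> / 4) * qpoch \<tau> (\<tau> / 2 + z) * qpoch \<tau> (\<tau> / 2 - z) / (qpoch \<tau> \<tau>)\<^sup>2"
  proof -
    have "- (z + \<tau> / 2) / 2 = - z / 2 - \<tau> / 4" "\<tau> - (z + \<tau> / 2) = \<tau> / 2 - z" "z + \<tau> / 2 = \<tau> / 2 + z"
      by (simp_all add: field_simps)
    then show ?thesis unfolding klein_theta[OF \<tau>] by (simp only:)
  qed
  have 2: "e (\<tau> / 8) * e (- z / 2 - \<tau> / 4) = e (- \<tau> / 8 - z / 2)"
    unfolding e_add[symmetric] by (rule arg_cong[where f = e]) (simp add: field_simps)
  have "- e (- \<tau> / 8 - z / 2) * theta01 \<tau> z = - (e (\<tau> / 8) * e (- z / 2 - \<tau> / 4)) * (theta_const \<tau> * tprod \<tau> z)"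
    unfolding theta01_eq[symmetric] theta_eq_theta_const[OF \<tau>] 1 tprod_def using qpoch_self_nz[OF \<tau>]
    by (simp add: field_simps power2_eq_square power3_eq_cube)
  then show ?thesis unfolding 2 by simp
qed

lemma tprod_quarter:
  assumes \<tau>: "\<tau> \<in> uhp"
  shows "tprod \<tau> (3 / 4) = tprod (4 * \<tau>) 0"
proof -
  have 2: "2 * \<tau> \<in> uhp" using \<tau> by (simp add: uhp_def)
  have a: "\<tau> / 2 - 3 / 4 = (\<tau> / 2 + 1 / 4) - 1" "\<tau> / 2 + 3 / 4 = (\<tau> / 2 + 1 / 4) + 1 / 2" by simp_all
  have b: "2 * (\<tau> / 2 + 1 / 4) = \<tau> + 1 / 2" by (simp add: field_simps)
  have c: "qpoch \<tau> (\<tau> / 2 + 3 / 4) * qpoch \<tau> (\<tau> / 2 - 3 / 4) = qpoch (2 * \<tau>) (\<tau> + 1 / 2)"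
    using qpoch_mult_half[OF \<tau>, of "\<tau> / 2 + 1 / 4"] unfolding a qpoch_minus_1 b by (simp only: mult.commute)
  have d: "qpoch \<tau> \<tau> = qpoch (2 * \<tau>) \<tau> * qpoch (2 * \<tau>) (2 * \<tau>)" using qpoch_even_odd[OF \<tau>, of \<tau>] by simp
  have f: "qpoch (2 * \<tau>) \<tau> * qpoch (2 * \<tau>) (\<tau> + 1 / 2) = qpoch (4 * \<tau>) (2 * \<tau>)" using qpoch_mult_half[OF 2, of \<tau>] by simp
  have g: "qpoch (2 * \<tau>) (2 * \<tau>) = qpoch (4 * \<tau>) (2 * \<tau>) * qpoch (4 * \<tau>) (4 * \<tau>)" using qpoch_even_odd[OF 2, of "2 * \<tau>"] by simp
  have "tprod \<tau> (3 / 4) = (qpoch (2 * \<tau>) \<tau> * qpoch (2 * \<tau>) (\<tau> + 1 / 2)) * qpoch (2 * \<tau>) (2 * \<tau>)"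
    unfolding tprod_def c d by (simp only: mult_ac)
  then show ?thesis unfolding f g by (simp add: tprod_def mult_ac)
qed

lemma tprod_0_nz:
  assumes \<tau>: "\<tau> \<in> uhp"
  shows "tprod \<tau> 0 \<noteq> 0"
proof
  assume "tprod \<tau> 0 = 0"
  then have "qpoch \<tau> (\<tau> / 2) = 0" using qpoch_self_nz[OF \<tau>] by (simp add: tprod_def)
  then have "klein \<tau> (\<tau> / 2) = 0" unfolding klein_theta[OF \<tau>] by simp
  then show False using klein_half_nz(2)[OF \<tau>] by simp
qed

text \<open>
  At \<open>z = 3/4\<close> the terms of odd \<open>n\<close> cancel in pairs \<open>\<plusminus> n\<close>, and the even ones are the series for \<open>4 \<tau>\<close>.
\<close>

lemma theta01_quadruple:
  assumes \<tau>: "\<tau> \<in> uhp"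
  shows "theta01 (4 * \<tau>) 0 = theta01 \<tau> (3 / 4)"
proof -
  define f where "f n = e ((of_int n)\<^sup>2 / 2 * \<tau>) * e (of_int n * (1 / 4))" for n :: int
  have "f summable_on UNIV"
  proof (rule abs_summable_summable, rule Infinite_Sum.abs_summable_on_comparison_test')
    show "(\<lambda>k :: int. exp (- (pi * Im \<tau>) * (of_int k)\<^sup>2 + 0 * \<bar>of_int k\<bar>)) summable_on UNIV"
      using \<tau> by (intro gauss_summable) (simp add: uhp_def)
    show "norm (f k) \<le> exp (- (pi * Im \<tau>) * (of_int k)\<^sup>2 + 0 * \<bar>of_int k\<bar>)" for k
      by (simp add: f_def norm_mult norm_e Im_divide power2_eq_square)
  qed
  then have s: "f summable_on A" for A using summable_on_subset_banach by blast
  let ?E = "{n :: int. even n}" and ?O = "{n :: int. odd n}"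
  have U: "UNIV = ?E \<union> ?O" by auto
  have "infsum f UNIV = infsum f ?E + infsum f ?O"
    unfolding U by (intro infsum_Un_disjoint s) auto
  moreover have "infsum f ?O = 0"
  proof -
    have "bij_betw uminus ?O ?O" by (rule bij_betwI[where g = uminus]) auto
    from infsum_reindex_bij_betw[OF this, of f]
    have "infsum f ?O = infsum (\<lambda>n. f (- n)) ?O" by (rule sym)
    also have "\<dots> = infsum (\<lambda>n. - f n) ?O"
    proof (rule infsum_cong)
      fix n assume "n \<in> ?O"
      then obtain m where m: "n = 2 * m + 1" by (auto elim: oddE)
      have "of_int (- n) * (1 / 4 :: complex) = (of_int n * (1 / 4) - 1 / 2) + of_int (- m)"
        by (simp add: m field_simps)
      then have "e (of_int (- n) * (1 / 4)) = - e (of_int n * (1 / 4))"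
        by (simp only: e_add_int e_diff e_half) simp
      then show "f (- n) = - f n" by (simp add: f_def)
    qed
    also have "\<dots> = - infsum f ?O" by (rule infsum_uminus)
    finally have "infsum f ?O + infsum f ?O = 0" by (simp only: eq_neg_iff_add_eq_0)
    then show ?thesis by simp
  qed
  moreover have "infsum f ?E = theta01 (4 * \<tau>) 0"
  proof -
    have "bij_betw (\<lambda>m :: int. 2 * m) UNIV ?E" by (rule bij_betwI[where g = "\<lambda>n. n div 2"]) auto
    from infsum_reindex_bij_betw[OF this, of f]
    have "infsum f ?E = (\<Sum>\<^sub>\<infinity>m. f (2 * m))" by (rule sym)
    also have "\<dots> = (\<Sum>\<^sub>\<infinity>m. (- 1) powi m * e ((of_int m)\<^sup>2 / 2 * (4 * \<tau>)) * e (of_int m * 0))"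
    proof (rule infsum_cong)
      fix m :: int
      have "(of_int (2 * m))\<^sup>2 / 2 * \<tau> = (of_int m)\<^sup>2 / 2 * (4 * \<tau>)" "of_int (2 * m) * (1 / 4) = (of_int m / 2 :: complex)"
        by (simp_all add: power2_eq_square)
      then show "f (2 * m) = (- 1) powi m * e ((of_int m)\<^sup>2 / 2 * (4 * \<tau>)) * e (of_int m * 0)"
        unfolding f_def by (simp only: e_int_half mult_zero_right e_0 mult_1_right) (simp only: mult.commute)
    qed
    finally show ?thesis by (simp add: theta01_def)
  qed
  moreover have "infsum f UNIV = theta00 \<tau> (1 / 4)" by (simp only: theta00_def f_def[abs_def])
  ultimately show ?thesis by (simp add: theta00_eq)
qed

lemma theta_const_quadruple:
  assumes \<tau>: "\<tau> \<in> uhp"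
  shows "theta_const (4 * \<tau>) = theta_const \<tau>"
proof -
  have 4: "4 * \<tau> \<in> uhp" using \<tau> by (simp add: uhp_def)
  show ?thesis using theta01_quadruple[OF \<tau>] tprod_0_nz[OF 4]
    unfolding theta01_eq_tprod[OF \<tau>] theta01_eq_tprod[OF 4] tprod_quarter[OF \<tau>] by simp
qed

lemma theta_const_eq_1:
  assumes \<tau>: "\<tau> \<in> uhp"
  shows "theta_const \<tau> = 1"
proof -
  define t where "t j = 4 ^ j * \<tau>" for j :: nat
  have tu: "t j \<in> uhp" for j
  proof -
    have "Im (4 ^ j * \<tau>) = 4 ^ j * Im \<tau>" by (induction j) simp_all
    then show ?thesis using \<tau> by (simp add: t_def uhp_def)
  qed
  have theta_const: "theta_const (t j) = theta_const \<tau>" for j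
  proof (induction j)
    case (Suc j)
    have "t (Suc j) = 4 * t j" by (simp add: t_def)
    then show ?case using theta_const_quadruple[OF tu[of j]] Suc by simp
  qed (simp add: t_def)
  have elim: "(\<lambda>j. e (c * t j)) \<longlonglongrightarrow> 0" if c: "Im (c * \<tau>) > 0" for c
  proof -
    have "(\<lambda>j. e (c * \<tau>) ^ (4 ^ j)) \<longlonglongrightarrow> 0"
      using LIMSEQ_subseq_LIMSEQ[OF LIMSEQ_power_zero, of "e (c * \<tau>)" "\<lambda>j. 4 ^ j"] norm_e_less_1[of "c * \<tau>"] c
      by (simp add: strict_mono_Suc_iff o_def uhp_def)
    moreover have "e (c * t j) = e (c * \<tau>) ^ (4 ^ j)" for j
      using e_of_nat_mult[of "4 ^ j" "c * \<tau>"] by (simp add: t_def mult_ac)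
    ultimately show ?thesis by simp
  qed
  have I: "Im \<tau> > 0" using \<tau> by (simp add: uhp_def)
  have Ps1: "(\<lambda>j. qpoch (t j) (c * t j)) \<longlonglongrightarrow> 1" if c: "Im (c * \<tau>) > 0" for c
  proof -
    have "(\<lambda>j. exp (norm (e (c * t j)) / (1 - norm (e (1 * t j)))) - 1) \<longlonglongrightarrow> exp (norm (0 :: complex) / (1 - norm (0 :: complex))) - 1"
      by (intro tendsto_intros elim) (use c I in auto)
    then have "(\<lambda>j. exp (norm (e (c * t j)) / (1 - norm (e (t j)))) - 1) \<longlonglongrightarrow> 0" by simp
    then have "(\<lambda>j. qpoch (t j) (c * t j) - 1) \<longlonglongrightarrow> 0"
      by (rule Lim_null_comparison[rotated]) (intro always_eventually allI norm_qpoch_minus_1_le tu)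
    then show ?thesis by (simp add: LIM_zero_iff)
  qed
  have "(\<lambda>j. tprod (t j) 0) \<longlonglongrightarrow> 1 * (1 * 1)"
  proof -
    have "(\<lambda>j. qpoch (t j) (1 * t j) * (qpoch (t j) (1 / 2 * t j) * qpoch (t j) (1 / 2 * t j))) \<longlonglongrightarrow> 1 * (1 * 1)"
      by (intro tendsto_mult Ps1) (use I in auto)
    then show ?thesis by (simp add: tprod_def)
  qed
  then have L1: "(\<lambda>j. theta_const \<tau> * tprod (t j) 0) \<longlonglongrightarrow> theta_const \<tau>" using tendsto_mult_left[of _ 1 _ "theta_const \<tau>"] by simp
  have "(\<lambda>j. theta01 (t j) 0) \<longlonglongrightarrow> (\<Sum>\<^sub>\<infinity>n\<in>(UNIV :: int set). if n = 0 then 1 else 0)"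
    unfolding theta01_def
  proof (rule infsum_tannery)
    show "(\<lambda>k :: int. exp (- (pi * Im \<tau>) * (of_int k)\<^sup>2 + 0 * \<bar>of_int k\<bar>)) summable_on UNIV"
      using I by (intro gauss_summable) simp
    show "\<forall>\<^sub>F j in sequentially. \<forall>n\<in>UNIV. norm ((- 1) powi n * e ((of_int n)\<^sup>2 / 2 * t j) * e (of_int n * 0)) \<le> exp (- (pi * Im \<tau>) * (of_int n)\<^sup>2 + 0 * \<bar>of_int n\<bar>)"
    proof (intro always_eventually allI ballI)
      fix j and n :: int
      have Imt: "Im \<tau> \<le> Im (t j)"
      proof -
        have "Im (4 ^ j * \<tau>) = 4 ^ j * Im \<tau>" by (induction j) simp_all
        moreover have "1 * Im \<tau> \<le> 4 ^ j * Im \<tau>" using I by (intro mult_right_mono) auto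
        ultimately show ?thesis by (simp add: t_def)
      qed
      have "norm ((- 1) powi n * e ((of_int n)\<^sup>2 / 2 * t j) * e (of_int n * 0)) = exp (- (pi * (of_int n)\<^sup>2) * Im (t j))"
        by (simp add: norm_mult norm_e norm_power_int Im_divide power2_eq_square mult_ac)
      also have "\<dots> \<le> exp (- (pi * (of_int n)\<^sup>2) * Im \<tau>)"
        using Imt by (subst exp_le_cancel_iff, intro mult_left_mono_neg) auto
      finally show "norm ((- 1) powi n * e ((of_int n)\<^sup>2 / 2 * t j) * e (of_int n * 0)) \<le> exp (- (pi * Im \<tau>) * (of_int n)\<^sup>2 + 0 * \<bar>of_int n\<bar>)"
        by (simp add: mult_ac)
    qed
    fix n :: int
    show "(\<lambda>j. (- 1) powi n * e ((of_int n)\<^sup>2 / 2 * t j) * e (of_int n * 0)) \<longlonglongrightarrow> (if n = 0 then 1 else 0)"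
    proof (cases "n = 0")
      case False
      have "Im ((of_int n)\<^sup>2 / 2 * \<tau>) > 0"
      proof -
        have "Im ((of_int n)\<^sup>2 / 2 * \<tau>) = (of_int n)\<^sup>2 / 2 * Im \<tau>" by (simp add: Im_divide power2_eq_square)
        then show ?thesis using False I by simp
      qed
      from tendsto_mult_left[OF elim[OF this], of "(- 1) powi n"] False show ?thesis by simp
    qed simp
  qed simp
  also have "(\<Sum>\<^sub>\<infinity>n\<in>(UNIV :: int set). if n = 0 then 1 else 0) = (\<Sum>\<^sub>\<infinity>n\<in>{0 :: int}. (1 :: complex))"
    by (rule infsum_cong_neutral) auto
  finally have L2: "(\<lambda>j. theta01 (t j) 0) \<longlonglongrightarrow> 1" by simp
  have "theta01 (t j) 0 = theta_const \<tau> * tprod (t j) 0" for j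
    using theta01_eq_tprod[OF tu[of j]] theta_const by simp
  then show ?thesis using LIMSEQ_unique[OF L1] L2 by simp
qed

lemma theta_eq_klein: "\<tau> \<in> uhp \<Longrightarrow> theta \<tau> z = e (\<tau> / 8) * qpoch \<tau> \<tau> ^ 3 * klein \<tau> z"
  by (simp add: theta_eq_theta_const theta_const_eq_1)

lemma theta_power_24:
  assumes \<tau>: "\<tau> \<in> uhp"
  shows "theta \<tau> z ^ 24 = Delta \<tau> ^ 3 * Qf \<tau> z ^ 12"
proof -
  have 1: "e (\<tau> / 8) ^ 24 = e \<tau> ^ 3"
    using e_of_nat_mult[of 24 "\<tau> / 8"] e_of_nat_mult[of 3 \<tau>] by simp
  have "(qpoch \<tau> \<tau> ^ 3) ^ 24 = (qpoch \<tau> \<tau> ^ 24) ^ 3" "klein \<tau> z ^ 24 = (klein \<tau> z)\<^sup>2 ^ 12"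
    unfolding power_mult[symmetric] by simp_all
  then show ?thesis
    unfolding theta_eq_klein[OF \<tau>] Delta_eq_qpoch[OF \<tau>] Qf_def power_mult_distrib 1 by (simp only:)
qed

lemma theta_ratio: "\<tau> \<in> uhp \<Longrightarrow> theta \<tau> z / theta \<tau> w = klein \<tau> z / klein \<tau> w"
  by (simp add: theta_eq_klein qpoch_self_nz)

lemma xi_sq:
  assumes \<tau>: "\<tau> \<in> uhp"
  shows "(xi10 \<tau> z)\<^sup>2 = X10 \<tau> z" "(xi01 \<tau> z)\<^sup>2 = X01 \<tau> z" "(xi00 \<tau> z)\<^sup>2 = X00 \<tau> z"
proof -
  have "theta10 \<tau> z = - \<i> * theta \<tau> (z + 1 / 2)" for z by (simp add: theta10_eq)
  then show "(xi10 \<tau> z)\<^sup>2 = X10 \<tau> z"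
    using theta_ratio[OF \<tau>, of "z + 1 / 2" "1 / 2"] by (simp add: xi10_def X10_def)
  have *: "theta01 \<tau> w = - e (\<tau> / 8 + w / 2) * theta \<tau> (w + \<tau> / 2)" for w
  proof -
    have "e (\<tau> / 8 + w / 2) * e (- \<tau> / 8 - w / 2) = 1" unfolding e_add[symmetric] by simp
    then show ?thesis unfolding theta01_eq by (simp add: mult.assoc[symmetric])
  qed
  have sq: "e (w / 2) ^ 2 = e w" for w using e_half_mult[of w] by (simp add: power2_eq_square)
  have "theta01 \<tau> z / theta01 \<tau> 0 = e (z / 2) * (klein \<tau> (z + \<tau> / 2) / klein \<tau> (\<tau> / 2))"
    unfolding * theta_ratio[OF \<tau>, symmetric] by (simp add: e_add)
  then show "(xi01 \<tau> z)\<^sup>2 = X01 \<tau> z"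
    by (simp only: xi01_def X01_def power_mult_distrib sq mult.commute)
  have h: "z + 1 / 2 + \<tau> / 2 = z + (\<tau> + 1) / 2" for z by (simp add: field_simps)
  have "theta00 \<tau> w = - e (\<tau> / 8 + 1 / 4) * e (w / 2) * theta \<tau> (w + (\<tau> + 1) / 2)" for w
  proof -
    have "\<tau> / 8 + (w + 1 / 2) / 2 = (\<tau> / 8 + 1 / 4) + w / 2" by (simp add: field_simps)
    then have "e (\<tau> / 8 + (w + 1 / 2) / 2) = e (\<tau> / 8 + 1 / 4) * e (w / 2)" by (simp only: e_add)
    then show ?thesis unfolding theta00_eq * h by simp
  qed
  then have "theta00 \<tau> z / theta00 \<tau> 0 = e (z / 2) * (klein \<tau> (z + (\<tau> + 1) / 2) / klein \<tau> ((\<tau> + 1) / 2))"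
    unfolding theta_ratio[OF \<tau>, symmetric] by simp
  then show "(xi00 \<tau> z)\<^sup>2 = X00 \<tau> z"
    by (simp only: xi00_def X00_def power_mult_distrib sq mult.commute)
qed

section \<open>Polynomials in the basic forms\<close>

text \<open>
  Polynomials in \<open>a, b, Y, Q\<close> as lists of exponents and coefficients, so that weight and index are read off each
  monomial. At the cusp they take their values at \<open>a = - 1/48\<close>, \<open>b = 1/864\<close>, \<open>Y = 1 + q0/12\<close>, \<open>Q = q0\<close>.
\<close>

definition cpoly :: "(nat \<times> nat \<times> nat \<times> nat \<times> complex) list \<Rightarrow> complex \<Rightarrow> complex \<Rightarrow> complex \<Rightarrow> complex \<Rightarrow> complex" where
  "cpoly L a b Y Q = (\<Sum>(i, j, r, s, c)\<leftarrow>L. c * (a ^ i * b ^ j * Y ^ r * Q ^ s))"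

lemma jform_zero: "jform k m (\<lambda>_ _. 0) (\<lambda>_. 0)"
  by (rule jformI) (auto intro: hol2_const cusp_lim_const)

lemma jform_cpoly:
  assumes "\<And>i j r s c. (i, j, r, s, c) \<in> set L \<Longrightarrow> 4 * int i + 6 * int j - 2 * int s = k \<and> r + s = m"
  shows "jform k m (\<lambda>\<tau> z. cpoly L (cub_a \<tau>) (cub_b \<tau>) (Yf \<tau> z) (Qf \<tau> z))
     (\<lambda>z. cpoly L (- 1 / 48) (1 / 864) (1 + q0 z / 12) (q0 z))"
  using assms
proof (induction L)
  case Nil
  then show ?case by (simp add: cpoly_def jform_zero)
next
  case (Cons x L)
  obtain i j r s c where x: "x = (i, j, r, s, c)" by (cases x)
  have k: "4 * int i + 6 * int j - 2 * int s = k" "r + s = m" using Cons.prems[of i j r s c] by (auto simp: x)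
  have "jform (int i * 4 + int j * 6 + int r * 0 + int s * - 2) (i * 0 + j * 0 + r * 1 + s * 1)
      (\<lambda>\<tau> z. cub_a \<tau> ^ i * cub_b \<tau> ^ j * Yf \<tau> z ^ r * Qf \<tau> z ^ s)
      (\<lambda>z. (- 1 / 48) ^ i * (1 / 864) ^ j * (1 + q0 z / 12) ^ r * q0 z ^ s)"
    by (intro jform_mult jform_power jform_cub_a jform_cub_b jform_Yf jform_Qf)
  moreover have "int i * 4 + int j * 6 + int r * 0 + int s * - 2 = k" "i * 0 + j * 0 + r * 1 + s * 1 = m" using k by simp_all
  ultimately have "jform k m (\<lambda>\<tau> z. cub_a \<tau> ^ i * cub_b \<tau> ^ j * Yf \<tau> z ^ r * Qf \<tau> z ^ s)
      (\<lambda>z. (- 1 / 48) ^ i * (1 / 864) ^ j * (1 + q0 z / 12) ^ r * q0 z ^ s)" by (simp only:)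
  note 1 = jform_cmult[OF this, of c]
  have IH: "jform k m (\<lambda>\<tau> z. cpoly L (cub_a \<tau>) (cub_b \<tau>) (Yf \<tau> z) (Qf \<tau> z))
      (\<lambda>z. cpoly L (- 1 / 48) (1 / 864) (1 + q0 z / 12) (q0 z))"
  proof (rule Cons.IH)
    fix i j r s c'
    assume "(i, j, r, s, c') \<in> set L"
    then show "4 * int i + 6 * int j - 2 * int s = k \<and> r + s = m" using Cons.prems[of i j r s c'] by simp
  qed
  show ?case
    by (rule jform_cong[OF jform_add[OF 1 IH]]) (simp_all add: cpoly_def x)
qed

lemma jform_eq_cpoly:
  assumes f: "jform k m f f0" and k: "k + 2 * int m < 12" and \<tau>: "\<tau> \<in> uhp"
    and L: "\<And>i j r s c. (i, j, r, s, c) \<in> set L \<Longrightarrow> 4 * int i + 6 * int j - 2 * int s = k \<and> r + s = m"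
    and f0: "\<And>z. f0 z = cpoly L (- 1 / 48) (1 / 864) (1 + q0 z / 12) (q0 z)"
  shows "f \<tau> z = cpoly L (cub_a \<tau>) (cub_b \<tau>) (Yf \<tau> z) (Qf \<tau> z)"
proof (rule jform_unique[OF f _ k \<tau>])
  have J: "jform k m (\<lambda>\<tau> z. cpoly L (cub_a \<tau>) (cub_b \<tau>) (Yf \<tau> z) (Qf \<tau> z))
      (\<lambda>z. cpoly L (- 1 / 48) (1 / 864) (1 + q0 z / 12) (q0 z))"
    by (rule jform_cpoly) (rule L)
  show "jform k m (\<lambda>\<tau> z. cpoly L (cub_a \<tau>) (cub_b \<tau>) (Yf \<tau> z) (Qf \<tau> z)) f0"
    by (rule jform_cong[OF J refl refl refl f0[symmetric]])
qed

lemma e_half_inverse: "e (- z / 2) = inverse (e (z / 2))"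
  using e_minus[of "z / 2"] by simp

lemma q0_double: "q0 (2 * z) = q0 z * (q0 z + 4)"
proof -
  define u where "u = e (z / 2)"
  have u: "u \<noteq> 0" by (simp add: u_def)
  have "e (2 * z / 2) = u\<^sup>2" using e_half_mult[of z] by (simp add: u_def power2_eq_square)
  then have A: "q0 (2 * z) = (u\<^sup>2 - inverse (u\<^sup>2))\<^sup>2" unfolding q0_def e_half_inverse by simp
  have B: "q0 z = (u - inverse u)\<^sup>2" unfolding q0_def e_half_inverse u_def by simp
  show ?thesis unfolding A B using u by (simp add: field_simps power2_eq_square)
qed

lemma Qf_double:
  assumes \<tau>: "\<tau> \<in> uhp"
  shows "Qf \<tau> (2 * z) = 4 * Qf \<tau> z * (Yf \<tau> z ^ 3 + cub_a \<tau> * Yf \<tau> z * (Qf \<tau> z)\<^sup>2 + cub_b \<tau> * Qf \<tau> z ^ 3)"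
proof -
  have "Qf \<tau> (2 * z) = cpoly [(0,0,3,1,4), (1,0,1,3,4), (0,1,0,4,4)] (cub_a \<tau>) (cub_b \<tau>) (Yf \<tau> z) (Qf \<tau> z)"
  proof (rule jform_eq_cpoly[OF jform_double[OF jform_Qf] _ \<tau>])
    fix z
    show "q0 (2 * z) = cpoly [(0,0,3,1,4), (1,0,1,3,4), (0,1,0,4,4)] (- 1 / 48) (1 / 864) (1 + q0 z / 12) (q0 z)"
      unfolding q0_double by (simp add: cpoly_def field_simps power2_eq_square power3_eq_cube power4_eq_xxxx)
  qed auto
  then show ?thesis by (simp add: cpoly_def algebra_simps power2_eq_square power3_eq_cube power4_eq_xxxx)
qed

lemma Yf_double:
  assumes \<tau>: "\<tau> \<in> uhp"
  shows "Yf \<tau> (2 * z) = Yf \<tau> z ^ 4 - 2 * cub_a \<tau> * (Yf \<tau> z)\<^sup>2 * (Qf \<tau> z)\<^sup>2 - 8 * cub_b \<tau> * Yf \<tau> z * Qf \<tau> z ^ 3 + (cub_a \<tau>)\<^sup>2 * Qf \<tau> z ^ 4"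
proof -
  have "Yf \<tau> (2 * z) = cpoly [(0,0,4,0,1), (1,0,2,2,-2), (0,1,1,3,-8), (2,0,0,4,1)] (cub_a \<tau>) (cub_b \<tau>) (Yf \<tau> z) (Qf \<tau> z)"
  proof (rule jform_eq_cpoly[OF jform_double[OF jform_Yf] _ \<tau>])
    fix z
    show "1 + q0 (2 * z) / 12 = cpoly [(0,0,4,0,1), (1,0,2,2,-2), (0,1,1,3,-8), (2,0,0,4,1)] (- 1 / 48) (1 / 864) (1 + q0 z / 12) (q0 z)"
      unfolding q0_double by (simp add: cpoly_def field_simps power2_eq_square power3_eq_cube power4_eq_xxxx)
  qed auto
  then show ?thesis by (simp add: cpoly_def algebra_simps)
qed

lemma jform_klein3: "jform (-2) 5 (\<lambda>\<tau> z. klein \<tau> (3 * z) * klein \<tau> z) (\<lambda>z. q0 z * (q0 z + 3))"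
proof (rule jformI)
  show "hol2 (\<lambda>\<tau> z. klein \<tau> (3 * z) * klein \<tau> z)" by (intro hol2_intros)
  show "cusp_lim (\<lambda>\<tau> z. klein \<tau> (3 * z) * klein \<tau> z) (\<lambda>z. q0 z * (q0 z + 3))"
  proof (rule cusp_lim_cong[OF cusp_lim_mult[OF cusp_lim_affine[OF cusp_lim_klein, of 3 0] cusp_lim_klein]])
    fix z :: complex
    define u where "u = e (z / 2)"
    have u: "u \<noteq> 0" by (simp add: u_def)
    have "e ((3 * z + 0) / 2) = u ^ 3" using e_of_nat_mult[of 3 "z / 2"] by (simp add: u_def)
    then have A: "(e ((3 * z + 0) / 2) - e (- (3 * z + 0) / 2)) * (e (z / 2) - e (- z / 2)) = (u ^ 3 - inverse (u ^ 3)) * (u - inverse u)"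
      unfolding e_half_inverse u_def by simp
    have B: "q0 z = (u - inverse u)\<^sup>2" unfolding q0_def e_half_inverse u_def by simp
    show "(e ((3 * z + 0) / 2) - e (- (3 * z + 0) / 2)) * (e (z / 2) - e (- z / 2)) = q0 z * (q0 z + 3)"
      unfolding A B using u by (simp add: field_simps power2_eq_square power3_eq_cube)
  qed simp
  fix \<tau> z assume \<tau>: "\<tau> \<in> uhp"
  have 3: "3 * (z / \<tau>) = 3 * z / \<tau>" by simp
  have "e ((3 * z)\<^sup>2 / (2 * \<tau>)) * e (z\<^sup>2 / (2 * \<tau>)) = e (of_nat 5 * z\<^sup>2 / \<tau>)"
    unfolding e_add[symmetric] using uhp_nz[OF \<tau>] by (intro arg_cong[where f = e]) (simp add: field_simps)
  then show "klein (- 1 / \<tau>) (3 * (z / \<tau>)) * klein (- 1 / \<tau>) (z / \<tau>) = \<tau> powi (-2) * e (of_nat 5 * z\<^sup>2 / \<tau>) * (klein \<tau> (3 * z) * klein \<tau> z)"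
    unfolding 3 klein_S[OF \<tau>] using uhp_nz[OF \<tau>] by (simp add: power_int_minus field_simps power2_eq_square)
  have "3 * (z + 1) = 3 * z + 1 + 1 + 1" by simp
  then show "klein \<tau> (3 * (z + 1)) * klein \<tau> (z + 1) = klein \<tau> (3 * z) * klein \<tau> z"
    by (simp only: klein_plus_1) simp
  have 4: "3 * (z + \<tau>) = 3 * z + \<tau> + \<tau> + \<tau>" by simp
  have "e (- \<tau> / 2 - (3 * z + \<tau> + \<tau>)) * (e (- \<tau> / 2 - (3 * z + \<tau>)) * (e (- \<tau> / 2 - 3 * z) * e (- \<tau> / 2 - z))) = e (- of_nat 5 * (\<tau> + 2 * z))"
    unfolding e_add[symmetric] by (intro arg_cong[where f = e]) (simp add: field_simps)
  then show "klein \<tau> (3 * (z + \<tau>)) * klein \<tau> (z + \<tau>) = e (- of_nat 5 * (\<tau> + 2 * z)) * (klein \<tau> (3 * z) * klein \<tau> z)"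
    unfolding 4 klein_plus_\<tau>[OF \<tau>] by (simp only: mult_minus_left mult_minus_right minus_minus) (simp only: mult_ac)
qed (simp_all add: klein_T)

text \<open>
  The formula for \<open>k(3 z) / k(z)\<close>, multiplied by \<open>Q\<close>: the product \<open>k(3 z) k(z)\<close>, of weight -2 and index 5, is
  visibly holomorphic.
\<close>

lemma klein_triple:
  assumes \<tau>: "\<tau> \<in> uhp"
  shows "klein \<tau> (3 * z) * klein \<tau> z = Qf \<tau> z * (3 * Yf \<tau> z ^ 4 + 6 * cub_a \<tau> * (Yf \<tau> z)\<^sup>2 * (Qf \<tau> z)\<^sup>2
     + 12 * cub_b \<tau> * Yf \<tau> z * Qf \<tau> z ^ 3 - (cub_a \<tau>)\<^sup>2 * Qf \<tau> z ^ 4)"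
proof -
  have p5: "x ^ 5 = x * x * x * x * x" for x :: complex by (simp add: eval_nat_numeral)
  have "klein \<tau> (3 * z) * klein \<tau> z = cpoly [(0,0,4,1,3), (1,0,2,3,6), (0,1,1,4,12), (2,0,0,5,-1)] (cub_a \<tau>) (cub_b \<tau>) (Yf \<tau> z) (Qf \<tau> z)"
  proof (rule jform_eq_cpoly[OF jform_klein3 _ \<tau>])
    fix z
    show "q0 z * (q0 z + 3) = cpoly [(0,0,4,1,3), (1,0,2,3,6), (0,1,1,4,12), (2,0,0,5,-1)] (- 1 / 48) (1 / 864) (1 + q0 z / 12) (q0 z)"
      by (simp add: cpoly_def p5 field_simps power2_eq_square power3_eq_cube power4_eq_xxxx)
  qed auto
  then show ?thesis
    by (simp only:) (simp add: cpoly_def p5 algebra_simps power2_eq_square power3_eq_cube power4_eq_xxxx)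
qed

section \<open>The weak Jacobi forms of weight zero\<close>

lemma phi01_eq: "\<tau> \<in> uhp \<Longrightarrow> phi01 \<tau> z = 12 * Yf \<tau> z"
  by (simp add: phi01_def xi_sq Yf_def)

lemma phi02_eq:
  assumes \<tau>: "\<tau> \<in> uhp"
  shows "phi02 \<tau> z = 2 * (3 * (Yf \<tau> z)\<^sup>2 + cub_a \<tau> * (Qf \<tau> z)\<^sup>2)"
proof -
  have 0: "eps00 \<tau> = - eps10 \<tau> - eps01 \<tau>" using eps_sum[of \<tau>] by (simp add: algebra_simps eq_neg_iff_add_eq_0)
  show ?thesis unfolding phi02_def xi_sq[OF \<tau>] X_eq[OF \<tau>] cub_a_def 0
    by (simp add: algebra_simps power2_eq_square)
qed

text \<open>
  Zeros of \<open>k\<close> are isolated, which identifies the removable singularities in \<open>phi03\<close> and \<open>phi04\<close>.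
\<close>

lemma eventually_klein_nz:
  assumes \<tau>: "\<tau> \<in> uhp"
  shows "\<forall>\<^sub>F w in at z. klein \<tau> w \<noteq> 0"
proof (cases "klein \<tau> z = 0")
  case True
  obtain r where r: "0 < r" "ball z r \<subseteq> UNIV" "\<And>w. w \<in> ball z r - {z} \<Longrightarrow> klein \<tau> w \<noteq> 0"
    by (rule isolated_zeros[OF hol2_entire[OF hol2_klein \<tau>] open_UNIV connected_UNIV UNIV_I True UNIV_I klein_half_nz(1)[OF \<tau>]]) (rule that)
  show ?thesis unfolding eventually_at
  proof (intro exI conjI ballI impI)
    fix w assume "w \<noteq> z \<and> dist w z < r"
    then have "w \<in> ball z r - {z}" by (simp add: dist_commute)
    then show "klein \<tau> w \<noteq> 0" by (rule r(3))
  qed (rule r(1))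
next
  case False
  have "(klein \<tau> \<longlongrightarrow> klein \<tau> z) (at z)" using entire_isCont[OF hol2_entire[OF hol2_klein \<tau>]] by (simp add: isCont_def)
  from tendsto_imp_eventually_ne[OF this False] show ?thesis .
qed

lemma remove_sings_quotient:
  assumes \<tau>: "\<tau> \<in> uhp" and g: "g holomorphic_on UNIV" and eq: "\<And>w. klein \<tau> w \<noteq> 0 \<Longrightarrow> f w = g w"
  shows "remove_sings f z = g z"
proof (rule remove_sings_eqI)
  have "(g \<longlongrightarrow> g z) (at z)" using entire_isCont[OF g] by (simp add: isCont_def)
  moreover have "\<forall>\<^sub>F w in at z. g w = f w" using eventually_klein_nz[OF \<tau>] by eventually_elim (simp add: eq)
  ultimately show "(f \<longlongrightarrow> g z) (at z)" by (rule Lim_transform_eventually)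
qed

lemma entire_Yf_Qf: "\<tau> \<in> uhp \<Longrightarrow> Yf \<tau> holomorphic_on UNIV" "\<tau> \<in> uhp \<Longrightarrow> Qf \<tau> holomorphic_on UNIV"
  by (auto intro: hol2_entire hol2_Yf hol2_Qf)

lemma phi03_eq:
  assumes \<tau>: "\<tau> \<in> uhp"
  shows "phi03 \<tau> z = 4 * (Yf \<tau> z ^ 3 + cub_a \<tau> * Yf \<tau> z * (Qf \<tau> z)\<^sup>2 + cub_b \<tau> * Qf \<tau> z ^ 3)"
  unfolding phi03_def
proof (rule remove_sings_quotient[OF \<tau>])
  show "(\<lambda>z. 4 * (Yf \<tau> z ^ 3 + cub_a \<tau> * Yf \<tau> z * (Qf \<tau> z)\<^sup>2 + cub_b \<tau> * Qf \<tau> z ^ 3)) holomorphic_on UNIV"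
    by (intro holomorphic_intros entire_Yf_Qf \<tau>)
  fix w assume "klein \<tau> w \<noteq> 0"
  then have "(theta \<tau> (2 * w) / theta \<tau> w)\<^sup>2 * Qf \<tau> w = Qf \<tau> (2 * w)" "Qf \<tau> w \<noteq> 0"
    by (simp_all add: theta_ratio[OF \<tau>] Qf_def power_divide)
  then show "(theta \<tau> (2 * w) / theta \<tau> w)\<^sup>2 = 4 * (Yf \<tau> w ^ 3 + cub_a \<tau> * Yf \<tau> w * (Qf \<tau> w)\<^sup>2 + cub_b \<tau> * Qf \<tau> w ^ 3)"
    unfolding Qf_double[OF \<tau>] by simp
qed

lemma phi04_eq:
  assumes \<tau>: "\<tau> \<in> uhp"
  shows "phi04 \<tau> z = 3 * Yf \<tau> z ^ 4 + 6 * cub_a \<tau> * (Yf \<tau> z)\<^sup>2 * (Qf \<tau> z)\<^sup>2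
     + 12 * cub_b \<tau> * Yf \<tau> z * Qf \<tau> z ^ 3 - (cub_a \<tau>)\<^sup>2 * Qf \<tau> z ^ 4"
  unfolding phi04_def
proof (rule remove_sings_quotient[OF \<tau>])
  show "(\<lambda>z. 3 * Yf \<tau> z ^ 4 + 6 * cub_a \<tau> * (Yf \<tau> z)\<^sup>2 * (Qf \<tau> z)\<^sup>2
     + 12 * cub_b \<tau> * Yf \<tau> z * Qf \<tau> z ^ 3 - (cub_a \<tau>)\<^sup>2 * Qf \<tau> z ^ 4) holomorphic_on UNIV"
    by (intro holomorphic_intros entire_Yf_Qf \<tau>)
  fix w assume nz: "klein \<tau> w \<noteq> 0"
  have Q: "Qf \<tau> w \<noteq> 0" using nz by (simp add: Qf_def)
  have "Qf \<tau> w * (theta \<tau> (3 * w) / theta \<tau> w) = klein \<tau> (3 * w) * klein \<tau> w"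
    using nz by (simp add: theta_ratio[OF \<tau>] Qf_def power2_eq_square)
  then show "theta \<tau> (3 * w) / theta \<tau> w = 3 * Yf \<tau> w ^ 4 + 6 * cub_a \<tau> * (Yf \<tau> w)\<^sup>2 * (Qf \<tau> w)\<^sup>2
     + 12 * cub_b \<tau> * Yf \<tau> w * Qf \<tau> w ^ 3 - (cub_a \<tau>)\<^sup>2 * Qf \<tau> w ^ 4"
    unfolding klein_triple[OF \<tau>] mult_left_cancel[OF Q] .
qed

section \<open>The Eisenstein series of weight 4\<close>

text \<open>
  The logarithm of the product, expanded in powers of \<open>e u\<close>: the sum over the factors of the product is a
  geometric series.
\<close>

definition log_qpoch :: "complex \<Rightarrow> complex \<Rightarrow> complex" where
  "log_qpoch \<tau> x = (\<Sum>m. x ^ Suc m / (of_nat (Suc m) * (1 - e \<tau> ^ Suc m)))"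

lemma norm_1_minus_power_ge:
  assumes "\<tau> \<in> uhp"
  shows "norm (1 - e \<tau> ^ Suc m) \<ge> 1 - norm (e \<tau>)" "1 - e \<tau> ^ Suc m \<noteq> 0"
proof -
  have q: "norm (e \<tau>) < 1" by (rule norm_e_less_1[OF assms])
  have "norm (e \<tau> ^ Suc m) \<le> norm (e \<tau>)"
    using q by (simp add: norm_mult norm_power mult_left_le power_le_one)
  then show 1: "norm (1 - e \<tau> ^ Suc m) \<ge> 1 - norm (e \<tau>)"
    using norm_triangle_ineq2[of 1 "e \<tau> ^ Suc m"] by simp
  have "0 < norm (1 - e \<tau> ^ Suc m)" using 1 q by linarith
  then show "1 - e \<tau> ^ Suc m \<noteq> 0" unfolding zero_less_norm_iff .
qed

lemma log_qpoch_term_le: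
  assumes \<tau>: "\<tau> \<in> uhp"
  shows "norm (x ^ Suc m / (of_nat (Suc m) * (1 - e \<tau> ^ Suc m))) \<le> norm x ^ Suc m / (1 - norm (e \<tau>))"
proof -
  note q = norm_1_minus_power_ge[OF \<tau>, of m] norm_e_less_1[OF \<tau>]
  have "1 * (1 - norm (e \<tau>)) \<le> real (Suc m) * norm (1 - e \<tau> ^ Suc m)"
    using q by (intro mult_mono) auto
  then have "1 - norm (e \<tau>) \<le> norm (of_nat (Suc m) * (1 - e \<tau> ^ Suc m))"
    by (simp only: norm_mult norm_of_nat mult_1_left)
  then have "norm x ^ Suc m / norm (of_nat (Suc m) * (1 - e \<tau> ^ Suc m)) \<le> norm x ^ Suc m / (1 - norm (e \<tau>))"
    using q(3) by (intro divide_left_mono mult_pos_pos) auto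
  then show ?thesis by (simp only: norm_divide norm_power)
qed

lemma log_qpoch_summable:
  assumes \<tau>: "\<tau> \<in> uhp" and x: "norm x < 1"
  shows "summable (\<lambda>m. x ^ Suc m / (of_nat (Suc m) * (1 - e \<tau> ^ Suc m)))"
proof (rule summable_comparison_test')
  show "summable (\<lambda>m. norm x ^ Suc m / (1 - norm (e \<tau>)))"
    using x by (intro summable_divide summable_Suc_iff[THEN iffD2] summable_geometric) simp
  show "norm (x ^ Suc m / (of_nat (Suc m) * (1 - e \<tau> ^ Suc m))) \<le> norm x ^ Suc m / (1 - norm (e \<tau>))" for m
    by (rule log_qpoch_term_le[OF \<tau>])
qed

lemma norm_log_qpoch_le:
  assumes \<tau>: "\<tau> \<in> uhp" and x: "norm x < 1"
  shows "norm (log_qpoch \<tau> x) \<le> norm x / (1 - norm x) / (1 - norm (e \<tau>))"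
proof -
  have s: "summable (\<lambda>m. norm x ^ Suc m / (1 - norm (e \<tau>)))"
    using x by (intro summable_divide summable_Suc_iff[THEN iffD2] summable_geometric) simp
  have "norm (log_qpoch \<tau> x) \<le> (\<Sum>m. norm x ^ Suc m / (1 - norm (e \<tau>)))"
    unfolding log_qpoch_def by (rule norm_suminf_le[OF log_qpoch_term_le[OF \<tau>] s])
  also have "\<dots> = norm x / (1 - norm x) / (1 - norm (e \<tau>))"
  proof -
    have "(\<lambda>m. norm x ^ Suc m) sums (norm x / (1 - norm x))"
      using geometric_sums[of "norm x"] x sums_mult[of "\<lambda>m. norm x ^ m" "1 / (1 - norm x)" "norm x"] by simp
    from sums_divide[OF this] show ?thesis by (rule sums_unique[symmetric])
  qed
  finally show ?thesis .
qed

lemma log_qpoch_step: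
  assumes \<tau>: "\<tau> \<in> uhp" and x: "norm x < 1"
  shows "exp (- log_qpoch \<tau> x) = (1 - x) * exp (- log_qpoch \<tau> (e \<tau> * x))"
proof -
  have x': "norm (e \<tau> * x) < 1"
    using x norm_e_less_1[OF \<tau>] by (simp add: norm_mult) (metis mult_left_le norm_ge_zero order_le_less_trans less_imp_le)
  have "(\<lambda>n. - ((- (- x)) ^ n) / of_nat n) sums ln (1 + (- x))"
    by (rule Ln_series') (use x in simp)
  then have "(\<lambda>n. - (x ^ n) / of_nat n) sums ln (1 - x)" by simp
  then have "(\<lambda>n. - (x ^ Suc n) / of_nat (Suc n)) sums (ln (1 - x) - - (x ^ 0) / of_nat 0)"
    by (subst sums_Suc_iff) simp
  then have 1: "(\<lambda>n. - (x ^ Suc n) / of_nat (Suc n)) sums ln (1 - x)" by simp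
  have "(\<lambda>m. x ^ Suc m / (of_nat (Suc m) * (1 - e \<tau> ^ Suc m)) - (e \<tau> * x) ^ Suc m / (of_nat (Suc m) * (1 - e \<tau> ^ Suc m)))
          sums (log_qpoch \<tau> x - log_qpoch \<tau> (e \<tau> * x))"
    unfolding log_qpoch_def by (intro sums_diff summable_sums log_qpoch_summable \<tau> x x')
  moreover have "x ^ Suc m / (of_nat (Suc m) * (1 - e \<tau> ^ Suc m)) - (e \<tau> * x) ^ Suc m / (of_nat (Suc m) * (1 - e \<tau> ^ Suc m)) = - (- (x ^ Suc m) / of_nat (Suc m))" for m
  proof -
    define Q where "Q = e \<tau> ^ Suc m"
    have "1 - Q \<noteq> 0" unfolding Q_def by (rule norm_1_minus_power_ge(2)[OF \<tau>])
    moreover have "(e \<tau> * x) ^ Suc m = Q * x ^ Suc m" by (simp only: power_mult_distrib Q_def)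
    moreover have "of_nat (Suc m) \<noteq> (0 :: complex)" by (simp only: of_nat_eq_0_iff)
    moreover have "X / (n * (1 - Q)) - Q * X / (n * (1 - Q)) = - (- X / n)" if "n \<noteq> 0" "1 - Q \<noteq> 0" for X n :: complex
    proof -
      have "X / (n * (1 - Q)) - Q * X / (n * (1 - Q)) = X * (1 - Q) / (n * (1 - Q))"
        unfolding diff_divide_distrib[symmetric] by (simp add: algebra_simps)
      also have "\<dots> = X / n" using that by simp
      finally show ?thesis by simp
    qed
    ultimately show ?thesis unfolding Q_def[symmetric] by (simp only: not_False_eq_True)
  qed
  ultimately have "(\<lambda>m. - (- (x ^ Suc m) / of_nat (Suc m))) sums (log_qpoch \<tau> x - log_qpoch \<tau> (e \<tau> * x))" by (simp only:)
  from sums_unique2[OF this sums_minus[OF 1]] have "- log_qpoch \<tau> x = ln (1 - x) + - log_qpoch \<tau> (e \<tau> * x)"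
    by (simp add: algebra_simps)
  then have "exp (- log_qpoch \<tau> x) = exp (ln (1 - x)) * exp (- log_qpoch \<tau> (e \<tau> * x))" by (simp only: exp_add)
  moreover have "1 - x \<noteq> 0" using x by auto
  ultimately show ?thesis by simp
qed

lemma qpoch_eq_exp:
  assumes \<tau>: "\<tau> \<in> uhp" and u: "Im u > 0"
  shows "qpoch \<tau> u = exp (- log_qpoch \<tau> (e u))"
proof (rule qpoch_eqI[OF \<tau>])
  have x: "norm (e u) < 1" using u by (intro norm_e_less_1) (simp add: uhp_def)
  have xN: "norm (e (u + of_nat N * \<tau>)) < 1" for N
    using u \<tau> by (intro norm_e_less_1) (simp add: uhp_def add_pos_nonneg)
  have prod: "exp (- log_qpoch \<tau> (e u)) = (\<Prod>n<N. 1 - e (u + of_nat n * \<tau>)) * exp (- log_qpoch \<tau> (e (u + of_nat N * \<tau>)))" for N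
  proof (induction N)
    case (Suc N)
    have "e \<tau> * e (u + of_nat N * \<tau>) = e (u + of_nat (Suc N) * \<tau>)"
      unfolding e_add[symmetric] by (simp add: algebra_simps)
    with log_qpoch_step[OF \<tau> xN[of N]] Suc show ?case by (simp add: mult.assoc)
  qed simp
  have eN: "(\<lambda>N. norm (e (u + of_nat N * \<tau>))) \<longlonglongrightarrow> 0"
    unfolding e_add_nat_mult using tendsto_mult_left[OF LIMSEQ_power_zero[OF norm_e_less_1[OF \<tau>]], of "e u"]
    by (simp add: tendsto_norm_zero)
  have "(\<lambda>N. norm (e (u + of_nat N * \<tau>)) / (1 - norm (e (u + of_nat N * \<tau>))) / (1 - norm (e \<tau>))) \<longlonglongrightarrow> 0 / (1 - 0) / (1 - norm (e \<tau>))"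
    using norm_e_less_1[OF \<tau>] by (intro tendsto_intros eN) auto
  then have "(\<lambda>N. log_qpoch \<tau> (e (u + of_nat N * \<tau>))) \<longlonglongrightarrow> 0"
    by (intro Lim_null_comparison[OF always_eventually[OF allI[OF norm_log_qpoch_le[OF \<tau> xN]]]]) simp
  then have "(\<lambda>N. exp (- log_qpoch \<tau> (e (u + of_nat N * \<tau>)))) \<longlonglongrightarrow> exp (- 0)" by (intro tendsto_intros)
  then have "(\<lambda>N. exp (- log_qpoch \<tau> (e u)) / exp (- log_qpoch \<tau> (e (u + of_nat N * \<tau>)))) \<longlonglongrightarrow> exp (- log_qpoch \<tau> (e u)) / exp (- 0)"
    by (intro tendsto_divide tendsto_const) auto
  moreover have "exp (- log_qpoch \<tau> (e u)) / exp (- log_qpoch \<tau> (e (u + of_nat N * \<tau>))) = (\<Prod>n<N. 1 - e (u + of_nat n * \<tau>))" for N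
    by (subst prod[of N]) simp
  ultimately show "(\<lambda>N. \<Prod>n<N. 1 - e (u + of_nat n * \<tau>)) \<longlonglongrightarrow> exp (- log_qpoch \<tau> (e u))" by simp
qed

text \<open>
  The expansion of \<open>log (k(z) / (2 i sin (\<pi> z)))\<close> in the powers of \<open>q\<close>, which is valid for \<open>\<bar>Im z\<bar> < Im \<tau>\<close>. Its Taylor coefficients
  at \<open>z = 0\<close> are Lambert series, the one of degree 4 being that of \<open>E\<^sub>4\<close>.
\<close>

definition log_klein_term :: "complex \<Rightarrow> nat \<Rightarrow> complex \<Rightarrow> complex" where
  "log_klein_term \<tau> m z = - (e \<tau> ^ Suc m / (of_nat (Suc m) * (1 - e \<tau> ^ Suc m))) * (e (of_nat (Suc m) * z) + e (- of_nat (Suc m) * z) - 2)"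

definition log_klein :: "complex \<Rightarrow> complex \<Rightarrow> complex" where
  "log_klein \<tau> z = (\<Sum>m. log_klein_term \<tau> m z)"

definition log_klein_ball :: "complex \<Rightarrow> complex set" where
  "log_klein_ball \<tau> = ball 0 (Im \<tau> / 2)"

lemma klein_eq_exp:
  assumes \<tau>: "\<tau> \<in> uhp" and z: "z \<in> log_klein_ball \<tau>"
  shows "klein \<tau> z = (e (z / 2) - e (- z / 2)) * exp (log_klein \<tau> z)"
proof -
  have z': "norm z < Im \<tau>" "\<bar>Im z\<bar> < Im \<tau>" using z abs_Im_le_cmod[of z] \<tau> by (auto simp: log_klein_ball_def uhp_def)
  have I: "Im \<tau> > 0" "Im (\<tau> + z) > 0" "Im (\<tau> - z) > 0" using z' \<tau> by (auto simp: uhp_def)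
  then have n: "norm (e \<tau>) < 1" "norm (e (\<tau> + z)) < 1" "norm (e (\<tau> - z)) < 1"
    by (auto intro!: norm_e_less_1 simp: uhp_def)
  have "(\<lambda>m. 2 * (e \<tau> ^ Suc m / (of_nat (Suc m) * (1 - e \<tau> ^ Suc m)))
          - e (\<tau> + z) ^ Suc m / (of_nat (Suc m) * (1 - e \<tau> ^ Suc m))
          - e (\<tau> - z) ^ Suc m / (of_nat (Suc m) * (1 - e \<tau> ^ Suc m)))
       sums (2 * log_qpoch \<tau> (e \<tau>) - log_qpoch \<tau> (e (\<tau> + z)) - log_qpoch \<tau> (e (\<tau> - z)))"
    unfolding log_qpoch_def by (intro sums_diff sums_mult summable_sums log_qpoch_summable \<tau> n)
  moreover have "2 * (e \<tau> ^ Suc m / (of_nat (Suc m) * (1 - e \<tau> ^ Suc m)))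
          - e (\<tau> + z) ^ Suc m / (of_nat (Suc m) * (1 - e \<tau> ^ Suc m))
          - e (\<tau> - z) ^ Suc m / (of_nat (Suc m) * (1 - e \<tau> ^ Suc m)) = log_klein_term \<tau> m z" for m
  proof -
    have "e (\<tau> + z) ^ Suc m = e \<tau> ^ Suc m * e (of_nat (Suc m) * z)"
      by (simp only: e_add power_mult_distrib e_of_nat_mult)
    moreover have "e (\<tau> - z) ^ Suc m = e \<tau> ^ Suc m * e (- of_nat (Suc m) * z)"
      using e_of_nat_mult[of "Suc m" "- z"] e_add[of \<tau> "- z"] by (simp only: power_mult_distrib mult_minus_left mult_minus_right diff_conv_add_uminus)
    moreover have "2 * (E / d) - E * A / d - E * B / d = - (E / d) * (A + B - 2)" for E d A B :: complex
      by (cases "d = 0") (simp_all add: field_simps)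
    ultimately show ?thesis unfolding log_klein_term_def by (simp only:)
  qed
  ultimately have "(\<lambda>m. log_klein_term \<tau> m z) sums (2 * log_qpoch \<tau> (e \<tau>) - log_qpoch \<tau> (e (\<tau> + z)) - log_qpoch \<tau> (e (\<tau> - z)))"
    by (simp only:)
  then have "log_klein \<tau> z = 2 * log_qpoch \<tau> (e \<tau>) - log_qpoch \<tau> (e (\<tau> + z)) - log_qpoch \<tau> (e (\<tau> - z))"
    unfolding log_klein_def by (rule sums_unique[symmetric])
  then have "exp (log_klein \<tau> z) = exp (- log_qpoch \<tau> (e (\<tau> + z))) * exp (- log_qpoch \<tau> (e (\<tau> - z))) * (exp (log_qpoch \<tau> (e \<tau>)))\<^sup>2"
    by (simp only: exp_add[symmetric] exp_double[symmetric]) (simp add: algebra_simps)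
  also have "\<dots> = qpoch \<tau> (\<tau> + z) * qpoch \<tau> (\<tau> - z) / (qpoch \<tau> \<tau>)\<^sup>2"
    unfolding qpoch_eq_exp[OF \<tau> I(1)] qpoch_eq_exp[OF \<tau> I(2)] qpoch_eq_exp[OF \<tau> I(3)] exp_minus power_inverse
    by (simp add: field_simps)
  finally show ?thesis by (simp add: klein_def)
qed

lemma log_klein_uniform_limit:
  assumes \<tau>: "\<tau> \<in> uhp"
  shows "uniform_limit (log_klein_ball \<tau>) (\<lambda>N z. \<Sum>m<N. log_klein_term \<tau> m z) (log_klein \<tau>) sequentially"
  unfolding log_klein_def
proof (rule Weierstrass_m_test)
  define y where "y = Im \<tau>"
  have y: "y > 0" using \<tau> by (simp add: y_def uhp_def)
  define C where "C = 4 / (1 - norm (e \<tau>))"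
  show "summable (\<lambda>m. C * exp (- pi * y) ^ Suc m)"
    using y by (intro summable_mult summable_Suc_iff[THEN iffD2] summable_geometric) simp
  fix m z assume z: "z \<in> log_klein_ball \<tau>"
  have z': "\<bar>Im z\<bar> \<le> y / 2" using z abs_Im_le_cmod[of z] by (auto simp: log_klein_ball_def y_def)
  note q = norm_e_less_1[OF \<tau>]
  define E where "E = exp (pi * y) ^ Suc m"
  have E1: "E \<ge> 1" unfolding E_def using y by (intro one_le_power) simp
  have bd: "norm (e (of_nat (Suc m) * w)) \<le> E" if w: "\<bar>Im w\<bar> \<le> y / 2" for w
  proof -
    have "norm (e w) \<le> exp (pi * y)"
    proof -
      have "- Im w \<le> y / 2" using w by linarith
      then have "2 * pi * (- Im w) \<le> 2 * pi * (y / 2)" by (intro mult_left_mono) auto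
      then show ?thesis by (simp add: norm_e)
    qed
    then have "norm (e w) ^ Suc m \<le> E" unfolding E_def by (intro power_mono) auto
    then show ?thesis by (simp only: e_of_nat_mult norm_power)
  qed
  have "norm (e (of_nat (Suc m) * z) + e (- of_nat (Suc m) * z) - 2) \<le> E + E + 2"
  proof -
    have "norm (A + B - 2) \<le> norm A + norm B + 2" for A B :: complex
      using norm_triangle_ineq4[of "A + B" 2] norm_triangle_ineq[of A B] by simp
    moreover have "of_nat (Suc m) * (- z) = - of_nat (Suc m) * z" by (simp only: mult_minus_right mult_minus_left)
    then have "norm (e (- of_nat (Suc m) * z)) \<le> E" using bd[of "- z"] z' by (simp only: minus_complex.sel uminus_complex.sel abs_minus_cancel)
    moreover have "norm (e (of_nat (Suc m) * z)) \<le> E" by (rule bd[OF z'])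
    ultimately show ?thesis by (meson add_mono order_trans order_refl)
  qed
  also have "\<dots> \<le> 4 * E" using E1 by simp
  finally have 1: "norm (e (of_nat (Suc m) * z) + e (- of_nat (Suc m) * z) - 2) \<le> 4 * E" .
  have "norm (log_klein_term \<tau> m z) \<le> norm (e \<tau>) ^ Suc m / (1 - norm (e \<tau>)) * (4 * E)"
    unfolding log_klein_term_def norm_mult norm_minus_cancel by (intro mult_mono 1 log_qpoch_term_le[OF \<tau>]) (use q in auto)
  also have "\<dots> = C * (norm (e \<tau>) * exp (pi * y)) ^ Suc m" by (simp only: power_mult_distrib E_def C_def) simp
  also have "norm (e \<tau>) * exp (pi * y) = exp (- pi * y)"
    by (simp add: norm_e y_def exp_add[symmetric])
  finally show "norm (log_klein_term \<tau> m z) \<le> C * exp (- pi * y) ^ Suc m" .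
qed

lemma log_klein_term_holomorphic: "log_klein_term \<tau> m holomorphic_on A"
  unfolding log_klein_term_def by (intro holomorphic_intros)

lemma open_log_klein_ball [simp]: "open (log_klein_ball \<tau>)" by (simp add: log_klein_ball_def)

lemma zero_log_klein_ball: "\<tau> \<in> uhp \<Longrightarrow> 0 \<in> log_klein_ball \<tau>" by (simp add: log_klein_ball_def uhp_def)

lemma log_klein_holomorphic:
  assumes \<tau>: "\<tau> \<in> uhp"
  shows "log_klein \<tau> holomorphic_on log_klein_ball \<tau>"
proof (rule holomorphic_uniform_sequence[OF open_log_klein_ball])
  show "(\<lambda>z. \<Sum>m<N. log_klein_term \<tau> m z) holomorphic_on log_klein_ball \<tau>" for N by (intro holomorphic_intros log_klein_term_holomorphic)
  fix z assume "z \<in> log_klein_ball \<tau>"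
  then obtain d where "d > 0" "cball z d \<subseteq> log_klein_ball \<tau>" using open_log_klein_ball open_contains_cball by blast
  then show "\<exists>d>0. cball z d \<subseteq> log_klein_ball \<tau> \<and> uniform_limit (cball z d) (\<lambda>N z. \<Sum>m<N. log_klein_term \<tau> m z) (log_klein \<tau>) sequentially"
    using uniform_limit_on_subset[OF log_klein_uniform_limit[OF \<tau>]] by blast
qed

lemma higher_deriv_e: "(deriv ^^ n) (\<lambda>z. e (c * z)) = (\<lambda>z. (2 * of_real pi * \<i> * c) ^ n * e (c * z))"
proof (induction n)
  case (Suc n)
  have "deriv (\<lambda>z. (2 * of_real pi * \<i> * c) ^ n * e (c * z)) z = (2 * of_real pi * \<i> * c) ^ Suc n * e (c * z)" for z
    unfolding e_def by (rule DERIV_imp_deriv) (auto intro!: derivative_eq_intros simp: algebra_simps)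
  then show ?case using Suc by simp
qed simp

definition E4sum :: "complex \<Rightarrow> complex" where
  "E4sum \<tau> = (\<Sum>m. of_nat (Suc m) ^ 3 * e \<tau> ^ Suc m / (1 - e \<tau> ^ Suc m))"

lemma cube_geometric_summable:
  fixes x :: real
  assumes "0 \<le> x" "x < 1"
  shows "summable (\<lambda>m. real (Suc m) ^ 3 * x ^ Suc m)"
proof (rule summable_comparison_test')
  have 1: "summable (\<lambda>n. diffs (\<lambda>_. 1) n * w ^ n)" if "norm w < 1" for w :: real
    by (rule termdiff_converges[OF that]) (simp add: summable_geometric)
  have 2: "summable (\<lambda>n. diffs (diffs (\<lambda>_. 1)) n * w ^ n)" if "norm w < 1" for w :: real
    by (rule termdiff_converges[OF that 1])
  have "norm x < 1" using assms by simp
  then have "summable (\<lambda>n. diffs (diffs (diffs (\<lambda>_. 1))) n * x ^ n)"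
    by (rule termdiff_converges[OF _ 2])
  then show "summable (\<lambda>n. diffs (diffs (diffs (\<lambda>_. 1))) n * x ^ n)" .
  fix m :: nat
  have "real (Suc m) ^ 3 \<le> real (Suc m) * (real (Suc (Suc m)) * real (Suc (Suc (Suc m))))"
    unfolding power3_eq_cube mult.assoc by (intro mult_mono) auto
  moreover have "x ^ Suc m \<le> x ^ m" using assms by (simp add: mult_left_le_one_le)
  ultimately show "norm (real (Suc m) ^ 3 * x ^ Suc m) \<le> diffs (diffs (diffs (\<lambda>_. 1))) m * x ^ m"
  proof -
    have "norm (real (Suc m) ^ 3 * x ^ Suc m) = real (Suc m) ^ 3 * x ^ Suc m"
      unfolding real_norm_def by (rule abs_of_nonneg) (use assms in simp)
    also have "\<dots> \<le> (real (Suc m) * (real (Suc (Suc m)) * real (Suc (Suc (Suc m))))) * x ^ m"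
      by (rule mult_mono) (fact, fact, use assms in simp_all)
    finally show ?thesis by (simp only: diffs_def mult_1_right mult.assoc)
  qed
qed

lemma E4sum_term_le:
  assumes \<tau>: "\<tau> \<in> uhp"
  shows "norm (of_nat (Suc m) ^ 3 * e \<tau> ^ Suc m / (1 - e \<tau> ^ Suc m)) \<le> real (Suc m) ^ 3 * norm (e \<tau>) ^ Suc m / (1 - norm (e \<tau>))"
proof -
  note q = norm_1_minus_power_ge[OF \<tau>, of m] norm_e_less_1[OF \<tau>]
  have "norm (of_nat (Suc m) ^ 3 * e \<tau> ^ Suc m) / norm (1 - e \<tau> ^ Suc m) \<le> norm (of_nat (Suc m) ^ 3 * e \<tau> ^ Suc m) / (1 - norm (e \<tau>))"
    using q by (intro divide_left_mono mult_pos_pos) auto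
  then show ?thesis by (simp only: norm_divide norm_mult norm_power norm_of_nat)
qed

text \<open>
  Each derivative of \<open>e (n z)\<close> contributes a factor \<open>2 \<pi> i n\<close>, so four of them turn \<open>q\<^sup>n / (n (1 - q\<^sup>n))\<close> into the
  general term of the Lambert series.
\<close>

lemma log_klein_deriv4:
  assumes \<tau>: "\<tau> \<in> uhp"
  shows "(deriv ^^ 4) (log_klein \<tau>) 0 = - 32 * of_real pi ^ 4 * E4sum \<tau>"
proof -
  have d: "(deriv ^^ 4) (log_klein_term \<tau> m) 0 = - 32 * of_real pi ^ 4 * (of_nat (Suc m) ^ 3 * e \<tau> ^ Suc m / (1 - e \<tau> ^ Suc m))" for m
  proof -
    define n where "n = (of_nat (Suc m) :: complex)"
    define c where "c = - (e \<tau> ^ Suc m / (n * (1 - e \<tau> ^ Suc m)))"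
    have n: "n \<noteq> 0" unfolding n_def by (simp only: of_nat_eq_0_iff)
    have "(deriv ^^ 4) (\<lambda>z. c * (e (n * z) + e (- n * z) - 2)) 0 = c * (deriv ^^ 4) (\<lambda>z. e (n * z) + e (- n * z) - 2) 0"
      by (rule higher_deriv_cmult[of _ UNIV]) (auto intro!: holomorphic_intros)
    also have "(deriv ^^ 4) (\<lambda>z. e (n * z) + e (- n * z) - 2) 0 = (deriv ^^ 4) (\<lambda>z. e (n * z) + e (- n * z)) 0 - (deriv ^^ 4) (\<lambda>z. 2) 0"
      by (rule higher_deriv_diff[of _ UNIV]) (auto intro!: holomorphic_intros)
    also have "(deriv ^^ 4) (\<lambda>z. e (n * z) + e (- n * z)) 0 = (deriv ^^ 4) (\<lambda>z. e (n * z)) 0 + (deriv ^^ 4) (\<lambda>z. e (- n * z)) 0"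
      by (rule higher_deriv_add[of _ UNIV]) (auto intro!: holomorphic_intros)
    finally have "(deriv ^^ 4) (\<lambda>z. c * (e (n * z) + e (- n * z) - 2)) 0 = c * (32 * of_real pi ^ 4 * n ^ 4)"
      unfolding higher_deriv_e by (simp add: power_mult_distrib)
    moreover have "c * (32 * of_real pi ^ 4 * n ^ 4) = - 32 * of_real pi ^ 4 * (n ^ 3 * e \<tau> ^ Suc m / (1 - e \<tau> ^ Suc m))"
      using n by (simp add: c_def power4_eq_xxxx power3_eq_cube)
    ultimately show ?thesis unfolding log_klein_term_def[abs_def] n_def c_def by simp
  qed
  have "(\<lambda>N. (deriv ^^ 4) (\<lambda>z. \<Sum>m<N. log_klein_term \<tau> m z) 0) \<longlonglongrightarrow> (deriv ^^ 4) (log_klein \<tau>) 0"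
    by (rule higher_deriv_complex_uniform_limit[OF log_klein_uniform_limit[OF \<tau>] _ _ open_log_klein_ball zero_log_klein_ball[OF \<tau>]])
       (auto intro!: always_eventually holomorphic_intros log_klein_term_holomorphic)
  moreover have "(deriv ^^ 4) (\<lambda>z. \<Sum>m<N. log_klein_term \<tau> m z) 0 = (\<Sum>m<N. (deriv ^^ 4) (log_klein_term \<tau> m) 0)" for N
  proof (induction N)
    case (Suc N)
    have "(deriv ^^ 4) (\<lambda>z. (\<Sum>m<N. log_klein_term \<tau> m z) + log_klein_term \<tau> N z) 0 = (deriv ^^ 4) (\<lambda>z. \<Sum>m<N. log_klein_term \<tau> m z) 0 + (deriv ^^ 4) (log_klein_term \<tau> N) 0"
      by (rule higher_deriv_add[of _ UNIV]) (auto intro!: holomorphic_intros log_klein_term_holomorphic)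
    then show ?case using Suc by simp
  qed simp
  ultimately have "(\<lambda>N. \<Sum>m<N. - 32 * of_real pi ^ 4 * (of_nat (Suc m) ^ 3 * e \<tau> ^ Suc m / (1 - e \<tau> ^ Suc m))) \<longlonglongrightarrow> (deriv ^^ 4) (log_klein \<tau>) 0"
    by (simp only: d)
  then have 1: "(\<lambda>m. - 32 * of_real pi ^ 4 * (of_nat (Suc m) ^ 3 * e \<tau> ^ Suc m / (1 - e \<tau> ^ Suc m))) sums (deriv ^^ 4) (log_klein \<tau>) 0"
    by (simp only: sums_def)
  have "summable (\<lambda>m. of_nat (Suc m) ^ 3 * e \<tau> ^ Suc m / (1 - e \<tau> ^ Suc m))"
    by (rule summable_comparison_test'[OF summable_divide[OF cube_geometric_summable] E4sum_term_le[OF \<tau>]])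
       (use norm_e_less_1[OF \<tau>] in auto)
  from sums_mult[OF summable_sums[OF this], of "- 32 * of_real pi ^ 4"] 1
  show ?thesis unfolding E4sum_def[symmetric] by (rule sums_unique2[symmetric])
qed

lemma fps_unique: "f has_fps_expansion F \<Longrightarrow> f has_fps_expansion G \<Longrightarrow> F = (G :: complex fps)"
  by (intro fps_ext) (simp add: fps_nth_fps_expansion)

text \<open>
  The logarithm of \<open>sin (\<pi> z) / (t sin (\<pi> z / t))\<close> to degree 4, found by comparing power series; the logarithm
  itself enters through \<open>deriv (exp h) = exp h * deriv h\<close>.
\<close>

lemma log_sine_quotient:
  assumes h: "h holomorphic_on ball 0 r" "r > 0" and t: "t \<noteq> 0"
    and eq: "\<And>z. z \<in> ball 0 r \<Longrightarrow> exp (h z) * (t * sin (of_real pi / t * z)) = sin (of_real pi * z)"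
  shows "(deriv ^^ 4) h 0 = 2 / 15 * of_real pi ^ 4 * (1 / t ^ 4 - 1)"
proof -
  define P where "P = complex_of_real pi"
  have P: "P \<noteq> 0" by (simp add: P_def)
  have ev: "\<forall>\<^sub>F z in nhds 0. z \<in> ball 0 r" using h(2) by (intro eventually_nhds_in_open) auto
  have ha: "h analytic_on {0}" using h by (intro analytic_at[THEN iffD2] exI[of _ "ball 0 r"]) auto
  define H where "H = fps_expansion h 0"
  define A where "A = fps_expansion (\<lambda>z. exp (h z)) 0"
  have fH: "h has_fps_expansion H" unfolding H_def by (rule analytic_at_imp_has_fps_expansion_0[OF ha])
  have fA: "(\<lambda>z. exp (h z)) has_fps_expansion A" unfolding A_def
    by (rule analytic_at_imp_has_fps_expansion_0) (intro analytic_intros ha)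
  have "(\<lambda>z. exp (h z) * (t * sin (P / t * z))) has_fps_expansion A * (fps_const t * fps_sin (P / t))"
    by (intro has_fps_expansion_mult fA has_fps_expansion_const has_fps_expansion_sin)
  then have "(\<lambda>z. sin (P * z)) has_fps_expansion A * (fps_const t * fps_sin (P / t))"
    by (subst (asm) has_fps_expansion_cong[OF eventually_mono[OF ev] refl]) (use eq in \<open>auto simp: P_def\<close>)
  from fps_unique[OF this has_fps_expansion_sin]
  have E1: "A * (fps_const t * fps_sin (P / t)) = fps_sin P" .
  have D: "(\<lambda>z. deriv (\<lambda>z. exp (h z)) z) has_fps_expansion fps_deriv A" by (rule has_fps_expansion_deriv[OF fA])
  have "(\<lambda>z. deriv h z * exp (h z)) has_fps_expansion fps_deriv H * A"
    by (intro has_fps_expansion_mult has_fps_expansion_deriv fH fA)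
  moreover have "\<forall>\<^sub>F z in nhds 0. deriv h z * exp (h z) = deriv (\<lambda>z. exp (h z)) z"
    using ev
  proof eventually_elim
    case (elim z)
    have "(h has_field_derivative deriv h z) (at z)"
      by (rule holomorphic_derivI[OF h(1) open_ball elim])
    then have "((\<lambda>z. exp (h z)) has_field_derivative exp (h z) * deriv h z) (at z)"
      by (auto intro!: derivative_eq_intros)
    from DERIV_imp_deriv[OF this] show ?case by simp
  qed
  ultimately have "(\<lambda>z. deriv (\<lambda>z. exp (h z)) z) has_fps_expansion fps_deriv H * A"
    by (subst (asm) has_fps_expansion_cong[OF _ refl]) auto
  from fps_unique[OF D this] have E2: "fps_deriv A = fps_deriv H * A" .
  define a where "a n = fps_nth A n" for n
  define b where "b n = fps_nth H n" for n
  have s: "fps_nth (fps_sin c) 0 = 0" "fps_nth (fps_sin c) 1 = c" "fps_nth (fps_sin c) 2 = 0" "fps_nth (fps_sin c) 3 = - (c ^ 3) / 6"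
    "fps_nth (fps_sin c) 4 = 0" "fps_nth (fps_sin c) 5 = c ^ 5 / 120" for c :: complex
    by (simp_all add: fps_sin_def fact_numeral)
  define B where "B = fps_const t * fps_sin (P / t)"
  have B: "fps_nth B 0 = 0" "fps_nth B 1 = P" "fps_nth B 2 = 0" "fps_nth B 3 = - (P ^ 3 / t ^ 2) / 6"
    "fps_nth B 4 = 0" "fps_nth B 5 = P ^ 5 / t ^ 4 / 120"
    unfolding B_def fps_mult_left_const_nth s using t by (simp_all add: field_simps eval_nat_numeral)
  have AB: "fps_nth A 0 * fps_nth B n + (\<Sum>i=1..n. fps_nth A i * fps_nth B (n - i)) = fps_nth (fps_sin P) n" for n
    unfolding E1[symmetric] B_def[symmetric] fps_mult_nth by (simp add: sum.atLeast_Suc_atMost)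
  have rng: "{1..1 :: nat} = {1}" "{1..2 :: nat} = {1, 2}" "{1..3 :: nat} = {1, 2, 3}" "{1..4 :: nat} = {1, 2, 3, 4}" "{1..5 :: nat} = {1, 2, 3, 4, 5}"
    by auto
  have a0: "a 0 = 1" using AB[of 1] P unfolding rng s B by (simp add: a_def B)
  have a1: "a 1 = 0" using AB[of 2] P unfolding rng s B by (simp add: a_def B[unfolded One_nat_def])
  have a2: "a 2 = (P ^ 2 / t ^ 2 - P ^ 2) / 6"
  proof -
    have "a 0 * (- (P ^ 3 / t ^ 2) / 6) + a 2 * P = - (P ^ 3) / 6"
      using AB[of 3] unfolding rng s B by (simp add: a_def B[unfolded One_nat_def])
    from add_implies_diff[OF this[unfolded add.commute[of "a 0 * _"]]]
    have "a 2 * P = - (P ^ 3) / 6 - 1 * (- (P ^ 3 / t ^ 2) / 6)" unfolding a0 .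
    then have "a 2 = (- (P ^ 3) / 6 - 1 * (- (P ^ 3 / t ^ 2) / 6)) / P" using P by (simp add: eq_divide_eq)
    also have "\<dots> = (P ^ 2 / t ^ 2 - P ^ 2) / 6" using P t by (simp add: field_simps power2_eq_square power3_eq_cube)
    finally show ?thesis .
  qed
  have a3: "a 3 = 0" using AB[of 4] P a1 unfolding rng s B by (simp add: a_def B[unfolded One_nat_def])
  have a4: "a 4 = P ^ 4 / 120 - P ^ 4 / t ^ 4 / 120 + a 2 * (P ^ 2 / t ^ 2) / 6"
  proof -
    have key: "1 * (u * P) + (x * (- (v * P) / 6) + y * P) = w * P \<Longrightarrow> y * P = (w - u + x * v / 6) * P" for u v w x y :: complex
      by (simp add: algebra_simps)
    have pw: "P ^ 5 / t ^ 4 / 120 = P ^ 4 / t ^ 4 / 120 * P" "P ^ 3 / t ^ 2 = P ^ 2 / t ^ 2 * P" "P ^ 5 / 120 = P ^ 4 / 120 * P"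
      by (simp_all add: power_numeral_reduce)
    have "a 0 * (P ^ 5 / t ^ 4 / 120) + (a 2 * (- (P ^ 3 / t ^ 2) / 6) + a 4 * P) = P ^ 5 / 120"
      using AB[of 5] unfolding rng s B by (simp add: a_def B[unfolded One_nat_def] add_ac)
    from key[OF this[unfolded a0 pw]]
    have "a 4 * P = (P ^ 4 / 120 - P ^ 4 / t ^ 4 / 120 + a 2 * (P ^ 2 / t ^ 2) / 6) * P" .
    then show ?thesis using P by simp
  qed
  have dA: "of_nat (Suc n) * a (Suc n) = (\<Sum>i=0..n. of_nat (Suc i) * b (Suc i) * a (n - i))" for n
    using arg_cong[OF E2, of "\<lambda>F. fps_nth F n"] by (simp add: fps_mult_nth a_def b_def)
  have rng0: "{0..0 :: nat} = {0}" "{0..1 :: nat} = {0, 1}" "{0..2 :: nat} = {0, 1, 2}" "{0..3 :: nat} = {0, 1, 2, 3}" by auto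
  have b1: "b 1 = 0" using dA[of 0] a0 a1 unfolding rng0 by simp
  have b2: "b 2 = a 2" using dA[of 1] a0 a1 b1 unfolding rng0 by (simp add: numeral_2_eq_2)
  have "4 * a 4 = b 1 * a 3 + 2 * b 2 * a 2 + 3 * b 3 * a 1 + 4 * b 4 * a 0"
    using dA[of 3] unfolding rng0 by (simp add: eval_nat_numeral)
  then have "4 * b 4 = 4 * (a 4 - (a 2)\<^sup>2 / 2)"
    unfolding b1 b2 a0 a1 a3 by (simp add: right_diff_distrib power2_eq_square)
  then have "b 4 = a 4 - (a 2)\<^sup>2 / 2" by (simp only: mult_cancel_left) simp
  also have "\<dots> = 1 / 180 * P ^ 4 * (1 / t ^ 4 - 1)"
    unfolding a4 a2 using t by (simp add: field_simps eval_nat_numeral)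
  finally have b4: "b 4 = 1 / 180 * P ^ 4 * (1 / t ^ 4 - 1)" .
  have "b 4 = (deriv ^^ 4) h 0 / fact 4"
    unfolding b_def by (rule fps_nth_fps_expansion[OF fH])
  then have "(deriv ^^ 4) h 0 = 24 * b 4" by (simp add: fact_numeral mult.commute[of 24])
  also have "\<dots> = 24 * (1 / 180 * P ^ 4 * (1 / t ^ 4 - 1))" by (simp only: b4)
  also have "\<dots> = 24 * (1 / 180) * P ^ 4 * (1 / t ^ 4 - 1)" by (simp only: mult.assoc)
  also have "24 * (1 / 180) = (2 / 15 :: complex)" by simp
  finally show ?thesis by (simp only: P_def)
qed

text \<open>
  By the inversion formula for \<open>k\<close>, the function \<open>log_klein\<close> changes under \<open>\<tau> \<mapsto> - 1 / \<tau>\<close> by a quadratic term and the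
  logarithm of a quotient of sines. In degree 4 the quadratic term is invisible and the sines give the constant term of
  \<open>E\<^sub>4\<close>.
\<close>

lemma E4sum_S:
  assumes \<tau>: "\<tau> \<in> uhp"
  shows "1 + 240 * E4sum (- 1 / \<tau>) = \<tau> ^ 4 * (1 + 240 * E4sum \<tau>)"
proof -
  have nz: "\<tau> \<noteq> 0" by (rule uhp_nz[OF \<tau>])
  have \<tau>': "- 1 / \<tau> \<in> uhp" by (rule uhp_neg_inverse[OF \<tau>])
  define r where "r = min (Im \<tau> / 2) (norm \<tau> * (Im (- 1 / \<tau>) / 2))"
  have "Im (- 1 / \<tau>) / 2 > 0" by (rule half_gt_zero) (use \<tau>' in \<open>simp only: uhp_def mem_Collect_eq\<close>)
  then have "norm \<tau> * (Im (- 1 / \<tau>) / 2) > 0" using nz by (intro mult_pos_pos) auto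
  then have r: "r > 0" using \<tau> by (simp only: r_def uhp_def mem_Collect_eq min_less_iff_conj half_gt_zero_iff)
  have b1: "z \<in> log_klein_ball \<tau>" if "z \<in> ball 0 r" for z :: complex using that by (simp add: log_klein_ball_def r_def)
  have b2: "1 / \<tau> * z \<in> log_klein_ball (- 1 / \<tau>)" if "z \<in> ball 0 r" for z :: complex
  proof -
    have "norm z < norm \<tau> * (Im (- 1 / \<tau>) / 2)" using that by (simp add: r_def)
    then show ?thesis using nz by (simp add: log_klein_ball_def norm_divide field_simps)
  qed
  define h where "h z = log_klein (- 1 / \<tau>) (1 / \<tau> * z) - log_klein \<tau> z - of_real pi * \<i> / \<tau> * z\<^sup>2" for z
  have hol1: "(\<lambda>z. log_klein (- 1 / \<tau>) (1 / \<tau> * z)) holomorphic_on ball 0 r"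
    by (rule holomorphic_on_compose_gen[OF _ log_klein_holomorphic[OF \<tau>'], of "\<lambda>z. 1 / \<tau> * z", unfolded o_def])
       (use b2 in \<open>auto intro!: holomorphic_intros\<close>)
  have hol2: "log_klein \<tau> holomorphic_on ball 0 r"
    by (rule holomorphic_on_subset[OF log_klein_holomorphic[OF \<tau>]]) (use b1 in auto)
  have hol3: "(\<lambda>z. of_real pi * \<i> / \<tau> * z\<^sup>2) holomorphic_on ball 0 r" by (intro holomorphic_intros)
  have sin: "e (w / 2) - e (- w / 2) = 2 * \<i> * sin (of_real pi * w)" for w :: complex
    by (simp add: e_def sin_exp_eq field_simps)
  have "(deriv ^^ 4) h 0 = 2 / 15 * of_real pi ^ 4 * (1 / \<tau> ^ 4 - 1)"
  proof (rule log_sine_quotient[OF _ r nz])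
    show "h holomorphic_on ball 0 r" unfolding h_def by (intro holomorphic_on_diff hol1 hol2 hol3)
    fix z :: complex assume z: "z \<in> ball 0 r"
    have eq1: "z / \<tau> = 1 / \<tau> * z" by simp
    have "2 * \<i> * sin (of_real pi * (1 / \<tau> * z)) * exp (log_klein (- 1 / \<tau>) (1 / \<tau> * z)) = e (z\<^sup>2 / (2 * \<tau>)) * (2 * \<i> * sin (of_real pi * z) * exp (log_klein \<tau> z)) / \<tau>"
      using klein_S[OF \<tau>, of z] unfolding eq1 klein_eq_exp[OF \<tau> b1[OF z]] klein_eq_exp[OF \<tau>' b2[OF z]] sin .
    then have "\<tau> * sin (of_real pi * (1 / \<tau> * z)) * exp (log_klein (- 1 / \<tau>) (1 / \<tau> * z)) = e (z\<^sup>2 / (2 * \<tau>)) * (sin (of_real pi * z) * exp (log_klein \<tau> z))"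
      using nz by (simp add: field_simps)
    moreover have "e (z\<^sup>2 / (2 * \<tau>)) = exp (of_real pi * \<i> / \<tau> * z\<^sup>2)" by (simp add: e_def mult.assoc)
    ultimately have *: "\<tau> * sin (of_real pi * (1 / \<tau> * z)) * exp (log_klein (- 1 / \<tau>) (1 / \<tau> * z)) = exp (of_real pi * \<i> / \<tau> * z\<^sup>2) * (sin (of_real pi * z) * exp (log_klein \<tau> z))"
      by (simp only:)
    have "exp (h z) = exp (log_klein (- 1 / \<tau>) (1 / \<tau> * z)) / exp (log_klein \<tau> z) / exp (of_real pi * \<i> / \<tau> * z\<^sup>2)"
      by (simp only: h_def exp_diff)
    moreover have "of_real pi / \<tau> * z = of_real pi * (1 / \<tau> * z)" by simp
    ultimately have "exp (h z) * (\<tau> * sin (of_real pi / \<tau> * z)) = (\<tau> * sin (of_real pi * (1 / \<tau> * z)) * exp (log_klein (- 1 / \<tau>) (1 / \<tau> * z))) / (exp (log_klein \<tau> z) * exp (of_real pi * \<i> / \<tau> * z\<^sup>2))"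
      by (simp only:) (simp add: mult_ac)
    then show "exp (h z) * (\<tau> * sin (of_real pi / \<tau> * z)) = sin (of_real pi * z)"
      unfolding * by simp
  qed
  moreover have "(deriv ^^ 4) h 0 = - 32 * of_real pi ^ 4 * (E4sum (- 1 / \<tau>) / \<tau> ^ 4 - E4sum \<tau>)"
  proof -
    have o: "open (ball (0 :: complex) r)" "0 \<in> ball (0 :: complex) r" using r by auto
    have "(deriv ^^ 4) h 0 = (deriv ^^ 4) (\<lambda>z. log_klein (- 1 / \<tau>) (1 / \<tau> * z) - log_klein \<tau> z) 0 - (deriv ^^ 4) (\<lambda>z. of_real pi * \<i> / \<tau> * z\<^sup>2) 0"
      unfolding h_def by (rule higher_deriv_diff[OF holomorphic_on_diff[OF hol1 hol2] hol3 o])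
    also have "(deriv ^^ 4) (\<lambda>z. log_klein (- 1 / \<tau>) (1 / \<tau> * z) - log_klein \<tau> z) 0 = (deriv ^^ 4) (\<lambda>z. log_klein (- 1 / \<tau>) (1 / \<tau> * z)) 0 - (deriv ^^ 4) (log_klein \<tau>) 0"
      by (rule higher_deriv_diff[OF hol1 hol2 o])
    also have "(deriv ^^ 4) (\<lambda>z. log_klein (- 1 / \<tau>) (1 / \<tau> * z)) 0 = (1 / \<tau>) ^ 4 * (deriv ^^ 4) (log_klein (- 1 / \<tau>)) (1 / \<tau> * 0)"
      by (rule higher_deriv_compose_linear[OF log_klein_holomorphic[OF \<tau>'] o(1) open_log_klein_ball o(2) b2])
    also have "(deriv ^^ 4) (\<lambda>z. of_real pi * \<i> / \<tau> * z\<^sup>2) 0 = 0"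
    proof -
      have "(deriv ^^ 4) (\<lambda>z. c * z\<^sup>2) 0 = 0" for c :: complex
      proof -
        have 1: "deriv (\<lambda>z. c * z\<^sup>2) = (\<lambda>z. 2 * c * z)"
          by (rule ext, rule DERIV_imp_deriv) (auto intro!: derivative_eq_intros)
        have 2: "deriv (\<lambda>z. 2 * c * z) = (\<lambda>z. 2 * c)"
          by (rule ext, rule DERIV_imp_deriv) (auto intro!: derivative_eq_intros)
        show ?thesis by (simp add: eval_nat_numeral funpow_swap1 1[unfolded power2_eq_square] 2)
      qed
      then show ?thesis .
    qed
    finally show ?thesis unfolding mult_zero_right log_klein_deriv4[OF \<tau>] log_klein_deriv4[OF \<tau>'] by (simp add: field_simps)
  qed
  ultimately have "of_real pi ^ 4 * (- 32 * (E4sum (- 1 / \<tau>) / \<tau> ^ 4 - E4sum \<tau>)) = of_real pi ^ 4 * (2 / 15 * (1 / \<tau> ^ 4 - 1))"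
    by (simp only: mult_ac)
  then have "- 32 * (E4sum (- 1 / \<tau>) / \<tau> ^ 4 - E4sum \<tau>) = 2 / 15 * (1 / \<tau> ^ 4 - 1)"
    by (subst (asm) mult_left_cancel) auto
  then have "15 / 2 * (- 32 * (E4sum (- 1 / \<tau>) / \<tau> ^ 4 - E4sum \<tau>)) = 15 / 2 * (2 / 15 * (1 / \<tau> ^ 4 - 1))"
    by (simp only:)
  then have "240 * (E4sum (- 1 / \<tau>) / \<tau> ^ 4) = 240 * E4sum \<tau> - (1 / \<tau> ^ 4 - 1)"
    by (simp add: algebra_simps)
  then have "\<tau> ^ 4 * (240 * (E4sum (- 1 / \<tau>) / \<tau> ^ 4)) = \<tau> ^ 4 * (240 * E4sum \<tau> - (1 / \<tau> ^ 4 - 1))"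
    by (simp only:)
  then show ?thesis using nz by (simp add: algebra_simps)
qed

lemma E4sum_summable:
  assumes \<tau>: "\<tau> \<in> uhp"
  shows "summable (\<lambda>m. norm (of_nat (Suc m) ^ 3 * e \<tau> ^ Suc m / (1 - e \<tau> ^ Suc m)))"
proof (rule summable_comparison_test')
  show "summable (\<lambda>m. real (Suc m) ^ 3 * norm (e \<tau>) ^ Suc m / (1 - norm (e \<tau>)))"
    using norm_e_less_1[OF \<tau>] by (intro summable_divide cube_geometric_summable) auto
  show "norm (norm (of_nat (Suc m) ^ 3 * e \<tau> ^ Suc m / (1 - e \<tau> ^ Suc m))) \<le> real (Suc m) ^ 3 * norm (e \<tau>) ^ Suc m / (1 - norm (e \<tau>))" for m
    unfolding real_norm_def abs_norm_cancel by (rule E4sum_term_le[OF \<tau>])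
qed

lemma E4sum_has_sum:
  assumes \<tau>: "\<tau> \<in> uhp"
  shows "((\<lambda>m. of_nat (Suc m) ^ 3 * e \<tau> ^ Suc m / (1 - e \<tau> ^ Suc m)) has_sum E4sum \<tau>) UNIV"
  unfolding E4sum_def
  by (rule norm_summable_imp_has_sum[OF E4sum_summable[OF \<tau>] summable_sums[OF summable_norm_cancel[OF E4sum_summable[OF \<tau>]]]])

text \<open>
  Both are the sum of \<open>d\<^sup>3 q\<^sup>d\<^sup>j\<close> over pairs \<open>d, j \<ge> 1\<close>, ordered differently.
\<close>

lemma E4_eq_E4sum:
  assumes \<tau>: "\<tau> \<in> uhp"
  shows "E4 \<tau> = 1 + 240 * E4sum \<tau>"
proof -
  define q where "q = e \<tau>"
  have q: "norm q < 1" unfolding q_def by (rule norm_e_less_1[OF \<tau>])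
  define f where "f p = of_nat (Suc (fst p)) ^ 3 * q ^ (Suc (fst p) * Suc (snd p))" for p :: "nat \<times> nat"
  have geo: "((\<lambda>j. c * x ^ j) has_sum c * (1 / (1 - x))) UNIV" if "norm x < 1" for c x :: "'a :: {real_normed_field, banach}"
  proof (rule has_sum_cmult_right, rule norm_summable_imp_has_sum)
    show "summable (\<lambda>n. norm (x ^ n))" unfolding norm_power using that by (intro summable_geometric) simp
    show "(\<lambda>n. x ^ n) sums (1 / (1 - x))" by (rule geometric_sums[OF that])
  qed
  have sf: "f summable_on UNIV \<times> UNIV"
  proof (rule abs_summable_summable, rule summable_on_comparison_test)
    define g where "g p = real (Suc (fst p)) ^ 3 * norm q ^ Suc (fst p) * norm q ^ snd p" for p :: "nat \<times> nat"
    show "g summable_on UNIV \<times> UNIV"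
    proof (rule summable_on_SigmaI)
      fix m :: nat
      show "((\<lambda>j. g (m, j)) has_sum real (Suc m) ^ 3 * norm q ^ Suc m * (1 / (1 - norm q))) UNIV"
        unfolding g_def fst_conv snd_conv by (rule geo) (use q in simp)
    next
      have "summable (\<lambda>m. real (Suc m) ^ 3 * norm q ^ Suc m * (1 / (1 - norm q)))"
        using q by (intro summable_mult2 cube_geometric_summable) auto
      then show "(\<lambda>m. real (Suc m) ^ 3 * norm q ^ Suc m * (1 / (1 - norm q))) summable_on UNIV"
        by (intro norm_summable_imp_summable_on) (use q in \<open>simp add: abs_mult\<close>)
    qed (simp add: g_def)
    fix p :: "nat \<times> nat"
    have "Suc (fst p) + snd p \<le> Suc (fst p) * Suc (snd p)" by simp
    then have "norm q ^ (Suc (fst p) * Suc (snd p)) \<le> norm q ^ (Suc (fst p) + snd p)"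
      using q by (intro power_decreasing) auto
    then have "real (Suc (fst p)) ^ 3 * norm q ^ (Suc (fst p) * Suc (snd p)) \<le> real (Suc (fst p)) ^ 3 * norm q ^ (Suc (fst p) + snd p)"
      by (intro mult_left_mono) auto
    then show "norm (f p) \<le> g p"
      by (simp only: f_def g_def norm_mult norm_power norm_of_nat power_add mult.assoc)
  qed simp
  have "E4sum \<tau> = infsum (\<lambda>m. infsum (\<lambda>j. f (m, j)) UNIV) UNIV"
  proof -
    have "infsum (\<lambda>j. f (m, j)) UNIV = of_nat (Suc m) ^ 3 * q ^ Suc m / (1 - q ^ Suc m)" for m
    proof -
      have "norm (q ^ Suc m) < 1" unfolding norm_power using q by (simp add: power_less_one_iff del: power_Suc)
      from infsumI[OF geo[OF this, of "of_nat (Suc m) ^ 3 * q ^ Suc m"]]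
      show ?thesis by (simp only: f_def fst_conv snd_conv mult_Suc_right power_add power_mult mult.assoc times_divide_eq_right mult_1_right)
    qed
    then show ?thesis using infsumI[OF E4sum_has_sum[OF \<tau>]] by (simp only: q_def)
  qed
  also have "\<dots> = infsum f (UNIV \<times> UNIV)" by (rule infsum_Sigma_banach[OF sf])
  finally have 1: "E4sum \<tau> = infsum f (UNIV \<times> UNIV)" .
  let ?T = "Sigma UNIV (\<lambda>N :: nat. {d. d dvd Suc N})"
  define G where "G p = of_nat (snd p) ^ 3 * q ^ Suc (fst p)" for p :: "nat \<times> nat"
  define \<phi> where "\<phi> p = (Suc (fst p) * Suc (snd p) - 1, Suc (fst p))" for p :: "nat \<times> nat"
  have bij: "bij_betw \<phi> (UNIV \<times> UNIV) ?T"
  proof (rule bij_betwI[where g = "\<lambda>p. (snd p - 1, Suc (fst p) div snd p - 1)"])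
    have S: "Suc (Suc m * Suc j - 1) = Suc m * Suc j" for m j by simp
    show "\<phi> \<in> UNIV \<times> UNIV \<rightarrow> ?T" unfolding \<phi>_def by (auto simp only: S intro!: dvdI)
    show "(\<lambda>p. (snd p - 1, Suc (fst p) div snd p - 1)) \<in> ?T \<rightarrow> UNIV \<times> UNIV" by simp
    show "(snd (\<phi> p) - 1, Suc (fst (\<phi> p)) div snd (\<phi> p) - 1) = p" for p
      unfolding \<phi>_def fst_conv snd_conv S by (simp add: prod_eq_iff del: mult_Suc mult_Suc_right)
    fix p assume "p \<in> ?T"
    then obtain N d k where p: "p = (N, d)" "Suc N = d * k" by (auto elim!: dvdE)
    then have "d > 0" "k > 0" by (auto intro: Nat.gr0I)
    then have "Suc N div d = k" "Suc (d - 1) = d" "Suc (k - 1) = k" unfolding p(2) by simp_all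
    then show "\<phi> (snd p - 1, Suc (fst p) div snd p - 1) = p"
      unfolding \<phi>_def p(1) fst_conv snd_conv using p(2) by (simp del: mult_Suc mult_Suc_right)
  qed
  have "G (\<phi> p) = f p" for p
  proof -
    have "Suc (Suc (fst p) * Suc (snd p) - 1) = Suc (fst p) * Suc (snd p)" by simp
    then show ?thesis by (simp only: G_def \<phi>_def f_def fst_conv snd_conv)
  qed
  then have Gf: "(\<lambda>p. G (\<phi> p)) = f" by auto
  have sG: "G summable_on ?T" using sf unfolding summable_on_reindex_bij_betw[OF bij, of G, symmetric] Gf .
  have "E4sum \<tau> = infsum G ?T" unfolding 1 Gf[symmetric] by (rule infsum_reindex_bij_betw[OF bij])
  also have "\<dots> = infsum (\<lambda>N. infsum (\<lambda>d. G (N, d)) {d. d dvd Suc N}) UNIV"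
    by (rule infsum_Sigma_banach[OF sG, symmetric])
  finally have 2: "E4sum \<tau> = infsum (\<lambda>N. infsum (\<lambda>d. G (N, d)) {d. d dvd Suc N}) UNIV" .
  have 3: "infsum (\<lambda>d. G (N, d)) {d. d dvd Suc N} = of_nat (sigma3 (Suc N)) * q ^ Suc N" for N
  proof -
    have "finite {d. d dvd Suc N}" by simp
    then show ?thesis by (simp only: infsum_finite G_def fst_conv snd_conv sigma3_def of_nat_sum of_nat_power sum_distrib_right)
  qed
  have "(\<lambda>N. infsum (\<lambda>d. G (N, d)) {d. d dvd Suc N}) summable_on UNIV"
    by (rule summable_on_Sigma_banach[of "\<lambda>N d. G (N, d)"]) (use sG in simp)
  then have "((\<lambda>N. of_nat (sigma3 (Suc N)) * q ^ Suc N) has_sum E4sum \<tau>) UNIV"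
    unfolding 2 3 by (rule has_sum_infsum)
  then have "(\<lambda>N. of_nat (sigma3 (Suc N)) * q ^ Suc N) sums E4sum \<tau>" by (rule has_sum_imp_sums)
  then show ?thesis unfolding E4_def q_def by (simp only: sums_unique[symmetric])
qed

lemma jform_E4: "jform 4 0 (\<lambda>\<tau> _. E4 \<tau>) (\<lambda>_. 1)"
proof -
  define t where "t m \<tau> = of_nat (Suc m) ^ 3 * e \<tau> ^ Suc m / (1 - e \<tau> ^ Suc m)" for m \<tau>
  have E: "E4 \<tau> = 1 + 240 * (\<Sum>\<^sub>\<infinity>m. t m \<tau>)" if \<tau>: "\<tau> \<in> uhp" for \<tau>
    unfolding E4_eq_E4sum[OF \<tau>] t_def using infsumI[OF E4sum_has_sum[OF \<tau>]] by simp
  have bd: "norm (t m \<tau>) \<le> real (Suc m) ^ 3 * \<rho> ^ Suc m / (1 - \<rho>)" if \<tau>: "\<tau> \<in> uhp" "norm (e \<tau>) \<le> \<rho>" "\<rho> < 1" for m \<tau> \<rho>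
  proof -
    have "real (Suc m) ^ 3 * norm (e \<tau>) ^ Suc m / (1 - norm (e \<tau>)) \<le> real (Suc m) ^ 3 * \<rho> ^ Suc m / (1 - \<rho>)"
      using that order_trans[OF norm_ge_zero that(2)] by (intro frac_le mult_left_mono power_mono mult_nonneg_nonneg zero_le_power) auto
    then show ?thesis using E4sum_term_le[OF \<tau>(1), of m] unfolding t_def by linarith
  qed
  have sm: "(\<lambda>m. real (Suc m) ^ 3 * \<rho> ^ Suc m / (1 - \<rho>)) summable_on UNIV" if "0 \<le> \<rho>" "\<rho> < 1" for \<rho>
    by (rule norm_summable_imp_summable_on)
       (use summable_divide[OF cube_geometric_summable[OF that], of "1 - \<rho>"] that in \<open>simp add: abs_mult\<close>)
  have "hol2 (\<lambda>\<tau> z. \<Sum>\<^sub>\<infinity>m. t m \<tau>)"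
  proof (rule hol2_infsum)
    show "hol2 (\<lambda>\<tau> z. t m \<tau>)" for m
      unfolding t_def by (intro hol2_intros norm_1_minus_power_ge(2))
    fix \<delta> R :: real assume \<delta>: "\<delta> > 0"
    have \<rho>: "0 \<le> exp (- 2 * pi * \<delta>)" "exp (- 2 * pi * \<delta>) < 1" using \<delta> by auto
    show "\<exists>M. M summable_on UNIV \<and> (\<forall>m\<in>UNIV. \<forall>(\<tau>, z)\<in>hbox \<delta> R. norm (t m \<tau>) \<le> M m)"
    proof (intro exI conjI ballI, rule sm[OF \<rho>])
      fix m x assume x: "x \<in> hbox \<delta> R"
      then have "fst x \<in> uhp" "norm (e (fst x)) \<le> exp (- 2 * pi * \<delta>)"
        using \<delta> by (auto simp: hbox_def uhp_def norm_e)
      from bd[OF this \<rho>(2)] show "case x of (\<tau>, z) \<Rightarrow> norm (t m \<tau>) \<le> real (Suc m) ^ 3 * exp (- 2 * pi * \<delta>) ^ Suc m / (1 - exp (- 2 * pi * \<delta>))"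
        by (simp only: split_def)
    qed
  qed
  then have h: "hol2 (\<lambda>\<tau> z. 1 + 240 * (\<Sum>\<^sub>\<infinity>m. t m \<tau>))" by (intro hol2_intros)
  have "((\<lambda>\<tau>. \<Sum>\<^sub>\<infinity>m. t m \<tau>) \<longlongrightarrow> (\<Sum>\<^sub>\<infinity>m\<in>(UNIV :: nat set). 0)) cusp"
  proof (rule infsum_tannery)
    show "(\<lambda>m. real (Suc m) ^ 3 * (1 / 2) ^ Suc m / (1 - 1 / 2)) summable_on UNIV" by (rule sm) auto
    have "\<forall>\<^sub>F \<tau> in cusp. norm (e \<tau>) < 1 / 2" using tendstoD[OF e_cusp, of "1 / 2"] by simp
    then show "\<forall>\<^sub>F \<tau> in cusp. \<forall>m\<in>UNIV. norm (t m \<tau>) \<le> real (Suc m) ^ 3 * (1 / 2) ^ Suc m / (1 - 1 / 2)"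
      using eventually_cusp_uhp by eventually_elim (intro ballI bd, auto)
    fix m :: nat
    have "((\<lambda>\<tau>. of_nat (Suc m) ^ 3 * e \<tau> ^ Suc m / (1 - e \<tau> ^ Suc m)) \<longlongrightarrow> of_nat (Suc m) ^ 3 * 0 ^ Suc m / (1 - 0 ^ Suc m)) cusp"
      by (intro tendsto_intros e_cusp) auto
    then show "(t m \<longlongrightarrow> 0) cusp" by (simp add: t_def[abs_def])
  qed simp
  then have "((\<lambda>\<tau>. 1 + 240 * (\<Sum>\<^sub>\<infinity>m. t m \<tau>)) \<longlongrightarrow> 1 + 240 * 0) cusp" by (intro tendsto_intros) simp
  then have l: "cusp_lim (\<lambda>\<tau> z. 1 + 240 * (\<Sum>\<^sub>\<infinity>m. t m \<tau>)) (\<lambda>_. 1)" using cusp_lim_\<tau> by simp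
  show ?thesis
  proof (rule jformI)
    show "hol2 (\<lambda>\<tau> _. E4 \<tau>)" by (rule hol2_cong[OF h]) (simp add: E)
    show "cusp_lim (\<lambda>\<tau> _. E4 \<tau>) (\<lambda>_. 1)" by (rule cusp_lim_cong[OF l]) (simp_all add: E)
    fix \<tau> z assume \<tau>: "\<tau> \<in> uhp"
    show "E4 (- 1 / \<tau>) = \<tau> powi 4 * e (of_nat 0 * z\<^sup>2 / \<tau>) * E4 \<tau>"
      unfolding E4_eq_E4sum[OF \<tau>] E4_eq_E4sum[OF uhp_neg_inverse[OF \<tau>]] E4sum_S[OF \<tau>] by simp
  qed (simp_all add: E4_def e_plus_1)
qed

lemma E4_eq_cub_a: "\<tau> \<in> uhp \<Longrightarrow> E4 \<tau> = - 48 * cub_a \<tau>"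
  by (rule jform_unique[OF jform_E4, of "\<lambda>\<tau> _. - 48 * cub_a \<tau>"])
     (rule jform_cong[OF jform_cmult[OF jform_cub_a, of "- 48"]], simp_all)

section \<open>Sums over the lattice\<close>

lemma int_summable_powr:
  assumes "s < - 1"
  shows "(\<lambda>c :: int. (1 + \<bar>of_int c :: real\<bar>) powr s) summable_on UNIV"
    and "(\<lambda>c :: int. \<bar>of_int c :: real\<bar> powr s) summable_on UNIV"
proof -
  have 1: "summable (\<lambda>n. real n powr s)" using assms by (simp add: summable_real_powr_iff)
  then have 2: "summable (\<lambda>n. (1 + real n) powr s)"
    by (subst (asm) summable_Suc_iff[symmetric]) (simp add: add.commute)
  show "(\<lambda>c :: int. (1 + \<bar>of_int c :: real\<bar>) powr s) summable_on UNIV"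
    using int_summable[OF 2] by simp
  show "(\<lambda>c :: int. \<bar>of_int c :: real\<bar> powr s) summable_on UNIV"
    using int_summable[OF 1] by simp
qed

text \<open>
  A product weight that dominates a multiple of \<open>\<bar>c\<bar> + \<bar>d\<bar>\<close> to the power \<open>- 5/2\<close>, splitting the summation over pairs into two
  one-dimensional ones.
\<close>

definition lat_weight :: "int \<times> int \<Rightarrow> real" where
  "lat_weight p = (1 + \<bar>of_int (fst p)\<bar>) powr (- 5 / 4) * (1 + \<bar>of_int (snd p)\<bar>) powr (- 5 / 4)"

lemma lat_weight_summable: "lat_weight summable_on UNIV \<times> UNIV"
proof (rule summable_on_SigmaI)
  define S where "S = (\<Sum>\<^sub>\<infinity>d :: int. (1 + \<bar>of_int d :: real\<bar>) powr (- 5 / 4))"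
  have 1: "(\<lambda>c :: int. (1 + \<bar>of_int c :: real\<bar>) powr (- 5 / 4)) summable_on UNIV" by (rule int_summable_powr) simp
  show "((\<lambda>d. lat_weight (c, d)) has_sum (1 + \<bar>of_int c\<bar>) powr (- 5 / 4) * S) UNIV" for c
    unfolding lat_weight_def fst_conv snd_conv S_def by (intro has_sum_cmult_right has_sum_infsum 1)
  show "(\<lambda>c :: int. (1 + \<bar>of_int c\<bar>) powr (- 5 / 4) * S) summable_on UNIV"
    by (rule summable_on_cmult_left[OF 1])
qed (simp add: lat_weight_def)

lemma powr_le_lat_weight:
  assumes N: "\<bar>of_int c\<bar> + \<bar>of_int d\<bar> \<le> N" "(c, d) \<noteq> (0, 0)"
  shows "(2 * N) powr (- 5 / 2) \<le> lat_weight (c, d)"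
proof -
  have "1 \<le> \<bar>c\<bar> + \<bar>d\<bar>" using N(2) by auto
  then have "real_of_int 1 \<le> of_int (\<bar>c\<bar> + \<bar>d\<bar>)" by (simp only: of_int_le_iff)
  then have N1: "1 \<le> N" using N(1) by simp
  have "(1 + \<bar>of_int c\<bar>) * (1 + \<bar>of_int d\<bar>) \<le> (2 * N) * (2 * N)"
    using N(1) N1 by (intro mult_mono) auto
  then have "(1 + \<bar>of_int c\<bar>) * (1 + \<bar>of_int d\<bar>) \<le> (2 * N) powr 2"
    using N1 by (simp add: powr_numeral power2_eq_square)
  moreover have "0 < (1 + \<bar>real_of_int c\<bar>) * (1 + \<bar>of_int d\<bar>)" by (intro mult_pos_pos) auto
  ultimately have "((2 * N) powr 2) powr (- 5 / 4) \<le> ((1 + \<bar>of_int c\<bar>) * (1 + \<bar>of_int d\<bar>)) powr (- 5 / 4)"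
    by (intro powr_mono2') auto
  moreover have "((2 * N) powr 2) powr (- 5 / 4) = (2 * N) powr (- 5 / 2)" by (simp only: powr_powr) simp
  ultimately show ?thesis by (simp only: powr_mult lat_weight_def fst_conv snd_conv)
qed

text \<open>
  The exponent \<open>- 3/4\<close> is what the convergence leaves room for: beyond \<open>- 1/2\<close> it makes the sum over \<open>\<lambda>\<close> converge,
  above \<open>- 1\<close> it makes the sum over \<open>(c, d)\<close> converge in weight 4.
\<close>

lemma exp_minus_le_powr:
  fixes x :: real
  assumes "x > 0"
  shows "exp (- x) \<le> x powr (- 3 / 4)"
proof -
  have "x powr (3 / 4) \<le> exp x"
  proof (cases "x \<le> 1")
    case True
    then have "x powr (3 / 4) \<le> 1 powr (3 / 4)" using assms by (intro powr_mono2) auto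
    also have "\<dots> \<le> exp x" using assms by simp
    finally show ?thesis .
  next
    case False
    then have "x powr (3 / 4) \<le> x powr 1" by (intro powr_mono) auto
    moreover have "x powr 1 = x" using assms by simp
    ultimately show ?thesis using exp_ge_add_one_self[of x] by linarith
  qed
  then have "inverse (exp x) \<le> inverse (x powr (3 / 4))" using assms by (intro le_imp_inverse_le) auto
  then show ?thesis by (simp add: exp_minus powr_minus)
qed

lemma divide_powr_minus: "x / y powr - a = x * y powr (a :: real)"
  by (simp only: powr_minus divide_inverse inverse_inverse_eq)

definition gauss_const :: real where "gauss_const = (\<Sum>\<^sub>\<infinity>l :: int. 4 * \<bar>of_int l\<bar> powr (- 3 / 2))"

text \<open>
  The bound is uniform in the shift \<open>s\<close>: an integer translation brings \<open>s\<close> into \<open>[- 1/2, 1/2]\<close>, and then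
  \<open>\<bar>l + s\<bar> \<ge> \<bar>l\<bar> / 2\<close>.
\<close>

lemma gauss_shift:
  assumes \<alpha>: "\<alpha> > 0"
  shows "(\<lambda>l :: int. exp (- \<alpha> * (of_int l + s)\<^sup>2)) summable_on UNIV"
    and "(\<Sum>\<^sub>\<infinity>l :: int. exp (- \<alpha> * (of_int l + s)\<^sup>2)) \<le> 1 + gauss_const * \<alpha> powr (- 3 / 4)"
proof -
  define r t where "r = round s" and "t = s - of_int r"
  have t: "\<bar>t\<bar> \<le> 1 / 2" unfolding t_def r_def using of_int_round_abs_le[of s] by (simp add: abs_minus_commute)
  define M :: "int \<Rightarrow> real" where "M l = (if l = 0 then 1 else 0) + 4 * \<bar>of_int l\<bar> powr (- 3 / 2) * \<alpha> powr (- 3 / 4)" for l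
  have 1: "((\<lambda>l :: int. if l = 0 then 1 else 0 :: real) has_sum 1) UNIV"
    by (rule has_sum_finite_neutralI[of "{0}"]) auto
  have 2: "((\<lambda>l :: int. 4 * \<bar>of_int l\<bar> powr (- 3 / 2)) has_sum gauss_const) UNIV"
    unfolding gauss_const_def by (intro has_sum_infsum summable_on_cmult_right int_summable_powr) simp
  have M: "(M has_sum (1 + gauss_const * \<alpha> powr (- 3 / 4))) UNIV"
    unfolding M_def by (intro has_sum_add has_sum_cmult_left 1 2)
  have bd: "exp (- \<alpha> * (of_int l + t)\<^sup>2) \<le> M l" for l
  proof (cases "l = 0")
    case True
    then show ?thesis using \<alpha> by (simp add: M_def)
  next
    case False
    define L where "L = \<bar>real_of_int l\<bar>"
    have "real_of_int 1 \<le> of_int \<bar>l\<bar>" using False by (simp only: of_int_le_iff)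
    then have L: "L \<ge> 1" by (simp add: L_def)
    have "L / 2 \<le> \<bar>of_int l + t\<bar>" using L t unfolding L_def by linarith
    then have "(L / 2)\<^sup>2 \<le> (of_int l + t)\<^sup>2" using L by (simp add: abs_le_square_iff[symmetric])
    then have "\<alpha> * (L / 2)\<^sup>2 \<le> \<alpha> * (of_int l + t)\<^sup>2" using \<alpha> by (intro mult_left_mono) auto
    then have "exp (- \<alpha> * (of_int l + t)\<^sup>2) \<le> exp (- (\<alpha> * (L / 2)\<^sup>2))" by simp
    also have "\<dots> \<le> (\<alpha> * (L / 2)\<^sup>2) powr (- 3 / 4)" using \<alpha> L by (intro exp_minus_le_powr mult_pos_pos) auto
    also have "\<dots> = \<alpha> powr (- 3 / 4) * ((L / 2) powr 2) powr (- 3 / 4)"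
      using \<alpha> L by (simp add: powr_mult powr_numeral)
    also have "((L / 2) powr 2) powr (- 3 / 4) = (L / 2) powr (- 3 / 2)" by (simp only: powr_powr, simp?)
    also have "\<dots> = L powr (- 3 / 2) / 2 powr (- 3 / 2)" by (simp only: powr_divide)
    also have "\<dots> = L powr (- 3 / 2) * 2 powr (3 / 2)" using divide_powr_minus[of _ 2 "3 / 2"] by simp
    also have "(2 :: real) powr (3 / 2) \<le> 2 powr 2" by (intro powr_mono) auto
    also have "(2 :: real) powr 2 = 4" by simp
    finally show ?thesis using \<alpha> L False by (simp add: M_def L_def mult_ac)
  qed
  have s1: "(\<lambda>l :: int. exp (- \<alpha> * (of_int l + t)\<^sup>2)) summable_on UNIV"
    by (rule summable_on_comparison_test[OF has_sum_imp_summable[OF M]]) (use bd in auto)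
  have le: "(\<Sum>\<^sub>\<infinity>l :: int. exp (- \<alpha> * (of_int l + t)\<^sup>2)) \<le> 1 + gauss_const * \<alpha> powr (- 3 / 4)"
    using infsum_mono[OF s1 has_sum_imp_summable[OF M] bd] infsumI[OF M] by simp
  have bij: "bij_betw (\<lambda>l :: int. l + r) UNIV UNIV" by (rule bij_betwI[of _ _ _ "\<lambda>l. l - r"]) auto
  have eq: "of_int (l + r) + t = of_int l + s" for l by (simp add: t_def)
  show "(\<lambda>l :: int. exp (- \<alpha> * (of_int l + s)\<^sup>2)) summable_on UNIV"
    using s1 unfolding summable_on_reindex_bij_betw[OF bij, of "\<lambda>l. exp (- \<alpha> * (of_int l + t)\<^sup>2)", symmetric] eq .
  show "(\<Sum>\<^sub>\<infinity>l :: int. exp (- \<alpha> * (of_int l + s)\<^sup>2)) \<le> 1 + gauss_const * \<alpha> powr (- 3 / 4)"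
    using le unfolding infsum_reindex_bij_betw[OF bij, of "\<lambda>l. exp (- \<alpha> * (of_int l + t)\<^sup>2)", symmetric] eq .
qed

lemma gauss_const_nonneg: "gauss_const \<ge> 0"
  unfolding gauss_const_def by (intro infsum_nonneg) simp

section \<open>Jacobi--Eisenstein series\<close>

definition jac_arg :: "int \<Rightarrow> int \<Rightarrow> int \<Rightarrow> int \<Rightarrow> int \<Rightarrow> complex \<Rightarrow> complex \<Rightarrow> complex" where
  "jac_arg a b c d l \<tau> z =
     ((of_int l)\<^sup>2 * (of_int a * \<tau> + of_int b) + 2 * of_int l * z - of_int c * z\<^sup>2) / (of_int c * \<tau> + of_int d)"

text \<open>
  The summand of the Jacobi--Eisenstein series for the bottom row \<open>(c, d)\<close>, with the top row \<open>(a, b)\<close> as a parameter: the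
  modular group acts on the whole matrix, whereas \<open>cofactors\<close> is an arbitrary choice.
\<close>

definition jac_row :: "nat \<Rightarrow> int \<Rightarrow> int \<Rightarrow> int \<Rightarrow> int \<Rightarrow> complex \<Rightarrow> complex \<Rightarrow> complex" where
  "jac_row m a b c d \<tau> z = (\<Sum>\<^sub>\<infinity>l. e (of_nat m * jac_arg a b c d l \<tau> z)) / (of_int c * \<tau> + of_int d) ^ 4"

definition jac_term :: "nat \<Rightarrow> int \<times> int \<Rightarrow> complex \<Rightarrow> complex \<Rightarrow> complex" where
  "jac_term m p \<tau> z = (case cofactors (fst p) (snd p) of (a, b) \<Rightarrow> jac_row m a b (fst p) (snd p) \<tau> z)"

abbreviation coprimes :: "(int \<times> int) set" where "coprimes \<equiv> {(c, d). coprime c d}"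

lemma Jacobi_Eisenstein_4: "Jacobi_Eisenstein 4 m \<tau> z = 1 / 2 * (\<Sum>\<^sub>\<infinity>p\<in>coprimes. jac_term m p \<tau> z)"
proof -
  have "(\<Sum>\<^sub>\<infinity>l\<in>(UNIV :: int set).
       (let (a, b) = cofactors c d; j = of_int c * \<tau> + of_int d in
          j powi (- int 4) *
          e (of_nat m * ((of_int l)\<^sup>2 * ((of_int a * \<tau> + of_int b) / j)
                         + 2 * of_int l * (z / j) - of_int c * z\<^sup>2 / j)))) = jac_term m (c, d) \<tau> z" for c d
  proof -
    obtain a b where ab: "cofactors c d = (a, b)" by (cases "cofactors c d")
    define j where "j = of_int c * \<tau> + of_int d"
    have "(of_int l)\<^sup>2 * ((of_int a * \<tau> + of_int b) / j) + 2 * of_int l * (z / j) - of_int c * z\<^sup>2 / j = jac_arg a b c d l \<tau> z" for l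
    proof -
      have "L * (N / j) + L' * (z / j) - C / j = (L * N + L' * z - C) / j" for L L' N C
        by (simp add: diff_divide_distrib add_divide_distrib)
      then show ?thesis unfolding jac_arg_def j_def[symmetric] .
    qed
    moreover have "j powi (- int 4) = inverse (j ^ 4)" by (simp only: power_int_minus power_int_of_nat)
    ultimately show ?thesis
      unfolding jac_term_def jac_row_def fst_conv snd_conv ab prod.case Let_def j_def[symmetric]
      by (simp only: infsum_cmult_right' divide_inverse mult.commute)
  qed
  then show ?thesis unfolding Jacobi_Eisenstein_def by (simp only: split_def prod.collapse)
qed

lemma cofactors_det:
  assumes "coprime c d" "cofactors c d = (a, b)"
  shows "a * d - b * c = 1"
proof -
  obtain u v where "u * c + v * d = 1" using bezout_int[of c d] assms(1) by auto
  then have "case (v, - u) of (a, b) \<Rightarrow> a * d - b * c = 1" by simp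
  then have "case cofactors c d of (a, b) \<Rightarrow> a * d - b * c = 1" unfolding cofactors_def by (rule someI)
  then show ?thesis using assms(2) by simp
qed

lemma jac_denom_nz:
  assumes "\<tau> \<in> uhp" "(c, d) \<noteq> (0, 0)"
  shows "of_int c * \<tau> + of_int d \<noteq> 0"
proof
  assume 0: "of_int c * \<tau> + of_int d = 0"
  then have "Im (of_int c * \<tau> + of_int d) = 0" by simp
  then have "c = 0" using assms(1) by (simp add: uhp_def)
  then show False using 0 assms(2) by simp
qed

text \<open>
  Two top rows differ by an integer multiple \<open>t\<close> of the bottom row, which shifts the exponent by \<open>m \<lambda>\<^sup>2 t\<close>.
\<close>

lemma jac_row_unique:
  assumes \<tau>: "\<tau> \<in> uhp" and 1: "a * d - b * c = 1" and 2: "a' * d - b' * c = 1"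
  shows "jac_row m a b c d \<tau> z = jac_row m a' b' c d \<tau> z"
proof -
  define t where "t = a * b' - b * a'"
  have "a' = a + t * c" "b' = b + t * d" unfolding t_def using 1 2 by algebra+
  then have n: "of_int a' * \<tau> + of_int b' = of_int a * \<tau> + of_int b + of_int t * (of_int c * \<tau> + of_int d)"
    by (simp add: algebra_simps)
  have nz: "of_int c * \<tau> + of_int d \<noteq> 0" by (rule jac_denom_nz[OF \<tau>]) (use 1 in auto)
  have "jac_arg a' b' c d l \<tau> z = jac_arg a b c d l \<tau> z + of_int (l\<^sup>2 * t)" for l
    unfolding jac_arg_def n using nz by (simp add: divide_simps) (simp add: algebra_simps)
  then have "of_nat m * jac_arg a' b' c d l \<tau> z = of_nat m * jac_arg a b c d l \<tau> z + of_int (int m * (l\<^sup>2 * t))" for l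
    by (simp add: ring_distribs)
  then show ?thesis by (simp only: jac_row_def e_add_int)
qed

lemma jac_term_eq:
  assumes "\<tau> \<in> uhp" "a * d - b * c = 1"
  shows "jac_term m (c, d) \<tau> z = jac_row m a b c d \<tau> z"
proof -
  have "coprime c d" using assms(2) by (intro coprimeI) (metis dvd_diff dvd_mult)
  then show ?thesis unfolding jac_term_def fst_conv snd_conv
    using jac_row_unique[OF assms(1) _ assms(2)] cofactors_det[of c d] by (cases "cofactors c d") simp
qed

lemma coprimes_cofactors:
  assumes "p \<in> coprimes"
  obtains a b c d where "p = (c, d)" "a * d - b * c = 1"
proof -
  obtain c d a b where "p = (c, d)" "cofactors c d = (a, b)" by (metis surj_pair)
  then show thesis using assms cofactors_det[of c d a b] that by auto
qed

lemma divide_eq_shift: "X = Y + t * j \<Longrightarrow> j \<noteq> 0 \<Longrightarrow> X / j = Y / j + (t :: complex)"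
  by (simp add: add_divide_distrib)

text \<open>
  The exponent changes by an integer after the substitution \<open>\<lambda> \<mapsto> \<lambda> - c\<close>.
\<close>

lemma jac_term_plus_1: "p \<in> coprimes \<Longrightarrow> \<tau> \<in> uhp \<Longrightarrow> jac_term m p \<tau> (z + 1) = jac_term m p \<tau> z"
proof -
  assume p: "p \<in> coprimes" and \<tau>: "\<tau> \<in> uhp"
  obtain a b c d where d: "p = (c, d)" "a * d - b * c = 1" using coprimes_cofactors[OF p] .
  have nz: "of_int c * \<tau> + of_int d \<noteq> 0" by (rule jac_denom_nz[OF \<tau>]) (use d in auto)
  have d': "of_int a * of_int d = 1 + of_int b * (of_int c :: complex)"
    using d(2) by (metis add.commute diff_eq_eq of_int_1 of_int_add of_int_mult)
  have *: "jac_arg a b c d l \<tau> (z + 1) = jac_arg a b c d (l - c) \<tau> z + of_int (a * (2 * l - c))" for l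
    unfolding jac_arg_def by (rule divide_eq_shift[OF _ nz]) (simp only: of_int_mult of_int_diff of_int_numeral, use d' in algebra)
  have "of_nat m * jac_arg a b c d l \<tau> (z + 1) = of_nat m * jac_arg a b c d (l - c) \<tau> z + of_int (int m * (a * (2 * l - c)))" for l
    unfolding * by (simp add: ring_distribs)
  then have **: "e (of_nat m * jac_arg a b c d l \<tau> (z + 1)) = e (of_nat m * jac_arg a b c d (l - c) \<tau> z)" for l
    by (simp only: e_add_int)
  have bij: "bij_betw (\<lambda>l :: int. l - c) UNIV UNIV" by (rule bij_betwI[of _ _ _ "\<lambda>l. l + c"]) auto
  show ?thesis unfolding d(1) jac_term_eq[OF \<tau> d(2)] jac_row_def **
    infsum_reindex_bij_betw[OF bij, of "\<lambda>l. e (of_nat m * jac_arg a b c d l \<tau> z)"] ..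
qed

text \<open>
  Here the substitution is \<open>\<lambda> \<mapsto> \<lambda> + d\<close>.
\<close>

lemma jac_term_plus_\<tau>:
  assumes p: "p \<in> coprimes" and \<tau>: "\<tau> \<in> uhp"
  shows "jac_term m p \<tau> (z + \<tau>) = e (- of_nat m * (\<tau> + 2 * z)) * jac_term m p \<tau> z"
proof -
  obtain a b c d where d: "p = (c, d)" "a * d - b * c = 1" using coprimes_cofactors[OF p] .
  have nz: "of_int c * \<tau> + of_int d \<noteq> 0" by (rule jac_denom_nz[OF \<tau>]) (use d in auto)
  have d': "of_int a * of_int d = 1 + of_int b * (of_int c :: complex)"
    using d(2) by (metis add.commute diff_eq_eq of_int_1 of_int_add of_int_mult)
  have *: "jac_arg a b c d l \<tau> (z + \<tau>) = - (\<tau> + 2 * z) + jac_arg a b c d (l + d) \<tau> z + of_int (- b * (2 * l + d))" for l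
  proof -
    have "jac_arg a b c d l \<tau> (z + \<tau>) = jac_arg a b c d (l + d) \<tau> z + (- (\<tau> + 2 * z) + of_int (- b * (2 * l + d)))"
      unfolding jac_arg_def
      by (rule divide_eq_shift[OF _ nz]) (simp only: of_int_mult of_int_add of_int_minus of_int_numeral, use d' in algebra)
    then show ?thesis by (simp add: add_ac)
  qed
  have "of_nat m * jac_arg a b c d l \<tau> (z + \<tau>) = - of_nat m * (\<tau> + 2 * z) + of_nat m * jac_arg a b c d (l + d) \<tau> z + of_int (int m * (- b * (2 * l + d)))" for l
    unfolding * by (simp add: ring_distribs)
  then have **: "e (of_nat m * jac_arg a b c d l \<tau> (z + \<tau>)) = e (- of_nat m * (\<tau> + 2 * z)) * e (of_nat m * jac_arg a b c d (l + d) \<tau> z)" for l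
    by (simp only: e_add e_int mult_1_right)
  have bij: "bij_betw (\<lambda>l :: int. l + d) UNIV UNIV" by (rule bij_betwI[of _ _ _ "\<lambda>l. l - d"]) auto
  show ?thesis unfolding d(1) jac_term_eq[OF \<tau> d(2)] jac_row_def ** infsum_cmult_right'
    infsum_reindex_bij_betw[OF bij, of "\<lambda>l. e (of_nat m * jac_arg a b c d l \<tau> z)"] by simp
qed

lemma jac_term_T:
  assumes p: "p \<in> coprimes" and \<tau>: "\<tau> \<in> uhp"
  shows "jac_term m p (\<tau> + 1) z = jac_term m (fst p, fst p + snd p) \<tau> z"
proof -
  obtain a b c d where d: "p = (c, d)" "a * d - b * c = 1" using coprimes_cofactors[OF p] .
  have d2: "a * (c + d) - (a + b) * c = 1" using d(2) by (simp add: algebra_simps)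
  have s: "of_int x * (\<tau> + 1) + of_int y = of_int x * \<tau> + of_int (x + y)" for x y by (simp add: algebra_simps)
  show ?thesis unfolding d(1) fst_conv snd_conv jac_term_eq[OF \<tau> d2] jac_term_eq[OF uhp_add_1[OF \<tau>] d(2)]
    unfolding jac_row_def jac_arg_def s ..
qed

text \<open>
  The matrix with rows \<open>(a, b)\<close> and \<open>(c, d)\<close> is multiplied by the inversion from the right, giving \<open>(b, - a)\<close> and \<open>(d, - c)\<close>.
\<close>

lemma jac_term_S:
  assumes p: "p \<in> coprimes" and \<tau>: "\<tau> \<in> uhp"
  shows "jac_term m p (- 1 / \<tau>) (z / \<tau>) = \<tau> ^ 4 * e (of_nat m * z\<^sup>2 / \<tau>) * jac_term m (snd p, - fst p) \<tau> z"
proof -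
  obtain a b c d where d: "p = (c, d)" "a * d - b * c = 1" using coprimes_cofactors[OF p] .
  have d2: "b * (- c) - (- a) * d = 1" using d(2) by (simp add: algebra_simps)
  have nz: "\<tau> \<noteq> 0" by (rule uhp_nz[OF \<tau>])
  have nz2: "of_int d * \<tau> - of_int c \<noteq> 0" using jac_denom_nz[OF \<tau>, of d "- c"] d(2) by (cases "d = 0") auto
  have s: "of_int x * (- 1 / \<tau>) + of_int y = (of_int y * \<tau> - of_int x) / \<tau>" for x y using nz by (simp add: field_simps)
  have *: "jac_arg a b c d l (- 1 / \<tau>) (z / \<tau>) = z\<^sup>2 / \<tau> + jac_arg b (- a) d (- c) l \<tau> z" for l
  proof -
    have "z\<^sup>2 / \<tau> = z\<^sup>2 * (of_int d * \<tau> - of_int c) / \<tau> / (of_int d * \<tau> - of_int c)" using nz2 by simp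
    moreover have "jac_arg a b c d l (- 1 / \<tau>) (z / \<tau>) = \<tau> * ((of_int l)\<^sup>2 * ((of_int b * \<tau> - of_int a) / \<tau>) + 2 * of_int l * (z / \<tau>) - of_int c * (z / \<tau>)\<^sup>2) / (of_int d * \<tau> - of_int c)"
      unfolding jac_arg_def s by simp
    moreover have "\<tau> * ((of_int l)\<^sup>2 * ((of_int b * \<tau> - of_int a) / \<tau>) + 2 * of_int l * (z / \<tau>) - of_int c * (z / \<tau>)\<^sup>2)
       = z\<^sup>2 * (of_int d * \<tau> - of_int c) / \<tau> + ((of_int l)\<^sup>2 * (of_int b * \<tau> - of_int a) + 2 * of_int l * z - of_int d * z\<^sup>2)"
      using nz by (simp add: field_simps power2_eq_square)
    ultimately show ?thesis by (simp add: jac_arg_def add_divide_distrib)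
  qed
  have **: "e (of_nat m * jac_arg a b c d l (- 1 / \<tau>) (z / \<tau>)) = e (of_nat m * z\<^sup>2 / \<tau>) * e (of_nat m * jac_arg b (- a) d (- c) l \<tau> z)" for l
    unfolding * by (simp add: e_add[symmetric] ring_distribs)
  show ?thesis unfolding d(1) fst_conv snd_conv jac_term_eq[OF \<tau> d2] jac_term_eq[OF uhp_neg_inverse[OF \<tau>] d(2)]
    unfolding jac_row_def ** infsum_cmult_right' s using nz by (simp add: power_divide)
qed

text \<open>
  Write \<open>z = x \<tau> + w\<close> with real \<open>x, w\<close>. Completing the square in \<open>\<lambda>\<close> gives \<open>(\<lambda> + s)\<^sup>2 (a \<tau> + b) / (c \<tau> + d) - x z\<close> plus a real
  number, where \<open>s = x d - w c\<close>; and \<open>(a \<tau> + b) / (c \<tau> + d)\<close> has imaginary part \<open>Im \<tau> / \<bar>c \<tau> + d\<bar>\<^sup>2\<close>.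
\<close>

lemma norm_e_jac_arg:
  fixes \<tau> z :: complex and m :: nat and a b c d l :: int
  assumes \<tau>: "\<tau> \<in> uhp" and det: "a * d - b * c = 1"
  defines "x \<equiv> Im z / Im \<tau>"
  defines "w \<equiv> Re z - x * Re \<tau>"
  defines "\<alpha> \<equiv> 2 * pi * real m * Im \<tau> / (norm (of_int c * \<tau> + of_int d))\<^sup>2"
  shows "norm (e (of_nat m * jac_arg a b c d l \<tau> z)) =
    exp (2 * pi * real m * x\<^sup>2 * Im \<tau>) * exp (- \<alpha> * (of_int l + (x * of_int d - w * of_int c))\<^sup>2)"
proof -
  have y: "Im \<tau> > 0" using \<tau> by (simp add: uhp_def)
  define s r where "s = x * of_int d - w * of_int c" and "r = w * of_int a - x * of_int b"
  define j where "j = of_int c * \<tau> + of_int d"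
  define N where "N = of_int a * \<tau> + of_int b"
  have nz: "j \<noteq> 0" unfolding j_def by (rule jac_denom_nz[OF \<tau>]) (use det in auto)
  have z: "z = of_real x * \<tau> + of_real w" using y by (simp add: complex_eq_iff x_def w_def)
  have d': "of_int a * of_int d = 1 + of_int b * (of_int c :: complex)"
    using det by (metis add.commute diff_eq_eq of_int_1 of_int_add of_int_mult)
  have poly: "L\<^sup>2 * (A * \<tau> + B) + 2 * L * (X * \<tau> + W) - C * (X * \<tau> + W)\<^sup>2
      = (L + (X * D - W * C))\<^sup>2 * (A * \<tau> + B) + ((2 * L + (X * D - W * C)) * (W * A - X * B) - X * (X * \<tau> + W)) * (C * \<tau> + D)"
    if "A * D = 1 + B * C" for A B C D L X W :: complex using that by algebra
  have "jac_arg a b c d l \<tau> z = (of_real (of_int l + s))\<^sup>2 * (N / j) + (of_real ((2 * of_int l + s) * r) - of_real x * z)"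
    unfolding jac_arg_def j_def[symmetric] z poly[OF d'] using nz
    by (simp add: j_def[symmetric] N_def[symmetric] s_def r_def add_divide_distrib)
  then have "Im (jac_arg a b c d l \<tau> z) = (of_int l + s)\<^sup>2 * Im (N / j) - x * Im z"
  proof -
    have "Im (of_real u * v + (of_real p - of_real x * z)) = u * Im v - x * Im z" for u p v by simp
    then show ?thesis unfolding \<open>jac_arg a b c d l \<tau> z = _\<close> of_real_power[symmetric] .
  qed
  also have "Im (N / j) = Im \<tau> / (norm j)\<^sup>2"
  proof -
    have "Im N * Re j - Re N * Im j = Im \<tau> * of_int (a * d - b * c)"
      by (simp add: N_def j_def algebra_simps)
    then show ?thesis by (simp add: Im_divide cmod_power2 det)
  qed
  also have "x * Im z = x\<^sup>2 * Im \<tau>" using y by (simp add: x_def power2_eq_square)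
  finally have im: "Im (jac_arg a b c d l \<tau> z) = (of_int l + s)\<^sup>2 * (Im \<tau> / (norm j)\<^sup>2) - x\<^sup>2 * Im \<tau>" .
  have "Im (of_nat m * jac_arg a b c d l \<tau> z) = real m * Im (jac_arg a b c d l \<tau> z)" by simp
  then show ?thesis unfolding norm_e exp_add[symmetric]
    by (simp only: im \<alpha>_def j_def[symmetric] s_def[symmetric]) (simp add: algebra_simps)
qed

lemma jac_arg_summable:
  assumes \<tau>: "\<tau> \<in> uhp" and m: "m \<ge> 1" and det: "a * d - b * c = 1"
  shows "(\<lambda>l. norm (e (of_nat m * jac_arg a b c d l \<tau> z))) summable_on UNIV"
    and "norm (jac_row m a b c d \<tau> z) \<le> exp (2 * pi * real m * (Im z / Im \<tau>)\<^sup>2 * Im \<tau>) *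
      (norm (of_int c * \<tau> + of_int d) powr - 4
        + gauss_const * Im \<tau> powr (- 3 / 4) * norm (of_int c * \<tau> + of_int d) powr (- 5 / 2))"
proof -
  define \<nu> where "\<nu> = norm (of_int c * \<tau> + of_int d)"
  have y: "Im \<tau> > 0" using \<tau> by (simp add: uhp_def)
  have \<nu>: "\<nu> > 0" unfolding \<nu>_def using jac_denom_nz[OF \<tau>, of c d] det by (cases "c = 0 \<and> d = 0") auto
  define \<alpha> where "\<alpha> = 2 * pi * real m * Im \<tau> / \<nu>\<^sup>2"
  define E where "E = exp (2 * pi * real m * (Im z / Im \<tau>)\<^sup>2 * Im \<tau>)"
  obtain s where n: "norm (e (of_nat m * jac_arg a b c d l \<tau> z)) = E * exp (- \<alpha> * (of_int l + s)\<^sup>2)" for l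
    using norm_e_jac_arg[OF \<tau> det, of m] unfolding \<alpha>_def \<nu>_def E_def by blast
  have \<alpha>: "\<alpha> > 0" unfolding \<alpha>_def using y \<nu> m by (intro divide_pos_pos mult_pos_pos) auto
  show sm: "(\<lambda>l. norm (e (of_nat m * jac_arg a b c d l \<tau> z))) summable_on UNIV"
    unfolding n by (rule summable_on_cmult_right[OF gauss_shift(1)[OF \<alpha>]])
  have "norm (\<Sum>\<^sub>\<infinity>l. e (of_nat m * jac_arg a b c d l \<tau> z)) \<le> E * (\<Sum>\<^sub>\<infinity>l :: int. exp (- \<alpha> * (of_int l + s)\<^sup>2))"
    using norm_infsum_bound[OF sm] unfolding n infsum_cmult_right' .
  also have "\<dots> \<le> E * (1 + gauss_const * \<alpha> powr (- 3 / 4))"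
    by (intro mult_left_mono gauss_shift(2)[OF \<alpha>]) (simp add: E_def)
  also have "\<dots> \<le> E * (1 + gauss_const * (Im \<tau> powr (- 3 / 4) * \<nu> powr (3 / 2)))"
  proof (intro mult_left_mono add_left_mono)
    have "2 * pi * real m \<ge> 2 * pi * 1" using m by (intro mult_left_mono) auto
    then have "1 \<le> 2 * pi * real m" using pi_gt3 by linarith
    then have "1 * (Im \<tau> / \<nu>\<^sup>2) \<le> 2 * pi * real m * (Im \<tau> / \<nu>\<^sup>2)" using y by (intro mult_right_mono) auto
    then have "Im \<tau> / \<nu>\<^sup>2 \<le> \<alpha>" by (simp add: \<alpha>_def)
    then have "\<alpha> powr (- 3 / 4) \<le> (Im \<tau> / \<nu> powr 2) powr (- 3 / 4)"
      using y \<nu> by (intro powr_mono2') (auto simp: powr_numeral)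
    also have "\<dots> = Im \<tau> powr (- 3 / 4) / (\<nu> powr 2) powr (- 3 / 4)" by (simp only: powr_divide)
    also have "\<dots> = Im \<tau> powr (- 3 / 4) * \<nu> powr (3 / 2)" using divide_powr_minus[of _ \<nu> "3 / 2"] by (simp add: powr_powr del: powr_numeral)
    finally show "\<alpha> powr (- 3 / 4) \<le> Im \<tau> powr (- 3 / 4) * \<nu> powr (3 / 2)" .
  qed (simp_all add: E_def gauss_const_nonneg)
  finally have 1: "norm (\<Sum>\<^sub>\<infinity>l. e (of_nat m * jac_arg a b c d l \<tau> z)) \<le> E * (1 + gauss_const * (Im \<tau> powr (- 3 / 4) * \<nu> powr (3 / 2)))" .
  have p4: "\<nu> ^ 4 = \<nu> powr 4" using \<nu> by (simp add: powr_numeral)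
  have "norm (jac_row m a b c d \<tau> z) \<le> E * (1 + gauss_const * (Im \<tau> powr (- 3 / 4) * \<nu> powr (3 / 2))) / \<nu> ^ 4"
    unfolding jac_row_def norm_divide norm_power \<nu>_def[symmetric] by (rule divide_right_mono[OF 1]) simp
  also have "\<dots> = E * (1 / \<nu> powr 4 + gauss_const * Im \<tau> powr (- 3 / 4) * (\<nu> powr (3 / 2) / \<nu> powr 4))"
    unfolding p4 by (simp add: ring_distribs add_divide_distrib)
  also have "\<nu> powr (3 / 2) / \<nu> powr 4 = \<nu> powr (- 5 / 2)" by (simp add: powr_diff[symmetric] del: powr_numeral)
  also have "1 / \<nu> powr 4 = \<nu> powr - 4" by (simp add: powr_minus_divide del: powr_numeral)
  finally show "norm (jac_row m a b c d \<tau> z) \<le> E * (\<nu> powr - 4 + gauss_const * Im \<tau> powr (- 3 / 4) * \<nu> powr (- 5 / 2))" .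
qed

lemma jac_term_norm:
  assumes \<tau>: "\<tau> \<in> uhp" and m: "m \<ge> 1" and p: "(c, d) \<in> coprimes"
  shows "norm (jac_term m (c, d) \<tau> z) \<le> exp (2 * pi * real m * (Im z / Im \<tau>)\<^sup>2 * Im \<tau>) *
      (norm (of_int c * \<tau> + of_int d) powr - 4
        + gauss_const * Im \<tau> powr (- 3 / 4) * norm (of_int c * \<tau> + of_int d) powr (- 5 / 2))"
proof -
  obtain a b where d: "a * d - b * c = 1" using coprimes_cofactors[OF p] by auto
  show ?thesis unfolding jac_term_eq[OF \<tau> d] by (rule jac_arg_summable(2)[OF \<tau> m d])
qed

text \<open>
  A lower bound \<open>\<eta> (\<bar>c\<bar> + \<bar>d\<bar>)\<close> for \<open>\<bar>c \<tau> + d\<bar>\<close> makes the terms summable; it holds locally uniformly in \<open>\<tau>\<close>, and with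
  \<open>\<eta> = 1/3\<close> near the cusp.
\<close>

lemma jac_term_norm_weight:
  assumes \<tau>: "\<tau> \<in> uhp" and m: "m \<ge> 1" and p: "(c, d) \<in> coprimes"
    and \<eta>: "\<eta> > 0" "\<eta> * (\<bar>of_int c\<bar> + \<bar>of_int d\<bar>) \<le> norm (of_int c * \<tau> + of_int d)"
    and \<delta>: "\<delta> > 0" "\<delta> \<le> Im \<tau>"
    and B: "2 * pi * real m * (Im z / Im \<tau>)\<^sup>2 * Im \<tau> \<le> B"
  shows "norm (jac_term m (c, d) \<tau> z) \<le>
    exp B * ((\<eta> powr (- 3 / 2) + gauss_const * \<delta> powr (- 3 / 4)) * (2 / \<eta>) powr (5 / 2)) * lat_weight (c, d)"
proof -
  define \<nu> where "\<nu> = norm (of_int c * \<tau> + of_int d)"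
  have cd: "(c, d) \<noteq> (0, 0)" using p by auto
  have \<nu>: "\<nu> > 0" unfolding \<nu>_def using jac_denom_nz[OF \<tau> cd] by simp
  have "1 \<le> \<bar>c\<bar> + \<bar>d\<bar>" using cd by auto
  then have "real_of_int 1 \<le> of_int (\<bar>c\<bar> + \<bar>d\<bar>)" by (simp only: of_int_le_iff)
  then have "\<eta> * 1 \<le> \<eta> * (\<bar>of_int c\<bar> + \<bar>of_int d\<bar>)" using \<eta>(1) by (intro mult_left_mono) auto
  then have \<eta>\<nu>: "\<eta> \<le> \<nu>" using \<eta>(2) by (simp add: \<nu>_def)
  have "\<bar>of_int c\<bar> + \<bar>of_int d\<bar> \<le> \<nu> / \<eta>" using \<eta> by (simp add: \<nu>_def field_simps)
  then have w: "(2 * (\<nu> / \<eta>)) powr (- 5 / 2) \<le> lat_weight (c, d)" by (rule powr_le_lat_weight[OF _ cd])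
  have "\<nu> powr (- 5 / 2) = (2 * (\<nu> / \<eta>) * (\<eta> / 2)) powr (- 5 / 2)" using \<eta>(1) by simp
  also have "\<dots> = (2 * (\<nu> / \<eta>)) powr (- 5 / 2) * (\<eta> / 2) powr (- 5 / 2)" by (simp only: powr_mult)
  also have "(\<eta> / 2) powr (- 5 / 2) = (2 / \<eta>) powr (5 / 2)"
    by (simp add: powr_divide powr_minus_divide)
  finally have 1: "\<nu> powr (- 5 / 2) \<le> lat_weight (c, d) * (2 / \<eta>) powr (5 / 2)" using w by (simp add: mult_right_mono)
  have "\<nu> powr - 4 = \<nu> powr (- 3 / 2) * \<nu> powr (- 5 / 2)" by (simp add: powr_add[symmetric] del: powr_numeral)
  also have "\<dots> \<le> \<eta> powr (- 3 / 2) * \<nu> powr (- 5 / 2)" using \<eta>(1) \<eta>\<nu> by (intro mult_right_mono powr_mono2') auto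
  finally have 2: "\<nu> powr - 4 \<le> \<eta> powr (- 3 / 2) * \<nu> powr (- 5 / 2)" .
  have "Im \<tau> powr (- 3 / 4) \<le> \<delta> powr (- 3 / 4)" using \<delta> by (intro powr_mono2') auto
  then have 3: "gauss_const * Im \<tau> powr (- 3 / 4) * \<nu> powr (- 5 / 2) \<le> gauss_const * \<delta> powr (- 3 / 4) * \<nu> powr (- 5 / 2)"
    by (intro mult_right_mono mult_left_mono gauss_const_nonneg) auto
  have "norm (jac_term m (c, d) \<tau> z) \<le> exp (2 * pi * real m * (Im z / Im \<tau>)\<^sup>2 * Im \<tau>) * (\<nu> powr - 4 + gauss_const * Im \<tau> powr (- 3 / 4) * \<nu> powr (- 5 / 2))"
    unfolding \<nu>_def by (rule jac_term_norm[OF \<tau> m p])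
  also have "\<dots> \<le> exp B * ((\<eta> powr (- 3 / 2) + gauss_const * \<delta> powr (- 3 / 4)) * \<nu> powr (- 5 / 2))"
    using 2 3 B gauss_const_nonneg by (intro mult_mono) (auto simp: ring_distribs)
  also have "\<dots> \<le> exp B * ((\<eta> powr (- 3 / 2) + gauss_const * \<delta> powr (- 3 / 4)) * (lat_weight (c, d) * (2 / \<eta>) powr (5 / 2)))"
    using 1 gauss_const_nonneg by (intro mult_left_mono) auto
  finally show ?thesis by (simp only: mult_ac)
qed

lemma coprime_weight_summable: "(\<lambda>p. K * lat_weight p) summable_on coprimes"
  by (intro summable_on_cmult_right summable_on_subset_banach[OF lat_weight_summable]) auto

lemma hol2_jac_term:
  assumes p: "p \<in> coprimes" and m: "m \<ge> 1"
  shows "hol2 (jac_term m p)"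
proof -
  obtain a b c d where d: "p = (c, d)" "a * d - b * c = 1" using coprimes_cofactors[OF p] .
  have nz: "of_int c * \<tau> + of_int d \<noteq> 0" if "\<tau> \<in> uhp" for \<tau> by (rule jac_denom_nz[OF that]) (use d in auto)
  have "hol2 (\<lambda>\<tau> z. \<Sum>\<^sub>\<infinity>l. e (of_nat m * jac_arg a b c d l \<tau> z))"
  proof (rule hol2_infsum)
    show "hol2 (\<lambda>\<tau> z. e (of_nat m * jac_arg a b c d l \<tau> z))" for l
      unfolding jac_arg_def by (intro hol2_intros nz)
    fix \<delta> R :: real assume \<delta>: "\<delta> > 0"
    \<comment> \<open>The summand 1 keeps \<open>K\<close> positive when the box is empty.\<close>
    define K where "K = \<bar>of_int c\<bar> * \<bar>R\<bar> + \<bar>of_int d\<bar> + 1"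
    have K: "K \<ge> 1" by (simp add: K_def)
    define \<kappa> where "\<kappa> = 2 * pi * real m * \<delta> / K\<^sup>2"
    have \<kappa>: "\<kappa> > 0" using \<delta> m K by (simp add: \<kappa>_def)
    define S where "S = R / \<delta> * \<bar>of_int d\<bar> + (R + R / \<delta> * R) * \<bar>of_int c\<bar>"
    define E where "E = exp (2 * pi * real m * ((R / \<delta>)\<^sup>2 * R))"
    show "\<exists>M. M summable_on UNIV \<and> (\<forall>l\<in>UNIV. \<forall>(\<tau>, z)\<in>hbox \<delta> R. norm (e (of_nat m * jac_arg a b c d l \<tau> z)) \<le> M l)"
    proof (intro exI conjI ballI)
      show "(\<lambda>l :: int. E * exp (- \<kappa> * (of_int l)\<^sup>2 + 2 * \<kappa> * S * \<bar>of_int l\<bar>)) summable_on UNIV"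
        by (intro summable_on_cmult_right gauss_summable \<kappa>)
      fix l q assume q: "q \<in> hbox \<delta> R"
      obtain \<tau> z where [simp]: "q = (\<tau>, z)" by (cases q)
      have \<tau>: "\<tau> \<in> uhp" using hbox_uhp[OF \<delta>] q by auto
      have y: "\<delta> \<le> Im \<tau>" "norm \<tau> \<le> R" "norm z \<le> R" using q by (auto simp: hbox_def)
      have R: "0 \<le> R" using order_trans[OF norm_ge_zero y(3)] .
      define x w where "x = Im z / Im \<tau>" and "w = Re z - x * Re \<tau>"
      have x: "\<bar>x\<bar> \<le> R / \<delta>"
        unfolding x_def abs_divide using y \<delta> abs_Im_le_cmod[of z] R by (intro frac_le) auto
      have "\<bar>w\<bar> \<le> \<bar>Re z\<bar> + \<bar>x\<bar> * \<bar>Re \<tau>\<bar>" unfolding w_def abs_mult[symmetric] by (rule abs_triangle_ineq4)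
      also have "\<dots> \<le> R + R / \<delta> * R"
        using x y \<delta> R abs_Re_le_cmod[of z] abs_Re_le_cmod[of \<tau>] by (intro add_mono mult_mono) auto
      finally have w: "\<bar>w\<bar> \<le> R + R / \<delta> * R" .
      define s where "s = x * of_int d - w * of_int c"
      have "\<bar>s\<bar> \<le> \<bar>x\<bar> * \<bar>of_int d\<bar> + \<bar>w\<bar> * \<bar>of_int c\<bar>" unfolding s_def abs_mult[symmetric] by (rule abs_triangle_ineq4)
      also have "\<dots> \<le> S" unfolding S_def using x w by (intro add_mono mult_right_mono) auto
      finally have s: "\<bar>s\<bar> \<le> S" .
      define \<nu> where "\<nu> = norm (of_int c * \<tau> + of_int d)"
      have \<nu>0: "\<nu> > 0" unfolding \<nu>_def using nz[OF \<tau>] by simp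
      have "\<nu> \<le> \<bar>of_int c\<bar> * norm \<tau> + \<bar>of_int d\<bar>"
        unfolding \<nu>_def using norm_triangle_ineq[of "of_int c * \<tau>" "of_int d"] by (simp add: norm_mult)
      also have "\<dots> \<le> K" unfolding K_def using y(2) mult_left_mono[OF y(2), of "\<bar>of_int c\<bar>"] R by simp
      finally have \<nu>: "\<nu> \<le> K" .
      have \<kappa>le: "\<kappa> \<le> 2 * pi * real m * Im \<tau> / \<nu>\<^sup>2"
        unfolding \<kappa>_def using y \<delta> \<nu> \<nu>0 by (intro frac_le mult_left_mono power_mono) auto
      have "x\<^sup>2 * Im \<tau> \<le> (R / \<delta>)\<^sup>2 * R"
        using x y \<delta> R abs_Im_le_cmod[of \<tau>] by (intro mult_mono) (auto simp: abs_le_square_iff[symmetric])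
      then have "2 * pi * real m * (x\<^sup>2 * Im \<tau>) \<le> 2 * pi * real m * ((R / \<delta>)\<^sup>2 * R)" by (intro mult_left_mono) auto
      then have 1: "exp (2 * pi * real m * x\<^sup>2 * Im \<tau>) \<le> E" by (simp add: E_def mult.assoc)
      have "- (2 * pi * real m * Im \<tau> / \<nu>\<^sup>2) * (of_int l + s)\<^sup>2 \<le> - \<kappa> * (of_int l + s)\<^sup>2"
        using mult_right_mono[OF \<kappa>le, of "(of_int l + s)\<^sup>2"] by simp
      also have "\<dots> = - \<kappa> * (of_int l)\<^sup>2 + 2 * \<kappa> * (- (of_int l * s)) - \<kappa> * s\<^sup>2" by (simp add: power2_eq_square algebra_simps)
      also have "\<dots> \<le> - \<kappa> * (of_int l)\<^sup>2 + 2 * \<kappa> * (S * \<bar>of_int l\<bar>)"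
      proof -
        have "- (of_int l * s) \<le> \<bar>of_int l\<bar> * \<bar>s\<bar>" using abs_ge_minus_self[of "of_int l * s"] by (simp add: abs_mult)
        also have "\<dots> \<le> S * \<bar>of_int l\<bar>" using s by (simp add: mult.commute mult_right_mono)
        finally have "2 * \<kappa> * (- (of_int l * s)) \<le> 2 * \<kappa> * (S * \<bar>of_int l\<bar>)" using \<kappa> by (intro mult_left_mono) auto
        moreover have "\<kappa> * s\<^sup>2 \<ge> 0" using \<kappa> by simp
        ultimately show ?thesis by linarith
      qed
      finally have 2: "exp (- (2 * pi * real m * Im \<tau> / \<nu>\<^sup>2) * (of_int l + s)\<^sup>2) \<le> exp (- \<kappa> * (of_int l)\<^sup>2 + 2 * \<kappa> * S * \<bar>of_int l\<bar>)"
        by (simp add: mult.assoc)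
      have "norm (e (of_nat m * jac_arg a b c d l \<tau> z)) \<le> E * exp (- \<kappa> * (of_int l)\<^sup>2 + 2 * \<kappa> * S * \<bar>of_int l\<bar>)"
        unfolding norm_e_jac_arg[OF \<tau> d(2)] x_def[symmetric] w_def[symmetric] s_def[symmetric] \<nu>_def[symmetric]
        using 1 2 by (intro mult_mono) (auto simp: E_def)
      then show "case q of (\<tau>, z) \<Rightarrow> norm (e (of_nat m * jac_arg a b c d l \<tau> z)) \<le> E * exp (- \<kappa> * (of_int l)\<^sup>2 + 2 * \<kappa> * S * \<bar>of_int l\<bar>)"
        by simp
    qed
  qed
  then have "hol2 (\<lambda>\<tau> z. (\<Sum>\<^sub>\<infinity>l. e (of_nat m * jac_arg a b c d l \<tau> z)) / (of_int c * \<tau> + of_int d) ^ 4)"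
    by (intro hol2_intros) (use nz in auto)
  then show ?thesis
    by (rule hol2_cong) (simp add: d(1) jac_term_eq[OF _ d(2)] jac_row_def)
qed

lemma hol2_jac_sum:
  assumes m: "m \<ge> 1"
  shows "hol2 (\<lambda>\<tau> z. \<Sum>\<^sub>\<infinity>p\<in>coprimes. jac_term m p \<tau> z)"
proof (rule hol2_infsum)
  show "hol2 (jac_term m p)" if "p \<in> coprimes" for p by (rule hol2_jac_term[OF that m])
  fix \<delta> R :: real assume \<delta>: "\<delta> > 0"
  \<comment> \<open>From \<open>\<bar>c\<bar> \<delta> \<le> \<bar>c \<tau> + d\<bar>\<close> and \<open>\<bar>d\<bar> \<le> \<bar>c \<tau> + d\<bar> + \<bar>c\<bar> R\<close>.\<close>
  define \<eta> where "\<eta> = \<delta> / (1 + \<delta> + \<bar>R\<bar>)"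
  have \<eta>: "\<eta> > 0" using \<delta> by (auto simp: \<eta>_def)
  define B where "B = 2 * pi * real m * (R / \<delta>)\<^sup>2 * R"
  define C where "C = exp B * ((\<eta> powr (- 3 / 2) + gauss_const * \<delta> powr (- 3 / 4)) * (2 / \<eta>) powr (5 / 2))"
  show "\<exists>M. M summable_on coprimes \<and> (\<forall>p\<in>coprimes. \<forall>(\<tau>, z)\<in>hbox \<delta> R. norm (jac_term m p \<tau> z) \<le> M p)"
  proof (intro exI conjI ballI)
    show "(\<lambda>p. C * lat_weight p) summable_on coprimes" by (rule coprime_weight_summable)
    fix p q assume p: "p \<in> coprimes" and q: "q \<in> hbox \<delta> R"
    obtain \<tau> z c d where [simp]: "q = (\<tau>, z)" "p = (c, d)" by (cases q, cases p) auto
    have \<tau>: "\<tau> \<in> uhp" using hbox_uhp[OF \<delta>] q by auto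
    have y: "\<delta> \<le> Im \<tau>" "norm \<tau> \<le> R" "norm z \<le> R" using q by (auto simp: hbox_def)
    have R: "0 \<le> R" using order_trans[OF norm_ge_zero y(3)] .
    have "norm (jac_term m (c, d) \<tau> z) \<le> C * lat_weight (c, d)"
      unfolding C_def
    proof (rule jac_term_norm_weight[OF \<tau> m _ \<eta> _ \<delta> y(1)])
      show "(c, d) \<in> coprimes" using p by simp
      define \<nu> where "\<nu> = norm (of_int c * \<tau> + of_int d)"
      have "\<bar>of_int c\<bar> * \<delta> \<le> \<bar>of_int c\<bar> * Im \<tau>" using y(1) by (intro mult_left_mono) auto
      also have "\<dots> = \<bar>Im (of_int c * \<tau> + of_int d)\<bar>" using \<delta> y(1) by (simp add: abs_mult)
      also have "\<dots> \<le> \<nu>" unfolding \<nu>_def by (rule abs_Im_le_cmod)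
      finally have c: "\<bar>of_int c\<bar> * \<delta> \<le> \<nu>" .
      have "norm (of_int d :: complex) \<le> \<nu> + norm (of_int c * \<tau>)"
        unfolding \<nu>_def using norm_triangle_ineq4[of "of_int c * \<tau> + of_int d" "of_int c * \<tau>"] by simp
      then have "\<bar>of_int d\<bar> \<le> \<nu> + \<bar>of_int c\<bar> * norm \<tau>" by (simp add: norm_mult)
      also have "\<dots> \<le> \<nu> + \<bar>of_int c\<bar> * R" using y(2) by (intro add_left_mono mult_left_mono) auto
      finally have d: "\<bar>of_int d\<bar> \<le> \<nu> + \<bar>of_int c\<bar> * R" .
      have "\<delta> * \<bar>of_int d\<bar> \<le> \<delta> * \<nu> + (\<bar>of_int c\<bar> * \<delta>) * R" using mult_left_mono[OF d, of \<delta>] \<delta> by (simp add: algebra_simps)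
      also have "\<dots> \<le> \<delta> * \<nu> + \<nu> * R" using c R by (intro add_left_mono mult_right_mono) auto
      finally have "\<delta> * (\<bar>of_int c\<bar> + \<bar>of_int d\<bar>) \<le> \<nu> * (1 + \<delta> + \<bar>R\<bar>)" using c R by (simp add: algebra_simps)
      moreover have "1 + \<delta> + \<bar>R\<bar> > 0" using \<delta> by simp
      ultimately show "\<eta> * (\<bar>of_int c\<bar> + \<bar>of_int d\<bar>) \<le> norm (of_int c * \<tau> + of_int d)"
        unfolding \<eta>_def \<nu>_def[symmetric] by (simp add: pos_divide_le_eq)
      have "\<bar>Im z / Im \<tau>\<bar> \<le> R / \<delta>"
        unfolding abs_divide using y \<delta> abs_Im_le_cmod[of z] R by (intro frac_le) auto
      then have "(Im z / Im \<tau>)\<^sup>2 * Im \<tau> \<le> (R / \<delta>)\<^sup>2 * R"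
        using y \<delta> R abs_Im_le_cmod[of \<tau>] by (intro mult_mono) (auto simp: abs_le_square_iff[symmetric])
      then have "2 * pi * real m * ((Im z / Im \<tau>)\<^sup>2 * Im \<tau>) \<le> 2 * pi * real m * ((R / \<delta>)\<^sup>2 * R)" by (intro mult_left_mono) auto
      then show "2 * pi * real m * (Im z / Im \<tau>)\<^sup>2 * Im \<tau> \<le> B" by (simp add: B_def mult.assoc)
    qed
    then show "case q of (\<tau>, z) \<Rightarrow> norm (jac_term m p \<tau> z) \<le> C * lat_weight p" by simp
  qed
qed

text \<open>
  A uniform limit is a limit along a product filter, so that dominated convergence of sums applies to it.
\<close>

lemma uniform_limit_prod_principal:
  fixes f :: "'a \<Rightarrow> 'b \<Rightarrow> complex"
  assumes "((\<lambda>q. f (fst q) (snd q)) \<longlongrightarrow> L) (F \<times>\<^sub>F principal S)"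
  shows "uniform_limit S f (\<lambda>_. L) F"
  unfolding uniform_limit_iff
proof (intro allI impI)
  fix \<epsilon> :: real assume "\<epsilon> > 0"
  from tendstoD[OF assms this] obtain P Q where "eventually P F" "eventually Q (principal S)"
    "\<And>x y. P x \<Longrightarrow> Q y \<Longrightarrow> dist (f x y) L < \<epsilon>"
    unfolding eventually_prod_filter by auto
  then show "\<forall>\<^sub>F x in F. \<forall>y\<in>S. dist (f x y) L < \<epsilon>"
    by (auto simp: eventually_principal elim!: eventually_mono)
qed

lemma jac_denom_ge:
  assumes re: "\<bar>Re \<tau>\<bar> \<le> 1 / 2" and y: "Im \<tau> \<ge> 1"
  shows "1 / 3 * (\<bar>of_int c\<bar> + \<bar>of_int d\<bar>) \<le> norm (of_int c * \<tau> + of_int d)"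
    and "c \<noteq> 0 \<Longrightarrow> Im \<tau> \<le> norm (of_int c * \<tau> + of_int d)"
proof -
  define \<nu> where "\<nu> = norm (of_int c * \<tau> + of_int d)"
  have "\<bar>Im (of_int c * \<tau> + of_int d)\<bar> \<le> \<nu>" unfolding \<nu>_def by (rule abs_Im_le_cmod)
  then have c: "\<bar>of_int c\<bar> * Im \<tau> \<le> \<nu>" using y by (simp add: abs_mult)
  have c1: "\<bar>of_int c\<bar> * 1 \<le> \<bar>of_int c\<bar> * Im \<tau>" using y by (intro mult_left_mono) auto
  have "\<bar>Re (of_int c * \<tau> + of_int d)\<bar> \<le> \<nu>" unfolding \<nu>_def by (rule abs_Re_le_cmod)
  then have "\<bar>of_int c * Re \<tau> + of_int d\<bar> \<le> \<nu>" by simp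
  moreover have "\<bar>of_int c * Re \<tau>\<bar> \<le> \<bar>of_int c\<bar> * (1 / 2)" unfolding abs_mult using re by (intro mult_left_mono) auto
  ultimately have "\<bar>of_int d\<bar> \<le> \<nu> + \<bar>of_int c\<bar> * (1 / 2)" by linarith
  moreover have "C \<le> X \<Longrightarrow> X \<le> \<nu> \<Longrightarrow> D \<le> \<nu> + C * (1 / 2) \<Longrightarrow> 0 \<le> C \<Longrightarrow> 1 / 3 * (C + D) \<le> \<nu>" for C D X
    by simp
  ultimately show "1 / 3 * (\<bar>of_int c\<bar> + \<bar>of_int d\<bar>) \<le> \<nu>" using c c1 by (metis abs_ge_zero mult.right_neutral)
  assume "c \<noteq> 0"
  then have "real_of_int 1 \<le> of_int \<bar>c\<bar>" by (simp only: of_int_le_iff)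
  then have "1 * Im \<tau> \<le> \<bar>of_int c\<bar> * Im \<tau>" using y by (intro mult_right_mono) auto
  then show "Im \<tau> \<le> \<nu>" using c by linarith
qed

lemma jac_term_cusp_le:
  assumes y: "Im \<tau> \<ge> 1" and re: "\<bar>Re \<tau>\<bar> \<le> 1 / 2" and m: "m \<ge> 1" and p: "(c, d) \<in> coprimes" and c: "c \<noteq> 0"
    and B: "2 * pi * real m * (Im z / Im \<tau>)\<^sup>2 * Im \<tau> \<le> B"
  shows "norm (jac_term m (c, d) \<tau> z) \<le> exp B * (1 + gauss_const) / Im \<tau>"
proof -
  have \<tau>: "\<tau> \<in> uhp" using y by (simp add: uhp_def)
  define \<nu> where "\<nu> = norm (of_int c * \<tau> + of_int d)"
  have \<nu>: "Im \<tau> \<le> \<nu>" unfolding \<nu>_def by (rule jac_denom_ge(2)[OF re y c])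
  have 1: "\<nu> powr s \<le> 1 / Im \<tau>" if "s \<le> - 1" for s
  proof -
    have "\<nu> powr s \<le> \<nu> powr - 1" using that \<nu> y by (intro powr_mono) auto
    also have "\<dots> = 1 / \<nu>" using \<nu> y by (simp add: powr_minus_divide)
    also have "\<dots> \<le> 1 / Im \<tau>" using \<nu> y by (intro divide_left_mono) auto
    finally show ?thesis .
  qed
  have "Im \<tau> powr (- 3 / 4) \<le> Im \<tau> powr 0" using y by (intro powr_mono) auto
  then have 2: "Im \<tau> powr (- 3 / 4) \<le> 1" using y by simp
  have "gauss_const * Im \<tau> powr (- 3 / 4) * \<nu> powr (- 5 / 2) \<le> gauss_const * 1 * (1 / Im \<tau>)"
    using 1[of "- 5 / 2"] 2 y gauss_const_nonneg by (intro mult_mono) auto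
  then have "\<nu> powr - 4 + gauss_const * Im \<tau> powr (- 3 / 4) * \<nu> powr (- 5 / 2) \<le> 1 / Im \<tau> + gauss_const * 1 * (1 / Im \<tau>)"
    using 1[of "- 4"] by (intro add_mono) auto
  then have "exp (2 * pi * real m * (Im z / Im \<tau>)\<^sup>2 * Im \<tau>) * (\<nu> powr - 4 + gauss_const * Im \<tau> powr (- 3 / 4) * \<nu> powr (- 5 / 2))
      \<le> exp B * (1 / Im \<tau> + gauss_const * 1 * (1 / Im \<tau>))"
    using B gauss_const_nonneg by (intro mult_mono) auto
  also have "\<dots> = exp B * (1 + gauss_const) / Im \<tau>" by (simp add: algebra_simps add_divide_distrib)
  finally show ?thesis using jac_term_norm[OF \<tau> m p, of z] unfolding \<nu>_def by linarith
qed

lemma unit_square: "\<bar>d\<bar> = 1 \<Longrightarrow> d * d = (1 :: int)"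
  by (cases "d \<ge> 0") auto

lemma jac_term_0:
  assumes \<tau>: "\<tau> \<in> uhp" and d: "\<bar>d\<bar> = 1"
  shows "jac_term m (0, d) \<tau> z = (\<Sum>\<^sub>\<infinity>l. e (of_nat m * ((of_int l)\<^sup>2 * \<tau> + 2 * of_int l * of_int d * z)))"
proof -
  have dd: "d * d - 0 * 0 = 1" using unit_square[OF d] by simp
  have d1: "of_int d = (1 :: complex) \<or> of_int d = (- 1 :: complex)" using d by (cases "d \<ge> 0") auto
  have "jac_arg d 0 0 d l \<tau> z = (of_int l)\<^sup>2 * \<tau> + 2 * of_int l * of_int d * z" for l
    using d1 by (auto simp: jac_arg_def)
  moreover have "(of_int d :: complex) ^ 4 = 1" using d1 by auto
  ultimately show ?thesis by (simp add: jac_term_eq[OF \<tau> dd] jac_row_def)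
qed

text \<open>
  Only \<open>\<lambda> = 0\<close> survives at the cusp; the other terms are at most of size \<open>exp (- \<lambda>\<^sup>2 (Im \<tau> - 2 r))\<close> for \<open>\<bar>z\<bar> \<le> r\<close>.
\<close>

lemma jac_term_0_limit:
  assumes m: "m \<ge> 1" and d: "\<bar>d\<bar> = 1" and r: "r \<ge> 0"
  shows "((\<lambda>q. jac_term m (0, d) (fst q) (snd q)) \<longlongrightarrow> 1) (cusp \<times>\<^sub>F principal (cball 0 r))"
proof -
  let ?G = "cusp \<times>\<^sub>F principal (cball 0 r)"
  have nb: "?G \<noteq> bot" using r by (simp add: prod_filter_eq_bot principal_eq_bot_iff)
  define f where "f l q = e (of_nat m * ((of_int l)\<^sup>2 * fst q + 2 * of_int l * of_int d * snd q))" for l and q :: "complex \<times> complex"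
  have ev: "\<forall>\<^sub>F q in ?G. B \<le> Im (fst q) \<and> fst q \<in> uhp \<and> norm (snd q) \<le> r" for B
    unfolding eventually_prod_filter
  proof (intro exI conjI allI impI)
    show "eventually (\<lambda>\<tau>. B \<le> Im \<tau> \<and> \<tau> \<in> uhp) cusp"
      using filterlim_Im_cusp eventually_cusp_uhp by (auto simp: filterlim_at_top eventually_conj_iff)
    show "eventually (\<lambda>z. norm z \<le> r) (principal (cball 0 r))" by (simp add: eventually_principal)
  qed auto
  have bd: "norm (f l q) \<le> exp (- (of_int l)\<^sup>2 * (Im (fst q) - 2 * r))"
    if q: "2 * r + 1 \<le> Im (fst q)" "norm (snd q) \<le> r" for l q
  proof -
    have "\<bar>Im (snd q)\<bar> \<le> r" using abs_Im_le_cmod[of "snd q"] q(2) by linarith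
    then have "\<bar>of_int l * of_int d * Im (snd q)\<bar> \<le> \<bar>of_int l\<bar> * 1 * r"
      unfolding abs_mult using d by (intro mult_mono) (auto simp flip: of_int_abs)
    moreover have "\<bar>real_of_int l\<bar> \<le> (of_int l)\<^sup>2"
    proof -
      have "\<bar>l\<bar> \<le> l\<^sup>2" using self_le_power[of "\<bar>l\<bar>" 2] by (cases "l = 0") auto
      then have "real_of_int \<bar>l\<bar> \<le> of_int (l\<^sup>2)" by (simp only: of_int_le_iff)
      then show ?thesis by simp
    qed
    then have "\<bar>of_int l\<bar> * 1 * r \<le> (of_int l)\<^sup>2 * r" using r by (intro mult_right_mono) auto
    ultimately have "- (of_int l * of_int d * Im (snd q)) \<le> (of_int l)\<^sup>2 * r"
      using abs_ge_minus_self[of "of_int l * of_int d * Im (snd q)"] by linarith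
    moreover have "(of_int l)\<^sup>2 * (Im (fst q) - 2 * r) = (of_int l)\<^sup>2 * Im (fst q) - 2 * ((of_int l)\<^sup>2 * r)"
      by (simp add: right_diff_distrib)
    ultimately have 1: "(of_int l)\<^sup>2 * (Im (fst q) - 2 * r) \<le> (of_int l)\<^sup>2 * Im (fst q) + 2 * of_int l * of_int d * Im (snd q)"
      by (simp only: mult.assoc)
    have 0: "0 \<le> (of_int l)\<^sup>2 * (Im (fst q) - 2 * r)" using q(1) by (intro mult_nonneg_nonneg) auto
    have "1 * 1 \<le> 2 * pi * real m" using m pi_gt3 by (intro mult_mono) auto
    then have "1 * ((of_int l)\<^sup>2 * (Im (fst q) - 2 * r)) \<le> 2 * pi * real m * ((of_int l)\<^sup>2 * Im (fst q) + 2 * of_int l * of_int d * Im (snd q))"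
      using 0 1 by (intro mult_mono) auto
    moreover have "Im (of_nat m * ((of_int l)\<^sup>2 * fst q + 2 * of_int l * of_int d * snd q)) = real m * ((of_int l)\<^sup>2 * Im (fst q) + 2 * of_int l * of_int d * Im (snd q))"
      by (simp flip: of_int_power)
    ultimately show ?thesis by (simp add: f_def norm_e mult.assoc)
  qed
  have "((\<lambda>q. \<Sum>\<^sub>\<infinity>l. f l q) \<longlongrightarrow> (\<Sum>\<^sub>\<infinity>l\<in>(UNIV :: int set). if l = 0 then 1 else 0)) ?G"
  proof (rule infsum_tannery[OF _ _ _ nb])
    show "(\<lambda>l :: int. exp (- 1 * (of_int l)\<^sup>2 + 0 * \<bar>of_int l\<bar> :: real)) summable_on UNIV" by (rule gauss_summable) simp
    show "\<forall>\<^sub>F q in ?G. \<forall>l\<in>UNIV. norm (f l q) \<le> exp (- 1 * (of_int l)\<^sup>2 + 0 * \<bar>of_int l\<bar> :: real)"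
      using ev[of "2 * r + 1"]
    proof eventually_elim
      case (elim q)
      show ?case
      proof
        fix l :: int
        have "(of_int l)\<^sup>2 * 1 \<le> (of_int l)\<^sup>2 * (Im (fst q) - 2 * r)" using elim by (intro mult_left_mono) auto
        then show "norm (f l q) \<le> exp (- 1 * (of_int l)\<^sup>2 + 0 * \<bar>of_int l\<bar> :: real)"
          using bd[of q l] elim by (simp add: order_trans)
      qed
    qed
    fix l :: int
    show "(f l \<longlongrightarrow> (if l = 0 then 1 else 0)) ?G"
    proof (cases "l = 0")
      case False
      have fl: "filterlim (\<lambda>q. Im (fst q)) at_top ?G" by (rule filterlim_compose[OF filterlim_Im_cusp filterlim_fst])
      have "filterlim (\<lambda>q. - (2 * r) + Im (fst q)) at_top ?G" by (rule filterlim_tendsto_add_at_top[OF tendsto_const fl])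
      then have "((\<lambda>q. exp (- (- (2 * r) + Im (fst q)))) \<longlongrightarrow> 0) ?G"
        by (intro filterlim_compose[OF exp_at_bot] filterlim_compose[OF filterlim_uminus_at_bot_at_top])
      moreover have "\<forall>\<^sub>F q in ?G. norm (f l q) \<le> exp (- (- (2 * r) + Im (fst q)))"
        using ev[of "2 * r + 1"]
      proof eventually_elim
        case (elim q)
        have "1 \<le> l\<^sup>2" using False by (simp add: int_one_le_iff_zero_less)
        then have "real_of_int 1 \<le> of_int (l\<^sup>2)" by (simp only: of_int_le_iff)
        then have "1 * (Im (fst q) - 2 * r) \<le> (of_int l)\<^sup>2 * (Im (fst q) - 2 * r)" using elim by (intro mult_right_mono) auto
        then have "exp (- (of_int l)\<^sup>2 * (Im (fst q) - 2 * r)) \<le> exp (- (- (2 * r) + Im (fst q)))" by simp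
        then show ?case using bd[of q l] elim by linarith
      qed
      ultimately have "(f l \<longlongrightarrow> 0) ?G" by (rule Lim_null_comparison[rotated])
      then show ?thesis using False by simp
    qed (simp add: f_def[abs_def])
  qed
  moreover have "(\<Sum>\<^sub>\<infinity>l\<in>(UNIV :: int set). if l = 0 then 1 else 0) = (1 :: complex)"
    by (rule infsumI, rule has_sum_finite_neutralI[of "{0}"]) auto
  ultimately have "((\<lambda>q. \<Sum>\<^sub>\<infinity>l. f l q) \<longlongrightarrow> 1) ?G" by simp
  moreover have "\<forall>\<^sub>F q in ?G. (\<Sum>\<^sub>\<infinity>l. f l q) = jac_term m (0, d) (fst q) (snd q)"
    using ev[of 0] by eventually_elim (simp add: jac_term_0[OF _ d] f_def)
  ultimately show ?thesis by (rule Lim_transform_eventually)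
qed

lemma coprime_0_sum: "(\<Sum>\<^sub>\<infinity>p\<in>coprimes. if fst p = 0 then c else 0) = 2 * (c :: complex)"
proof (rule infsumI, rule has_sum_finite_neutralI[of "{(0, 1), (0, - 1)}"])
  show "x \<in> coprimes - {(0, 1), (0, - 1)} \<Longrightarrow> (if fst x = 0 then c else 0) = 0" for x
    by (cases x) auto
qed auto

text \<open>
  The two bottom rows \<open>(0, \<plusminus> 1)\<close> contribute 1 each, all others tend to zero.
\<close>

lemma jac_sum_cusp:
  assumes m: "m \<ge> 1"
  shows "uniform_limit (cball 0 r) (\<lambda>\<tau> z. \<Sum>\<^sub>\<infinity>p\<in>coprimes. jac_term m p \<tau> z) (\<lambda>_. 2) cusp"
proof (cases "r \<ge> 0")
  case True
  let ?G = "cusp \<times>\<^sub>F principal (cball 0 r)"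
  have nb: "?G \<noteq> bot" using True by (simp add: prod_filter_eq_bot principal_eq_bot_iff)
  define B where "B = 2 * pi * real m * r\<^sup>2"
  have ev: "\<forall>\<^sub>F q in ?G. 1 \<le> Im (fst q) \<and> \<bar>Re (fst q)\<bar> \<le> 1 / 2 \<and> norm (snd q) \<le> r"
    unfolding eventually_prod_filter
  proof (intro exI conjI allI impI)
    show "eventually (\<lambda>\<tau>. 1 \<le> Im \<tau> \<and> \<bar>Re \<tau>\<bar> \<le> 1 / 2) cusp" by (auto simp: eventually_cusp)
    show "eventually (\<lambda>z. norm z \<le> r) (principal (cball 0 r))" by (simp add: eventually_principal)
  qed auto
  have B: "2 * pi * real m * (Im z / Im \<tau>)\<^sup>2 * Im \<tau> \<le> B" if "1 \<le> Im \<tau>" "norm z \<le> r" for \<tau> z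
  proof -
    have "(Im z / Im \<tau>)\<^sup>2 * Im \<tau> = (Im z)\<^sup>2 / Im \<tau>" using that by (simp add: power2_eq_square)
    also have "\<dots> \<le> r\<^sup>2 / 1" using that abs_Im_le_cmod[of z] True by (intro frac_le) (auto simp: abs_le_square_iff[symmetric])
    finally have "2 * pi * real m * ((Im z / Im \<tau>)\<^sup>2 * Im \<tau>) \<le> 2 * pi * real m * r\<^sup>2" by (intro mult_left_mono) auto
    then show ?thesis by (simp add: B_def mult.assoc)
  qed
  define C where "C = exp B * (((1 / 3) powr (- 3 / 2) + gauss_const * 1 powr (- 3 / 4)) * (2 / (1 / 3)) powr (5 / 2))"
  have "((\<lambda>q. \<Sum>\<^sub>\<infinity>p\<in>coprimes. jac_term m p (fst q) (snd q)) \<longlongrightarrow> (\<Sum>\<^sub>\<infinity>p\<in>coprimes. if fst p = 0 then 1 else 0)) ?G"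
  proof (rule infsum_tannery[OF _ _ _ nb])
    show "(\<lambda>p. C * lat_weight p) summable_on coprimes" by (rule coprime_weight_summable)
    show "\<forall>\<^sub>F q in ?G. \<forall>p\<in>coprimes. norm (jac_term m p (fst q) (snd q)) \<le> C * lat_weight p"
      using ev
    proof eventually_elim
      case (elim q)
      show ?case
      proof
        fix p assume p: "p \<in> coprimes"
        obtain c d where cd: "p = (c, d)" by (cases p)
        have \<tau>: "fst q \<in> uhp" using elim by (simp add: uhp_def)
        show "norm (jac_term m p (fst q) (snd q)) \<le> C * lat_weight p"
          unfolding cd C_def
          by (rule jac_term_norm_weight[OF \<tau> m p[unfolded cd] _ jac_denom_ge(1) _ _ B]) (use elim in auto)
      qed
    qed
    fix p assume p: "p \<in> coprimes"
    obtain c d where cd: "p = (c, d)" by (cases p)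
    show "((\<lambda>q. jac_term m p (fst q) (snd q)) \<longlongrightarrow> (if fst p = 0 then 1 else 0)) ?G"
    proof (cases "c = 0")
      case c: True
      have "\<bar>d\<bar> = 1" using p cd c by simp
      from jac_term_0_limit[OF m this True] show ?thesis unfolding cd c by simp
    next
      case False
      have fl: "filterlim (\<lambda>q. Im (fst q)) at_top ?G" by (rule filterlim_compose[OF filterlim_Im_cusp filterlim_fst])
      have lim: "((\<lambda>q. exp B * (1 + gauss_const) / Im (fst q)) \<longlongrightarrow> 0) ?G"
        by (rule tendsto_divide_0[OF tendsto_const filterlim_at_top_imp_at_infinity[OF fl]])
      have "\<forall>\<^sub>F q in ?G. norm (jac_term m p (fst q) (snd q)) \<le> exp B * (1 + gauss_const) / Im (fst q)"
        using ev
      proof eventually_elim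
        case (elim q)
        then show ?case unfolding cd
          by (intro jac_term_cusp_le[OF _ _ m p[unfolded cd] False] B) auto
      qed
      from Lim_null_comparison[OF this lim] show ?thesis using False cd by simp
    qed
  qed
  then show ?thesis unfolding coprime_0_sum by (intro uniform_limit_prod_principal) simp
qed simp

theorem jform_Jacobi_Eisenstein:
  assumes m: "m \<ge> 1"
  shows "jform 4 m (Jacobi_Eisenstein 4 m) (\<lambda>_. 1)"
proof (rule jformI)
  have J: "Jacobi_Eisenstein 4 m = (\<lambda>\<tau> z. 1 / 2 * (\<Sum>\<^sub>\<infinity>p\<in>coprimes. jac_term m p \<tau> z))"
    by (intro ext Jacobi_Eisenstein_4)
  show "hol2 (Jacobi_Eisenstein 4 m)" unfolding J by (intro hol2_mult hol2_const hol2_jac_sum m)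
  have "cusp_lim (\<lambda>\<tau> z. \<Sum>\<^sub>\<infinity>p\<in>coprimes. jac_term m p \<tau> z) (\<lambda>_. 2)"
    unfolding cusp_lim_def using jac_sum_cusp[OF m] by auto
  from cusp_lim_mult[OF cusp_lim_const[of "1 / 2"] this]
  show "cusp_lim (Jacobi_Eisenstein 4 m) (\<lambda>_. 1)" unfolding J by simp
  fix \<tau> z assume \<tau>: "\<tau> \<in> uhp"
  have re: "(\<Sum>\<^sub>\<infinity>p\<in>coprimes. jac_term m p \<tau>' z') = K * (\<Sum>\<^sub>\<infinity>p\<in>coprimes. jac_term m p \<tau> z)"
    if "bij_betw g coprimes coprimes" "\<And>p. p \<in> coprimes \<Longrightarrow> jac_term m p \<tau>' z' = K * jac_term m (g p) \<tau> z" for g K \<tau>' z'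
  proof -
    have "(\<Sum>\<^sub>\<infinity>p\<in>coprimes. jac_term m p \<tau>' z') = (\<Sum>\<^sub>\<infinity>p\<in>coprimes. K * jac_term m (g p) \<tau> z)" by (rule infsum_cong[OF that(2)])
    also have "\<dots> = K * (\<Sum>\<^sub>\<infinity>p\<in>coprimes. jac_term m (g p) \<tau> z)" by (rule infsum_cmult_right')
    also have "(\<Sum>\<^sub>\<infinity>p\<in>coprimes. jac_term m (g p) \<tau> z) = (\<Sum>\<^sub>\<infinity>p\<in>coprimes. jac_term m p \<tau> z)"
      by (rule infsum_reindex_bij_betw[OF that(1), of "\<lambda>p. jac_term m p \<tau> z"])
    finally show ?thesis .
  qed
  have g1: "coprime c (c + d) \<longleftrightarrow> coprime c d" for c d :: int by (simp only: coprime_iff_gcd_eq_1 gcd_add2)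
  have g2: "coprime c (d - c) \<longleftrightarrow> coprime c d" for c d :: int using g1[of c "d - c"] by simp
  have b1: "bij_betw (\<lambda>p. (fst p, fst p + snd p)) coprimes coprimes"
    by (rule bij_betwI[where g = "\<lambda>p. (fst p, snd p - fst p)"]) (auto simp: g1 g2)
  show "Jacobi_Eisenstein 4 m (\<tau> + 1) z = Jacobi_Eisenstein 4 m \<tau> z"
    unfolding J using re[OF b1, of "\<tau> + 1" z 1] jac_term_T[OF _ \<tau>] by simp
  have b2: "bij_betw (\<lambda>p. (snd p, - fst p)) coprimes coprimes"
    by (rule bij_betwI[where g = "\<lambda>p. (- snd p, fst p)"]) (auto simp: coprime_commute)
  show "Jacobi_Eisenstein 4 m (- 1 / \<tau>) (z / \<tau>) = \<tau> powi 4 * e (of_nat m * z\<^sup>2 / \<tau>) * Jacobi_Eisenstein 4 m \<tau> z"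
    unfolding J using re[OF b2, of "- 1 / \<tau>" "z / \<tau>" "\<tau> ^ 4 * e (of_nat m * z\<^sup>2 / \<tau>)"] jac_term_S[OF _ \<tau>] by simp
  have b3: "bij_betw (\<lambda>p. p) coprimes coprimes" by (simp add: bij_betw_def)
  show "Jacobi_Eisenstein 4 m \<tau> (z + 1) = Jacobi_Eisenstein 4 m \<tau> z"
    unfolding J using re[OF b3, of \<tau> "z + 1" 1] jac_term_plus_1[OF _ \<tau>] by simp
  show "Jacobi_Eisenstein 4 m \<tau> (z + \<tau>) = e (- of_nat m * (\<tau> + 2 * z)) * Jacobi_Eisenstein 4 m \<tau> z"
    unfolding J using re[OF b3, of \<tau> "z + \<tau>" "e (- of_nat m * (\<tau> + 2 * z))"] jac_term_plus_\<tau>[OF _ \<tau>] by simp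
qed

section \<open>The Jacobi--Eisenstein series of index 3 and 4 as polynomials\<close>

lemma Jacobi_Eisenstein_4_3:
  assumes \<tau>: "\<tau> \<in> uhp"
  shows "Jacobi_Eisenstein 4 3 \<tau> z = - 48 * cub_a \<tau> * Yf \<tau> z ^ 3 - 216 * cub_b \<tau> * (Yf \<tau> z)\<^sup>2 * Qf \<tau> z
    + 48 * (cub_a \<tau>)\<^sup>2 * Yf \<tau> z * (Qf \<tau> z)\<^sup>2 + 24 * cub_a \<tau> * cub_b \<tau> * Qf \<tau> z ^ 3"
proof -
  have "Jacobi_Eisenstein 4 3 \<tau> z = cpoly [(1,0,3,0,-48), (0,1,2,1,-216), (2,0,1,2,48), (1,1,0,3,24)] (cub_a \<tau>) (cub_b \<tau>) (Yf \<tau> z) (Qf \<tau> z)"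
  proof (rule jform_eq_cpoly[OF jform_Jacobi_Eisenstein _ \<tau>])
    show "1 = cpoly [(1,0,3,0,-48), (0,1,2,1,-216), (2,0,1,2,48), (1,1,0,3,24)] (- 1 / 48) (1 / 864) (1 + q0 z / 12) (q0 z)" for z
      by (simp add: cpoly_def field_simps power2_eq_square power3_eq_cube)
  qed auto
  then show ?thesis by (simp add: cpoly_def algebra_simps)
qed

text \<open>
  At \<open>z = \<tau> / 2\<close> the factor \<open>\<bar>q\<bar>\<close> exactly compensates the growth \<open>exp (2 \<pi> m x\<^sup>2 Im \<tau>)\<close> of the general bound, as \<open>m = 4\<close> and
  \<open>x = 1/2\<close>. In the rows with \<open>c = 0\<close> the terms become \<open>q\<close> to the power \<open>(2 \<lambda> + d)\<^sup>2\<close> with \<open>d\<close> odd.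
\<close>

lemma Jacobi_Eisenstein_half_cusp:
  "((\<lambda>\<tau>. e \<tau> * Jacobi_Eisenstein 4 4 \<tau> (\<tau> / 2)) \<longlongrightarrow> 0) cusp"
proof -
  define C where "C = exp 0 * (((1 / 3) powr (- 3 / 2) + gauss_const * 1 powr (- 3 / 4)) * (2 / (1 / 3)) powr (5 / 2))"
  have m: "(1 :: nat) \<le> 4" by simp
  have ev: "\<forall>\<^sub>F \<tau> in cusp. 1 \<le> Im \<tau> \<and> \<bar>Re \<tau>\<bar> \<le> 1 / 2" by (auto simp: eventually_cusp)
  have D: "norm (e \<tau>) * N \<le> K" if "N \<le> exp B * K" "B = 2 * pi * Im \<tau>" for N K B \<tau>
  proof -
    have "norm (e \<tau>) * N \<le> norm (e \<tau>) * (exp B * K)" using that by (intro mult_left_mono) auto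
    also have "\<dots> = K" by (simp add: norm_e that(2) exp_minus)
    finally show ?thesis .
  qed
  have B: "2 * pi * real 4 * (Im (\<tau> / 2) / Im \<tau>)\<^sup>2 * Im \<tau> = 2 * pi * Im \<tau>" if "1 \<le> Im \<tau>" for \<tau>
  proof -
    have "Im (\<tau> / 2) / Im \<tau> = 1 / 2" using that by simp
    then show ?thesis by (simp only:) (simp add: power2_eq_square)
  qed
  have "((\<lambda>\<tau>. \<Sum>\<^sub>\<infinity>p\<in>coprimes. e \<tau> * jac_term 4 p \<tau> (\<tau> / 2)) \<longlongrightarrow> (\<Sum>\<^sub>\<infinity>p\<in>coprimes. 0)) cusp"
  proof (rule infsum_tannery[OF _ _ _ cusp_nonbot])
    show "(\<lambda>p. C * lat_weight p) summable_on coprimes" by (rule coprime_weight_summable)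
    show "\<forall>\<^sub>F \<tau> in cusp. \<forall>p\<in>coprimes. norm (e \<tau> * jac_term 4 p \<tau> (\<tau> / 2)) \<le> C * lat_weight p"
      using ev
    proof eventually_elim
      case (elim \<tau>)
      show ?case
      proof
        fix p assume p: "p \<in> coprimes"
        obtain c d where cd: "p = (c, d)" by (cases p)
        have \<tau>: "\<tau> \<in> uhp" using elim by (simp add: uhp_def)
        have "norm (jac_term 4 (c, d) \<tau> (\<tau> / 2)) \<le> exp (2 * pi * Im \<tau>) * (((1 / 3) powr (- 3 / 2) + gauss_const * 1 powr (- 3 / 4)) * (2 / (1 / 3)) powr (5 / 2)) * lat_weight (c, d)"
          by (rule jac_term_norm_weight[OF \<tau> m p[unfolded cd] _ jac_denom_ge(1) _ _ eq_refl[OF B]]) (use elim in auto)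
        then have "norm (jac_term 4 (c, d) \<tau> (\<tau> / 2)) \<le> exp (2 * pi * Im \<tau>) * (C * lat_weight (c, d))"
          by (simp only: C_def exp_zero mult_1 mult.assoc)
        from D[OF this refl] show "norm (e \<tau> * jac_term 4 p \<tau> (\<tau> / 2)) \<le> C * lat_weight p"
          unfolding cd norm_mult .
      qed
    qed
    fix p assume p: "p \<in> coprimes"
    obtain c d where cd: "p = (c, d)" by (cases p)
    show "((\<lambda>\<tau>. e \<tau> * jac_term 4 p \<tau> (\<tau> / 2)) \<longlongrightarrow> 0) cusp"
    proof (cases "c = 0")
      case False
      have lim: "((\<lambda>\<tau>. (1 + gauss_const) / Im \<tau>) \<longlongrightarrow> 0) cusp"
        by (rule tendsto_divide_0[OF tendsto_const filterlim_at_top_imp_at_infinity[OF filterlim_Im_cusp]])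
      have "\<forall>\<^sub>F \<tau> in cusp. norm (e \<tau> * jac_term 4 p \<tau> (\<tau> / 2)) \<le> (1 + gauss_const) / Im \<tau>"
        using ev
      proof eventually_elim
        case (elim \<tau>)
        then have "norm (jac_term 4 (c, d) \<tau> (\<tau> / 2)) \<le> exp (2 * pi * Im \<tau>) * (1 + gauss_const) / Im \<tau>"
          by (intro jac_term_cusp_le[OF _ _ m p[unfolded cd] False] eq_refl[OF B]) auto
        then have "norm (jac_term 4 (c, d) \<tau> (\<tau> / 2)) \<le> exp (2 * pi * Im \<tau>) * ((1 + gauss_const) / Im \<tau>)" by simp
        from D[OF this refl] show ?case unfolding cd norm_mult .
      qed
      from Lim_null_comparison[OF this lim] show ?thesis .
    next
      case True
      then have d: "\<bar>d\<bar> = 1" using p cd by simp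
      define f where "f l \<tau> = e ((of_int (2 * l + d))\<^sup>2 * \<tau>)" for l \<tau>
      have eq: "e \<tau> * jac_term 4 p \<tau> (\<tau> / 2) = (\<Sum>\<^sub>\<infinity>l. f l \<tau>)" if \<tau>: "\<tau> \<in> uhp" for \<tau>
      proof -
        have "(of_int d :: complex)\<^sup>2 = 1" using unit_square[OF d] by (simp add: power2_eq_square flip: of_int_mult)
        then have "\<tau> + of_nat 4 * ((of_int l)\<^sup>2 * \<tau> + 2 * of_int l * of_int d * (\<tau> / 2)) = (of_int (2 * l + d))\<^sup>2 * \<tau>" for l
          by (simp add: power2_eq_square algebra_simps)
        then show ?thesis
          unfolding cd True jac_term_0[OF \<tau> d] f_def infsum_cmult_right'[symmetric] e_add[symmetric] by simp
      qed
      have sq: "(of_int l)\<^sup>2 \<le> (of_int (2 * l + d) :: real)\<^sup>2" "1 \<le> (of_int (2 * l + d) :: real)\<^sup>2" for l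
      proof -
        have "\<bar>l\<bar> \<le> \<bar>2 * l + d\<bar>" "\<bar>1\<bar> \<le> \<bar>2 * l + d\<bar>" using d by presburger+
        then have "l\<^sup>2 \<le> (2 * l + d)\<^sup>2" "1\<^sup>2 \<le> (2 * l + d)\<^sup>2" by (simp_all only: abs_le_square_iff)
        then have "real_of_int (l\<^sup>2) \<le> of_int ((2 * l + d)\<^sup>2)" "real_of_int (1\<^sup>2) \<le> of_int ((2 * l + d)\<^sup>2)" by (simp_all only: of_int_le_iff)
        then show "(of_int l)\<^sup>2 \<le> (of_int (2 * l + d) :: real)\<^sup>2" "1 \<le> (of_int (2 * l + d) :: real)\<^sup>2"
          by (simp_all only: of_int_power of_int_1 power_one)
      qed
      have n: "norm (f l \<tau>) = exp (- (2 * pi * ((of_int (2 * l + d))\<^sup>2 * Im \<tau>)))" for l \<tau>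
        unfolding f_def norm_e of_int_power[symmetric] by simp
      have "((\<lambda>\<tau>. \<Sum>\<^sub>\<infinity>l. f l \<tau>) \<longlongrightarrow> (\<Sum>\<^sub>\<infinity>l\<in>(UNIV :: int set). 0)) cusp"
      proof (rule infsum_tannery[OF _ _ _ cusp_nonbot])
        show "(\<lambda>l :: int. exp (- 1 * (of_int l)\<^sup>2 + 0 * \<bar>of_int l\<bar> :: real)) summable_on UNIV" by (rule gauss_summable) simp
        show "\<forall>\<^sub>F \<tau> in cusp. \<forall>l\<in>UNIV. norm (f l \<tau>) \<le> exp (- 1 * (of_int l)\<^sup>2 + 0 * \<bar>of_int l\<bar> :: real)"
          using ev
        proof eventually_elim
          case (elim \<tau>)
          show ?case
          proof
            fix l :: int
            have "(of_int l)\<^sup>2 * 1 \<le> (of_int (2 * l + d))\<^sup>2 * Im \<tau>" using sq(1)[of l] elim by (intro mult_mono) auto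
            then have "1 * ((of_int l)\<^sup>2 * 1) \<le> 2 * pi * ((of_int (2 * l + d))\<^sup>2 * Im \<tau>)"
              by (rule mult_mono[rotated]) (use pi_gt3 in auto)
            then show "norm (f l \<tau>) \<le> exp (- 1 * (of_int l)\<^sup>2 + 0 * \<bar>of_int l\<bar> :: real)" unfolding n by simp
          qed
        qed
        fix l :: int
        have lim: "((\<lambda>\<tau>. norm (e \<tau>)) \<longlongrightarrow> 0) cusp" using e_cusp by (rule tendsto_norm_zero)
        have "\<forall>\<^sub>F \<tau> in cusp. norm (f l \<tau>) \<le> norm (e \<tau>)"
          using ev
        proof eventually_elim
          case (elim \<tau>)
          then have "1 * Im \<tau> \<le> (of_int (2 * l + d))\<^sup>2 * Im \<tau>" using sq(2)[of l] by (intro mult_right_mono) auto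
          then have "2 * pi * (1 * Im \<tau>) \<le> 2 * pi * ((of_int (2 * l + d))\<^sup>2 * Im \<tau>)" by (intro mult_left_mono) auto
          then show ?case unfolding n norm_e by simp
        qed
        from Lim_null_comparison[OF this lim] show "(f l \<longlongrightarrow> 0) cusp" .
      qed
      then have "((\<lambda>\<tau>. \<Sum>\<^sub>\<infinity>l. f l \<tau>) \<longlongrightarrow> 0) cusp" by simp
      moreover have "\<forall>\<^sub>F \<tau> in cusp. (\<Sum>\<^sub>\<infinity>l. f l \<tau>) = e \<tau> * jac_term 4 p \<tau> (\<tau> / 2)"
        using eventually_cusp_uhp by eventually_elim (rule eq[symmetric])
      ultimately show ?thesis by (rule Lim_transform_eventually)
    qed
  qed
  then have "((\<lambda>\<tau>. 1 / 2 * (\<Sum>\<^sub>\<infinity>p\<in>coprimes. e \<tau> * jac_term 4 p \<tau> (\<tau> / 2))) \<longlongrightarrow> 1 / 2 * 0) cusp" by (intro tendsto_intros) simp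
  then show ?thesis by (simp add: Jacobi_Eisenstein_4 infsum_cmult_right' mult.left_commute[of "e _"])
qed

text \<open>
  At \<open>z = \<tau> / 2\<close> the square \<open>X01\<close> vanishes. For the second equation \<open>\<Delta>\<close> and \<open>Q\<close> are expressed through the values of
  \<open>k\<close> at the half-periods; what remains is a difference of two \<open>\<epsilon>\<^sub>i\<close>, whose limit at the cusp is known.
\<close>

lemma half_period_values:
  assumes \<tau>: "\<tau> \<in> uhp"
  shows "Yf \<tau> (\<tau> / 2) = eps01 \<tau> * Qf \<tau> (\<tau> / 2)"
    and "e \<tau> * Delta \<tau> * Qf \<tau> (\<tau> / 2) ^ 4 = 16 * (eps10 \<tau> - eps00 \<tau>)\<^sup>2"
proof -
  have "klein \<tau> (\<tau> / 2 + \<tau> / 2) = 0" using klein_plus_\<tau>[OF \<tau>, of 0] by (simp add: klein_def)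
  then have "X01 \<tau> (\<tau> / 2) = 0" by (simp add: X01_def)
  then show "Yf \<tau> (\<tau> / 2) = eps01 \<tau> * Qf \<tau> (\<tau> / 2)" using X_eq(2)[OF \<tau>, of "\<tau> / 2"] by simp
  define k1 k2 k3 where k: "k1 = klein \<tau> (1 / 2)" "k2 = klein \<tau> (\<tau> / 2)" "k3 = klein \<tau> ((\<tau> + 1) / 2)"
  have nz: "k1 \<noteq> 0" "k2 \<noteq> 0" "k3 \<noteq> 0" using klein_half_nz[OF \<tau>] by (simp_all add: k)
  note d = eps_diff[OF \<tau>, folded k]
  have E: "e \<tau> * (e (- \<tau> / 2))\<^sup>2 = 1"
    unfolding power2_eq_square e_add[symmetric] by simp
  have "e \<tau> * (16 * (- k3\<^sup>2 / (k1\<^sup>2 * k2\<^sup>2) * D * (e (- \<tau> / 2) * k1\<^sup>2 / (k2\<^sup>2 * k3\<^sup>2)))\<^sup>2) * (k2\<^sup>2) ^ 4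
      = (e \<tau> * (e (- \<tau> / 2))\<^sup>2) * (16 * D\<^sup>2)" for D
    using nz by (simp add: power_mult_distrib power_divide)
  then show "e \<tau> * Delta \<tau> * Qf \<tau> (\<tau> / 2) ^ 4 = 16 * (eps10 \<tau> - eps00 \<tau>)\<^sup>2"
    unfolding Delta_eq_eps[OF \<tau>] d(1,3) E by (simp add: Qf_def k)
qed

text \<open>
  The combination \<open>E\<^sub>4 Y\<^sup>4 - E\<^sub>6 Y\<^sup>3 Q / 3 + E\<^sub>4\<^sup>2 Y\<^sup>2 Q\<^sup>2 / 24 - E\<^sub>4 E\<^sub>6 Y Q\<^sup>3 / 432 + E\<^sub>4\<^sup>3 Q\<^sup>4 / 20736\<close> for \<open>E\<^sub>4 = - 48 a\<close> and
  \<open>E\<^sub>6 = 864 b\<close>, which is \<open>(Y - Q / 12)\<^sup>4 = 1\<close> at the cusp.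
\<close>

definition E44_quartic :: "complex \<Rightarrow> complex \<Rightarrow> complex \<Rightarrow> complex \<Rightarrow> complex" where
  "E44_quartic a b Y Q = - 48 * a * Y ^ 4 - 288 * b * Y ^ 3 * Q + 96 * a\<^sup>2 * Y\<^sup>2 * Q\<^sup>2 + 96 * a * b * Y * Q ^ 3
     - 16 / 3 * a ^ 3 * Q ^ 4"

text \<open>
  At the cusp \<open>s\<close> and \<open>t\<close> coincide. Both the quartic at the root \<open>s\<close> and the discriminant vanish to second order in
  \<open>s - t\<close>, so that their quotient has a limit.
\<close>

lemma E44_quartic_root:
  assumes "r + s + t = 0"
  defines "u \<equiv> (s + t) / 2" and "v \<equiv> (s - t) / 2"
  shows "E44_quartic (r * s + r * t + s * t) (- r * s * t) (s * Q) Q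
    = v\<^sup>2 * (1728 * u ^ 4 + 3456 * u ^ 3 * v + 3072 * u\<^sup>2 * v\<^sup>2 + 1152 * u * v ^ 3 + 448 / 3 * v ^ 4) * Q ^ 4"
    and "((r - s) * (r - t) * (s - t))\<^sup>2 = 4 * v\<^sup>2 * (9 * u\<^sup>2 - v\<^sup>2)\<^sup>2"
proof -
  have "r = - (s + t)" using assms(1) by (simp only: eq_neg_iff_add_eq_0 add.assoc)
  moreover have "- 2 * u = - (s + t)" by (simp add: u_def)
  ultimately have s: "s = u + v" "t = u - v" "r = - 2 * u" by (simp_all only:) (simp_all add: u_def v_def field_simps)
  show "E44_quartic (r * s + r * t + s * t) (- r * s * t) (s * Q) Q
    = v\<^sup>2 * (1728 * u ^ 4 + 3456 * u ^ 3 * v + 3072 * u\<^sup>2 * v\<^sup>2 + 1152 * u * v ^ 3 + 448 / 3 * v ^ 4) * Q ^ 4"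
    unfolding E44_quartic_def s by (simp add: power2_eq_square power3_eq_cube power4_eq_xxxx algebra_simps)
  show "((r - s) * (r - t) * (s - t))\<^sup>2 = 4 * v\<^sup>2 * (9 * u\<^sup>2 - v\<^sup>2)\<^sup>2"
    unfolding s by algebra
qed

text \<open>
  The difference to \<open>E44_quartic\<close> is \<open>c \<Delta> Q\<^sup>4\<close>. At \<open>z = \<tau> / 2\<close>, multiplied by \<open>q\<close>, the quartic tends to \<open>1/3\<close> and \<open>\<Delta> Q\<^sup>4\<close> to 1,
  while \<open>E\<^bsub>4,4\<^esub>\<close> contributes nothing.
\<close>

lemma Jacobi_Eisenstein_4_4:
  assumes \<tau>: "\<tau> \<in> uhp"
  shows "Jacobi_Eisenstein 4 4 \<tau> z = E44_quartic (cub_a \<tau>) (cub_b \<tau>) (Yf \<tau> z) (Qf \<tau> z) - 1 / 3 * Delta \<tau> * Qf \<tau> z ^ 4"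
proof -
  let ?L = "[(1,0,4,0,-48), (0,1,3,1,-288), (2,0,2,2,96), (1,1,1,3,96), (3,0,0,4,- (16 / 3))] :: (nat \<times> nat \<times> nat \<times> nat \<times> complex) list"
  have L: "cpoly ?L a b Y Q = E44_quartic a b Y Q" for a b Y Q
    by (simp add: cpoly_def E44_quartic_def algebra_simps)
  have jq: "jform 4 4 (\<lambda>\<tau> z. E44_quartic (cub_a \<tau>) (cub_b \<tau>) (Yf \<tau> z) (Qf \<tau> z)) (\<lambda>z. E44_quartic (- 1 / 48) (1 / 864) (1 + q0 z / 12) (q0 z))"
    unfolding L[symmetric] by (rule jform_cpoly) auto
  have "E44_quartic (- 1 / 48) (1 / 864) (1 + q / 12) q = 1" for q
    by (simp add: E44_quartic_def field_simps power2_eq_square power3_eq_cube power4_eq_xxxx)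
  with jq have jq: "jform 4 4 (\<lambda>\<tau> z. E44_quartic (cub_a \<tau>) (cub_b \<tau>) (Yf \<tau> z) (Qf \<tau> z)) (\<lambda>z. 1)" by simp
  have "jform 4 4 (\<lambda>\<tau> z. Jacobi_Eisenstein 4 4 \<tau> z - E44_quartic (cub_a \<tau>) (cub_b \<tau>) (Yf \<tau> z) (Qf \<tau> z)) (\<lambda>_. 0)"
    by (rule jform_cong[OF jform_diff[OF jform_Jacobi_Eisenstein jq]]) simp_all
  from jform_weight_12[OF this] obtain c where
    c: "\<And>\<tau> z. \<tau> \<in> uhp \<Longrightarrow> Jacobi_Eisenstein 4 4 \<tau> z - E44_quartic (cub_a \<tau>) (cub_b \<tau>) (Yf \<tau> z) (Qf \<tau> z) = c * Delta \<tau> * Qf \<tau> z ^ 4"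
    by auto
  \<comment> \<open>At the cusp \<open>u\<close> tends to \<open>1/12\<close> and \<open>v\<close> to 0; \<open>h\<close> is the quartic at \<open>Y = eps01 Q\<close> without its factor \<open>v\<^sup>2 Q\<^sup>4\<close>.\<close>
  define u v where "u \<tau> = (eps01 \<tau> + eps00 \<tau>) / 2" and "v \<tau> = (eps01 \<tau> - eps00 \<tau>) / 2" for \<tau>
  define h where "h U V = 1728 * U ^ 4 + 3456 * U ^ 3 * V + 3072 * U\<^sup>2 * V\<^sup>2 + 1152 * U * V ^ 3 + 448 / 3 * V ^ 4" for U V :: complex
  define G where "G \<tau> = 16 * (eps10 \<tau> - eps00 \<tau>)\<^sup>2 * (h (u \<tau>) (v \<tau>) / (64 * (9 * (u \<tau>)\<^sup>2 - (v \<tau>)\<^sup>2)\<^sup>2) + c)" for \<tau>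
  have eq: "e \<tau> * Jacobi_Eisenstein 4 4 \<tau> (\<tau> / 2) = G \<tau>" if \<tau>: "\<tau> \<in> uhp" for \<tau>
  proof -
    have sum: "eps10 \<tau> + eps01 \<tau> + eps00 \<tau> = 0" by (rule eps_sum)
    note root = E44_quartic_root[OF sum, folded u_def v_def h_def]
    have \<Delta>: "Delta \<tau> = 64 * (v \<tau>)\<^sup>2 * (9 * (u \<tau>)\<^sup>2 - (v \<tau>)\<^sup>2)\<^sup>2"
      unfolding Delta_eq_eps[OF \<tau>] root(2) by simp
    then have nz: "v \<tau> \<noteq> 0" "9 * (u \<tau>)\<^sup>2 - (v \<tau>)\<^sup>2 \<noteq> 0" using Delta_nz[OF \<tau>] by auto
    have "E44_quartic (cub_a \<tau>) (cub_b \<tau>) (Yf \<tau> (\<tau> / 2)) (Qf \<tau> (\<tau> / 2)) = (v \<tau>)\<^sup>2 * h (u \<tau>) (v \<tau>) * Qf \<tau> (\<tau> / 2) ^ 4"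
      unfolding half_period_values(1)[OF \<tau>] cub_a_def cub_b_def by (rule root(1))
    also have "(v \<tau>)\<^sup>2 * h (u \<tau>) (v \<tau>) = Delta \<tau> * (h (u \<tau>) (v \<tau>) / (64 * (9 * (u \<tau>)\<^sup>2 - (v \<tau>)\<^sup>2)\<^sup>2))"
      unfolding \<Delta> using nz by simp
    finally have "Jacobi_Eisenstein 4 4 \<tau> (\<tau> / 2) = (h (u \<tau>) (v \<tau>) / (64 * (9 * (u \<tau>)\<^sup>2 - (v \<tau>)\<^sup>2)\<^sup>2) + c) * (Delta \<tau> * Qf \<tau> (\<tau> / 2) ^ 4)"
      using c[OF \<tau>, of "\<tau> / 2"] by (simp add: algebra_simps)
    then have "e \<tau> * Jacobi_Eisenstein 4 4 \<tau> (\<tau> / 2) = (e \<tau> * Delta \<tau> * Qf \<tau> (\<tau> / 2) ^ 4) * (h (u \<tau>) (v \<tau>) / (64 * (9 * (u \<tau>)\<^sup>2 - (v \<tau>)\<^sup>2)\<^sup>2) + c)"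
      by (simp only: mult_ac)
    then show ?thesis unfolding half_period_values(2)[OF \<tau>] G_def .
  qed
  have u: "(u \<longlongrightarrow> (1 / 12 + 1 / 12) / 2) cusp" and v: "(v \<longlongrightarrow> (1 / 12 - 1 / 12) / 2) cusp"
    unfolding u_def[abs_def] v_def[abs_def] by (intro tendsto_intros eps_cusp; simp)+
  have "(G \<longlongrightarrow> 16 * (- 1 / 6 - 1 / 12)\<^sup>2 * (h (1 / 12) 0 / (64 * (9 * (1 / 12)\<^sup>2 - 0\<^sup>2)\<^sup>2) + c)) cusp"
    unfolding G_def[abs_def] h_def using u v
    by (intro tendsto_intros eps_cusp) (simp_all add: power2_eq_square)
  then have lim: "(G \<longlongrightarrow> 1 / 3 + c) cusp" by (simp add: h_def power2_eq_square eval_nat_numeral)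
  have "\<forall>\<^sub>F \<tau> in cusp. e \<tau> * Jacobi_Eisenstein 4 4 \<tau> (\<tau> / 2) = G \<tau>"
    using eventually_cusp_uhp by eventually_elim (rule eq)
  from Lim_transform_eventually[OF Jacobi_Eisenstein_half_cusp this] have "(G \<longlongrightarrow> 0) cusp" .
  then have "1 / 3 + c = 0" using tendsto_unique[OF cusp_nonbot lim] by blast
  then have c3: "c = - (1 / 3)" by (simp add: eq_neg_iff_add_eq_0 add.commute)
  show ?thesis using c[OF \<tau>, of z] unfolding c3 by (simp add: algebra_simps)
qed

text \<open>
  The theorem in the variables \<open>Y, Q, a, b\<close>: here \<open>D\<close> stands for \<open>\<Delta>\<close>, \<open>Y2\<close> and \<open>Q2\<close> for the values of \<open>Y\<close> and \<open>Q\<close> at \<open>2 z\<close>,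
  \<open>E\<close> for \<open>E\<^bsub>4,4\<^esub>\<close> and \<open>f1, \<dots>, f4\<close> for \<open>\<phi>\<^bsub>0,1\<^esub>, \<dots>, \<phi>\<^bsub>0,4\<^esub>\<close>.
\<close>

lemma theta_24_polynomial:
  fixes Y Q a b :: complex
  defines "D \<equiv> 16 * (- 4 * a ^ 3 - 27 * b\<^sup>2)"
  defines "Y2 \<equiv> Y ^ 4 - 2 * a * Y\<^sup>2 * Q\<^sup>2 - 8 * b * Y * Q ^ 3 + a\<^sup>2 * Q ^ 4"
  defines "Q2 \<equiv> 4 * Q * (Y ^ 3 + a * Y * Q\<^sup>2 + b * Q ^ 3)"
  defines "f1 \<equiv> 12 * Y" and "f2 \<equiv> 2 * (3 * Y\<^sup>2 + a * Q\<^sup>2)"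
  defines "f3 \<equiv> 4 * (Y ^ 3 + a * Y * Q\<^sup>2 + b * Q ^ 3)"
  defines "f4 \<equiv> 3 * Y ^ 4 + 6 * a * Y\<^sup>2 * Q\<^sup>2 + 12 * b * Y * Q ^ 3 - a\<^sup>2 * Q ^ 4"
  defines "E \<equiv> - 48 * a * Y ^ 4 - 288 * b * Y ^ 3 * Q + 96 * a\<^sup>2 * Y\<^sup>2 * Q\<^sup>2 + 96 * a * b * Y * Q ^ 3 + (16 * a ^ 3 + 144 * b\<^sup>2) * Q ^ 4"
  shows "D ^ 3 * Q ^ 12 =
      (- 48 * a)\<^sup>2 * (- 48 * a * Y2 ^ 3 - 216 * b * Y2\<^sup>2 * Q2 + 48 * a\<^sup>2 * Y2 * Q2\<^sup>2 + 24 * a * b * Q2 ^ 3)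
      - E ^ 3
      - 24 * D * f1\<^sup>2 * f2 * f4\<^sup>2
      + 36 * D * f2 ^ 6
      + D * f3 *
          (- 38 * f1 * f2 ^ 4 - 477 * f1 * f2 * f3\<^sup>2 + 486 * f2 ^ 3 * f3 + 702 * f3 ^ 3
           + 55 * f1\<^sup>2 * f3 * f4 + 160 * f1 * f2\<^sup>2 * f4)"
  unfolding D_def Y2_def Q2_def f1_def f2_def f3_def f4_def E_def by algebra

theorem mainTheorem3:
  fixes \<tau> z :: complex
  assumes "Im \<tau> > 0"
  shows "theta \<tau> z ^ 24 =
      (E4 \<tau>)\<^sup>2 * Jacobi_Eisenstein 4 3 \<tau> (2 * z) - (Jacobi_Eisenstein 4 4 \<tau> z) ^ 3
      - 24 * Delta \<tau> * (phi01 \<tau> z)\<^sup>2 * phi02 \<tau> z * (phi04 \<tau> z)\<^sup>2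
      + 36 * Delta \<tau> * phi02 \<tau> z ^ 6
      + Delta \<tau> * phi03 \<tau> z *
          (- 38 * phi01 \<tau> z * phi02 \<tau> z ^ 4
           - 477 * phi01 \<tau> z * phi02 \<tau> z * (phi03 \<tau> z)\<^sup>2
           + 486 * phi02 \<tau> z ^ 3 * phi03 \<tau> z
           + 702 * phi03 \<tau> z ^ 3
           + 55 * (phi01 \<tau> z)\<^sup>2 * phi03 \<tau> z * phi04 \<tau> z
           + 160 * phi01 \<tau> z * (phi02 \<tau> z)\<^sup>2 * phi04 \<tau> z)"
proof -
  have \<tau>: "\<tau> \<in> uhp" using assms by (simp add: uhp_def)
  have E: "E44_quartic a b Y Q - 1 / 3 * (16 * (- 4 * a ^ 3 - 27 * b\<^sup>2)) * Q ^ 4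
      = - 48 * a * Y ^ 4 - 288 * b * Y ^ 3 * Q + 96 * a\<^sup>2 * Y\<^sup>2 * Q\<^sup>2 + 96 * a * b * Y * Q ^ 3
        + (16 * a ^ 3 + 144 * b\<^sup>2) * Q ^ 4" for a b Y Q
    by (simp add: E44_quartic_def algebra_simps)
  show ?thesis
    unfolding theta_power_24[OF \<tau>] E4_eq_cub_a[OF \<tau>] Jacobi_Eisenstein_4_3[OF \<tau>] Yf_double[OF \<tau>] Qf_double[OF \<tau>]
      Jacobi_Eisenstein_4_4[OF \<tau>] phi01_eq[OF \<tau>] phi02_eq[OF \<tau>] phi03_eq[OF \<tau>] phi04_eq[OF \<tau>]
      Delta_eq_cub_a_cub_b[OF \<tau>] E
    by (rule theta_24_polynomial)
qed

end
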